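(* Let $f\in L^2(\Omega)^2$, $\nu>0$, and assume $$\lambda_h:=C_{B_h}C_{F_h}(\widetilde\alpha\,\nu)^{-2}\|f\|_{0,\Omega}<1 .$$ Then there exists a unique $\psi_h\in\mathcal M_h$ such that $$\nu A_h(\psi_h,\phi_h)+B_h(\psi_h;\psi_h,\phi_h)=F_h(\phi_h)\qquad\forall\phi_h\in\mathcal M_h,$$ and it satisfies $$|\psi_h|_{2,h}\le C_{F_h}(\widetilde\alpha\,\nu)^{-1}\|f\|_{0,\Omega}.$$
   Context: Setting. $\Omega\subset\mathbb R^2$ is a simply connected bounded domain with polygonal Lipschitz boundary $\Gamma$. $(\cdot,\cdot)_{0,D}$ is the $L^2(D)$ inner product (scalar, vector or tensor); $|\cdot|_{\ell,D}$ is the $H^{\ell}(D)$ seminorm. $\mathbf{curl}\,\phi=(\partial_y\phi,-\partial_x\phi)$, $\mathbf D^2\phi$ is the Hessian. $A^K(\varphi,\phi)=(\mathbf D^2\varphi,\mathbf D^2\phi)_{0,K}$. $\mathbb P_\ell(D)$: polynomials of degree $\le\ell$ on $D$. Meshes. $\{\mathcal T_h\}_{h>0}$ is a family of decompositions of $\Omega$ into non-overlapping simple polygons $K$ with diameters $h_K$, $h=\max_Kh_K$. There is $\rho>0$ independent of $h$ such that every $K\in\mathcal T_h$ is star-shaped with respect to every point of a ball of radius $\ge\rho h_K$, and every edge $e$ of $K$ has length $h_e\ge\rho h_K$. $\mathcal E_h$ is the set of all edges; $n_e$ is a unit normal to $e$. The vertices are split into interior and boundary vertices. $H^\ell(\mathcal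 T_h)$ is the space of functions that are elementwise in $H^\ell$, and $|\phi|_{\ell,h}=\big(\sum_{K}|\phi|_{\ell,K}^2\big)^{1/2}$. The jump $[\![\cdot]\!]$ across an interior edge is the difference of traces; on a boundary edge it is the trace. Morley-type space $\mathcal M_h$. Locally put $\widetilde{\mathcal M}_h(K)=\{\phi\in H^2(K):\Delta^2\phi\in\mathbb P_2(K),\ \phi|_e\in\mathbb P_2(e),\ \Delta\phi|_e\in\mathbb P_0(e)\ \forall e\subset\partial K\}$. The projector $\Pi_K^{\mathbf D}:\widetilde{\mathcal M}_h(K)\to\mathbb P_2(K)$ is defined by $A^K(\Pi_K^{\mathbf D}\phi,\chi)=A^K(\phi,\chi)$ $\forall\chi\in\mathbb P_2(K)$ and $\sum_i(\Pi_K^{\mathbf D}\phi)(v_i)\chi(v_i)=\sum_i\phi(v_i)\chi(v_i)$ $\forall\chi\in\mathbb P_1(K)$ (sum over vertices $v_i$ of $K$). For vector fields $v$, $\boldsymbol\Pi_K^{\nabla}v\in\mathbb P_1(K)^2$ is defined by $(\nabla(\boldsymbol\Pi_K^\nabla v-v),\nabla\chi)_{0,K}=0$ $\forall\chi\in\mathbb P_1(K)^2$ and $\int_{\partial K}(\boldsymbol\Pi_K^\nabla v-v)=0$. Then $\mathcal M_h(K)$ is the set of $\phi\in\widetilde{\mathcal M}_h(K)$ with $(\mathbf{curl}\,\phi\cdot n_e-(\boldsymbol\Pi_K^\nabla\mathbf{curl}\,\phi)\cdot n_e,\chi)_{0,e}=0$ for every edge $e$ of $K$ and every $\chi\in\mathbb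 P_1(e)$ with zero mean on $e$, and $(\phi-\Pi_K^{\mathbf D}\phi,\chi)_{0,K}=0$ $\forall\chi\in\mathbb P_2(K)$. Globally, $\mathcal M_h$ is the set of $\phi_h\in H^2(\mathcal T_h)$ with $\phi_h|_K\in\mathcal M_h(K)$ for all $K$, continuous at interior vertices, zero at boundary vertices, and $([\![\partial_{n_e}\phi_h]\!],1)_{0,e}=0$ for all $e\in\mathcal E_h$. $|\cdot|_{2,h}$ is a norm on $\mathcal M_h$. Discrete forms. $\Pi_K^m$ (vector version $\boldsymbol\Pi_K^m$) is the $L^2(K)$-orthogonal projection onto $\mathbb P_m(K)$. $S_{\mathbf D}^K$ is a symmetric positive definite bilinear form on $\mathcal M_h(K)$ with $c_*A^K(\phi,\phi)\le S_{\mathbf D}^K(\phi,\phi)\le c^*A^K(\phi,\phi)$ for all $\phi\in\ker\Pi_K^{\mathbf D}$, with $c_*,c^*>0$ independent of $K$ and $h$. Set $A_h(\varphi,\phi)=\sum_K\big[A^K(\Pi_K^{\mathbf D}\varphi,\Pi_K^{\mathbf D}\phi)+S_{\mathbf D}^K(\varphi-\Pi_K^{\mathbf D}\varphi,\phi-\Pi_K^{\mathbf D}\phi)\big]$, $B_h(\zeta;\varphi,\phi)=\sum_K(\Pi_K^0\Delta\zeta\;\boldsymbol\Pi_K^1\mathbf{curl}\,\varphi,\boldsymbol\Pi_K^1\nabla\phi)_{0,K}$, $F_h(\phi)=\sum_K(\boldsymbol\Pi_K^1f,\mathbf{curl}\,\phi)_{0,K}$. $\widetilde\alpha,C_{B_h},C_{F_h}>0$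 denote $h$-independent constants with, for all $\zeta,\varphi,\phi\in\mathcal M_h$: $A_h(\phi,\phi)\ge\widetilde\alpha|\phi|_{2,h}^2$, $B_h(\zeta;\varphi,\phi)\le C_{B_h}|\zeta|_{2,h}|\varphi|_{2,h}|\phi|_{2,h}$, $|F_h(\phi)|\le C_{F_h}\|f\|_{0,\Omega}|\phi|_{2,h}$. *)

theory Defs
  imports "HOL-Analysis.Analysis"
begin

type_synonym point = "real^2"

section \<open>Smooth functions, polynomials, weak derivatives\<close>

definition pd :: "2 \<Rightarrow> (point \<Rightarrow> real) \<Rightarrow> point \<Rightarrow> real" where
  "pd i f x = frechet_derivative f (at x) (axis i 1)"

primrec Ck :: "nat \<Rightarrow> (point \<Rightarrow> real) \<Rightarrow> bool" where
  "Ck 0 f \<longleftrightarrow> continuous_on UNIV f"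
| "Ck (Suc k) f \<longleftrightarrow> (\<forall>x. f differentiable (at x)) \<and> (\<forall>i. Ck k (pd i f))"

definition smooth :: "(point \<Rightarrow> real) \<Rightarrow> bool" where
  "smooth f \<longleftrightarrow> (\<forall>k. Ck k f)"

definition test_function :: "point set \<Rightarrow> (point \<Rightarrow> real) \<Rightarrow> bool" where
  "test_function U \<eta> \<longleftrightarrow> smooth \<eta> \<and> (\<exists>C. compact C \<and> C \<subseteq> U \<and> (\<forall>x. x \<notin> C \<longrightarrow> \<eta> x = 0))"

text \<open>Polynomials of degree at most \<open>m\<close>, as functions on the whole plane. \<open>Poly m\<close> also serves for
  the polynomials on an element and, by restriction, on an edge.\<close>

definition Poly :: "nat \<Rightarrow> (point \<Rightarrow> real) set" where
  "Poly m = {p. \<exists>c :: nat \<Rightarrow> nat \<Rightarrow> real. \<forall>x. p x = (\<Sum>i\<le>m. \<Sum>j\<le>m - i. c i j * (x$1)^i * (x$2)^j)}"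

definition VPoly :: "nat \<Rightarrow> (point \<Rightarrow> point) set" where
  "VPoly m = {p. \<forall>i. (\<lambda>x. p x $ i) \<in> Poly m}"

definition sq_int :: "'a::euclidean_space set \<Rightarrow> ('a \<Rightarrow> real) \<Rightarrow> bool" where
  "sq_int S u \<longleftrightarrow> set_borel_measurable lebesgue S u \<and> set_integrable lebesgue S (\<lambda>x. (u x)^2)"

definition has_weak_deriv :: "point set \<Rightarrow> 2 \<Rightarrow> (point \<Rightarrow> real) \<Rightarrow> (point \<Rightarrow> real) \<Rightarrow> bool" where
  "has_weak_deriv U i u w \<longleftrightarrow> sq_int U w \<and>
     (\<forall>\<eta>. test_function U \<eta> \<longrightarrow>
        (LINT x:U|lebesgue. u x * pd i \<eta> x) = - (LINT x:U|lebesgue. w x * \<eta> x))"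

text \<open>A representative of the weak partial derivative on \<open>U\<close>; it is determined up to null sets.\<close>

definition wd :: "point set \<Rightarrow> 2 \<Rightarrow> (point \<Rightarrow> real) \<Rightarrow> point \<Rightarrow> real" where
  "wd U i u = (SOME w. has_weak_deriv U i u w)"

definition H1 :: "point set \<Rightarrow> (point \<Rightarrow> real) set" where
  "H1 U = {u. sq_int U u \<and> (\<forall>i. \<exists>w. has_weak_deriv U i u w)}"

definition H2 :: "point set \<Rightarrow> (point \<Rightarrow> real) set" where
  "H2 U = {u \<in> H1 U. \<forall>i. wd U i u \<in> H1 U}"

definition wgrad :: "point set \<Rightarrow> (point \<Rightarrow> real) \<Rightarrow> point \<Rightarrow> point" where
  "wgrad U u x = (\<chi> i. wd U i u x)"

definition wcurl :: "point set \<Rightarrow> (point \<Rightarrow> real) \<Rightarrow> point \<Rightarrow> point" where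
  "wcurl U u x = vector [wd U 2 u x, - wd U 1 u x]"

definition wlap :: "point set \<Rightarrow> (point \<Rightarrow> real) \<Rightarrow> point \<Rightarrow> real" where
  "wlap U u x = (\<Sum>i\<in>UNIV. wd U i (wd U i u) x)"

definition A_loc :: "point set \<Rightarrow> (point \<Rightarrow> real) \<Rightarrow> (point \<Rightarrow> real) \<Rightarrow> real" where
  "A_loc U \<phi> \<eta> = (LINT x:U|lebesgue.
     (\<Sum>i\<in>UNIV. \<Sum>j\<in>UNIV. wd U j (wd U i \<phi>) x * wd U j (wd U i \<eta>) x))"

definition L2norm :: "point set \<Rightarrow> (point \<Rightarrow> point) \<Rightarrow> real" where
  "L2norm U v = sqrt (LINT x:U|lebesgue. (norm (v x))^2)"

text \<open>\<open>L\<^sup>2\<close>-orthogonal projections onto polynomials, scalar and vector version.\<close>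

definition L2proj :: "nat \<Rightarrow> point set \<Rightarrow> (point \<Rightarrow> real) \<Rightarrow> point \<Rightarrow> real" where
  "L2proj m U u = (THE p. p \<in> Poly m \<and> (\<forall>\<eta>\<in>Poly m. (LINT x:U|lebesgue. (p x - u x) * \<eta> x) = 0))"

definition VL2proj :: "nat \<Rightarrow> point set \<Rightarrow> (point \<Rightarrow> point) \<Rightarrow> point \<Rightarrow> point" where
  "VL2proj m U v = (THE p. p \<in> VPoly m \<and>
     (\<forall>\<eta>\<in>VPoly m. (LINT x:U|lebesgue. (p x - v x) \<bullet> \<eta> x) = 0))"


section \<open>Polygons, domains and meshes\<close>

text \<open>A polygon is the cyclic list of its vertices. Consecutive edges may be aligned, so hanging
  nodes are ordinary vertices; this is why the vertex list, not just the point set, is the datum.\<close>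

type_synonym polygon = "point list"

definition vtx :: "polygon \<Rightarrow> nat \<Rightarrow> point" where
  "vtx K i = K ! (i mod length K)"

definition edges :: "polygon \<Rightarrow> (point \<times> point) set" where
  "edges K = {(a, b). \<exists>i<length K. {a, b} = {vtx K i, vtx K (Suc i)}}"

definition simple_polygon :: "polygon \<Rightarrow> bool" where
  "simple_polygon K \<longleftrightarrow> 3 \<le> length K \<and> distinct K \<and>
     (\<forall>i<length K. \<forall>j<length K. i \<noteq> j \<longrightarrow>
        closed_segment (vtx K i) (vtx K (Suc i)) \<inter> closed_segment (vtx K j) (vtx K (Suc j))
        = {vtx K i, vtx K (Suc i)} \<inter> {vtx K j, vtx K (Suc j)})"

definition polygon_boundary :: "polygon \<Rightarrow> point set" where
  "polygon_boundary K = (\<Union>i<length K. closed_segment (vtx K i) (vtx K (Suc i)))"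

text \<open>The open region enclosed by the polygon.\<close>

definition region :: "polygon \<Rightarrow> point set" where
  "region K = inside (polygon_boundary K)"

definition lipschitz_domain :: "point set \<Rightarrow> bool" where
  "lipschitz_domain \<Omega> \<longleftrightarrow> open \<Omega> \<and> connected \<Omega> \<and> \<Omega> \<noteq> {} \<and>
     (\<forall>z\<in>frontier \<Omega>. \<exists>r>0. \<exists>(T :: point \<Rightarrow> point) (g :: real \<Rightarrow> real) L.
        orthogonal_transformation T \<and> L-lipschitz_on UNIV g \<and>
        \<Omega> \<inter> ball z r = {x \<in> ball z r. T x $ 2 < g (T x $ 1)})"

definition polygonal_boundary :: "point set \<Rightarrow> bool" where
  "polygonal_boundary \<Omega> \<longleftrightarrow>
     (\<exists>E :: (point \<times> point) set. finite E \<and> frontier \<Omega> = (\<Union>(a, b)\<in>E. closed_segment a b))"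

definition is_mesh :: "point set \<Rightarrow> polygon set \<Rightarrow> bool" where
  "is_mesh \<Omega> \<T> \<longleftrightarrow> finite \<T> \<and> (\<forall>K\<in>\<T>. simple_polygon K \<and> region K \<subseteq> \<Omega>) \<and>
     (\<Union>K\<in>\<T>. closure (region K)) = closure \<Omega> \<and>
     (\<forall>K\<in>\<T>. \<forall>K'\<in>\<T>. K \<noteq> K' \<longrightarrow> region K \<inter> region K' = {} \<and>
        closure (region K) \<inter> closure (region K')
        = (set K \<inter> set K') \<union> (\<Union>(a, b)\<in>edges K \<inter> edges K'. closed_segment a b))"

definition shape_regular :: "real \<Rightarrow> polygon set \<Rightarrow> bool" where
  "shape_regular \<rho> \<T> \<longleftrightarrow> (\<forall>K\<in>\<T>.
     (\<exists>c r. r \<ge> \<rho> * diameter (region K) \<and> ball c r \<subseteq> region K \<and>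
        (\<forall>y\<in>ball c r. \<forall>x\<in>region K. closed_segment y x \<subseteq> region K)) \<and>
     (\<forall>(a, b)\<in>edges K. dist a b \<ge> \<rho> * diameter (region K)))"

text \<open>A family of meshes indexed by the mesh size \<open>h\<close>, which ranges over a set \<open>H\<close>.\<close>

definition mesh_family :: "point set \<Rightarrow> real \<Rightarrow> real set \<Rightarrow> (real \<Rightarrow> polygon set) \<Rightarrow> bool" where
  "mesh_family \<Omega> \<rho> H \<T> \<longleftrightarrow> (\<forall>h\<in>H. 0 < h \<and> is_mesh \<Omega> (\<T> h) \<and> shape_regular \<rho> (\<T> h) \<and>
     h = Max ((\<lambda>K. diameter (region K)) ` \<T> h))"

definition edge_normal :: "point \<Rightarrow> point \<Rightarrow> point" where
  "edge_normal a b = (1 / dist a b) *\<^sub>R vector [b$2 - a$2, a$1 - b$1]"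

definition outer_normal :: "polygon \<Rightarrow> point \<Rightarrow> point \<Rightarrow> point" where
  "outer_normal K a b =
     (if \<exists>\<delta>>0. \<forall>t. 0 < t \<and> t < \<delta> \<longrightarrow> midpoint a b + t *\<^sub>R edge_normal a b \<notin> region K
      then edge_normal a b else - edge_normal a b)"

definition edge_int :: "point \<Rightarrow> point \<Rightarrow> (point \<Rightarrow> real) \<Rightarrow> real" where
  "edge_int a b g = dist a b * (LINT t:{0..1}|lebesgue. g (linepath a b t))"


section \<open>Traces\<close>

text \<open>\<open>g\<close> is the trace of \<open>u \<in> H\<^sup>1(K)\<close> on the boundary of \<open>K\<close>: the trace map is the continuous extension
  of the restriction map from functions smooth up to the boundary. It is only determined almost
  everywhere on the boundary, hence a relation.\<close>

definition has_trace :: "polygon \<Rightarrow> (point \<Rightarrow> real) \<Rightarrow> (point \<Rightarrow> real) \<Rightarrow> bool" where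
  "has_trace K u g \<longleftrightarrow> u \<in> H1 (region K) \<and>
     (\<forall>(a, b)\<in>edges K. sq_int {0..1} (\<lambda>t. g (linepath a b t))) \<and>
     (\<exists>s. (\<forall>n::nat. smooth (s n)) \<and>
        (\<lambda>n. LINT x:region K|lebesgue. (s n x - u x)^2) \<longlonglongrightarrow> 0 \<and>
        (\<forall>i. (\<lambda>n. LINT x:region K|lebesgue. (pd i (s n) x - wd (region K) i u x)^2) \<longlonglongrightarrow> 0) \<and>
        (\<forall>(a, b)\<in>edges K. (\<lambda>n. edge_int a b (\<lambda>x. (s n x - g x)^2)) \<longlonglongrightarrow> 0))"

definition has_vtrace :: "polygon \<Rightarrow> (point \<Rightarrow> point) \<Rightarrow> (point \<Rightarrow> point) \<Rightarrow> bool" where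
  "has_vtrace K v g \<longleftrightarrow> (\<forall>i. has_trace K (\<lambda>x. v x $ i) (\<lambda>x. g x $ i))"

text \<open>For \<open>w \<in> L\<^sup>2(K)\<close> with \<open>\<Delta>w = q \<in> L\<^sup>2(K)\<close> in the sense of distributions (as is the case for the
  Laplacian of an \<open>H\<^sup>2\<close> function whose bilaplacian is a polynomial) the trace is understood, as usual,
  through Green's formula
  \<open>\<integral>\<^sub>K (w \<Delta>\<eta> - \<eta> \<Delta>w) = \<integral>\<^sub>\<partial>\<^sub>K w \<partial>\<^sub>n\<eta>\<close> for \<open>\<eta> \<in> H\<^sup>2(K)\<close> vanishing on the boundary.\<close>

definition has_weak_trace ::
  "polygon \<Rightarrow> (point \<Rightarrow> real) \<Rightarrow> (point \<Rightarrow> real) \<Rightarrow> (point \<Rightarrow> real) \<Rightarrow> bool" where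
  "has_weak_trace K w q g \<longleftrightarrow>
     (\<forall>\<eta> \<gamma>. \<eta> \<in> H2 (region K) \<and> has_trace K \<eta> (\<lambda>x. 0) \<and> has_vtrace K (wgrad (region K) \<eta>) \<gamma> \<longrightarrow>
        (LINT x:region K|lebesgue. w x * wlap (region K) \<eta> x - \<eta> x * q x)
        = (\<Sum>i<length K. edge_int (vtx K i) (vtx K (Suc i))
             (\<lambda>x. g x * (\<gamma> x \<bullet> outer_normal K (vtx K i) (vtx K (Suc i))))))"


section \<open>The Morley-type virtual element space\<close>

text \<open>Functions in \<open>H\<^sup>2(K)\<close> are identified with their representative that extends continuously to the
  closure of \<open>K\<close> (Sobolev embedding in the plane); since \<open>region K\<close> is bounded, this is uniform
  continuity. Off the open set \<open>K\<close> the representative is set to \<open>0\<close>, so that equality of functions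
  is equality of elements of the space. The value at a vertex is the limit from within \<open>K\<close>.\<close>

definition restr :: "polygon \<Rightarrow> (point \<Rightarrow> real) \<Rightarrow> point \<Rightarrow> real" where
  "restr K \<phi> x = (if x \<in> region K then \<phi> x else 0)"

definition H2_rep :: "polygon \<Rightarrow> (point \<Rightarrow> real) set" where
  "H2_rep K = {\<phi> \<in> H2 (region K). uniformly_continuous_on (region K) \<phi> \<and> restr K \<phi> = \<phi>}"

definition vval :: "polygon \<Rightarrow> (point \<Rightarrow> real) \<Rightarrow> point \<Rightarrow> real" where
  "vval K \<phi> v = Lim (at v within region K) \<phi>"

definition has_bilap :: "polygon \<Rightarrow> (point \<Rightarrow> real) \<Rightarrow> (point \<Rightarrow> real) \<Rightarrow> bool" where
  "has_bilap K \<phi> q \<longleftrightarrow> (\<forall>\<eta>. test_function (region K) \<eta> \<longrightarrow>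
     (LINT x:region K|lebesgue. wlap (region K) \<phi> x * (\<Sum>i\<in>UNIV. pd i (pd i \<eta>) x))
     = (LINT x:region K|lebesgue. q x * \<eta> x))"

definition M_tilde :: "polygon \<Rightarrow> (point \<Rightarrow> real) set" where
  "M_tilde K = {\<phi> \<in> H2_rep K.
     (\<exists>q\<in>Poly 2. has_bilap K \<phi> q \<and>
        (\<exists>g. has_weak_trace K (wlap (region K) \<phi>) q g \<and>
           (\<forall>(a, b)\<in>edges K. \<exists>p\<in>Poly 0. \<forall>x\<in>open_segment a b. g x = p x))) \<and>
     (\<exists>g. has_trace K \<phi> g \<and>
        (\<forall>(a, b)\<in>edges K. \<exists>p\<in>Poly 2. \<forall>x\<in>open_segment a b. g x = p x))}"

definition Pi_D :: "polygon \<Rightarrow> (point \<Rightarrow> real) \<Rightarrow> point \<Rightarrow> real" where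
  "Pi_D K \<phi> = (THE p. p \<in> Poly 2 \<and>
     (\<forall>\<eta>\<in>Poly 2. A_loc (region K) p \<eta> = A_loc (region K) \<phi> \<eta>) \<and>
     (\<forall>\<eta>\<in>Poly 1. (\<Sum>v\<in>set K. p v * \<eta> v) = (\<Sum>v\<in>set K. vval K \<phi> v * \<eta> v)))"

text \<open>The second vector field \<open>g\<close> is the trace of \<open>v\<close>, used for the boundary mean.\<close>

definition Pi_nabla :: "polygon \<Rightarrow> (point \<Rightarrow> point) \<Rightarrow> (point \<Rightarrow> point) \<Rightarrow> point \<Rightarrow> point" where
  "Pi_nabla K v g = (THE p. p \<in> VPoly 1 \<and>
     (\<forall>\<eta>\<in>VPoly 1. (LINT x:region K|lebesgue. (\<Sum>i\<in>UNIV. \<Sum>j\<in>UNIV.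
        (wd (region K) j (\<lambda>y. p y $ i) x - wd (region K) j (\<lambda>y. v y $ i) x)
        * wd (region K) j (\<lambda>y. \<eta> y $ i) x)) = 0) \<and>
     (\<forall>i. (\<Sum>k<length K. edge_int (vtx K k) (vtx K (Suc k)) (\<lambda>x. p x $ i - g x $ i)) = 0))"

definition M_loc :: "polygon \<Rightarrow> (point \<Rightarrow> real) set" where
  "M_loc K = {\<phi> \<in> M_tilde K.
     (\<exists>\<gamma>. has_vtrace K (wcurl (region K) \<phi>) \<gamma> \<and>
        (\<forall>(a, b)\<in>edges K. \<forall>\<eta>\<in>Poly 1. edge_int a b \<eta> = 0 \<longrightarrow>
           edge_int a b (\<lambda>x. (\<gamma> x \<bullet> edge_normal a b
             - Pi_nabla K (wcurl (region K) \<phi>) \<gamma> x \<bullet> edge_normal a b) * \<eta> x) = 0)) \<and>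
     (\<forall>\<eta>\<in>Poly 2. (LINT x:region K|lebesgue. (\<phi> x - Pi_D K \<phi> x) * \<eta> x) = 0)}"

definition H2_broken :: "polygon set \<Rightarrow> (point \<Rightarrow> real) set" where
  "H2_broken \<T> = {\<phi>. \<forall>K\<in>\<T>. \<phi> \<in> H2 (region K)}"

text \<open>\<open>(\<lbrakk>\<partial>\<^sub>n\<phi>\<rbrakk>, 1)\<^sub>e = 0\<close> for all edges: \<open>\<gamma> K\<close> is the trace of the gradient from within \<open>K\<close>. The sign of
  the unit normal and the order of the two elements sharing an edge are immaterial.\<close>

definition normal_jumps_vanish :: "point set \<Rightarrow> polygon set \<Rightarrow> (point \<Rightarrow> real) \<Rightarrow> bool" where
  "normal_jumps_vanish \<Omega> \<T> \<phi> \<longleftrightarrow>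
     (\<exists>\<gamma>. (\<forall>K\<in>\<T>. has_vtrace K (wgrad (region K) \<phi>) (\<gamma> K)) \<and>
        (\<forall>K\<in>\<T>. \<forall>K'\<in>\<T>. K \<noteq> K' \<longrightarrow> (\<forall>(a, b)\<in>edges K \<inter> edges K'.
           edge_int a b (\<lambda>x. \<gamma> K x \<bullet> edge_normal a b - \<gamma> K' x \<bullet> edge_normal a b) = 0)) \<and>
        (\<forall>K\<in>\<T>. \<forall>(a, b)\<in>edges K. closed_segment a b \<subseteq> frontier \<Omega> \<longrightarrow>
           edge_int a b (\<lambda>x. \<gamma> K x \<bullet> edge_normal a b) = 0))"

definition M_glob :: "point set \<Rightarrow> polygon set \<Rightarrow> (point \<Rightarrow> real) set" where
  "M_glob \<Omega> \<T> = {\<phi> \<in> H2_broken \<T>.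
     (\<forall>x. x \<notin> (\<Union>K\<in>\<T>. region K) \<longrightarrow> \<phi> x = 0) \<and>
     (\<forall>K\<in>\<T>. restr K \<phi> \<in> M_loc K) \<and>
     (\<forall>K\<in>\<T>. \<forall>K'\<in>\<T>. \<forall>v\<in>set K \<inter> set K'. v \<in> \<Omega> \<longrightarrow> vval K \<phi> v = vval K' \<phi> v) \<and>
     (\<forall>K\<in>\<T>. \<forall>v\<in>set K. v \<in> frontier \<Omega> \<longrightarrow> vval K \<phi> v = 0) \<and>
     normal_jumps_vanish \<Omega> \<T> \<phi>}"

definition seminorm2h :: "polygon set \<Rightarrow> (point \<Rightarrow> real) \<Rightarrow> real" where
  "seminorm2h \<T> \<phi> = sqrt (\<Sum>K\<in>\<T>. A_loc (region K) \<phi> \<phi>)"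


section \<open>Discrete forms\<close>

text \<open>Symmetric positive definite bilinear forms on a linear space of functions.\<close>

definition spd_form ::
  "(point \<Rightarrow> real) set \<Rightarrow> ((point \<Rightarrow> real) \<Rightarrow> (point \<Rightarrow> real) \<Rightarrow> real) \<Rightarrow> bool" where
  "spd_form V s \<longleftrightarrow>
     (\<forall>u\<in>V. \<forall>v\<in>V. \<forall>w\<in>V. \<forall>a. s (\<lambda>x. a * u x + v x) w = a * s u w + s v w) \<and>
     (\<forall>u\<in>V. \<forall>v\<in>V. s u v = s v u) \<and>
     (\<forall>u\<in>V. u \<noteq> (\<lambda>x. 0) \<longrightarrow> s u u > 0)"

definition stabilisation ::
  "real \<Rightarrow> real \<Rightarrow> polygon \<Rightarrow> ((point \<Rightarrow> real) \<Rightarrow> (point \<Rightarrow> real) \<Rightarrow> real) \<Rightarrow> bool" where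
  "stabilisation c_lo c_up K s \<longleftrightarrow> spd_form (M_loc K) s \<and>
     (\<forall>\<phi>\<in>M_loc K. Pi_D K \<phi> = (\<lambda>x. 0) \<longrightarrow>
        c_lo * A_loc (region K) \<phi> \<phi> \<le> s \<phi> \<phi> \<and> s \<phi> \<phi> \<le> c_up * A_loc (region K) \<phi> \<phi>)"

definition A_h ::
  "(polygon \<Rightarrow> (point \<Rightarrow> real) \<Rightarrow> (point \<Rightarrow> real) \<Rightarrow> real) \<Rightarrow> polygon set \<Rightarrow>
   (point \<Rightarrow> real) \<Rightarrow> (point \<Rightarrow> real) \<Rightarrow> real" where
  "A_h S \<T> \<phi> \<eta> = (\<Sum>K\<in>\<T>.
     A_loc (region K) (Pi_D K \<phi>) (Pi_D K \<eta>)
     + S K (restr K (\<lambda>x. \<phi> x - Pi_D K \<phi> x)) (restr K (\<lambda>x. \<eta> x - Pi_D K \<eta> x)))"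

definition B_h ::
  "polygon set \<Rightarrow> (point \<Rightarrow> real) \<Rightarrow> (point \<Rightarrow> real) \<Rightarrow> (point \<Rightarrow> real) \<Rightarrow> real" where
  "B_h \<T> \<zeta> \<phi> \<eta> = (\<Sum>K\<in>\<T>. LINT x:region K|lebesgue.
     (L2proj 0 (region K) (wlap (region K) \<zeta>) x *\<^sub>R VL2proj 1 (region K) (wcurl (region K) \<phi>) x)
     \<bullet> VL2proj 1 (region K) (wgrad (region K) \<eta>) x)"

definition F_h :: "(point \<Rightarrow> point) \<Rightarrow> polygon set \<Rightarrow> (point \<Rightarrow> real) \<Rightarrow> real" where
  "F_h f \<T> \<eta> = (\<Sum>K\<in>\<T>. LINT x:region K|lebesgue.
     VL2proj 1 (region K) f x \<bullet> wcurl (region K) \<eta> x)"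

definition solves ::
  "(polygon \<Rightarrow> (point \<Rightarrow> real) \<Rightarrow> (point \<Rightarrow> real) \<Rightarrow> real) \<Rightarrow> real \<Rightarrow> (point \<Rightarrow> point) \<Rightarrow>
   point set \<Rightarrow> polygon set \<Rightarrow> (point \<Rightarrow> real) \<Rightarrow> bool" where
  "solves S \<nu> f \<Omega> \<T> \<psi> \<longleftrightarrow> \<psi> \<in> M_glob \<Omega> \<T> \<and>
     (\<forall>\<phi>\<in>M_glob \<Omega> \<T>. \<nu> * A_h S \<T> \<psi> \<phi> + B_h \<T> \<psi> \<psi> \<phi> = F_h f \<T> \<phi>)"

end

theory Submission
  imports Defs "HOL-Computational_Algebra.Polynomial"
begin

text \<open>The convective form is alternating, since the projected curl is the projected gradient turned by a
  right angle; testing with the solution itself gives the bound, and testing the difference of two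
  solutions with itself gives uniqueness under the smallness condition. For existence one needs that
  the space is finite-dimensional and that \<open>A_h\<close> is an inner product on it. Finite dimension holds
  because a local function is determined by finitely many coefficients: if these vanish, it is harmonic
  with zero trace on the element and hence 0. Definiteness holds because a function with \<open>A_h \<phi> \<phi> = 0\<close>
  is affine on every element, and its vertex values and mean normal derivatives carry the value 0
  from the boundary across every shared edge. Existence then follows by applying the contraction principle
  to a gradient-like iteration on a suitable ball.\<close>

section \<open>Smooth functions\<close>

text \<open>Weak derivatives are chosen representatives and traces are relations, so every identity
  rests on a uniqueness statement: almost everywhere for derivatives, by the fundamental lemma, and
  in the mean over each edge for traces, by Green's formula. Green's formula must know on which side
  of an edge an element lies. Star-shapedness with respect to a ball reduces this to one sign, the
  position of the centre relative to the line of the edge, and the divergence theorem then becomes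
  the fundamental theorem of calculus on axis-parallel lines. That vanishing coefficients make a
  function harmonic follows by duality: the trace of the Laplacian is defined by pairing with
  functions of zero trace, and the function itself is an admissible partner. The same sign separates
  the two elements at a shared edge and so drives the propagation of zero through the mesh. The
  smallness condition survives the passage from the seminorm to the norm of \<open>A_h\<close>,
  where it says exactly that the interval of admissible radii is non-empty.\<close>

lemma pd_eq: "(f has_derivative f') (at x) \<Longrightarrow> pd i f x = f' (axis i 1)"
  unfolding pd_def by (metis frechet_derivative_at)

lemma Ck_Suc_D: "Ck (Suc k) f \<Longrightarrow> Ck k f"
proof (induction k arbitrary: f)
  case 0
  then show ?case
    by (auto intro!: differentiable_imp_continuous_on simp: differentiable_on_def)
next
  case (Suc k)
  then show ?case by (metis Ck.simps(2))
qed

lemma smooth_differentiable: "smooth f \<Longrightarrow> f differentiable (at x)"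
  unfolding smooth_def by (metis Ck.simps(2))

lemma smooth_pd: "smooth f \<Longrightarrow> smooth (pd i f)"
  unfolding smooth_def by (metis Ck.simps(2))

lemma smooth_continuous_on: "smooth f \<Longrightarrow> continuous_on A f"
  unfolding smooth_def by (metis Ck.simps(1) continuous_on_subset top_greatest)

lemma smooth_borel [measurable]: "smooth f \<Longrightarrow> f \<in> borel_measurable borel"
  by (intro borel_measurable_continuous_onI smooth_continuous_on)

text \<open>Membership in a class closed under \<open>pd\<close> passes to partial derivatives of
  every order, so differentiability of its members is enough. Smoothness of affine functions and of
  bumps thereby reduces to naming a closed family.\<close>

lemma smooth_coinduct:
  assumes "P f" and step: "\<And>f. P f \<Longrightarrow> (\<forall>x. f differentiable (at x)) \<and> (\<forall>i. P (pd i f))"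
  shows "smooth f"
proof -
  have "Ck k f" if "P f" for k f using that
  proof (induction k arbitrary: f)
    case 0
    then show ?case using step
      by (auto intro!: differentiable_imp_continuous_on simp: differentiable_on_def)
  next
    case (Suc k)
    then show ?case using step by simp
  qed
  then show ?thesis using assms unfolding smooth_def by blast
qed

lemma pd_add:
  assumes "f differentiable (at x)" "g differentiable (at x)"
  shows "pd i (\<lambda>x. f x + g x) x = pd i f x + pd i g x"
proof -
  from assms obtain f' g' where *: "(f has_derivative f') (at x)" "(g has_derivative g') (at x)"
    unfolding differentiable_def by blast
  show ?thesis
    using pd_eq[OF has_derivative_add[OF *]] pd_eq[OF *(1)] pd_eq[OF *(2)] by simp
qed

lemma pd_mult:
  assumes "f differentiable (at x)" "g differentiable (at x)"
  shows "pd i (\<lambda>x. f x * g x) x = pd i f x * g x + f x * pd i g x"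
proof -
  from assms obtain f' g' where *: "(f has_derivative f') (at x)" "(g has_derivative g') (at x)"
    unfolding differentiable_def by blast
  show ?thesis
    using pd_eq[OF has_derivative_mult[OF *]] pd_eq[OF *(1)] pd_eq[OF *(2)] by simp
qed

lemma Ck_add: "Ck k f \<Longrightarrow> Ck k g \<Longrightarrow> Ck k (\<lambda>x. f x + g x)"
proof (induction k arbitrary: f g)
  case (Suc k)
  then have "pd i (\<lambda>x. f x + g x) = (\<lambda>x. pd i f x + pd i g x)" for i
    by (simp add: pd_add fun_eq_iff)
  with Suc show ?case by simp
qed (simp add: continuous_on_add)

lemma Ck_mult: "Ck k f \<Longrightarrow> Ck k g \<Longrightarrow> Ck k (\<lambda>x. f x * g x)"
proof (induction k arbitrary: f g)
  case (Suc k)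
  then have "pd i (\<lambda>x. f x * g x) = (\<lambda>x. pd i f x * g x + f x * pd i g x)" for i
    by (simp add: pd_mult fun_eq_iff)
  with Suc Ck_Suc_D show ?case by (simp add: Ck_add)
qed (simp add: continuous_on_mult)

lemma smooth_add: "smooth f \<Longrightarrow> smooth g \<Longrightarrow> smooth (\<lambda>x. f x + g x)"
  by (simp add: smooth_def Ck_add)

lemma smooth_mult: "smooth f \<Longrightarrow> smooth g \<Longrightarrow> smooth (\<lambda>x. f x * g x)"
  by (simp add: smooth_def Ck_mult)

lemma affine_has_derivative:
  "((\<lambda>x::point. n \<bullet> x + c) has_derivative (\<lambda>h. n \<bullet> h)) (at x)"
  by (auto intro!: derivative_eq_intros)

lemma pd_affine: "pd i (\<lambda>x. n \<bullet> x + c) = (\<lambda>x. n $ i)"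
  using pd_eq[OF affine_has_derivative] by (auto simp: inner_axis)

lemma smooth_affine: "smooth (\<lambda>x. n \<bullet> x + c)"
proof (rule smooth_coinduct[where P = "\<lambda>f. \<exists>n c. f = (\<lambda>x. n \<bullet> x + c)"])
  fix f :: "point \<Rightarrow> real"
  assume "\<exists>n c. f = (\<lambda>x. n \<bullet> x + c)"
  then obtain n c where f: "f = (\<lambda>x. n \<bullet> x + c)" by blast
  show "(\<forall>x. f differentiable (at x)) \<and> (\<forall>i. \<exists>n c. pd i f = (\<lambda>x. n \<bullet> x + c))"
  proof (intro conjI allI)
    show "f differentiable (at x)" for x
      unfolding f differentiable_def using affine_has_derivative by blast
    show "\<exists>n c. pd i f = (\<lambda>x. n \<bullet> x + c)" for i
      unfolding f pd_affine by (rule exI[of _ 0], rule exI[of _ "n $ i"]) simp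
  qed
qed blast

lemma smooth_const: "smooth (\<lambda>x. c)"
  using smooth_affine[of 0 c] by simp

lemma pd_const: "pd i (\<lambda>x. c) = (\<lambda>x. 0)"
  using pd_affine[of i 0 c] by simp

lemma smooth_coord: "smooth (\<lambda>x. x $ i)"
  using smooth_affine[of "axis i 1" 0] by (simp add: inner_axis')

lemma pd_coord: "pd i (\<lambda>x. x $ j) = (\<lambda>x. if i = j then 1 else 0)"
  using pd_affine[of i "axis j 1" 0] by (simp add: inner_axis') (simp add: axis_def)

lemma smooth_power: "smooth f \<Longrightarrow> smooth (\<lambda>x. f x ^ n)"
  by (induction n) (auto intro: smooth_mult smooth_const)

lemma smooth_sum: "(\<And>i. i \<in> I \<Longrightarrow> smooth (f i)) \<Longrightarrow> smooth (\<lambda>x. \<Sum>i\<in>I. f i x)"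
  by (induction I rule: infinite_finite_induct) (auto intro: smooth_add smooth_const)

lemma smooth_lincomb: "smooth f \<Longrightarrow> smooth g \<Longrightarrow> smooth (\<lambda>x. a * f x + g x)"
  by (intro smooth_add smooth_mult smooth_const)

lemma pd_lincomb:
  assumes "smooth f" "smooth g"
  shows "pd i (\<lambda>x. a * f x + g x) x = a * pd i f x + pd i g x"
  using assms by (simp add: pd_add pd_mult pd_const smooth_differentiable smooth_mult smooth_const)

lemma pd_mult_smooth:
  "smooth f \<Longrightarrow> smooth g \<Longrightarrow> pd i (\<lambda>x. f x * g x) x = pd i f x * g x + f x * pd i g x"
  by (simp add: pd_mult smooth_differentiable)

lemma smooth_has_derivative:
  assumes "smooth f" shows "(f has_derivative (\<lambda>h. \<Sum>i\<in>UNIV. pd i f x * h $ i)) (at x)"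
proof -
  have f: "(f has_derivative frechet_derivative f (at x)) (at x)"
    using assms smooth_differentiable frechet_derivative_works by blast
  interpret bounded_linear "frechet_derivative f (at x)" using f by (rule has_derivative_bounded_linear)
  have "frechet_derivative f (at x) h = (\<Sum>i\<in>UNIV. pd i f x * h $ i)" for h
  proof -
    have "h = (\<Sum>i\<in>UNIV. h $ i *\<^sub>R axis i 1)"
      by (simp add: vec_eq_iff axis_def if_distrib cong: if_cong)
    then have "frechet_derivative f (at x) h = frechet_derivative f (at x) (\<Sum>i\<in>UNIV. h $ i *\<^sub>R axis i 1)"
      by simp
    also have "\<dots> = (\<Sum>i\<in>UNIV. h $ i *\<^sub>R frechet_derivative f (at x) (axis i 1))"
      by (simp add: sum scale del: sum_2)
    finally show ?thesis by (simp add: pd_def mult.commute)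
  qed
  then have "frechet_derivative f (at x) = (\<lambda>h. \<Sum>i\<in>UNIV. pd i f x * h $ i)" by blast
  with f show ?thesis by simp
qed

section \<open>Smooth cut-off functions built from exp(-1/t)\<close>

text \<open>The family p(1/t) exp(-1/t), extended by 0, is closed under differentiation; this is why
  a polynomial is carried along instead of fixing p = 1.\<close>

definition bump :: "real poly \<Rightarrow> real \<Rightarrow> real" where
  "bump p t = (if t > 0 then poly p (1 / t) * exp (- (1 / t)) else 0)"

lemma tendsto_poly_exp_neg: "((\<lambda>s::real. poly p s * exp (- s)) \<longlongrightarrow> 0) at_top"
proof -
  have "((\<lambda>s::real. \<Sum>i\<le>degree p. coeff p i * (s ^ i / exp s)) \<longlongrightarrow> (\<Sum>i\<le>degree p. coeff p i * 0)) at_top"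
    by (intro tendsto_sum tendsto_mult tendsto_const tendsto_power_div_exp_0)
  then show ?thesis
    by (simp add: poly_altdef exp_minus divide_inverse sum_distrib_right mult.assoc)
qed

text \<open>For t > 0 the product rule gives (p - p')(1/t) exp(-1/t) / t^2, whence the factor
  \<open>monom 1 2\<close>. At 0 the quotient from the right is the same kind of expression with
  \<open>pCons 0 p\<close>, and the exponential beats every polynomial in 1/t.\<close>

lemma bump_has_derivative:
  "(bump p has_real_derivative bump (monom 1 2 * (p - pderiv p)) t) (at t)"
proof -
  consider "t > 0" | "t < 0" | "t = 0" by linarith
  then show ?thesis
  proof cases
    case 1
    have "((\<lambda>t. poly p (1 / t) * exp (- (1 / t))) has_real_derivative
        bump (monom 1 2 * (p - pderiv p)) t) (at t)"
      using 1 by (auto intro!: derivative_eq_intros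
          simp: bump_def poly_monom power2_eq_square divide_simps) (simp add: algebra_simps)
    moreover have "\<forall>\<^sub>F s in nhds t. bump p s = poly p (1 / s) * exp (- (1 / s))"
      using eventually_nhds_in_open[of "{0<..}" t] 1 by (auto elim!: eventually_mono simp: bump_def)
    ultimately show ?thesis by (subst DERIV_cong_ev[OF refl _ refl]) auto
  next
    case 2
    have "\<forall>\<^sub>F s in nhds t. bump p s = 0"
      using eventually_nhds_in_open[of "{..<0}" t] 2 by (auto elim!: eventually_mono simp: bump_def)
    then show ?thesis using 2 by (subst DERIV_cong_ev[OF refl _ refl]) (auto simp: bump_def)
  next
    case 3
    have "((\<lambda>s::real. poly (pCons 0 p) (inverse s) * exp (- (inverse s))) \<longlongrightarrow> 0) (at_right 0)"
      using filterlim_compose[OF tendsto_poly_exp_neg filterlim_inverse_at_top_right] .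
    then have r: "((\<lambda>s. bump p s / s) \<longlongrightarrow> 0) (at_right 0)"
      by (rule Lim_transform_eventually)
        (auto simp: eventually_at_right_field bump_def divide_inverse intro!: exI[of _ 1])
    have l: "((\<lambda>s. bump p s / s) \<longlongrightarrow> 0) (at_left 0)"
      by (rule Lim_transform_eventually[OF tendsto_const])
        (auto simp: eventually_at_left_field bump_def intro!: exI[of _ "-1"])
    have "((\<lambda>s. bump p s / s) \<longlongrightarrow> 0) (at 0)"
      using l r filterlim_split_at_real by blast
    then show ?thesis using 3 by (simp add: has_field_derivative_iff bump_def)
  qed
qed

lemma smooth_bump: "smooth (\<lambda>x. bump p (n \<bullet> x + c))"
proof (rule smooth_coinduct[where P = "\<lambda>f. \<exists>a p. f = (\<lambda>x. a * bump p (n \<bullet> x + c))"])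
  show "\<exists>a q. (\<lambda>x. bump p (n \<bullet> x + c)) = (\<lambda>x. a * bump q (n \<bullet> x + c))"
    by (rule exI[of _ 1]) auto
  fix f :: "point \<Rightarrow> real"
  assume "\<exists>a p. f = (\<lambda>x. a * bump p (n \<bullet> x + c))"
  then obtain a p where f: "f = (\<lambda>x. a * bump p (n \<bullet> x + c))" by blast
  have d: "(f has_derivative (\<lambda>h. a * ((n \<bullet> h) * bump (monom 1 2 * (p - pderiv p)) (n \<bullet> x + c)))) (at x)" for x
  proof -
    have "((\<lambda>x. bump p (n \<bullet> x + c)) has_derivative
       (\<lambda>h. (n \<bullet> h) * bump (monom 1 2 * (p - pderiv p)) (n \<bullet> x + c))) (at x)"
      using has_derivative_compose[OF affine_has_derivative[of n c x]
          bump_has_derivative[of p "n \<bullet> x + c", THEN has_field_derivative_imp_has_derivative]]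
      by (simp add: mult.commute)
    then show ?thesis unfolding f by (intro has_derivative_mult_right)
  qed
  show "(\<forall>x. f differentiable (at x)) \<and> (\<forall>i. \<exists>a p. pd i f = (\<lambda>x. a * bump p (n \<bullet> x + c)))"
  proof (intro conjI allI)
    show "f differentiable (at x)" for x using d differentiable_def by blast
    fix i
    have "pd i f = (\<lambda>x. (a * n $ i) * bump (monom 1 2 * (p - pderiv p)) (n \<bullet> x + c))"
      using pd_eq[OF d] by (auto simp: inner_axis fun_eq_iff)
    then show "\<exists>a p. pd i f = (\<lambda>x. a * bump p (n \<bullet> x + c))" by blast
  qed
qed

text \<open>The function exp(-1/t) for t > 0. As m grows, ramp(m t) increases to the indicator of t
  > 0 and stays between 0 and 1, which makes it the building block of the box and cone
  cut-offs.\<close>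

definition ramp :: "real \<Rightarrow> real" where "ramp = bump 1"

lemma ramp_nonpos [simp]: "t \<le> 0 \<Longrightarrow> ramp t = 0"
  by (simp add: ramp_def bump_def)

lemma ramp_bounds: "0 \<le> ramp t" "ramp t \<le> 1"
  by (auto simp: ramp_def bump_def)

lemma smooth_ramp: "smooth (\<lambda>x. ramp (n \<bullet> x + c))"
  unfolding ramp_def by (rule smooth_bump)

lemma ramp_at_top: "(ramp \<longlongrightarrow> 1) at_top"
proof -
  have "((\<lambda>t::real. exp (- inverse t)) \<longlongrightarrow> exp (- 0)) at_top"
    by (intro tendsto_intros tendsto_inverse_0_at_top filterlim_ident)
  then have "((\<lambda>t::real. exp (- inverse t)) \<longlongrightarrow> 1) at_top" by simp
  then show ?thesis
    by (rule Lim_transform_eventually)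
      (auto simp: ramp_def bump_def eventually_at_top_linorder divide_inverse intro!: exI[of _ 1])
qed

lemma ramp_limit: assumes "t > 0" shows "(\<lambda>m::nat. ramp (real m * t + c)) \<longlonglongrightarrow> 1"
proof (rule filterlim_compose[OF ramp_at_top])
  have "filterlim (\<lambda>m. t * real m) at_top sequentially"
    using assms filterlim_real_sequentially
    by (intro filterlim_tendsto_pos_mult_at_top[OF tendsto_const])
  then show "filterlim (\<lambda>m. real m * t + c) at_top sequentially"
    by (intro filterlim_tendsto_add_at_top[OF tendsto_const, of _ _ c, simplified add.commute[of c]])
      (simp add: mult.commute)
qed

lemma Poly_smooth: "p \<in> Poly m \<Longrightarrow> smooth p"
proof -
  assume "p \<in> Poly m"
  then obtain c :: "nat \<Rightarrow> nat \<Rightarrow> real"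
    where "\<forall>x. p x = (\<Sum>i\<le>m. \<Sum>j\<le>m - i. c i j * (x$1)^i * (x$2)^j)"
    unfolding Poly_def by blast
  then have "p = (\<lambda>x. \<Sum>i\<le>m. \<Sum>j\<le>m - i. c i j * (x$1)^i * (x$2)^j)" by blast
  then show ?thesis
    by (auto intro!: smooth_sum smooth_mult smooth_power smooth_coord smooth_const)
qed

section \<open>Square integrable functions\<close>

lemma discriminant_bound:
  fixes A B C :: real
  assumes "\<And>t. 0 \<le> A + 2 * t * B + t^2 * C" "0 \<le> C"
  shows "B^2 \<le> A * C"
proof (cases "C = 0")
  case True
  have "B = 0"
  proof (rule ccontr)
    assume "B \<noteq> 0"
    \<comment> \<open>With C = 0 the expression is affine in t, and at this point its value is
      -1.\<close>
    then show False using assms(1)[of "- (A + 1) / (2 * B)"] True by (simp add: field_simps)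
  qed
  then show ?thesis using True by simp
next
  case False
  then have "C > 0" using assms by simp
  have "0 \<le> A + 2 * (- B / C) * B + (- B / C)^2 * C" by (rule assms)
  also have "\<dots> = A - B^2 / C" using \<open>C > 0\<close> by (simp add: field_simps power2_eq_square)
  finally show ?thesis using \<open>C > 0\<close> by (simp add: field_simps)
qed

text \<open>Formulated for a measure instead of a set, so that the interior of an element and the
  unit interval parametrising an edge share one theory.\<close>

definition L2_on :: "'a measure \<Rightarrow> ('a \<Rightarrow> real) \<Rightarrow> bool" where
  "L2_on M u \<longleftrightarrow> u \<in> borel_measurable M \<and> integrable M (\<lambda>x. (u x)^2)"

lemma L2_on_measurable [measurable_dest]: "L2_on M u \<Longrightarrow> u \<in> borel_measurable M"
  by (simp add: L2_on_def)

lemma L2_on_integrable_mult: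
  assumes "L2_on M u" "L2_on M v" shows "integrable M (\<lambda>x. u x * v x)"
proof (rule Bochner_Integration.integrable_bound)
  show "integrable M (\<lambda>x. (u x)^2 + (v x)^2)" using assms by (simp add: L2_on_def)
  note [measurable] = assms[THEN L2_on_measurable]
  show "(\<lambda>x. u x * v x) \<in> borel_measurable M" by measurable
  have "\<bar>a * b\<bar> \<le> a^2 + b^2" for a b :: real
  proof -
    have "2 * (\<bar>a\<bar> * \<bar>b\<bar>) \<le> a^2 + b^2" using sum_squares_bound[of "\<bar>a\<bar>" "\<bar>b\<bar>"] by simp
    moreover have "0 \<le> \<bar>a\<bar> * \<bar>b\<bar>" by simp
    ultimately show ?thesis unfolding abs_mult by linarith
  qed
  then show "AE x in M. norm (u x * v x) \<le> norm ((u x)^2 + (v x)^2)" by simp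
qed

lemma L2_on_lincomb:
  assumes "L2_on M u" "L2_on M v" shows "L2_on M (\<lambda>x. a * u x + v x)"
proof -
  have "(\<lambda>x. (a * u x + v x)^2) = (\<lambda>x. a^2 * (u x)^2 + 2 * a * (u x * v x) + (v x)^2)"
    by (auto simp: power2_eq_square algebra_simps)
  then have "integrable M (\<lambda>x. (a * u x + v x)^2)"
    using assms L2_on_integrable_mult[OF assms] by (simp add: L2_on_def)
  moreover note [measurable] = assms[THEN L2_on_measurable]
  have "(\<lambda>x. a * u x + v x) \<in> borel_measurable M" by measurable
  ultimately show ?thesis by (simp add: L2_on_def)
qed

lemma L2_on_zero: "L2_on M (\<lambda>x. 0)"
  by (simp add: L2_on_def)

lemma L2_on_scale: "L2_on M u \<Longrightarrow> L2_on M (\<lambda>x. a * u x)"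
  using L2_on_lincomb[OF _ L2_on_zero, of M u a] by simp

lemma L2_on_add: "L2_on M u \<Longrightarrow> L2_on M v \<Longrightarrow> L2_on M (\<lambda>x. u x + v x)"
  using L2_on_lincomb[of M u v 1] by simp

lemma L2_on_diff: "L2_on M u \<Longrightarrow> L2_on M v \<Longrightarrow> L2_on M (\<lambda>x. u x - v x)"
  using L2_on_lincomb[of M v u "-1"] by simp

lemma L2_on_sum: "(\<And>i. i \<in> I \<Longrightarrow> L2_on M (u i)) \<Longrightarrow> L2_on M (\<lambda>x. \<Sum>i\<in>I. u i x)"
  by (induction I rule: infinite_finite_induct) (auto intro: L2_on_add L2_on_zero)

lemma L2_on_cong_AE:
  assumes "L2_on M u" "v \<in> borel_measurable M" "AE x in M. u x = v x" shows "L2_on M v"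
proof -
  have "integrable M (\<lambda>x. (u x)^2) \<longleftrightarrow> integrable M (\<lambda>x. (v x)^2)"
    using assms by (intro integrable_cong_AE) (auto simp: L2_on_def)
  then show ?thesis using assms by (simp add: L2_on_def)
qed

lemma (in finite_measure) L2_on_bounded:
  assumes "u \<in> borel_measurable M" "\<And>x. x \<in> space M \<Longrightarrow> \<bar>u x\<bar> \<le> B"
  shows "L2_on M u"
  unfolding L2_on_def
proof
  show "integrable M (\<lambda>x. (u x)^2)"
  proof (rule integrable_const_bound)
    show "AE x in M. norm ((u x)^2) \<le> B^2"
    proof (rule AE_I2)
      fix x assume "x \<in> space M"
      then have "\<bar>u x\<bar>^2 \<le> B^2" using assms(2) by (intro power_mono) auto
      then show "norm ((u x)^2) \<le> B^2" by simp
    qed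
  qed (use assms in simp)
qed (rule assms)

lemma (in finite_measure) L2_on_integrable: "L2_on M u \<Longrightarrow> integrable M u"
proof -
  assume "L2_on M u"
  moreover have "L2_on M (\<lambda>x. 1)" by (rule L2_on_bounded[of _ 1]) auto
  ultimately show "integrable M u" using L2_on_integrable_mult by fastforce
qed

lemma L2_on_cauchy_schwarz:
  assumes "L2_on M u" "L2_on M v"
  shows "(\<integral>x. u x * v x \<partial>M)^2 \<le> (\<integral>x. (u x)^2 \<partial>M) * (\<integral>x. (v x)^2 \<partial>M)"
proof (rule discriminant_bound)
  fix t :: real
  have "0 \<le> (\<integral>x. (t * v x + u x)^2 \<partial>M)" by simp
  also have "(\<lambda>x. (t * v x + u x)^2) = (\<lambda>x. (u x)^2 + 2 * t * (u x * v x) + t^2 * (v x)^2)"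
    by (auto simp: power2_eq_square algebra_simps)
  also have "(\<integral>x. (u x)^2 + 2 * t * (u x * v x) + t^2 * (v x)^2 \<partial>M)
    = (\<integral>x. (u x)^2 \<partial>M) + 2 * t * (\<integral>x. u x * v x \<partial>M) + t^2 * (\<integral>x. (v x)^2 \<partial>M)"
    using assms L2_on_integrable_mult[OF assms] by (simp add: L2_on_def)
  finally show "0 \<le> \<dots>" .
qed simp

definition L2_tendsto :: "'a measure \<Rightarrow> (nat \<Rightarrow> 'a \<Rightarrow> real) \<Rightarrow> ('a \<Rightarrow> real) \<Rightarrow> bool" where
  "L2_tendsto M s u \<longleftrightarrow> (\<lambda>n. \<integral>x. (s n x - u x)^2 \<partial>M) \<longlonglongrightarrow> 0"

text \<open>Strong convergence implies weak convergence, by the Cauchy-Schwarz inequality. All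
  limits in Green's formula are taken this way.\<close>

lemma L2_tendsto_integral_mult:
  assumes s: "\<And>n. L2_on M (s n)" and u: "L2_on M u" and v: "L2_on M v" and lim: "L2_tendsto M s u"
  shows "(\<lambda>n. \<integral>x. s n x * v x \<partial>M) \<longlonglongrightarrow> (\<integral>x. u x * v x \<partial>M)"
proof -
  have "(\<lambda>n. (\<integral>x. (s n x - u x) * v x \<partial>M)^2) \<longlonglongrightarrow> 0"
  proof (rule tendsto_sandwich)
    show "\<forall>\<^sub>F n in sequentially. 0 \<le> (\<integral>x. (s n x - u x) * v x \<partial>M)^2"
      by simp
    show "\<forall>\<^sub>F n in sequentially. (\<integral>x. (s n x - u x) * v x \<partial>M)^2
        \<le> (\<integral>x. (s n x - u x)^2 \<partial>M) * (\<integral>x. (v x)^2 \<partial>M)"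
      using s u v by (intro always_eventually allI L2_on_cauchy_schwarz L2_on_diff)
    show "(\<lambda>n. (\<integral>x. (s n x - u x)^2 \<partial>M) * (\<integral>x. (v x)^2 \<partial>M)) \<longlonglongrightarrow> 0"
      using tendsto_mult_right[OF lim[unfolded L2_tendsto_def], of "\<integral>x. (v x)^2 \<partial>M"] by simp
  qed auto
  then have "(\<lambda>n. \<integral>x. (s n x - u x) * v x \<partial>M) \<longlonglongrightarrow> 0"
    using tendsto_real_sqrt[of "\<lambda>n. (\<integral>x. (s n x - u x) * v x \<partial>M)^2" 0 sequentially]
    by (simp add: tendsto_rabs_zero_iff)
  moreover have "(\<integral>x. (s n x - u x) * v x \<partial>M) = (\<integral>x. s n x * v x \<partial>M) - (\<integral>x. u x * v x \<partial>M)" for n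
    using L2_on_integrable_mult[OF s v] L2_on_integrable_mult[OF u v] by (simp add: left_diff_distrib)
  ultimately show ?thesis by (simp add: LIM_zero_iff)
qed

text \<open>The pointwise inequality (a x + y)^2 \<le> 2 a^2 x^2 + 2 y^2, integrated, gives the
  dominating sequence.\<close>

lemma L2_tendsto_lincomb:
  assumes "\<And>n. L2_on M (s n)" "L2_on M u" "L2_tendsto M s u"
    and "\<And>n. L2_on M (t n)" "L2_on M v" "L2_tendsto M t v"
  shows "L2_tendsto M (\<lambda>n x. a * s n x + t n x) (\<lambda>x. a * u x + v x)"
  unfolding L2_tendsto_def
proof (rule tendsto_sandwich[where f = "\<lambda>n. 0" and h = "\<lambda>n. 2 * a^2 * (\<integral>x. (s n x - u x)^2 \<partial>M) + 2 * (\<integral>x. (t n x - v x)^2 \<partial>M)"])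
  let ?f = "\<lambda>n. 2 * a^2 * (\<integral>x. (s n x - u x)^2 \<partial>M) + 2 * (\<integral>x. (t n x - v x)^2 \<partial>M)"
  have "?f \<longlonglongrightarrow> 2 * a^2 * 0 + 2 * 0"
    using assms unfolding L2_tendsto_def by (intro tendsto_intros) auto
  then show "?f \<longlonglongrightarrow> 0" by simp
  show "\<forall>\<^sub>F n in sequentially. (\<integral>x. (a * s n x + t n x - (a * u x + v x))^2 \<partial>M) \<le> ?f n"
  proof (intro always_eventually allI)
    fix n
    have i1: "L2_on M (\<lambda>x. s n x - u x)" and i2: "L2_on M (\<lambda>x. t n x - v x)"
      using assms by (auto intro: L2_on_diff)
    then have i: "integrable M (\<lambda>x. (s n x - u x)^2)" "integrable M (\<lambda>x. (t n x - v x)^2)"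
      by (auto simp: L2_on_def)
    have "(\<integral>x. (a * s n x + t n x - (a * u x + v x))^2 \<partial>M)
      \<le> (\<integral>x. 2 * a^2 * (s n x - u x)^2 + 2 * (t n x - v x)^2 \<partial>M)"
    proof (rule integral_mono)
      have "(\<lambda>x. a * s n x + t n x - (a * u x + v x)) = (\<lambda>x. a * (s n x - u x) + (t n x - v x))"
        by (simp add: algebra_simps)
      then have "L2_on M (\<lambda>x. a * s n x + t n x - (a * u x + v x))"
        using L2_on_lincomb[OF i1 i2, of a] by simp
      then show "integrable M (\<lambda>x. (a * s n x + t n x - (a * u x + v x))^2)"
        by (simp add: L2_on_def)
      show "(a * s n x + t n x - (a * u x + v x))^2 \<le> 2 * a^2 * (s n x - u x)^2 + 2 * (t n x - v x)^2" for x
      proof -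
        have "0 \<le> (a * (s n x - u x) - (t n x - v x))^2" by simp
        then show ?thesis by (simp add: power2_eq_square algebra_simps)
      qed
    qed (use i in simp)
    also have "\<dots> = ?f n" using i by simp
    finally show "(\<integral>x. (a * s n x + t n x - (a * u x + v x))^2 \<partial>M) \<le> ?f n" .
  qed
  show "\<forall>\<^sub>F n in sequentially. 0 \<le> (\<integral>x. (a * s n x + t n x - (a * u x + v x))^2 \<partial>M)"
    by simp
qed auto

lemma L2_tendsto_cong_AE:
  assumes "L2_tendsto M s u" "AE x in M. u x = v x"
    and "\<And>n. s n \<in> borel_measurable M" "u \<in> borel_measurable M" "v \<in> borel_measurable M"
  shows "L2_tendsto M s v"
proof -
  have "(\<integral>x. (s n x - u x)^2 \<partial>M) = (\<integral>x. (s n x - v x)^2 \<partial>M)" for n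
    using assms by (intro integral_cong_AE) auto
  then show ?thesis using assms(1) by (simp add: L2_tendsto_def)
qed

lemma L2_tendsto_const: "L2_tendsto M (\<lambda>n. u) u"
  by (simp add: L2_tendsto_def)

lemma L2_on_zero_AE:
  assumes "L2_on M u" "(\<integral>x. (u x)^2 \<partial>M) = 0" shows "AE x in M. u x = 0"
proof -
  have "AE x in M. (u x)^2 = 0"
    using assms integral_nonneg_eq_0_iff_AE[of M "\<lambda>x. (u x)^2"] by (simp add: L2_on_def)
  then show ?thesis by simp
qed

lemma LINT_lebesgue_on:
  "U \<in> sets lebesgue \<Longrightarrow> (LINT x:U|lebesgue. f x) = (\<integral>x. f x \<partial>lebesgue_on U)"
  for f :: "'a::euclidean_space \<Rightarrow> real"
  unfolding set_lebesgue_integral_def by (subst integral_restrict_space) auto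

lemma sq_int_iff:
  assumes "U \<in> sets lebesgue" shows "sq_int U u \<longleftrightarrow> L2_on (lebesgue_on U) u"
proof -
  have "set_borel_measurable lebesgue U u \<longleftrightarrow> u \<in> borel_measurable (lebesgue_on U)"
    unfolding set_borel_measurable_def
    using borel_measurable_restrict_space_iff[of U lebesgue u] assms by simp
  moreover have "set_integrable lebesgue U (\<lambda>x. (u x)^2) \<longleftrightarrow> integrable (lebesgue_on U) (\<lambda>x. (u x)^2)"
    unfolding set_integrable_def using assms by (subst integrable_restrict_space) auto
  ultimately show ?thesis by (simp add: sq_int_def L2_on_def)
qed

lemma finite_measure_lebesgue_on:
  assumes "bounded U" "U \<in> sets lebesgue" shows "finite_measure (lebesgue_on U)"
proof
  have "U \<in> lmeasurable" using assms bounded_set_imp_lmeasurable by blast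
  then show "emeasure (lebesgue_on U) (space (lebesgue_on U)) \<noteq> \<infinity>"
    using assms by (simp add: emeasure_restrict_space fmeasurable_def space_restrict_space)
qed

lemma continuous_L2_on:
  fixes f :: "'a::euclidean_space \<Rightarrow> real"
  assumes "continuous_on UNIV f" "bounded U" "U \<in> sets lebesgue"
  shows "L2_on (lebesgue_on U) f"
proof -
  interpret finite_measure "lebesgue_on U" using assms finite_measure_lebesgue_on by blast
  have "compact (closure U)" using assms by (simp add: compact_closure)
  then have "bounded (f ` closure U)"
    by (intro compact_imp_bounded compact_continuous_image continuous_on_subset[OF assms(1)]) auto
  then obtain B where "\<And>x. x \<in> U \<Longrightarrow> \<bar>f x\<bar> \<le> B"
    unfolding bounded_iff using closure_subset by fastforce
  moreover have "f \<in> borel_measurable (lebesgue_on U)"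
    by (intro continuous_imp_measurable_on_sets_lebesgue continuous_on_subset[OF assms(1)] assms(3)) auto
  ultimately show ?thesis by (intro L2_on_bounded) auto
qed

section \<open>Weak derivatives\<close>

text \<open>Open boxes are stable under intersection and generate the Borel sets, so vanishing of
  the integral spreads from boxes to Borel sets by Dynkin's argument; the vanishing total integral
  serves the complements. A density with all integrals zero is zero almost everywhere.\<close>

lemma AE_zero_of_boxes:
  fixes g :: "'a::euclidean_space \<Rightarrow> real"
  assumes g: "integrable lborel g" and tot: "(\<integral>x. g x \<partial>lborel) = 0"
    and box: "\<And>a b. (\<integral>x. indicator (box a b) x * g x \<partial>lborel) = 0"
  shows "AE x in lborel. g x = 0"
proof (rule density_unique_real[where f' = "\<lambda>x. 0"])
  fix A assume "A \<in> sets (lborel :: 'a measure)"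
  then have A: "A \<in> sigma_sets UNIV (range (\<lambda>(a, b). box a b :: 'a set))"
    unfolding sets_lborel by (simp add: borel_eq_box)
  have sb: "sigma_sets UNIV (range (\<lambda>(a, b). box a b :: 'a set)) = sets lborel"
    unfolding sets_lborel by (simp add: borel_eq_box)
  have st: "Int_stable (range (\<lambda>(a, b). box a b :: 'a set))"
  proof (rule Int_stableI)
    fix P Q assume "P \<in> range (\<lambda>(a, b). box a b :: 'a set)" "Q \<in> range (\<lambda>(a, b). box a b :: 'a set)"
    then obtain a b c d where PQ: "P = box a b" "Q = box c d" by auto
    show "P \<inter> Q \<in> range (\<lambda>(a, b). box a b)"
      unfolding PQ box_Int_box by (rule range_eqI[where x = "(_, _)"]) simp
  qed
  have int: "set_integrable lborel B g" if "B \<in> sets lborel" for B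
    using g that integrable_mult_indicator[of B lborel g] unfolding set_integrable_def by blast
  have cl: "range (\<lambda>(a, b). box a b :: 'a set) \<subseteq> Pow UNIV" by simp
  have "(LINT x:A|lborel. g x) = 0"
    using st cl A
  proof (induction rule: sigma_sets_induct_disjoint)
    case (basic A)
    then show ?case using box by (auto simp: set_lebesgue_integral_def)
  next
    case (compl A)
    then have "A \<in> sets lborel" using sb by blast
    have "(LINT x:UNIV - A|lborel. g x) = (\<integral>x. g x - indicator A x *\<^sub>R g x \<partial>lborel)"
      unfolding set_lebesgue_integral_def
      by (intro Bochner_Integration.integral_cong) (auto simp: indicator_def)
    also have "\<dots> = 0"
      using int[OF \<open>A \<in> sets lborel\<close>] g compl tot
      by (simp add: set_integrable_def set_lebesgue_integral_def)
    finally show ?case .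
  next
    case (union A)
    then have A: "\<And>i. A i \<in> sets lborel" using sb by blast
    then have "(\<Union>i. A i) \<in> sets lborel" by blast
    have "(LINT x:(\<Union>i. A i)|lborel. g x) = (\<Sum>i. (LINT x:(A i)|lborel. g x))"
      using A union(1) int[OF \<open>(\<Union>i. A i) \<in> sets lborel\<close>]
      by (intro lebesgue_integral_countable_add) (auto simp: disjoint_family_on_def)
    then show ?case using union by simp
  qed (auto simp: set_lebesgue_integral_def)
  then show "(LINT x:A|lborel. g x) = (LINT x:A|lborel. 0)" by (simp add: set_lebesgue_integral_def)
qed (use g in auto)

text \<open>The shift by -1 makes each factor vanish already at distance 1/m from its side of the
  box, so the support is a compact subset of the open box. As m grows the product converges to the
  indicator of that box.\<close>

definition box_cutoff :: "point \<Rightarrow> point \<Rightarrow> nat \<Rightarrow> point \<Rightarrow> real" where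
  "box_cutoff a b m x = ramp (m * (x$1 - a$1) - 1) * ramp (m * (b$1 - x$1) - 1)
     * (ramp (m * (x$2 - a$2) - 1) * ramp (m * (b$2 - x$2) - 1))"

lemma smooth_ramp_coord: "smooth (\<lambda>x. ramp (\<alpha> * x $ i + c))"
proof -
  have "(\<lambda>x. ramp (\<alpha> * x $ i + c)) = (\<lambda>x. ramp (axis i \<alpha> \<bullet> x + c))"
    by (simp add: inner_axis')
  then show ?thesis using smooth_ramp by metis
qed

lemma test_function_box_cutoff:
  assumes "box a b \<subseteq> U" shows "test_function U (box_cutoff a b m)"
  unfolding test_function_def
proof
  have "box_cutoff a b m = (\<lambda>x. ramp (m * x$1 + (- m * a$1 - 1)) * ramp (- m * x$1 + (m * b$1 - 1))
     * (ramp (m * x$2 + (- m * a$2 - 1)) * ramp (- m * x$2 + (m * b$2 - 1))))"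
    unfolding box_cutoff_def by (auto simp: algebra_simps)
  then show "smooth (box_cutoff a b m)"
    by (simp only:) (intro smooth_mult smooth_ramp_coord)
  show "\<exists>C. compact C \<and> C \<subseteq> U \<and> (\<forall>x. x \<notin> C \<longrightarrow> box_cutoff a b m x = 0)"
  proof (cases "m = 0")
    case True
    then show ?thesis by (intro exI[of _ "{}"]) (auto simp: box_cutoff_def)
  next
    case False
    let ?e = "(\<chi> i. 1 / real m) :: point"
    have sub: "cbox (a + ?e) (b - ?e) \<subseteq> U"
    proof
      fix x assume "x \<in> cbox (a + ?e) (b - ?e)"
      then have x: "a $ i + 1 / m \<le> x $ i \<and> x $ i \<le> b $ i - 1 / m" for i
        by (simp add: mem_box_cart)
      have "1 / real m > 0" using False by simp
      then have "a $ i < x $ i \<and> x $ i < b $ i" for i using x[of i] by linarith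
      then show "x \<in> U" using assms by (auto simp: mem_box_cart)
    qed
    have "box_cutoff a b m x = 0" if "x \<notin> cbox (a + ?e) (b - ?e)" for x
    proof -
      have "\<exists>i. real m * (x$i - a$i) - 1 \<le> 0 \<or> real m * (b$i - x$i) - 1 \<le> 0"
      proof -
        obtain i where "\<not> (a $ i + 1 / m \<le> x $ i \<and> x $ i \<le> b $ i - 1 / m)"
          using \<open>x \<notin> cbox (a + ?e) (b - ?e)\<close> by (auto simp: mem_box_cart)
        then have "x$i - a$i < 1 / m \<or> b$i - x$i < 1 / m" by linarith
        then have "real m * (x$i - a$i) < m * (1 / m) \<or> real m * (b$i - x$i) < m * (1 / m)"
          using False by (metis mult_less_cancel_left_pos of_nat_0_less_iff neq0_conv)
        then show ?thesis using False by (intro exI[of _ i]) auto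
      qed
      then obtain i where i: "real m * (x$i - a$i) - 1 \<le> 0 \<or> real m * (b$i - x$i) - 1 \<le> 0" ..
      have "i = 1 \<or> i = 2" using exhaust_2 by blast
      with i show ?thesis by (auto simp: box_cutoff_def)
    qed
    with sub show ?thesis by (intro exI[of _ "cbox (a + ?e) (b - ?e)"] conjI compact_cbox allI impI)
  qed
qed

lemma box_cutoff_bounds: "0 \<le> box_cutoff a b m x" "box_cutoff a b m x \<le> 1"
  unfolding box_cutoff_def by (auto intro!: mult_nonneg_nonneg mult_le_one ramp_bounds)

lemma box_cutoff_limit: "(\<lambda>m. box_cutoff a b m x) \<longlonglongrightarrow> indicator (box a b) x"
proof (cases "x \<in> box a b")
  case True
  then have "\<And>i. 0 < x $ i - a $ i" "\<And>i. 0 < b $ i - x $ i" by (auto simp: mem_box_cart)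
  then have "(\<lambda>m. box_cutoff a b m x) \<longlonglongrightarrow> 1 * 1 * (1 * 1)"
    unfolding box_cutoff_def diff_conv_add_uminus[of _ 1] by (intro tendsto_mult ramp_limit)
  then show ?thesis using True by simp
next
  case False
  then obtain i where "x $ i \<le> a $ i \<or> b $ i \<le> x $ i" by (auto simp: mem_box_cart not_less)
  moreover have "real m * (x$i - a$i) - 1 \<le> 0" if "x $ i \<le> a $ i" for m
    using mult_nonneg_nonpos[of "real m" "x$i - a$i"] that by simp
  moreover have "real m * (b$i - x$i) - 1 \<le> 0" if "b $ i \<le> x $ i" for m
    using mult_nonneg_nonpos[of "real m" "b$i - x$i"] that by simp
  moreover have "i = 1 \<or> i = 2" using exhaust_2 by blast
  ultimately have "box_cutoff a b m x = 0" for m by (auto simp: box_cutoff_def)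
  then show ?thesis using False by simp
qed

text \<open>Box cut-offs are admissible for boxes inside U and converge boundedly to the indicator,
  so w has integral 0 over each such box. Countably many of these boxes exhaust U, and on each one
  the box criterion applies. Since w is only Lebesgue measurable and the criterion concerns
  \<open>lborel\<close>, a Borel representative g mediates.\<close>

lemma fundamental_lemma:
  assumes U: "open U" "bounded U" and w: "L2_on (lebesgue_on U) w"
    and zero: "\<And>\<eta>. test_function U \<eta> \<Longrightarrow> (\<integral>x. w x * \<eta> x \<partial>lebesgue_on U) = 0"
  shows "AE x in lebesgue_on U. w x = 0"
proof -
  have UL: "U \<in> sets lebesgue" using U lmeasurable_open fmeasurableD by metis
  interpret finite_measure "lebesgue_on U" using U UL finite_measure_lebesgue_on by blast
  have wi: "integrable (lebesgue_on U) w" using w L2_on_integrable by blast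
  have boxU: "(\<integral>x. w x * indicator (box a b) x \<partial>lebesgue_on U) = 0" if "box a b \<subseteq> U" for a b
  proof -
    have "(\<lambda>m. \<integral>x. w x * box_cutoff a b m x \<partial>lebesgue_on U)
        \<longlonglongrightarrow> (\<integral>x. w x * indicator (box a b) x \<partial>lebesgue_on U)"
    proof (rule integral_dominated_convergence[where w = "\<lambda>x. \<bar>w x\<bar>"])
      have wm[measurable]: "w \<in> borel_measurable (lebesgue_on U)" using wi by auto
      show "(\<lambda>x. w x * indicator (box a b) x) \<in> borel_measurable (lebesgue_on U)"
        by (intro borel_measurable_times wm borel_measurable_indicator)
          (use that in \<open>auto simp: sets_restrict_space_iff UL\<close>)
      show "(\<lambda>x. w x * box_cutoff a b m x) \<in> borel_measurable (lebesgue_on U)" for m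
      proof (intro borel_measurable_times wm)
        have "smooth (box_cutoff a b m)"
          using test_function_box_cutoff[of a b UNIV] by (simp add: test_function_def)
        then show "box_cutoff a b m \<in> borel_measurable (lebesgue_on U)"
          by (intro continuous_imp_measurable_on_sets_lebesgue smooth_continuous_on UL)
      qed
      show "AE x in lebesgue_on U. (\<lambda>m. w x * box_cutoff a b m x) \<longlonglongrightarrow> w x * indicator (box a b) x"
        by (intro AE_I2 tendsto_mult tendsto_const box_cutoff_limit)
      show "AE x in lebesgue_on U. norm (w x * box_cutoff a b m x) \<le> \<bar>w x\<bar>" for m
        using box_cutoff_bounds[of a b m]
        by (intro AE_I2) (auto simp: abs_mult intro!: mult_left_le)
    qed (use wi in auto)
    moreover have "(\<integral>x. w x * box_cutoff a b m x \<partial>lebesgue_on U) = 0" for m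
      using zero test_function_box_cutoff that by blast
    ultimately show ?thesis by (simp add: LIMSEQ_const_iff)
  qed
  let ?f = "\<lambda>x. indicator U x * w x"
  have fi: "integrable lebesgue ?f" using wi UL by (subst (asm) integrable_restrict_space) auto
  then obtain g where g: "g \<in> borel_measurable lborel" and gf: "AE x in lborel. ?f x = g x"
    using completion_ex_borel_measurable_real[of ?f lborel] by auto
  have gfl: "AE x in lebesgue. ?f x = g x" using gf by (rule AE_completion)
  have gm: "g \<in> borel_measurable lebesgue" using g by (rule measurable_completion)
  have gi: "integrable lborel g"
    using integrable_cong_AE[OF _ gm gfl] fi g by (auto simp: integrable_completion)
  obtain D where D: "countable D" "D \<subseteq> Pow U" "\<And>X. X \<in> D \<Longrightarrow> \<exists>a b. X = box a b" "\<Union>D = U"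
    using open_countable_Union_open_box[OF U(1)] by metis
  have "AE x in lborel. \<forall>X\<in>D. indicator X x * g x = 0"
  proof (rule AE_ball_countable[THEN iffD2, OF D(1)], rule ballI)
    fix X assume "X \<in> D"
    then obtain p q where X: "X = box p q" "box p q \<subseteq> U" using D by blast
    have I: "(\<integral>x. indicator (box a b) x * (indicator X x * g x) \<partial>lborel) = 0" for a b
    proof -
      \<comment> \<open>The intersection of two boxes is a box, here inside U, so its integral is
        already known to vanish.\<close>
      obtain c d where cd: "box a b \<inter> box p q = box c d" unfolding box_Int_box by blast
      have "(\<integral>x. indicator (box a b) x * (indicator X x * g x) \<partial>lborel) = (\<integral>x. indicator (box c d) x * g x \<partial>lborel)"
        unfolding X cd[symmetric] by (intro Bochner_Integration.integral_cong) (auto simp: indicator_def)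
      also have "\<dots> = (\<integral>x. indicator (box c d) x * g x \<partial>lebesgue)"
        using g by (subst integral_completion) auto
      also have "\<dots> = (\<integral>x. indicator (box c d) x * ?f x \<partial>lebesgue)"
      proof (rule integral_cong_AE)
        show "AE x in lebesgue. indicator (box c d) x * g x = indicator (box c d) x * ?f x"
          using gfl by eventually_elim simp
      next
        have fm: "?f \<in> borel_measurable lebesgue" using fi by (rule borel_measurable_integrable)
        show "(\<lambda>x. indicator (box c d) x * g x) \<in> borel_measurable lebesgue"
          by (intro borel_measurable_times[OF _ gm] borel_measurable_indicator) auto
        show "(\<lambda>x. indicator (box c d) x * ?f x) \<in> borel_measurable lebesgue"
          by (intro borel_measurable_times[OF _ fm] borel_measurable_indicator) auto
      qed
      also have "\<dots> = (\<integral>x. indicator U x *\<^sub>R (w x * indicator (box c d) x) \<partial>lebesgue)"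
        by (intro Bochner_Integration.integral_cong) (auto simp: indicator_def)
      also have "\<dots> = (\<integral>x. w x * indicator (box c d) x \<partial>lebesgue_on U)"
        using UL by (subst integral_restrict_space) auto
      also have "\<dots> = 0" using boxU cd X by blast
      finally show ?thesis .
    qed
    show "AE x in lborel. indicator X x * g x = 0"
    proof (rule AE_zero_of_boxes[OF _ _ I])
      show "integrable lborel (\<lambda>x. indicator X x * g x)"
        using integrable_mult_indicator[of X lborel g] gi X by simp
      have "(\<integral>x. indicator X x * g x \<partial>lborel) = (\<integral>x. indicator X x * (indicator X x * g x) \<partial>lborel)"
        by (intro Bochner_Integration.integral_cong) (auto simp: indicator_def)
      then show "(\<integral>x. indicator X x * g x \<partial>lborel) = 0" using I[of p q] X by simp
    qed
  qed
  then have "AE x in lebesgue. \<forall>X\<in>D. indicator X x * g x = 0" by (rule AE_completion)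
  then have "AE x in lebesgue. x \<in> U \<longrightarrow> w x = 0"
    using gfl
  proof eventually_elim
    case (elim x)
    show ?case
    proof
      assume "x \<in> U"
      then obtain X where "X \<in> D" "x \<in> X" using D by blast
      then show "w x = 0" using elim \<open>x \<in> U\<close> by auto
    qed
  qed
  then show ?thesis using UL by (subst AE_restrict_space_iff) auto
qed

section \<open>Fubini's theorem in coordinates and integration by parts for compact supports\<close>

lemma slice_continuous: "continuous_on UNIV (\<lambda>(s, t). axis i s + axis j t :: point)"
proof -
  have "(\<lambda>(s, t). axis i s + axis j t :: point) = (\<lambda>z. fst z *\<^sub>R axis i 1 + snd z *\<^sub>R axis j 1)"
    by (auto simp: vec_eq_iff axis_def)
  then show ?thesis by (auto intro!: continuous_intros)
qed

text \<open>Both measures assign to a box the product of its side lengths. The two coordinates may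
  come in either order, so that the inner integral can later run in the direction of
  differentiation.\<close>

lemma slice_distr:
  assumes "i \<noteq> (j::2)"
  shows "distr (lborel \<Otimes>\<^sub>M lborel) lborel (\<lambda>(s, t). axis i s + axis j t) = (lborel :: point measure)"
proof (rule lborel_eqI[symmetric])
  have U: "(UNIV :: 2 set) = {i, j}" using assms exhaust_2[of i] exhaust_2[of j] by (auto simp: UNIV_2)
  have m: "(\<lambda>(s, t). axis i s + axis j t :: point) \<in> borel_measurable borel"
    by (intro borel_measurable_continuous_onI slice_continuous)
  then have m: "(\<lambda>(s, t). axis i s + axis j t :: point) \<in> lborel \<Otimes>\<^sub>M lborel \<rightarrow>\<^sub>M lborel"
    by (simp add: lborel_prod)
  show "emeasure (distr (lborel \<Otimes>\<^sub>M lborel) lborel (\<lambda>(s, t). axis i s + axis j t :: point)) (box l u)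
      = (\<Prod>b\<in>Basis. (u - l) \<bullet> b)"
    if "\<And>b. b \<in> Basis \<Longrightarrow> l \<bullet> b \<le> u \<bullet> b" for l u :: point
  proof -
    have le: "l $ k \<le> u $ k" for k using that[of "axis k 1"] by (simp add: axis_in_Basis_iff inner_axis)
    have "(\<lambda>(s, t). axis i s + axis j t :: point) -` box l u \<inter> space (lborel \<Otimes>\<^sub>M lborel)
       = {l$i<..<u$i} \<times> {l$j<..<u$j}"
    proof -
      have "(axis i s + axis j t :: point) \<in> box l u \<longleftrightarrow> s \<in> {l$i<..<u$i} \<and> t \<in> {l$j<..<u$j}" for s t
      proof -
        have "(\<forall>k::2. P k) \<longleftrightarrow> P i \<and> P j" for P using U by (metis UNIV_I insertE singletonD)
        then show ?thesis using assms by (auto simp: mem_box_cart axis_def)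
      qed
      then show ?thesis by (auto simp: space_pair_measure)
    qed
    then have "emeasure (distr (lborel \<Otimes>\<^sub>M lborel) lborel (\<lambda>(s, t). axis i s + axis j t :: point)) (box l u)
      = emeasure (lborel \<Otimes>\<^sub>M lborel) ({l$i<..<u$i} \<times> {l$j<..<u$j})"
      using m by (subst emeasure_distr) auto
    also have "\<dots> = ennreal (u$i - l$i) * ennreal (u$j - l$j)"
      using le by (subst lborel.emeasure_pair_measure_Times) auto
    also have "\<dots> = ennreal ((u$i - l$i) * (u$j - l$j))" using le by (simp add: ennreal_mult)
    also have "(u$i - l$i) * (u$j - l$j) = (\<Prod>b\<in>Basis. (u - l) \<bullet> b)"
    proof -
      have B: "(Basis :: point set) = (\<lambda>k. axis k 1) ` UNIV" by (auto simp: Basis_vec_def)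
      have inj: "inj (\<lambda>k::2. axis k (1::real))" by (auto simp: inj_on_def axis_eq_axis)
      show ?thesis unfolding B prod.reindex[OF inj] using assms by (simp add: U inner_axis)
    qed
    finally show ?thesis .
  qed
qed simp

lemma integral_slice:
  assumes "i \<noteq> (j::2)" "integrable lborel (f :: point \<Rightarrow> real)"
  shows "(\<integral>x. f x \<partial>lborel) = (\<integral>t. (\<integral>s. f (axis i s + axis j t) \<partial>lborel) \<partial>lborel)"
proof -
  let ?T = "\<lambda>(s, t). axis i s + axis j t :: point"
  have "?T \<in> borel_measurable borel"
    by (intro borel_measurable_continuous_onI slice_continuous)
  then have m[measurable]: "?T \<in> lborel \<Otimes>\<^sub>M lborel \<rightarrow>\<^sub>M lborel" by (simp add: lborel_prod)
  have fm: "f \<in> borel_measurable lborel" using assms by auto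
  have "integrable (distr (lborel \<Otimes>\<^sub>M lborel) lborel ?T) f" using slice_distr[OF assms(1)] assms(2) by simp
  then have "integrable (lborel \<Otimes>\<^sub>M lborel) (\<lambda>z. f (?T z))"
    using integrable_distr_eq[OF m fm] by simp
  then have i: "integrable (lborel \<Otimes>\<^sub>M lborel) (\<lambda>(s, t). f (axis i s + axis j t))"
    by (simp add: case_prod_unfold)
  have "(\<integral>x. f x \<partial>lborel) = (\<integral>z. f (?T z) \<partial>(lborel \<Otimes>\<^sub>M lborel))"
    using integral_distr[OF m fm] slice_distr[OF assms(1)] by simp
  also have "\<dots> = (\<integral>t. (\<integral>s. f (axis i s + axis j t) \<partial>lborel) \<partial>lborel)"
    using lborel_pair.integral_snd[OF i] by (simp add: case_prod_unfold)
  finally show ?thesis .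
qed

lemma integral_derivative_compact_support:
  fixes F :: "real \<Rightarrow> real"
  assumes "\<And>s. (F has_real_derivative f s) (at s)" "continuous_on UNIV f"
    and "0 \<le> B" "\<And>s. \<bar>s\<bar> \<ge> B \<Longrightarrow> F s = 0" "\<And>s. \<bar>s\<bar> \<ge> B \<Longrightarrow> f s = 0"
  shows "(\<integral>s. f s \<partial>lborel) = 0"
proof -
  have "has_bochner_integral lborel (\<lambda>s. f s * indicator {-B..B} s) (F B - F (-B))"
    using assms by (intro has_bochner_integral_FTC_Icc_real) (auto simp: continuous_on_eq_continuous_at)
  then have "(\<integral>s. f s * indicator {-B..B} s \<partial>lborel) = 0"
    using assms by (simp add: has_bochner_integral_iff)
  moreover have "f s * indicator {-B..B} s = f s" for s
    using assms(5)[of s] by (cases "\<bar>s\<bar> \<ge> B") (auto simp: indicator_def)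
  ultimately show ?thesis by simp
qed

lemma has_derivative_axis_line:
  "smooth u \<Longrightarrow> ((\<lambda>s. u (axis i s + y)) has_real_derivative pd i u (axis i s + y)) (at s)"
proof -
  assume u: "smooth u"
  have "((\<lambda>s. s *\<^sub>R axis i 1 + y :: point) has_derivative (\<lambda>h. h *\<^sub>R axis i 1)) (at s)"
    by (auto intro!: derivative_eq_intros)
  from has_derivative_compose[OF this smooth_has_derivative[OF u]]
  have "((\<lambda>s. u (s *\<^sub>R axis i 1 + y)) has_derivative
      (\<lambda>h. \<Sum>k\<in>UNIV. pd k u (s *\<^sub>R axis i 1 + y) * (h *\<^sub>R axis i 1 :: point) $ k)) (at s)" .
  moreover have "(\<lambda>h. \<Sum>k\<in>UNIV. pd k u (s *\<^sub>R axis i 1 + y) * (h *\<^sub>R axis i 1 :: point) $ k)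
    = (*) (pd i u (s *\<^sub>R axis i 1 + y))"
    by (auto simp: fun_eq_iff axis_def if_distrib cong: if_cong)
  moreover have "s *\<^sub>R axis i 1 = (axis i s :: point)" for s by (simp add: vec_eq_iff axis_def)
  ultimately show ?thesis unfolding has_field_derivative_def by simp
qed

lemma axis_line_continuous: "continuous_on UNIV (\<lambda>s. axis i s + y :: point)"
proof -
  have eq: "axis i s + y = s *\<^sub>R axis i 1 + y" for s
    by (auto simp: vec_eq_iff axis_def)
  show ?thesis unfolding eq by (intro continuous_intros)
qed

lemma smooth_axis_line_continuous: "smooth u \<Longrightarrow> continuous_on UNIV (\<lambda>s. u (axis i s + y))"
  using continuous_on_compose2[OF smooth_continuous_on[of u UNIV] axis_line_continuous] by auto

lemma two_indices: "\<exists>j. i \<noteq> (j::2)"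
proof -
  have "(1::2) \<noteq> 2" by simp
  then show ?thesis by metis
qed

text \<open>On every line parallel to the axis i the integrand is the derivative of a compactly
  supported function of one variable, so the inner integral of Fubini's theorem is 0.\<close>

lemma integral_pd_compact_support:
  assumes u: "smooth u" and C: "compact C" "\<And>x. x \<notin> C \<Longrightarrow> u x = 0"
  shows "(\<integral>x. pd i u x \<partial>lborel) = 0"
proof -
  obtain j where ij: "i \<noteq> (j::2)" using two_indices by blast
  have z: "pd i u x = 0" if "x \<notin> C" for x
  proof -
    have "open (- C)" using C by (simp add: compact_imp_closed open_Compl)
    then have "(u has_derivative (\<lambda>h. 0)) (at x)"
      using that C(2) by (intro has_derivative_transform_within_open[OF has_derivative_const[of 0]]) auto
    from pd_eq[OF this] show ?thesis .
  qed
  obtain B where B: "B > 0" "\<And>x. x \<in> C \<Longrightarrow> norm x \<le> B" using C compact_imp_bounded bounded_pos by metis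
  have "integrable lborel (\<lambda>x. indicator C x *\<^sub>R pd i u x)"
    using C u by (intro borel_integrable_compact smooth_continuous_on smooth_pd)
  moreover have "(\<lambda>x. indicator C x *\<^sub>R pd i u x) = pd i u" using z by (auto simp: fun_eq_iff indicator_def)
  ultimately have "(\<integral>x. pd i u x \<partial>lborel) = (\<integral>t. (\<integral>s. pd i u (axis i s + axis j t) \<partial>lborel) \<partial>lborel)"
    using integral_slice[OF ij, of "pd i u"] by simp
  also have "\<dots> = 0"
  proof -
    have "(\<integral>s. pd i u (axis i s + axis j t) \<partial>lborel) = 0" for t
    \<comment> \<open>The margin of 1 excludes points with coordinate of modulus exactly B, which
      may still belong to the support.\<close>
    proof (rule integral_derivative_compact_support[where F = "\<lambda>s. u (axis i s + axis j t)" and B = "B + 1"])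
      fix s :: real assume s: "\<bar>s\<bar> \<ge> B + 1"
      have "axis i s + axis j t \<notin> C"
      proof
        assume "axis i s + axis j t \<in> C"
        then have "\<bar>(axis i s + axis j t :: point) $ i\<bar> \<le> B" using B component_le_norm_cart order_trans by blast
        then show False using s ij by (simp add: axis_def)
      qed
      then show "u (axis i s + axis j t) = 0" "pd i u (axis i s + axis j t) = 0" using C z by auto
    qed (use u B in \<open>auto intro: has_derivative_axis_line smooth_axis_line_continuous smooth_pd\<close>)
    then show ?thesis by simp
  qed
  finally show ?thesis .
qed

section \<open>Weak derivatives and Sobolev spaces on a bounded open set\<close>

locale bounded_open =
  fixes U :: "point set"
  assumes open_U: "open U" and bounded_U: "bounded U"
begin

lemma U_sets [simp, measurable]: "U \<in> sets lebesgue"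
  using open_U lmeasurable_open fmeasurableD bounded_U by metis

lemma finite_measure_U: "finite_measure (lebesgue_on U)"
  by (intro finite_measure_lebesgue_on bounded_U U_sets)

lemma LINT_U: "(LINT x:U|lebesgue. f x) = (\<integral>x. f x \<partial>lebesgue_on U)"
  for f :: "point \<Rightarrow> real" by (simp add: LINT_lebesgue_on)

lemma sq_int_U: "sq_int U u \<longleftrightarrow> L2_on (lebesgue_on U) u"
  by (simp add: sq_int_iff)

lemma smooth_L2: "smooth u \<Longrightarrow> L2_on (lebesgue_on U) u"
  by (intro continuous_L2_on smooth_continuous_on bounded_U U_sets)

lemma test_function_L2: "test_function U \<eta> \<Longrightarrow> L2_on (lebesgue_on U) \<eta>"
  by (auto simp: test_function_def intro: smooth_L2)

lemma test_function_pd_L2: "test_function U \<eta> \<Longrightarrow> L2_on (lebesgue_on U) (pd i \<eta>)"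
  by (auto simp: test_function_def intro: smooth_L2 smooth_pd)

lemma has_weak_deriv_iff: "has_weak_deriv U i u w \<longleftrightarrow> L2_on (lebesgue_on U) w \<and>
  (\<forall>\<eta>. test_function U \<eta> \<longrightarrow> (\<integral>x. u x * pd i \<eta> x \<partial>lebesgue_on U) = - (\<integral>x. w x * \<eta> x \<partial>lebesgue_on U))"
  by (simp add: has_weak_deriv_def sq_int_U LINT_U)

text \<open>The difference of two candidates is orthogonal to all test functions. Because
  \<open>wd\<close> is an arbitrary choice among the candidates, this is the source of every later
  statement about its values.\<close>

lemma has_weak_deriv_unique:
  assumes "has_weak_deriv U i u w" "has_weak_deriv U i u w'"
  shows "AE x in lebesgue_on U. w x = w' x"
proof -
  have L: "L2_on (lebesgue_on U) w" "L2_on (lebesgue_on U) w'" using assms by (auto simp: has_weak_deriv_iff)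
  have "AE x in lebesgue_on U. w x - w' x = 0"
  proof (rule fundamental_lemma[OF open_U bounded_U L2_on_diff[OF L]])
    fix \<eta> assume "test_function U \<eta>"
    then have "(\<integral>x. w x * \<eta> x \<partial>lebesgue_on U) = (\<integral>x. w' x * \<eta> x \<partial>lebesgue_on U)"
      using assms by (simp add: has_weak_deriv_iff)
    then show "(\<integral>x. (w x - w' x) * \<eta> x \<partial>lebesgue_on U) = 0"
      using L2_on_integrable_mult[OF L(1) test_function_L2[OF \<open>test_function U \<eta>\<close>]]
        L2_on_integrable_mult[OF L(2) test_function_L2[OF \<open>test_function U \<eta>\<close>]]
      by (simp add: left_diff_distrib)
  qed
  then show ?thesis by eventually_elim simp
qed

lemma integral_lincomb_mult:
  assumes "L2_on M u" "L2_on M v" "L2_on M w"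
  shows "(\<integral>x. (a * u x + v x) * w x \<partial>M) = a * (\<integral>x. u x * w x \<partial>M) + (\<integral>x. v x * w x \<partial>M)"
  using L2_on_integrable_mult[OF assms(1,3)] L2_on_integrable_mult[OF assms(2,3)]
  by (simp add: distrib_right mult.assoc)

lemma has_weak_deriv_lincomb:
  assumes "L2_on (lebesgue_on U) u" "L2_on (lebesgue_on U) v"
    and "has_weak_deriv U i u u'" "has_weak_deriv U i v v'"
  shows "has_weak_deriv U i (\<lambda>x. a * u x + v x) (\<lambda>x. a * u' x + v' x)"
  using assms unfolding has_weak_deriv_iff
  by (auto simp: integral_lincomb_mult test_function_L2 test_function_pd_L2 L2_on_lincomb)

lemma has_weak_deriv_wd: "has_weak_deriv U i u w \<Longrightarrow> has_weak_deriv U i u (wd U i u)"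
  unfolding wd_def by (rule someI[where P = "has_weak_deriv U i u"])

lemma wd_AE: "has_weak_deriv U i u w \<Longrightarrow> AE x in lebesgue_on U. wd U i u x = w x"
  by (rule has_weak_deriv_unique[OF has_weak_deriv_wd])

lemma H1_iff: "u \<in> H1 U \<longleftrightarrow> L2_on (lebesgue_on U) u \<and> (\<forall>i. has_weak_deriv U i u (wd U i u))"
  by (simp add: H1_def sq_int_U) (metis has_weak_deriv_wd)

lemma H1_L2: "u \<in> H1 U \<Longrightarrow> L2_on (lebesgue_on U) u"
  by (simp add: H1_iff)

lemma wd_L2: "u \<in> H1 U \<Longrightarrow> L2_on (lebesgue_on U) (wd U i u)"
  by (simp add: H1_iff has_weak_deriv_iff)

lemma wd_lincomb:
  assumes "u \<in> H1 U" "v \<in> H1 U"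
  shows "AE x in lebesgue_on U. wd U i (\<lambda>x. a * u x + v x) x = a * wd U i u x + wd U i v x"
  using assms by (intro wd_AE has_weak_deriv_lincomb) (auto simp: H1_iff)

lemma H1_lincomb: "u \<in> H1 U \<Longrightarrow> v \<in> H1 U \<Longrightarrow> (\<lambda>x. a * u x + v x) \<in> H1 U"
  unfolding H1_iff by (auto intro!: L2_on_lincomb has_weak_deriv_wd has_weak_deriv_lincomb)

lemma has_weak_deriv_cong_AE:
  assumes "L2_on (lebesgue_on U) u" "L2_on (lebesgue_on U) v" "AE x in lebesgue_on U. u x = v x"
  shows "has_weak_deriv U i u = has_weak_deriv U i v"
proof (rule ext)
  fix w
  have "(\<integral>x. u x * pd i \<eta> x \<partial>lebesgue_on U) = (\<integral>x. v x * pd i \<eta> x \<partial>lebesgue_on U)"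
    if "test_function U \<eta>" for \<eta>
  proof (rule integral_cong_AE)
    show "AE x in lebesgue_on U. u x * pd i \<eta> x = v x * pd i \<eta> x" using assms(3) by eventually_elim simp
  qed (use assms that test_function_pd_L2 L2_on_integrable_mult borel_measurable_integrable in blast)+
  then show "has_weak_deriv U i u w = has_weak_deriv U i v w" by (simp add: has_weak_deriv_iff)
qed

text \<open>The two functions have literally the same set of weak derivatives, and the choice
  operator picks the same element of it. Equality thus holds everywhere, which permits rewriting
  under a further \<open>wd\<close>.\<close>

lemma wd_cong_AE:
  assumes "L2_on (lebesgue_on U) u" "L2_on (lebesgue_on U) v" "AE x in lebesgue_on U. u x = v x"
  shows "wd U i u = wd U i v"
  unfolding wd_def using has_weak_deriv_cong_AE[OF assms] by simp

lemma H1_cong_AE: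
  assumes "u \<in> H1 U" "L2_on (lebesgue_on U) v" "AE x in lebesgue_on U. u x = v x"
  shows "v \<in> H1 U"
proof -
  have "has_weak_deriv U i u = has_weak_deriv U i v" for i
    using has_weak_deriv_cong_AE[OF H1_L2[OF assms(1)] assms(2,3)] .
  moreover have "\<exists>w. has_weak_deriv U i u w" for i using assms(1) by (auto simp: H1_def)
  ultimately show ?thesis using assms(2) by (simp add: H1_def sq_int_U)
qed

lemma H2_H1: "u \<in> H2 U \<Longrightarrow> u \<in> H1 U" "u \<in> H2 U \<Longrightarrow> wd U i u \<in> H1 U"
  by (auto simp: H2_def)

lemma H2_lincomb: assumes "u \<in> H2 U" "v \<in> H2 U" shows "(\<lambda>x. a * u x + v x) \<in> H2 U"
  unfolding H2_def
proof (intro CollectI conjI allI)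
  show H: "(\<lambda>x. a * u x + v x) \<in> H1 U" using assms by (simp add: H2_H1 H1_lincomb)
  fix i
  have "AE x in lebesgue_on U. a * wd U i u x + wd U i v x = wd U i (\<lambda>x. a * u x + v x) x"
    using wd_lincomb[OF H2_H1(1)[OF assms(1)] H2_H1(1)[OF assms(2)], of i a] by eventually_elim simp
  then show "wd U i (\<lambda>x. a * u x + v x) \<in> H1 U"
    by (rule H1_cong_AE[OF H1_lincomb[OF H2_H1(2)[OF assms(1)] H2_H1(2)[OF assms(2)]] wd_L2[OF H]])
qed

lemma wd2_lincomb:
  assumes "u \<in> H2 U" "v \<in> H2 U"
  shows "AE x in lebesgue_on U. wd U j (wd U i (\<lambda>x. a * u x + v x)) x = a * wd U j (wd U i u) x + wd U j (wd U i v) x"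
proof -
  have "wd U j (wd U i (\<lambda>x. a * u x + v x)) = wd U j (\<lambda>x. a * wd U i u x + wd U i v x)"
    using assms[THEN H2_H1(1)] by (intro wd_cong_AE wd_lincomb wd_L2 H1_lincomb L2_on_lincomb)
  then show ?thesis using wd_lincomb[OF H2_H1(2)[OF assms(1)] H2_H1(2)[OF assms(2)]] by simp
qed

lemma wd_local: "(\<And>x. x \<in> U \<Longrightarrow> u x = v x) \<Longrightarrow> wd U i u = wd U i v"
proof -
  assume "\<And>x. x \<in> U \<Longrightarrow> u x = v x"
  then have "(\<integral>x. u x * pd i \<eta> x \<partial>lebesgue_on U) = (\<integral>x. v x * pd i \<eta> x \<partial>lebesgue_on U)" for \<eta>
    by (intro Bochner_Integration.integral_cong) (auto simp: space_restrict_space)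
  then show "wd U i u = wd U i v" unfolding wd_def has_weak_deriv_iff by simp
qed

text \<open>The product of u with a test function is smooth with compact support in U, so the
  integral of its partial derivative over U equals that over the whole plane, which is 0.\<close>

lemma smooth_has_weak_deriv:
  assumes u: "smooth u" shows "has_weak_deriv U i u (pd i u)"
  unfolding has_weak_deriv_iff
proof (intro conjI allI impI)
  show "L2_on (lebesgue_on U) (pd i u)" using u by (intro smooth_L2 smooth_pd)
  fix \<eta> assume t: "test_function U \<eta>"
  then obtain C where C: "compact C" "C \<subseteq> U" "\<And>x. x \<notin> C \<Longrightarrow> \<eta> x = 0" and \<eta>: "smooth \<eta>"
    by (auto simp: test_function_def)
  have z: "pd i (\<lambda>x. u x * \<eta> x) x = 0" if "x \<notin> U" for x
  proof -
    have "open (- C)" using C by (simp add: compact_imp_closed open_Compl)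
    then have "((\<lambda>x. u x * \<eta> x) has_derivative (\<lambda>h. 0)) (at x)"
      using that C by (intro has_derivative_transform_within_open[OF has_derivative_const[of 0]]) auto
    from pd_eq[OF this] show ?thesis .
  qed
  have "(\<integral>x. u x * pd i \<eta> x \<partial>lebesgue_on U) + (\<integral>x. pd i u x * \<eta> x \<partial>lebesgue_on U)
    = (\<integral>x. u x * pd i \<eta> x + pd i u x * \<eta> x \<partial>lebesgue_on U)"
    using u \<eta> by (intro Bochner_Integration.integral_add[symmetric] L2_on_integrable_mult smooth_L2 smooth_pd)
  also have "\<dots> = (\<integral>x. pd i (\<lambda>x. u x * \<eta> x) x \<partial>lebesgue_on U)"
    using u \<eta> by (intro Bochner_Integration.integral_cong) (auto simp: pd_mult_smooth)
  also have "\<dots> = (\<integral>x. indicator U x *\<^sub>R pd i (\<lambda>x. u x * \<eta> x) x \<partial>lebesgue)"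
    by (subst integral_restrict_space) auto
  also have "(\<lambda>x. indicator U x *\<^sub>R pd i (\<lambda>x. u x * \<eta> x) x) = pd i (\<lambda>x. u x * \<eta> x)"
    using z by (auto simp: fun_eq_iff indicator_def)
  also have "(\<integral>x. pd i (\<lambda>x. u x * \<eta> x) x \<partial>lebesgue) = (\<integral>x. pd i (\<lambda>x. u x * \<eta> x) x \<partial>lborel)"
    using u \<eta> by (intro integral_completion) (auto intro!: smooth_borel smooth_pd smooth_mult)
  also have "\<dots> = 0"
    by (rule integral_pd_compact_support[OF _ C(1)]) (use u \<eta> C in \<open>auto intro: smooth_mult\<close>)
  finally show "(\<integral>x. u x * pd i \<eta> x \<partial>lebesgue_on U) = - (\<integral>x. pd i u x * \<eta> x \<partial>lebesgue_on U)" by simp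
qed

lemma smooth_H1: "smooth u \<Longrightarrow> u \<in> H1 U"
  unfolding H1_def sq_int_U using smooth_L2 smooth_has_weak_deriv by blast

lemma smooth_wd: "smooth u \<Longrightarrow> AE x in lebesgue_on U. wd U i u x = pd i u x"
  by (intro wd_AE smooth_has_weak_deriv)

lemma smooth_wd2: assumes "smooth u" shows "AE x in lebesgue_on U. wd U j (wd U i u) x = pd j (pd i u) x"
proof -
  have "wd U j (wd U i u) = wd U j (pd i u)"
    using assms by (intro wd_cong_AE wd_L2 smooth_H1 smooth_L2 smooth_pd smooth_wd)
  then show ?thesis using assms by (simp add: smooth_wd smooth_pd)
qed

lemma smooth_H2: assumes "smooth u" shows "u \<in> H2 U"
proof -
  have "wd U i u \<in> H1 U" for i
  proof (rule H1_cong_AE[OF smooth_H1[OF smooth_pd[OF assms]]])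
    show "AE x in lebesgue_on U. pd i u x = wd U i u x" using smooth_wd[OF assms, of i] by eventually_elim simp
  qed (intro wd_L2 smooth_H1 assms)
  then show ?thesis using assms smooth_H1 by (simp add: H2_def)
qed

end

section \<open>Finite-dimensional function spaces\<close>

text \<open>Linear spaces are sets of functions, since the spaces in question depend on the element
  or on the mesh. The one closure condition a u + v covers sums and multiples.\<close>

definition lin_space :: "('a \<Rightarrow> real) set \<Rightarrow> bool" where
  "lin_space V \<longleftrightarrow> (\<lambda>x. 0) \<in> V \<and> (\<forall>u\<in>V. \<forall>v\<in>V. \<forall>a. (\<lambda>x. a * u x + v x) \<in> V)"

definition lin_on :: "('a \<Rightarrow> real) set \<Rightarrow> (('a \<Rightarrow> real) \<Rightarrow> real) \<Rightarrow> bool" where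
  "lin_on V l \<longleftrightarrow> (\<forall>u\<in>V. \<forall>v\<in>V. \<forall>a. l (\<lambda>x. a * u x + v x) = a * l u + l v)"

definition fin_span :: "(nat \<Rightarrow> 'a \<Rightarrow> real) \<Rightarrow> nat \<Rightarrow> ('a \<Rightarrow> real) set" where
  "fin_span e N = {\<lambda>x. \<Sum>k<N. c k * e k x |c. True}"

text \<open>Containment in a finite span instead of possession of a basis: the notion passes to
  arbitrary subsets, and no independence has to be maintained.\<close>

definition fin_dim :: "('a \<Rightarrow> real) set \<Rightarrow> bool" where
  "fin_dim V \<longleftrightarrow> (\<exists>e N. V \<subseteq> fin_span e N)"

lemma lin_space_comb: "lin_space V \<Longrightarrow> u \<in> V \<Longrightarrow> v \<in> V \<Longrightarrow> (\<lambda>x. a * u x + v x) \<in> V"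
  by (simp add: lin_space_def)

lemma lin_space_zero: "lin_space V \<Longrightarrow> (\<lambda>x. 0) \<in> V"
  by (simp add: lin_space_def)

lemma lin_space_scale: "lin_space V \<Longrightarrow> u \<in> V \<Longrightarrow> (\<lambda>x. a * u x) \<in> V"
  using lin_space_comb[of V u "\<lambda>x. 0" a] by (simp add: lin_space_zero)

lemma lin_space_add: "lin_space V \<Longrightarrow> u \<in> V \<Longrightarrow> v \<in> V \<Longrightarrow> (\<lambda>x. u x + v x) \<in> V"
  using lin_space_comb[of V u v 1] by simp

lemma lin_space_diff: "lin_space V \<Longrightarrow> u \<in> V \<Longrightarrow> v \<in> V \<Longrightarrow> (\<lambda>x. u x - v x) \<in> V"
  using lin_space_comb[of V v u "-1"] by simp

lemma lin_space_sum:
  "lin_space V \<Longrightarrow> (\<And>k. k < n \<Longrightarrow> e k \<in> V) \<Longrightarrow> (\<lambda>x. \<Sum>k<(n::nat). c k * e k x) \<in> V"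
proof (induction n)
  case (Suc n)
  then show ?case using lin_space_comb[of V "e n" "\<lambda>x. \<Sum>k<n. c k * e k x" "c n"] by (simp add: add.commute)
qed (simp add: lin_space_zero)

lemma lin_on_comb: "lin_on V l \<Longrightarrow> u \<in> V \<Longrightarrow> v \<in> V \<Longrightarrow> l (\<lambda>x. a * u x + v x) = a * l u + l v"
  by (simp add: lin_on_def)

lemma lin_on_zero: "lin_space V \<Longrightarrow> lin_on V l \<Longrightarrow> l (\<lambda>x. 0) = 0"
  using lin_on_comb[of V l "\<lambda>x. 0" "\<lambda>x. 0" 1] by (simp add: lin_space_zero)

lemma lin_on_scale: "lin_space V \<Longrightarrow> lin_on V l \<Longrightarrow> u \<in> V \<Longrightarrow> l (\<lambda>x. a * u x) = a * l u"
  using lin_on_comb[of V l u "\<lambda>x. 0" a] lin_on_zero[of V l] by (simp add: lin_space_zero)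

lemma lin_on_add: "lin_on V l \<Longrightarrow> u \<in> V \<Longrightarrow> v \<in> V \<Longrightarrow> l (\<lambda>x. u x + v x) = l u + l v"
  using lin_on_comb[of V l u v 1] by simp

lemma lin_on_diff: "lin_on V l \<Longrightarrow> u \<in> V \<Longrightarrow> v \<in> V \<Longrightarrow> l (\<lambda>x. u x - v x) = l u - l v"
  using lin_on_comb[of V l v u "-1"] by simp

lemma lin_on_sum:
  "lin_space V \<Longrightarrow> lin_on V l \<Longrightarrow> (\<And>k. k < n \<Longrightarrow> e k \<in> V) \<Longrightarrow> l (\<lambda>x. \<Sum>k<(n::nat). c k * e k x) = (\<Sum>k<n. c k * l (e k))"
proof (induction n)
  case (Suc n)
  have "l (\<lambda>x. c n * e n x + (\<Sum>k<n. c k * e k x)) = c n * l (e n) + l (\<lambda>x. \<Sum>k<n. c k * e k x)"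
    using Suc by (intro lin_on_comb lin_space_sum) auto
  then show ?case using Suc by (simp add: add.commute)
qed (simp add: lin_on_zero)

lemma fin_spanI: "u = (\<lambda>x. \<Sum>k<N. c k * e k x) \<Longrightarrow> u \<in> fin_span e N"
  unfolding fin_span_def by blast

lemma fin_span_Suc: "fin_span e (Suc N) = {\<lambda>x. a * e N x + v x |a v. v \<in> fin_span e N}"
proof (intro equalityI subsetI)
  fix u assume "u \<in> fin_span e (Suc N)"
  then obtain c where "u = (\<lambda>x. \<Sum>k<Suc N. c k * e k x)" by (auto simp: fin_span_def)
  then have "u = (\<lambda>x. c N * e N x + (\<Sum>k<N. c k * e k x))" by (simp add: add.commute)
  moreover have "(\<lambda>x. \<Sum>k<N. c k * e k x) \<in> fin_span e N" by (rule fin_spanI) (rule refl)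
  ultimately show "u \<in> {\<lambda>x. a * e N x + v x |a v. v \<in> fin_span e N}"
    by (intro CollectI exI conjI)
next
  fix u assume "u \<in> {\<lambda>x. a * e N x + v x |a v. v \<in> fin_span e N}"
  then obtain a c where "u = (\<lambda>x. a * e N x + (\<Sum>k<N. c k * e k x))" by (auto simp: fin_span_def)
  then have "u = (\<lambda>x. \<Sum>k<Suc N. (c(N := a)) k * e k x)" by (simp add: add.commute)
  then show "u \<in> fin_span e (Suc N)" by (rule fin_spanI)
qed

lemma lin_space_fin_span: "lin_space (fin_span e N)"
  unfolding lin_space_def
proof (intro conjI ballI allI)
  have "(\<lambda>x. 0) = (\<lambda>x. \<Sum>k<N. 0 * e k x)" by simp
  then show "(\<lambda>x. 0) \<in> fin_span e N" by (rule fin_spanI)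
  fix u v a assume "u \<in> fin_span e N" "v \<in> fin_span e N"
  then obtain c d where "u = (\<lambda>x. \<Sum>k<N. c k * e k x)" "v = (\<lambda>x. \<Sum>k<N. d k * e k x)"
    by (auto simp: fin_span_def)
  then have "(\<lambda>x. a * u x + v x) = (\<lambda>x. \<Sum>k<N. (a * c k + d k) * e k x)"
    by (simp add: sum_distrib_left sum.distrib[symmetric] algebra_simps)
  then show "(\<lambda>x. a * u x + v x) \<in> fin_span e N" by (rule fin_spanI)
qed

lemma fin_dim_subset: "fin_dim V \<Longrightarrow> W \<subseteq> V \<Longrightarrow> fin_dim W"
  unfolding fin_dim_def by blast

lemma fin_dim_zero: "fin_dim {\<lambda>x. 0}"
  unfolding fin_dim_def using lin_space_zero[OF lin_space_fin_span[of undefined 0]]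
  by (intro exI[of _ undefined] exI[of _ 0]) auto

lemma fin_dim_extend:
  assumes "fin_dim W" "\<And>u. u \<in> V \<Longrightarrow> \<exists>a w. w \<in> W \<and> u = (\<lambda>x. a * v x + w x)"
  shows "fin_dim V"
proof -
  obtain e N where W: "W \<subseteq> fin_span e N" using assms by (auto simp: fin_dim_def)
  have "V \<subseteq> fin_span (e(N := v)) (Suc N)"
  proof
    fix u assume "u \<in> V"
    then obtain a w where w: "w \<in> W" "u = (\<lambda>x. a * v x + w x)" using assms by blast
    then obtain c where c: "w = (\<lambda>x. \<Sum>k<N. c k * e k x)" using W by (auto simp: fin_span_def)
    have "u = (\<lambda>x. \<Sum>k<Suc N. (c(N := a)) k * (e(N := v)) k x)" using w c by (simp add: add.commute)
    then show "u \<in> fin_span (e(N := v)) (Suc N)" by (rule fin_spanI)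
  qed
  then show ?thesis by (auto simp: fin_dim_def)
qed

text \<open>Only a decomposition of each u in V is required, so V may be a proper subset of the sum,
  as the global space is in the sum of the element spaces. One summand at a time is absorbed,
  spanning function by spanning function.\<close>

lemma fin_dim_sum:
  assumes "finite I" "\<And>i. i \<in> I \<Longrightarrow> fin_dim (W i)"
    and "\<And>u. u \<in> V \<Longrightarrow> \<exists>w. (\<forall>i\<in>I. w i \<in> W i) \<and> u = (\<lambda>x. \<Sum>i\<in>I. w i x)"
  shows "fin_dim V"
  using assms
proof (induction I arbitrary: V rule: finite_induct)
  case empty
  then have "V \<subseteq> {\<lambda>x. 0}" by auto
  then show ?case using fin_dim_zero fin_dim_subset by blast
next
  case (insert i I)
  define X where "X = {\<lambda>x. \<Sum>i\<in>I. w i x |w. \<forall>i\<in>I. w i \<in> W i}"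
  have "fin_dim X"
  proof (rule insert.IH)
    show "fin_dim (W j)" if "j \<in> I" for j using insert.prems that by blast
    show "\<exists>w. (\<forall>i\<in>I. w i \<in> W i) \<and> u = (\<lambda>x. \<Sum>i\<in>I. w i x)" if "u \<in> X" for u
      using that unfolding X_def by blast
  qed
  obtain e N where W: "W i \<subseteq> fin_span e N" using insert.prems(1)[of i] by (auto simp: fin_dim_def)
  have "fin_dim {\<lambda>x. u x + v x |u v. u \<in> fin_span e n \<and> v \<in> X}" for n
  proof (induction n)
    case 0
    have "{\<lambda>x. u x + v x |u v. u \<in> fin_span e 0 \<and> v \<in> X} \<subseteq> X" by (auto simp: fin_span_def)
    then show ?case using \<open>fin_dim X\<close> fin_dim_subset by blast
  next
    case (Suc n)
    show ?case
    proof (rule fin_dim_extend[OF Suc, of _ "e n"])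
      fix u assume "u \<in> {\<lambda>x. u x + v x |u v. u \<in> fin_span e (Suc n) \<and> v \<in> X}"
      then obtain a p v where "p \<in> fin_span e n" "v \<in> X" "u = (\<lambda>x. (a * e n x + p x) + v x)"
        unfolding fin_span_Suc by auto
      then show "\<exists>a w. w \<in> {\<lambda>x. u x + v x |u v. u \<in> fin_span e n \<and> v \<in> X} \<and> u = (\<lambda>x. a * e n x + w x)"
        by (intro exI[of _ a] exI[of _ "\<lambda>x. p x + v x"]) (auto simp: add.assoc)
    qed
  qed
  moreover have "V \<subseteq> {\<lambda>x. u x + v x |u v. u \<in> fin_span e N \<and> v \<in> X}"
  proof
    fix u assume "u \<in> V"
    then obtain w where w: "\<forall>j\<in>insert i I. w j \<in> W j" "u = (\<lambda>x. \<Sum>j\<in>insert i I. w j x)"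
      using insert.prems(2) by meson
    then have "u = (\<lambda>x. w i x + (\<Sum>j\<in>I. w j x))" using insert by simp
    moreover have "w i \<in> fin_span e N" using w W by auto
    moreover have "(\<lambda>x. \<Sum>j\<in>I. w j x) \<in> X" using w unfolding X_def by auto
    ultimately show "u \<in> {\<lambda>x. u x + v x |u v. u \<in> fin_span e N \<and> v \<in> X}"
      by (intro CollectI exI conjI)
  qed
  ultimately show ?case using fin_dim_subset by blast
qed

text \<open>A relation replaces the linear map onto the data, which need not be unique.\<close>

lemma fin_dim_relation:
  fixes R :: "('a \<Rightarrow> real) \<Rightarrow> ('i \<Rightarrow> real) \<Rightarrow> bool"
  assumes "finite J"
    and R: "\<And>u v c d a. R u c \<Longrightarrow> R v d \<Longrightarrow> R (\<lambda>x. a * u x + v x) (\<lambda>j. a * c j + d j)"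
    and ker: "fin_dim {u. \<exists>c. R u c \<and> (\<forall>j\<in>J. c j = 0)}"
  shows "fin_dim {u. \<exists>c. R u c}"
  using assms(1,3)
proof (induction J rule: finite_induct)
  case (insert j J)
  let ?V = "{u. \<exists>c. R u c \<and> (\<forall>j\<in>J. c j = 0)}"
  let ?W = "{u. \<exists>c. R u c \<and> (\<forall>j\<in>insert j J. c j = 0)}"
  have "fin_dim ?V"
  \<comment> \<open>Either the datum j already vanishes on all of \<open>?V\<close>, or a single v
    with non-zero datum j accounts for the one additional dimension.\<close>
  proof (cases "\<exists>v d. R v d \<and> (\<forall>j\<in>J. d j = 0) \<and> d j \<noteq> 0")
    case False
    then have "?V \<subseteq> ?W" by auto
    then show ?thesis using insert fin_dim_subset by blast
  next
    case True
    then obtain v d where vd: "R v d" "\<forall>j\<in>J. d j = 0" "d j \<noteq> 0" by blast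
    show ?thesis
    proof (rule fin_dim_extend[OF insert.prems])
      fix u assume "u \<in> ?V"
      then obtain c where c: "R u c" "\<forall>j\<in>J. c j = 0" by blast
      let ?a = "c j / d j"
      have "R (\<lambda>x. (- ?a) * v x + u x) (\<lambda>j. (- ?a) * d j + c j)" using R vd c by blast
      then have "(\<lambda>x. (- ?a) * v x + u x) \<in> ?W" using c vd
        by (intro CollectI exI[of _ "\<lambda>j. (- ?a) * d j + c j"]) auto
      then show "\<exists>a w. w \<in> ?W \<and> u = (\<lambda>x. a * v x + w x)"
        by (intro exI[of _ ?a] exI[of _ "\<lambda>x. (- ?a) * v x + u x"]) auto
    qed
  qed
  then show ?case using insert by blast
qed simp

section \<open>Orthonormal bases, Riesz representation and completeness in finite dimension\<close>

definition inner_on :: "('a \<Rightarrow> real) set \<Rightarrow> (('a \<Rightarrow> real) \<Rightarrow> ('a \<Rightarrow> real) \<Rightarrow> real) \<Rightarrow> bool" where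
  "inner_on V s \<longleftrightarrow> (\<forall>w\<in>V. lin_on V (\<lambda>u. s u w)) \<and> (\<forall>u\<in>V. \<forall>v\<in>V. s u v = s v u)
     \<and> (\<forall>u\<in>V. 0 \<le> s u u \<and> (s u u = 0 \<longrightarrow> u = (\<lambda>x. 0)))"

definition orthonormal_basis ::
  "('a \<Rightarrow> real) set \<Rightarrow> (('a \<Rightarrow> real) \<Rightarrow> ('a \<Rightarrow> real) \<Rightarrow> real) \<Rightarrow> nat \<Rightarrow> (nat \<Rightarrow> 'a \<Rightarrow> real) \<Rightarrow> bool" where
  "orthonormal_basis V s n b \<longleftrightarrow> (\<forall>k<n. b k \<in> V) \<and> (\<forall>j<n. \<forall>k<n. s (b j) (b k) = (if j = k then 1 else 0))
     \<and> (\<forall>v\<in>V. v = (\<lambda>x. \<Sum>k<n. s v (b k) * b k x))"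

lemma inner_on_subset: "inner_on V s \<Longrightarrow> W \<subseteq> V \<Longrightarrow> inner_on W s"
  unfolding inner_on_def lin_on_def by blast

text \<open>The Gram-Schmidt process, by induction on the number of spanning functions. The part W
  of V inside the shorter span has codimension at most one, so one vector outside W, made orthogonal
  and normalised, completes the basis.\<close>

lemma ex_orthonormal_basis:
  assumes "lin_space V" "inner_on V s" "V \<subseteq> fin_span e N"
  shows "\<exists>n b. orthonormal_basis V s n b"
  using assms
proof (induction N arbitrary: V)
  case 0
  then have "\<forall>v\<in>V. v = (\<lambda>x. 0)" by (auto simp: fin_span_def)
  then show ?case by (intro exI[of _ 0]) (auto simp: orthonormal_basis_def)
next
  case (Suc N)
  define W where "W = V \<inter> fin_span e N"
  have W: "lin_space W" using Suc.prems(1) lin_space_fin_span[of e N] by (auto simp: W_def lin_space_def)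
  obtain n b where b: "orthonormal_basis W s n b"
    using Suc.IH[OF W inner_on_subset[OF Suc.prems(2)]] by (auto simp: W_def)
  show ?case
  proof (cases "V = W")
    case True
    then show ?thesis using b by blast
  next
    case False
    note V = Suc.prems(1) and ip = Suc.prems(2)
    have lin: "lin_on V (\<lambda>u. s u w)" if "w \<in> V" for w using ip that by (simp add: inner_on_def)
    have sym: "s u v = s v u" if "u \<in> V" "v \<in> V" for u v using ip that by (simp add: inner_on_def)
    have bW: "\<And>k. k < n \<Longrightarrow> b k \<in> W" and bV: "\<And>k. k < n \<Longrightarrow> b k \<in> V"
      and bo: "\<And>j k. j < n \<Longrightarrow> k < n \<Longrightarrow> s (b j) (b k) = (if j = k then 1 else 0)"
      using b by (auto simp: orthonormal_basis_def W_def)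
    obtain v where v: "v \<in> V" "v \<notin> W" using False W_def by blast
    define p where "p = (\<lambda>x. \<Sum>k<n. s v (b k) * b k x)"
    have p: "p \<in> W" unfolding p_def using W bW by (rule lin_space_sum)
    then have pV: "p \<in> V" by (simp add: W_def)
    define u where "u = (\<lambda>x. v x - p x)"
    have u: "u \<in> V" unfolding u_def using V v pV by (intro lin_space_diff)
    have unz: "u \<notin> W"
    proof
      assume "u \<in> W"
      then have "(\<lambda>x. u x + p x) \<in> W" using W p lin_space_add by blast
      then show False using v by (simp add: u_def)
    qed
    have orth: "s u (b k) = 0" if "k < n" for k
    proof -
      have "s p (b k) = (\<Sum>j<n. s v (b j) * s (b j) (b k))"
        unfolding p_def using V lin[OF bV[OF that]] bV by (rule lin_on_sum)
      also have "\<dots> = (\<Sum>j<n. s v (b j) * (if j = k then 1 else 0))"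
        using that bo by (intro sum.cong) auto
      also have "\<dots> = s v (b k)" using that by (simp add: if_distrib cong: if_cong)
      finally show ?thesis unfolding u_def using lin_on_diff[OF lin[OF bV[OF that]] v(1) pV] by simp
    qed
    have pos: "s u u > 0"
      using ip u unz W lin_space_zero unfolding inner_on_def by (metis less_eq_real_def)
    define q where "q = (\<lambda>x. (1 / sqrt (s u u)) * u x)"
    have q: "q \<in> V" unfolding q_def using V u by (rule lin_space_scale)
    have qs: "s q w = s u w / sqrt (s u u)" if "w \<in> V" for w
      unfolding q_def using lin_on_scale[OF V lin[OF that] u, of "1 / sqrt (s u u)"] by simp
    have qq: "s q q = 1"
    proof -
      have "s q q = s u q / sqrt (s u u)" using qs q by simp
      also have "s u q = s u u / sqrt (s u u)" using qs[OF u] sym[OF u q] by simp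
      finally show ?thesis using pos by (simp add: real_div_sqrt)
    qed
    have qb: "s q (b k) = 0" "s (b k) q = 0" if "k < n" for k
      using qs[OF bV[OF that]] orth[OF that] sym[OF q bV[OF that]] by auto
    have "orthonormal_basis V s (Suc n) (b(n := q))"
      unfolding orthonormal_basis_def
    proof (intro conjI allI ballI impI)
      fix k assume "k < Suc n"
      then show "(b(n := q)) k \<in> V" using q bV by (auto simp: less_Suc_eq)
    next
      fix j k assume "j < Suc n" "k < Suc n"
      then show "s ((b(n := q)) j) ((b(n := q)) k) = (if j = k then 1 else 0)"
        using qq qb bo by (auto simp: less_Suc_eq)
    next
      fix y assume y: "y \<in> V"
      obtain a w where ve: "v = (\<lambda>x. a * e N x + w x)" "w \<in> fin_span e N"
        using v(1) Suc.prems(3) unfolding fin_span_Suc by auto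
      obtain a' w' where ye: "y = (\<lambda>x. a' * e N x + w' x)" "w' \<in> fin_span e N"
        using y Suc.prems(3) unfolding fin_span_Suc by auto
      \<comment> \<open>Otherwise v would lie in the shorter span and hence in W.\<close>
      have "a \<noteq> 0" using ve v by (auto simp: W_def)
      let ?r = "a' / a"
      \<comment> \<open>Subtracting this multiple of v cancels the component along
        \<open>e N\<close>, so z falls back into W.\<close>
      define z where "z = (\<lambda>x. (- ?r) * v x + y x)"
      have "z = (\<lambda>x. (- ?r) * w x + w' x)"
        using \<open>a \<noteq> 0\<close> by (auto simp: z_def ve(1) ye(1) field_simps)
      then have "z \<in> fin_span e N" using lin_space_comb[OF lin_space_fin_span ve(2) ye(2), of "- ?r"] by simp
      moreover have "z \<in> V" unfolding z_def using V v(1) y by (rule lin_space_comb)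
      ultimately have zW: "z \<in> W" by (simp add: W_def)
      then have zV: "z \<in> V" by (simp add: W_def)
      define c where "c = ?r * sqrt (s u u)"
      define g where "g = (\<lambda>x. ?r * p x + z x)"
      have gW: "g \<in> W" unfolding g_def using W p zW by (rule lin_space_comb)
      have yq: "y = (\<lambda>x. c * q x + g x)"
      proof
        fix x
        have "c * q x = ?r * u x" using pos by (simp add: c_def q_def)
        then show "y x = c * q x + g x" by (simp add: g_def z_def u_def algebra_simps)
      qed
      have gV: "g \<in> V" using gW by (simp add: W_def)
      have gexp: "g = (\<lambda>x. \<Sum>k<n. s g (b k) * b k x)"
        using b gW by (simp add: orthonormal_basis_def)
      have "s y (b k) = s g (b k)" if "k < n" for k
        unfolding yq using lin_on_comb[OF lin[OF bV[OF that]] q gV] qb[OF that] by simp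
      moreover have "s y q = c"
      proof -
        have "s g q = (\<Sum>k<n. s g (b k) * s (b k) q)"
          by (subst gexp) (rule lin_on_sum[OF V lin[OF q] bV])
        then have "s g q = 0" using qb by simp
        then show ?thesis unfolding yq using lin_on_comb[OF lin[OF q] q gV] qq by simp
      qed
      ultimately show "y = (\<lambda>x. \<Sum>k<Suc n. s y ((b(n := q)) k) * (b(n := q)) k x)"
        using gexp by (subst yq) (simp add: fun_eq_iff add.commute)
    qed
    then show ?thesis by blast
  qed
qed

locale fin_inner =
  fixes V :: "('a \<Rightarrow> real) set" and s :: "('a \<Rightarrow> real) \<Rightarrow> ('a \<Rightarrow> real) \<Rightarrow> real"
  assumes V: "lin_space V" and ip: "inner_on V s" and fd: "fin_dim V"
begin

lemma lin: "w \<in> V \<Longrightarrow> lin_on V (\<lambda>u. s u w)"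
  using ip by (simp add: inner_on_def)

lemma sym: "u \<in> V \<Longrightarrow> v \<in> V \<Longrightarrow> s u v = s v u"
  using ip by (simp add: inner_on_def)

lemma nonneg: "u \<in> V \<Longrightarrow> 0 \<le> s u u"
  using ip by (simp add: inner_on_def)

lemma definite: "u \<in> V \<Longrightarrow> s u u = 0 \<Longrightarrow> u = (\<lambda>x. 0)"
  using ip by (simp add: inner_on_def)

lemma basis: obtains n b where "orthonormal_basis V s n b"
  using fd ex_orthonormal_basis[OF V ip] unfolding fin_dim_def by metis

text \<open>The representer is the combination of an orthonormal basis with coefficients
  \<open>l (b k)\<close>.\<close>

lemma riesz:
  assumes l: "lin_on V l" shows "\<exists>r\<in>V. \<forall>v\<in>V. s r v = l v"
proof -
  obtain n b where b: "orthonormal_basis V s n b" by (rule basis)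
  then have bV: "\<And>k. k < n \<Longrightarrow> b k \<in> V" by (simp add: orthonormal_basis_def)
  let ?r = "\<lambda>x. \<Sum>k<n. l (b k) * b k x"
  show ?thesis
  proof (intro bexI ballI)
    show "?r \<in> V" using V bV by (rule lin_space_sum)
    fix v assume v: "v \<in> V"
    have "s ?r v = (\<Sum>k<n. l (b k) * s (b k) v)" using V lin[OF v] bV by (rule lin_on_sum)
    also have "\<dots> = (\<Sum>k<n. s v (b k) * l (b k))" using sym[OF v bV] by (simp add: mult.commute)
    also have "\<dots> = l (\<lambda>x. \<Sum>k<n. s v (b k) * b k x)" using V l bV by (rule lin_on_sum[symmetric])
    also have "(\<lambda>x. \<Sum>k<n. s v (b k) * b k x) = v" using b v by (simp add: orthonormal_basis_def)
    finally show "s ?r v = l v" .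
  qed
qed

definition nrm :: "('a \<Rightarrow> real) \<Rightarrow> real" where "nrm u = sqrt (s u u)"

lemma nrm_nonneg: "u \<in> V \<Longrightarrow> 0 \<le> nrm u"
  by (simp add: nrm_def nonneg)

lemma nrm_sq: "u \<in> V \<Longrightarrow> (nrm u)^2 = s u u"
  by (simp add: nrm_def nonneg)

lemma s_expand:
  assumes "u \<in> V" "v \<in> V"
  shows "s (\<lambda>x. a * u x + v x) (\<lambda>x. a * u x + v x) = a^2 * s u u + 2 * a * s u v + s v v"
proof -
  let ?w = "\<lambda>x. a * u x + v x"
  have w: "?w \<in> V" using V assms by (rule lin_space_comb)
  have "s ?w ?w = a * s u ?w + s v ?w" using lin_on_comb[OF lin[OF w] assms] .
  also have "s u ?w = a * s u u + s v u" using lin_on_comb[OF lin[OF assms(1)] assms] sym[OF assms(1) w] by simp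
  also have "s v ?w = a * s u v + s v v" using lin_on_comb[OF lin[OF assms(2)] assms] sym[OF assms(2) w] by simp
  finally show ?thesis using sym[OF assms] by (simp add: power2_eq_square algebra_simps)
qed

lemma cauchy_schwarz:
  assumes "u \<in> V" "v \<in> V" shows "\<bar>s u v\<bar> \<le> nrm u * nrm v"
proof -
  have "(s v u)^2 \<le> s u u * s v v"
  proof (rule discriminant_bound)
    fix t
    have "0 \<le> s (\<lambda>x. t * v x + u x) (\<lambda>x. t * v x + u x)"
      using V assms by (intro nonneg lin_space_comb)
    then show "0 \<le> s u u + 2 * t * s v u + t^2 * s v v"
      using s_expand[OF assms(2,1)] by simp
  qed (rule nonneg[OF assms(2)])
  then have "(s u v)^2 \<le> (nrm u * nrm v)^2"
    using sym[OF assms] nrm_sq assms by (simp add: power_mult_distrib)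
  then show ?thesis using nrm_nonneg assms by (simp add: abs_le_square_iff[symmetric] abs_mult)
qed

lemma nrm_scale: "u \<in> V \<Longrightarrow> nrm (\<lambda>x. a * u x) = \<bar>a\<bar> * nrm u"
  using s_expand[OF _ lin_space_zero[OF V], of u a] lin_on_zero[OF V lin] sym lin_space_zero[OF V]
  by (simp add: nrm_def real_sqrt_mult)

lemma nrm_add_le: "u \<in> V \<Longrightarrow> v \<in> V \<Longrightarrow> nrm (\<lambda>x. u x + v x) \<le> nrm u + nrm v"
proof -
  assume uv: "u \<in> V" "v \<in> V"
  have "(nrm (\<lambda>x. u x + v x))^2 = s u u + 2 * s u v + s v v"
    using s_expand[OF uv, of 1] nrm_sq[OF lin_space_add[OF V uv]] by simp
  also have "\<dots> \<le> (nrm u)^2 + 2 * (nrm u * nrm v) + (nrm v)^2"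
    using cauchy_schwarz[OF uv] nrm_sq uv by auto
  also have "\<dots> = (nrm u + nrm v)^2" by (simp add: power2_eq_square algebra_simps)
  finally show ?thesis by (rule power2_le_imp_le) (use nrm_nonneg[OF uv(1)] nrm_nonneg[OF uv(2)] in auto)
qed

lemma nrm_zero [simp]: "nrm (\<lambda>x. 0) = 0"
  using lin_on_zero[OF V lin[OF lin_space_zero[OF V]]] by (simp add: nrm_def)

text \<open>The value 0 off V is a default: in \<open>Metric_space\<close> non-negativity and
  symmetry are demanded for all arguments, not only for points of the carrier.\<close>

definition d :: "('a \<Rightarrow> real) \<Rightarrow> ('a \<Rightarrow> real) \<Rightarrow> real" where
  "d u v = (if u \<in> V \<and> v \<in> V then nrm (\<lambda>x. u x - v x) else 0)"

sublocale M: Metric_space V d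
proof
  show "0 \<le> d u v" for u v by (simp add: d_def nrm_nonneg lin_space_diff V)
  show "d u v = d v u" for u v
    using nrm_scale[of "\<lambda>x. u x - v x" "-1"] by (auto simp: d_def lin_space_diff V)
  show "d u v = 0 \<longleftrightarrow> u = v" if "u \<in> V" "v \<in> V" for u v
  proof
    assume "d u v = 0"
    then have "(\<lambda>x. u x - v x) = (\<lambda>x. 0)"
      using that by (intro definite) (auto simp: d_def nrm_def lin_space_diff V)
    then show "u = v" by (auto simp: fun_eq_iff)
  qed (use that in \<open>simp add: d_def\<close>)
  show "d u w \<le> d u v + d v w" if "u \<in> V" "v \<in> V" "w \<in> V" for u v w
    using nrm_add_le[of "\<lambda>x. u x - v x" "\<lambda>x. v x - w x"] that by (simp add: d_def lin_space_diff V)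
qed

text \<open>Coordinates in an orthonormal basis are Cauchy sequences of reals by the Cauchy-Schwarz
  inequality. Their limits define the limit vector, because the norm is at most the sum of the
  absolute coordinates.\<close>

lemma mcomplete: "M.mcomplete"
  unfolding M.mcomplete_def
proof (intro allI impI)
  fix \<sigma> assume \<sigma>: "M.MCauchy \<sigma>"
  then have sV: "\<sigma> n \<in> V" for n by (auto simp: M.MCauchy_def)
  obtain n b where b: "orthonormal_basis V s n b" by (rule basis)
  then have bV: "\<And>k. k < n \<Longrightarrow> b k \<in> V" and bo: "\<And>k. k < n \<Longrightarrow> s (b k) (b k) = 1"
    by (auto simp: orthonormal_basis_def)
  have bn: "nrm (b k) = 1" if "k < n" for k using bo that by (simp add: nrm_def)
  have "convergent (\<lambda>m. s (\<sigma> m) (b k))" if k: "k < n" for k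
  proof (rule Cauchy_convergent, rule metric_CauchyI)
    fix e :: real assume "e > 0"
    then obtain N where N: "\<And>p q. p \<ge> N \<Longrightarrow> q \<ge> N \<Longrightarrow> d (\<sigma> p) (\<sigma> q) < e"
      using \<sigma> unfolding M.MCauchy_def by blast
    show "\<exists>M. \<forall>p\<ge>M. \<forall>q\<ge>M. dist (s (\<sigma> p) (b k)) (s (\<sigma> q) (b k)) < e"
    proof (intro exI[of _ N] allI impI)
      fix p q assume pq: "p \<ge> N" "q \<ge> N"
      have "\<bar>s (\<lambda>x. \<sigma> p x - \<sigma> q x) (b k)\<bar> \<le> nrm (\<lambda>x. \<sigma> p x - \<sigma> q x) * nrm (b k)"
        by (intro cauchy_schwarz lin_space_diff V sV bV k)
      then have "\<bar>s (\<sigma> p) (b k) - s (\<sigma> q) (b k)\<bar> \<le> d (\<sigma> p) (\<sigma> q)"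
        using lin_on_diff[OF lin[OF bV[OF k]] sV sV] bn[OF k] sV by (simp add: d_def)
      then show "dist (s (\<sigma> p) (b k)) (s (\<sigma> q) (b k)) < e" using N[OF pq] by (simp add: dist_real_def)
    qed
  qed
  then obtain l where l: "\<And>k. k < n \<Longrightarrow> (\<lambda>m. s (\<sigma> m) (b k)) \<longlonglongrightarrow> l k"
    unfolding convergent_def by metis
  let ?u = "\<lambda>x. \<Sum>k<n. l k * b k x"
  have uV: "?u \<in> V" using V bV by (rule lin_space_sum)
  have bound: "nrm (\<lambda>x. \<Sum>k<j. c k * b k x) \<le> (\<Sum>k<j. \<bar>c k\<bar>)" if "j \<le> n" for c j
    using that
  proof (induction j)
    case (Suc j)
    have "nrm (\<lambda>x. (\<Sum>k<j. c k * b k x) + c j * b j x) \<le> nrm (\<lambda>x. \<Sum>k<j. c k * b k x) + nrm (\<lambda>x. c j * b j x)"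
      using Suc bV by (intro nrm_add_le lin_space_sum lin_space_scale V) auto
    then show ?case using Suc nrm_scale[OF bV, of j "c j"] bn by auto
  qed simp
  have "(\<lambda>m. \<Sum>k<n. \<bar>s (\<sigma> m) (b k) - l k\<bar>) \<longlonglongrightarrow> (\<Sum>k<n. \<bar>l k - l k\<bar>)"
    using l by (intro tendsto_intros) auto
  then have lim: "(\<lambda>m. \<Sum>k<n. \<bar>s (\<sigma> m) (b k) - l k\<bar>) \<longlonglongrightarrow> 0" by simp
  have "(\<lambda>m. d (\<sigma> m) ?u) \<longlonglongrightarrow> 0"
  proof (rule tendsto_sandwich[OF _ _ tendsto_const lim])
    show "\<forall>\<^sub>F m in sequentially. d (\<sigma> m) ?u \<le> (\<Sum>k<n. \<bar>s (\<sigma> m) (b k) - l k\<bar>)"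
    proof (intro always_eventually allI)
      fix m
      have "\<sigma> m = (\<lambda>x. \<Sum>k<n. s (\<sigma> m) (b k) * b k x)"
        using b sV[of m] unfolding orthonormal_basis_def by blast
      then have "\<sigma> m x = (\<Sum>k<n. s (\<sigma> m) (b k) * b k x)" for x by (rule fun_cong)
      then have "(\<lambda>x. \<sigma> m x - ?u x) = (\<lambda>x. \<Sum>k<n. (s (\<sigma> m) (b k) - l k) * b k x)"
        by (simp add: left_diff_distrib sum_subtractf)
      then show "d (\<sigma> m) ?u \<le> (\<Sum>k<n. \<bar>s (\<sigma> m) (b k) - l k\<bar>)"
        using bound[of n "\<lambda>k. s (\<sigma> m) (b k) - l k"] sV uV by (simp add: d_def)
    qed
  qed simp
  then have "limitin M.mtopology \<sigma> ?u sequentially"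
    using uV sV by (simp add: M.limitin_metric_dist_null)
  then show "\<exists>x. limitin M.mtopology \<sigma> x sequentially" by blast
qed

lemma mcomplete_ball:
  assumes "0 \<le> R" shows "Metric_space.mcomplete {u \<in> V. nrm u \<le> R} d"
proof -
  have z: "(\<lambda>x. 0) \<in> V" using V by (rule lin_space_zero)
  have "{u \<in> V. nrm u \<le> R} = M.mcball (\<lambda>x. 0) R"
  proof -
    have "d (\<lambda>x. 0) u = nrm u" if "u \<in> V" for u
      using that z nrm_scale[OF that, of "-1"] by (simp add: d_def)
    then show ?thesis using z by (auto simp: M.mcball_def)
  qed
  then have "closedin M.mtopology {u \<in> V. nrm u \<le> R}" using M.closedin_mcball by simp
  moreover have "Submetric V d {u \<in> V. nrm u \<le> R}" by unfold_locales auto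
  then interpret S: Submetric V d "{u \<in> V. nrm u \<le> R}" .
  from calculation show ?thesis using S.closedin_eq_mcomplete[OF mcomplete] by blast
qed

end

section \<open>A discrete Navier--Stokes problem in the abstract\<close>

text \<open>The residual of the equation is strongly monotone on balls of radius below \<open>\<nu> / C\<close> and points
  outwards on spheres of radius above \<open>D / \<nu>\<close>; a small step against its Riesz representative is
  therefore a contraction of a ball with radius between the two.\<close>

lemma (in fin_inner) ex_solution:
  fixes B :: "('a \<Rightarrow> real) \<Rightarrow> ('a \<Rightarrow> real) \<Rightarrow> ('a \<Rightarrow> real) \<Rightarrow> real"
  assumes \<nu>: "\<nu> > 0" and C: "C > 0" and D: "D \<ge> 0"
    and B1: "\<And>v w. v \<in> V \<Longrightarrow> w \<in> V \<Longrightarrow> lin_on V (\<lambda>u. B u v w)"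
    and B2: "\<And>u w. u \<in> V \<Longrightarrow> w \<in> V \<Longrightarrow> lin_on V (\<lambda>v. B u v w)"
    and B3: "\<And>u v. u \<in> V \<Longrightarrow> v \<in> V \<Longrightarrow> lin_on V (\<lambda>w. B u v w)"
    and skew: "\<And>u v. u \<in> V \<Longrightarrow> v \<in> V \<Longrightarrow> B u v v = 0"
    and Bb: "\<And>u v w. u \<in> V \<Longrightarrow> v \<in> V \<Longrightarrow> w \<in> V \<Longrightarrow> \<bar>B u v w\<bar> \<le> C * nrm u * nrm v * nrm w"
    and F: "lin_on V F" and Fb: "\<And>v. v \<in> V \<Longrightarrow> \<bar>F v\<bar> \<le> D * nrm v"
    and small: "C * D < \<nu>^2"
  shows "\<exists>u\<in>V. \<forall>v\<in>V. \<nu> * s u v + B u u v = F v"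
proof -
  \<comment> \<open>The smallness condition is equivalent to this interval being non-empty.\<close>
  have "D / \<nu> < \<nu> / C" using small \<nu> C by (simp add: field_simps power2_eq_square)
  then obtain R where RD: "D / \<nu> < R" and RC: "R < \<nu> / C" using dense by blast
  \<comment> \<open>A second radius is needed inside the ball: for norm below R' a short step cannot
    leave the ball of radius R, and from R' on the residual points outwards by a definite
    amount.\<close>
  obtain R' where R': "D / \<nu> < R'" and R'R: "R' < R" using dense[OF RD] by blast
  have D\<nu>: "0 \<le> D / \<nu>" using D \<nu> by simp
  then have R'p: "0 < R'" using R' by linarith
  then have Rp: "0 < R" using R'R by linarith
  \<comment> \<open>The monotonicity constant on the ball: the form contributes \<nu>, and the
    single surviving convective term costs at most C R.\<close>
  define m where "m = \<nu> - C * R"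
  have m: "m > 0" using RC C by (simp add: m_def field_simps)
  \<comment> \<open>The Lipschitz constant of the residual: \<nu> from the form and C R from each of
    the two convective differences.\<close>
  define L where "L = \<nu> + 2 * C * R"
  have L: "L > 0" using \<nu> C Rp by (simp add: L_def add_pos_nonneg)
  define E where "E = L * R + D"
  have E: "E > 0" using L Rp D by (simp add: E_def add_pos_nonneg)
  \<comment> \<open>A lower bound for the pairing of the residual at u with u when the norm of u is
    at least R'.\<close>
  define \<delta> where "\<delta> = R' * (\<nu> * R' - D)"
  have \<delta>: "\<delta> > 0" using R' R'p \<nu> by (simp add: \<delta>_def field_simps)
  \<comment> \<open>The three bounds serve, in order, the contraction estimate, the step from the
    outer shell and the step from the inner ball; E bounds the residual on the whole ball.\<close>
  define \<tau> where "\<tau> = Min {m / L^2, 2 * \<delta> / E^2, (R - R') / E}"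
  have \<tau>: "\<tau> > 0" using m L \<delta> E R'R by (simp add: \<tau>_def)
  have "\<tau> \<le> m / L^2" "\<tau> \<le> 2 * \<delta> / E^2" "\<tau> \<le> (R - R') / E" by (auto simp: \<tau>_def)
  then have \<tau>1: "\<tau> * L^2 \<le> m" and \<tau>2: "\<tau> * E^2 \<le> 2 * \<delta>" and \<tau>3: "\<tau> * E \<le> R - R'"
    using L E by (auto simp: field_simps)
  define G where "G u v = \<nu> * s u v + B u u v - F v" for u v
  have Glin: "lin_on V (G u)" if "u \<in> V" for u
    unfolding lin_on_def
  proof (intro ballI allI)
    fix v w a assume vw: "v \<in> V" "w \<in> V"
    then have vwV: "(\<lambda>x. a * v x + w x) \<in> V" using V lin_space_comb by blast
    have "s u (\<lambda>x. a * v x + w x) = a * s u v + s u w"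
      using lin_on_comb[OF lin[OF that] vw] sym[OF that] vw vwV by metis
    then show "G u (\<lambda>x. a * v x + w x) = a * G u v + G u w"
      using lin_on_comb[OF B3[OF that that] vw] lin_on_comb[OF F vw] by (simp add: G_def algebra_simps)
  qed
  obtain r where rV: "\<And>u. u \<in> V \<Longrightarrow> r u \<in> V" and rG: "\<And>u v. u \<in> V \<Longrightarrow> v \<in> V \<Longrightarrow> s (r u) v = G u v"
    using riesz[OF Glin] by metis
  let ?K = "{u \<in> V. nrm u \<le> R}"
  \<comment> \<open>The quadratic term is split as B(u,u) - B(w,w) = B(u-w,u) + B(w,u-w).\<close>
  have diffG: "G u v - G w v = \<nu> * s (\<lambda>x. u x - w x) v + B (\<lambda>x. u x - w x) u v + B w (\<lambda>x. u x - w x) v"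
    if "u \<in> V" "w \<in> V" "v \<in> V" for u w v
    using lin_on_diff[OF lin[OF that(3)] that(1,2)] lin_on_diff[OF B1[OF that(1,3)] that(1,2)]
      lin_on_diff[OF B2[OF that(2,3)] that(1,2)] by (simp add: G_def right_diff_distrib)
  have lip: "nrm (\<lambda>x. r u x - r w x) \<le> L * nrm (\<lambda>x. u x - w x)" if u: "u \<in> ?K" and w: "w \<in> ?K" for u w
  proof -
    have uV: "u \<in> V" and wV: "w \<in> V" and un: "nrm u \<le> R" and wn: "nrm w \<le> R" using u w by auto
    define y where "y = (\<lambda>x. u x - w x)"
    define z where "z = (\<lambda>x. r u x - r w x)"
    have y: "y \<in> V" and z: "z \<in> V" unfolding y_def z_def using V uV wV rV by (auto intro: lin_space_diff)
    have "s z z = G u z - G w z"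
      unfolding z_def using lin_on_diff[OF lin[OF z] rV[OF uV] rV[OF wV]] rG uV wV z by (simp add: z_def)
    also have "\<dots> = \<nu> * s y z + B y u z + B w y z" unfolding y_def using diffG uV wV z by blast
    also have "\<dots> \<le> \<nu> * (nrm y * nrm z) + C * nrm y * R * nrm z + C * R * nrm y * nrm z"
    proof (intro add_mono)
      show "\<nu> * s y z \<le> \<nu> * (nrm y * nrm z)" using cauchy_schwarz[OF y z] \<nu> by auto
      have "B y u z \<le> C * nrm y * nrm u * nrm z" using Bb[OF y uV z] by simp
      also have "\<dots> \<le> C * nrm y * R * nrm z"
        using un C nrm_nonneg y z uV by (intro mult_right_mono mult_left_mono) auto
      finally show "B y u z \<le> C * nrm y * R * nrm z" .
      have "B w y z \<le> C * nrm w * nrm y * nrm z" using Bb[OF wV y z] by simp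
      also have "\<dots> \<le> C * R * nrm y * nrm z"
        using wn C nrm_nonneg y z wV by (intro mult_right_mono mult_left_mono) auto
      finally show "B w y z \<le> C * R * nrm y * nrm z" .
    qed
    also have "\<dots> = (L * nrm y) * nrm z" by (simp add: L_def algebra_simps)
    finally have "nrm z * nrm z \<le> (L * nrm y) * nrm z" using nrm_sq[OF z] by (simp add: power2_eq_square)
    then have "nrm z \<le> L * nrm y"
      using nrm_nonneg[OF z] nrm_nonneg[OF y] L by (cases "nrm z = 0") auto
    then show ?thesis by (simp add: y_def z_def)
  qed
  have mono: "m * s (\<lambda>x. u x - w x) (\<lambda>x. u x - w x) \<le> s (\<lambda>x. u x - w x) (\<lambda>x. r u x - r w x)"
    if u: "u \<in> ?K" and w: "w \<in> ?K" for u w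
  proof -
    have uV: "u \<in> V" and wV: "w \<in> V" and un: "nrm u \<le> R" using u w by auto
    define y where "y = (\<lambda>x. u x - w x)"
    define z where "z = (\<lambda>x. r u x - r w x)"
    have y: "y \<in> V" and z: "z \<in> V" unfolding y_def z_def using V uV wV rV by (auto intro: lin_space_diff)
    have "s y z = s z y" using sym y z by blast
    also have "\<dots> = G u y - G w y"
      unfolding z_def using lin_on_diff[OF lin[OF y] rV[OF uV] rV[OF wV]] rG uV wV y by simp
    \<comment> \<open>The other convective difference is B(w,y,y), which vanishes by
      skewness.\<close>
    also have "\<dots> = \<nu> * s y y + B y u y" using diffG[OF uV wV y] skew[OF wV y] by (simp add: y_def)
    also have "\<dots> \<ge> \<nu> * s y y - C * R * s y y"
    proof -
      have "\<bar>B y u y\<bar> \<le> C * nrm y * nrm u * nrm y" by (rule Bb[OF y uV y])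
      also have "\<dots> \<le> C * nrm y * R * nrm y"
        using un C nrm_nonneg y uV by (intro mult_right_mono mult_left_mono) auto
      also have "\<dots> = C * R * s y y" using nrm_sq[OF y] by (simp add: power2_eq_square)
      finally show ?thesis by simp
    qed
    finally show ?thesis by (simp add: y_def z_def m_def left_diff_distrib)
  qed
  have rb: "nrm (r u) \<le> E" if u: "u \<in> ?K" for u
  proof -
    have zK: "(\<lambda>x. 0) \<in> ?K" using Rp V lin_space_zero by auto
    have r0: "nrm (r (\<lambda>x. 0)) \<le> D"
    proof -
      let ?z = "r (\<lambda>x. 0)"
      have z: "?z \<in> V" using zK rV by auto
      have zV: "(\<lambda>x. 0) \<in> V" using zK by simp
      \<comment> \<open>At the origin the residual consists of the load alone.\<close>
      have "s ?z ?z = - F ?z"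
        using rG[OF zV z] lin_on_zero[OF V lin[OF z]] lin_on_zero[OF V B1[OF zV z]] by (simp add: G_def)
      then have "nrm ?z * nrm ?z \<le> D * nrm ?z" using Fb[OF z] nrm_sq[OF z] by (simp add: power2_eq_square)
      then show ?thesis using nrm_nonneg[OF z] D by (cases "nrm ?z = 0") auto
    qed
    have uV: "u \<in> V" using u by simp
    have "nrm (r u) = nrm (\<lambda>x. (r u x - r (\<lambda>x. 0) x) + r (\<lambda>x. 0) x)" by simp
    also have "\<dots> \<le> nrm (\<lambda>x. r u x - r (\<lambda>x. 0) x) + nrm (r (\<lambda>x. 0))"
      using rV uV zK V by (intro nrm_add_le lin_space_diff) auto
    also have "\<dots> \<le> L * nrm u + D" using lip[OF u zK] r0 by simp
    also have "\<dots> \<le> L * R + D" using u L by simp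
    finally show ?thesis by (simp add: E_def)
  qed
  define T where "T u = (\<lambda>x. (- \<tau>) * r u x + u x)" for u
  have TV: "T u \<in> V" if "u \<in> V" for u unfolding T_def using V rV that by (intro lin_space_comb)
  have TK: "T u \<in> ?K" if u: "u \<in> ?K" for u
  proof -
    have uV: "u \<in> V" and un: "nrm u \<le> R" using u by auto
    have "nrm (T u) \<le> R"
    \<comment> \<open>In the shell the norm cannot grow: the quadratic cost \<tau>^2 E^2 is
      dominated by the gain 2 \<tau> \<delta>. In the inner ball the length of the step, at most
      \<tau> E, is dominated by R - R'.\<close>
    proof (cases "nrm u \<ge> R'")
      case True
      have "\<bar>F u\<bar> \<le> D * nrm u" by (rule Fb[OF uV])
      then have "s (r u) u \<ge> \<nu> * (nrm u)^2 - D * nrm u"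
        using rG[OF uV uV] skew[OF uV uV] nrm_sq[OF uV] by (simp add: G_def)
      moreover have "\<nu> * (nrm u)^2 - D * nrm u = nrm u * (\<nu> * nrm u - D)" by (simp add: power2_eq_square algebra_simps)
      moreover have "nrm u * (\<nu> * nrm u - D) \<ge> R' * (\<nu> * R' - D)"
        using True R'p R' \<nu> by (intro mult_mono) (auto simp: field_simps)
      ultimately have a: "s (r u) u \<ge> \<delta>" by (simp add: \<delta>_def)
      have b: "s (r u) (r u) \<le> E^2"
        using power_mono[OF rb[OF u] nrm_nonneg[OF rV[OF uV]], of 2] nrm_sq[OF rV[OF uV]] by simp
      have "(nrm (T u))^2 = \<tau>^2 * s (r u) (r u) - 2 * \<tau> * s (r u) u + s u u"
        using nrm_sq[OF TV[OF uV]] s_expand[OF rV[OF uV] uV, of "- \<tau>"] by (simp add: T_def)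
      also have "\<dots> \<le> \<tau>^2 * E^2 - 2 * \<tau> * \<delta> + s u u"
        using a b \<tau> by (intro add_mono diff_mono mult_left_mono) auto
      also have "\<dots> = \<tau> * (\<tau> * E^2 - 2 * \<delta>) + s u u" by (simp add: power2_eq_square algebra_simps)
      also have "\<dots> \<le> s u u" using \<tau>2 \<tau> by (simp add: mult_nonneg_nonpos)
      also have "\<dots> \<le> R^2" using power_mono[OF un nrm_nonneg[OF uV], of 2] nrm_sq[OF uV] by simp
      finally show ?thesis by (rule power2_le_imp_le) (use Rp in auto)
    next
      case False
      have "nrm (T u) \<le> nrm (\<lambda>x. (- \<tau>) * r u x) + nrm u"
        unfolding T_def using V rV uV by (intro nrm_add_le lin_space_scale)
      also have "\<dots> = \<tau> * nrm (r u) + nrm u" using nrm_scale[OF rV[OF uV], of "- \<tau>"] \<tau> by simp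
      also have "\<dots> \<le> \<tau> * E + R'" using rb[OF u] \<tau> False by (intro add_mono mult_left_mono) auto
      finally show ?thesis using \<tau>3 by simp
    qed
    then show ?thesis using TV[OF uV] by simp
  qed
  \<comment> \<open>This keeps the contraction factor real: m \<le> L gives \<tau> m^2 \<le> \<tau>
    L^2 \<le> m.\<close>
  have m0: "0 \<le> 1 - \<tau> * m"
  proof -
    have "m \<le> L" using C Rp by (simp add: m_def L_def)
    then have "\<tau> * m * m \<le> \<tau> * L^2" using m \<tau> by (simp add: power2_eq_square mult_mono)
    then have "m * (1 - \<tau> * m) \<ge> 0" using \<tau>1 by (simp add: algebra_simps)
    then show ?thesis using m by (simp add: zero_le_mult_iff)
  qed
  have contr: "d (T u) (T w) \<le> sqrt (1 - \<tau> * m) * d u w" if u: "u \<in> ?K" and w: "w \<in> ?K" for u w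
  proof -
    have uV: "u \<in> V" and wV: "w \<in> V" using u w by auto
    define y where "y = (\<lambda>x. u x - w x)"
    define z where "z = (\<lambda>x. r u x - r w x)"
    have y: "y \<in> V" and z: "z \<in> V" unfolding y_def z_def using V uV wV rV by (auto intro: lin_space_diff)
    have Te: "(\<lambda>x. T u x - T w x) = (\<lambda>x. (- \<tau>) * z x + y x)"
      by (auto simp: T_def y_def z_def algebra_simps)
    have "(nrm (\<lambda>x. (- \<tau>) * z x + y x))^2 = \<tau>^2 * s z z - 2 * \<tau> * s z y + s y y"
      using nrm_sq[OF lin_space_comb[OF V z y], of "- \<tau>"] s_expand[OF z y, of "- \<tau>"] by simp
    also have "\<dots> \<le> \<tau>^2 * (L^2 * s y y) - 2 * \<tau> * (m * s y y) + s y y"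
    proof (intro add_mono diff_mono mult_left_mono)
      have "nrm z \<le> L * nrm y" using lip[OF u w] by (simp add: y_def z_def)
      then have "(nrm z)^2 \<le> (L * nrm y)^2" using nrm_nonneg[OF z] by (intro power_mono)
      then show "s z z \<le> L^2 * s y y" using nrm_sq y z by (simp add: power_mult_distrib)
      show "m * s y y \<le> s z y" using mono[OF u w] sym[OF y z] by (simp add: y_def z_def)
    qed (use \<tau> in auto)
    \<comment> \<open>Half of the gain 2 \<tau> m pays for the quadratic term \<tau>^2 L^2; the
      other half remains as the contraction.\<close>
    also have "\<dots> = \<tau> * (\<tau> * L^2 - m) * s y y + (1 - \<tau> * m) * s y y"
      by (simp add: power2_eq_square algebra_simps)
    also have "\<dots> \<le> (1 - \<tau> * m) * s y y"
      using \<tau>1 \<tau> nonneg[OF y] by (simp add: mult_nonneg_nonpos mult_nonpos_nonneg)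
    also have "\<dots> = (sqrt (1 - \<tau> * m) * nrm y)^2" using m0 nrm_sq[OF y] by (simp add: power_mult_distrib)
    finally have "nrm (\<lambda>x. (- \<tau>) * z x + y x) \<le> sqrt (1 - \<tau> * m) * nrm y"
      by (rule power2_le_imp_le) (use m0 nrm_nonneg[OF y] in auto)
    then show ?thesis using TV[OF uV] TV[OF wV] uV wV Te by (simp add: d_def y_def)
  qed
  interpret S: Submetric V d ?K by unfold_locales auto
  obtain u where u: "u \<in> ?K" "T u = u"
  proof (rule S.sub.Banach_fixedpoint_thm[of T "sqrt (1 - \<tau> * m)"])
    show "S.sub.mcomplete" using mcomplete_ball Rp by simp
    show "?K \<noteq> {}" using Rp V lin_space_zero nrm_zero by (metis (mono_tags, lifting) empty_iff less_imp_le mem_Collect_eq)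
    show "T \<in> ?K \<rightarrow> ?K" using TK by blast
    show "sqrt (1 - \<tau> * m) < 1" using \<tau> m by simp
  qed (use contr in auto)
  have "r u = (\<lambda>x. 0)"
  proof
    fix x
    have "T u x = u x" using u by simp
    then show "r u x = 0" using \<tau> by (simp add: T_def)
  qed
  then have "G u v = 0" if "v \<in> V" for v
    using rG[of u v] u that lin_on_zero[OF V lin[OF that]] by simp
  then show ?thesis using u unfolding G_def by (intro bexI[of _ u]) auto
qed

text \<open>The bounds are given in the seminorm N, the contraction lives in the norm of the inner
  product. Since N is at most that norm divided by sqrt \<alpha>, the constants become CB /
  \<alpha>^(3/2) and CF / sqrt \<alpha>, and the smallness condition is unchanged. The a priori
  bound and uniqueness are argued in N itself, which yields the constant CF / (\<alpha> \<nu>). Here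
  CF includes the norm of the load.\<close>

lemma (in fin_inner) ex1_solution:
  fixes B :: "('a \<Rightarrow> real) \<Rightarrow> ('a \<Rightarrow> real) \<Rightarrow> ('a \<Rightarrow> real) \<Rightarrow> real"
  assumes \<nu>: "\<nu> > 0" and \<alpha>: "\<alpha> > 0" and CB: "CB > 0" and CF: "CF \<ge> 0"
    and B1: "\<And>v w. v \<in> V \<Longrightarrow> w \<in> V \<Longrightarrow> lin_on V (\<lambda>u. B u v w)"
    and B2: "\<And>u w. u \<in> V \<Longrightarrow> w \<in> V \<Longrightarrow> lin_on V (\<lambda>v. B u v w)"
    and B3: "\<And>u v. u \<in> V \<Longrightarrow> v \<in> V \<Longrightarrow> lin_on V (\<lambda>w. B u v w)"
    and skew: "\<And>u v. u \<in> V \<Longrightarrow> v \<in> V \<Longrightarrow> B u v v = 0"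
    and F: "lin_on V F"
    and N: "\<And>u. u \<in> V \<Longrightarrow> 0 \<le> N u" and coercive: "\<And>u. u \<in> V \<Longrightarrow> \<alpha> * (N u)^2 \<le> s u u"
    and Bb: "\<And>u v w. u \<in> V \<Longrightarrow> v \<in> V \<Longrightarrow> w \<in> V \<Longrightarrow> B u v w \<le> CB * N u * N v * N w"
    and Fb: "\<And>v. v \<in> V \<Longrightarrow> \<bar>F v\<bar> \<le> CF * N v"
    and small: "CB * CF < (\<alpha> * \<nu>)^2"
  defines "sol u \<equiv> u \<in> V \<and> (\<forall>v\<in>V. \<nu> * s u v + B u u v = F v)"
  shows "(\<exists>!u. sol u) \<and> (\<forall>u. sol u \<longrightarrow> N u \<le> CF / (\<alpha> * \<nu>))"
proof -
  \<comment> \<open>Polarisation of the skewness. It also upgrades the one-sided bound on B to a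
    bound on its absolute value, by exchanging the last two arguments.\<close>
  have alt: "B u v w = - B u w v" if "u \<in> V" "v \<in> V" "w \<in> V" for u v w
  proof -
    let ?z = "\<lambda>x. v x + w x"
    have z: "?z \<in> V" using V that by (intro lin_space_add)
    have "B u ?z ?z = B u v ?z + B u w ?z" using lin_on_add[OF B2] that z by blast
    also have "\<dots> = (B u v v + B u v w) + (B u w v + B u w w)"
      using lin_on_add[OF B3[OF that(1,2)] that(2,3)] lin_on_add[OF B3[OF that(1,3)] that(2,3)] by simp
    finally show ?thesis using skew that z by simp
  qed
  have Babs: "\<bar>B u v w\<bar> \<le> CB * N u * N v * N w" if "u \<in> V" "v \<in> V" "w \<in> V" for u v w
    using Bb[OF that] Bb[OF that(1,3,2)] alt[OF that] by (simp add: mult.assoc mult.commute[of "N v"])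
  have Nn: "N u \<le> nrm u / sqrt \<alpha>" if "u \<in> V" for u
  proof -
    have "sqrt (\<alpha> * (N u)^2) \<le> nrm u" using coercive[OF that] by (simp add: nrm_def)
    then show ?thesis using \<alpha> N[OF that] by (simp add: real_sqrt_mult field_simps)
  qed
  have "\<exists>u\<in>V. \<forall>v\<in>V. \<nu> * s u v + B u u v = F v"
  proof (rule ex_solution[where B = B and F = F and \<nu> = \<nu> and C = "CB / (\<alpha> * sqrt \<alpha>)" and D = "CF / sqrt \<alpha>"])
    show "CB / (\<alpha> * sqrt \<alpha>) > 0" "CF / sqrt \<alpha> \<ge> 0" using CB CF \<alpha> by auto
    have "CB / (\<alpha> * sqrt \<alpha>) * (CF / sqrt \<alpha>) = CB * CF / \<alpha>^2" using \<alpha> by (simp add: power2_eq_square)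
    also have "\<dots> < \<nu>^2" using small \<alpha> by (simp add: pos_divide_less_eq power_mult_distrib mult.commute)
    finally show "CB / (\<alpha> * sqrt \<alpha>) * (CF / sqrt \<alpha>) < \<nu>^2" .
    show "\<bar>B u v w\<bar> \<le> CB / (\<alpha> * sqrt \<alpha>) * nrm u * nrm v * nrm w" if "u \<in> V" "v \<in> V" "w \<in> V" for u v w
    proof -
      have "CB * N u * N v * N w \<le> CB * (nrm u / sqrt \<alpha>) * (nrm v / sqrt \<alpha>) * (nrm w / sqrt \<alpha>)"
        using that N Nn nrm_nonneg CB \<alpha> by (intro mult_mono mult_nonneg_nonneg) auto
      also have "\<dots> = CB / (\<alpha> * sqrt \<alpha>) * nrm u * nrm v * nrm w" using \<alpha> by simp
      finally show ?thesis using Babs[OF that] by linarith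
    qed
    show "\<bar>F v\<bar> \<le> CF / sqrt \<alpha> * nrm v" if "v \<in> V" for v
      using Fb[OF that] mult_left_mono[OF Nn[OF that] CF] by simp
  qed (use \<nu> B1 B2 B3 skew F in auto)
  then have ex: "\<exists>u. sol u" by (auto simp: sol_def)
  have bound: "N u \<le> CF / (\<alpha> * \<nu>)" if "sol u" for u
  proof -
    have u: "u \<in> V" and "\<nu> * s u u = F u" using that skew by (auto simp: sol_def)
    then have "\<nu> * (\<alpha> * (N u)^2) \<le> CF * N u" using coercive[OF u] Fb[OF u] \<nu> mult_left_mono[of _ _ \<nu>] by fastforce
    then have "(\<alpha> * \<nu> * N u) * N u \<le> CF * N u" by (simp add: power2_eq_square mult_ac)
    then have "\<alpha> * \<nu> * N u \<le> CF" if "N u > 0" using that by simp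
    then show ?thesis using N[OF u] \<alpha> \<nu> CF by (cases "N u = 0") (auto simp: field_simps)
  qed
  have "u = w" if u: "sol u" and w: "sol w" for u w
  proof -
    let ?d = "\<lambda>x. u x - w x"
    have V': "u \<in> V" "w \<in> V" using u w by (auto simp: sol_def)
    then have d: "?d \<in> V" using V by (intro lin_space_diff)
    have "\<nu> * s u ?d + B u u ?d = \<nu> * s w ?d + B w w ?d" using u w d by (simp add: sol_def)
    moreover have "s ?d ?d = s u ?d - s w ?d" by (rule lin_on_diff[OF lin[OF d] V'])
    moreover have "B ?d u ?d = B u u ?d - B w u ?d" by (rule lin_on_diff[OF B1[OF V'(1) d] V'])
    moreover have "B w ?d ?d = B w u ?d - B w w ?d" by (rule lin_on_diff[OF B2[OF V'(2) d] V'])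
    moreover have "B w ?d ?d = 0" using skew V' d by simp
    ultimately have "\<nu> * s ?d ?d = - B ?d u ?d" by (simp add: right_diff_distrib)
    \<comment> \<open>Antisymmetry moves the solution u into the last slot, where its a priori bound
      can be inserted.\<close>
    also have "\<dots> = B ?d ?d u" using alt[OF d V'(1) d] by simp
    also have "\<dots> \<le> CB * N ?d * N ?d * N u" by (rule Bb[OF d d V'(1)])
    finally have e: "\<nu> * s ?d ?d \<le> CB * N ?d * N ?d * N u" .
    have "N ?d = 0"
    proof (rule ccontr)
      assume "N ?d \<noteq> 0"
      \<comment> \<open>Coercivity from below meets continuity from above; cancelling the square of
        N would give (\<alpha> \<nu>)^2 \<le> CB CF.\<close>
      have "\<nu> * (\<alpha> * (N ?d)^2) \<le> CB * N ?d * N ?d * N u"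
        using e mult_left_mono[OF coercive[OF d], of \<nu>] \<nu> by linarith
      also have "\<dots> \<le> CB * N ?d * N ?d * (CF / (\<alpha> * \<nu>))"
        using bound[OF u] CB N[OF d] by (intro mult_left_mono) auto
      finally have "(\<alpha> * \<nu>) * (N ?d)^2 \<le> (CB * CF / (\<alpha> * \<nu>)) * (N ?d)^2" by (simp add: power2_eq_square mult_ac)
      then have "\<alpha> * \<nu> \<le> CB * CF / (\<alpha> * \<nu>)" using \<open>N ?d \<noteq> 0\<close> by (elim mult_right_le_imp_le) simp
      then have "(\<alpha> * \<nu>)^2 \<le> CB * CF" using \<alpha> \<nu> by (simp add: pos_le_divide_eq power2_eq_square)
      then show False using small by simp
    qed
    then have "s ?d ?d \<le> 0" using e \<nu> by (simp add: mult_le_0_iff)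
    then have "?d = (\<lambda>x. 0)" using nonneg[OF d] by (intro definite[OF d]) simp
    then show "u = w" by (auto simp: fun_eq_iff)
  qed
  then show ?thesis using ex bound by blast
qed

section \<open>Simple polygons\<close>

text \<open>Each inclusion says that a linear image of a connected set is connected, applied to f
  and to its inverse.\<close>

lemma connected_component_set_linear_image:
  fixes f :: "'a::euclidean_space \<Rightarrow> 'b::euclidean_space"
  assumes f: "linear f" "bij f" and x: "x \<in> S"
  shows "f ` connected_component_set S x = connected_component_set (f ` S) (f x)"
proof
  have img: "g ` connected_component_set T y \<subseteq> connected_component_set (g ` T) (g y)"
    if "linear g" "y \<in> T" for g :: "'c::euclidean_space \<Rightarrow> 'd::euclidean_space" and T y
  proof (rule connected_component_maximal)
    show "connected (g ` connected_component_set T y)"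
      using that by (intro connected_linear_image connected_connected_component)
    show "g y \<in> g ` connected_component_set T y" using that by (simp add: connected_component_refl_eq)
  qed (use connected_component_subset in blast)
  show "f ` connected_component_set S x \<subseteq> connected_component_set (f ` S) (f x)" using img f x by blast
  obtain g where g: "linear g" "g \<circ> f = id" "f \<circ> g = id"
    using f by (metis bij_betw_def linear_injective_left_inverse o_inv_distrib inj_iff surj_iff
        bij_is_inj bij_is_surj comp_assoc comp_id fun.map_id)
  have "g ` connected_component_set (f ` S) (f x) \<subseteq> connected_component_set (g ` f ` S) (g (f x))"
    using img g x by blast
  also have "\<dots> = connected_component_set S x"
    using g by (simp add: image_comp pointfree_idE)
  finally have "f ` g ` connected_component_set (f ` S) (f x) \<subseteq> f ` connected_component_set S x" by blast
  then show "connected_component_set (f ` S) (f x) \<subseteq> f ` connected_component_set S x"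
    using g by (simp add: image_comp)
qed

text \<open>A linear bijection respects components of the complement and, in both directions,
  boundedness, which is all that \<open>inside\<close> refers to.\<close>

lemma inside_linear_image:
  fixes f :: "'a::euclidean_space \<Rightarrow> 'b::euclidean_space"
  assumes f: "linear f" "bij f"
  shows "inside (f ` S) = f ` inside S"
proof -
  have c: "- f ` S = f ` (- S)" using f by (simp add: bij_image_Compl_eq)
  have b: "bounded (f ` T) \<longleftrightarrow> bounded T" for T
  proof
    assume "bounded (f ` T)"
    obtain g where g: "linear g" "g \<circ> f = id"
      using f linear_injective_left_inverse bij_is_inj by metis
    then have "g ` f ` T = T" by (simp add: image_comp)
    then show "bounded T" using bounded_linear_image[OF \<open>bounded (f ` T)\<close>] g linear_linear by metis
  qed (use f bounded_linear_image linear_linear in blast)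
  have in_iff: "f x \<in> inside (f ` S) \<longleftrightarrow> x \<in> inside S" for x
  proof -
    have "f x \<in> f ` S \<longleftrightarrow> x \<in> S" using f by (meson bij_is_inj inj_image_mem_iff)
    moreover have "bounded (connected_component_set (f ` (- S)) (f x)) \<longleftrightarrow> bounded (connected_component_set (- S) x)"
      if "x \<notin> S"
      using connected_component_set_linear_image[OF f, of x "- S"] b[of "connected_component_set (- S) x"] that
      by (metis ComplI)
    ultimately show ?thesis by (auto simp: inside_def c)
  qed
  show ?thesis
  proof (rule set_eqI)
    fix y
    obtain x where y: "y = f x" using f by (metis bij_is_surj surjD)
    show "y \<in> inside (f ` S) \<longleftrightarrow> y \<in> f ` inside S"
      unfolding y in_iff
      using inj_image_mem_iff[OF bij_is_inj[OF f(2)]] by metis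
  qed
qed

text \<open>The Jordan curve theorem is carried over from \<open>complex\<close> along the real
  linear bijection J.\<close>

lemma Jordan_plane:
  fixes c :: "real \<Rightarrow> point"
  assumes "simple_path c" "pathfinish c = pathstart c"
  shows "inside (path_image c) \<noteq> {}" "open (inside (path_image c))" "bounded (inside (path_image c))"
    "frontier (inside (path_image c)) = path_image c"
proof -
  define J :: "point \<Rightarrow> complex" where "J x = Complex (x $ 1) (x $ 2)" for x
  have lJ: "linear J" by (rule linearI) (auto simp: J_def complex_eq_iff)
  have bJ: "bij J"
  proof (rule bijI)
    show "inj J" by (auto simp: inj_def J_def vec_eq_iff forall_2)
    show "surj J"
    proof (rule surjI)
      show "J (vector [Re z, Im z]) = z" for z by (simp add: J_def)
    qed
  qed
  have iJ: "inj J" using bJ by (rule bij_is_inj)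
  have s: "simple_path (J \<circ> c)" "pathfinish (J \<circ> c) = pathstart (J \<circ> c)"
    using assms simple_path_linear_image_eq[OF lJ iJ] by (auto simp: pathfinish_def pathstart_def)
  have I: "inside (path_image (J \<circ> c)) = J ` inside (path_image c)"
    unfolding path_image_compose by (rule inside_linear_image[OF lJ bJ])
  note Jo = Jordan_inside_outside[OF s, unfolded I]
  show "inside (path_image c) \<noteq> {}" using Jo by auto
  have cl: "compact (path_image c)" using assms simple_path_imp_path compact_path_image by blast
  then show "open (inside (path_image c))" by (simp add: open_inside compact_imp_closed)
  show "bounded (inside (path_image c))" using cl by (simp add: bounded_inside compact_imp_bounded)
  have "open (inside (path_image c))" using cl by (simp add: open_inside compact_imp_closed)
  moreover have "open (J ` inside (path_image c))" using Jo by auto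
  ultimately have "frontier (J ` inside (path_image c)) = J ` frontier (inside (path_image c))"
    unfolding frontier_def using closure_injective_linear_image[OF lJ iJ] iJ
    by (simp add: image_set_diff interior_open)
  then have "J ` frontier (inside (path_image c)) = J ` path_image c" using Jo by (simp add: path_image_compose)
  then show "frontier (inside (path_image c)) = path_image c" using iJ by (simp add: inj_image_eq_iff)
qed

section \<open>The boundary of a simple polygon as a closed path\<close>

definition seg :: "polygon \<Rightarrow> nat \<Rightarrow> point set" where
  "seg K k = closed_segment (vtx K k) (vtx K (Suc k))"

text \<open>The path \<open>poly_path K i\<close> runs through the edges 0 to i. As long as the last
  edge is left out the path is an arc.\<close>

primrec poly_path :: "polygon \<Rightarrow> nat \<Rightarrow> real \<Rightarrow> point" where
  "poly_path K 0 = linepath (vtx K 0) (vtx K 1)"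
| "poly_path K (Suc i) = poly_path K i +++ linepath (vtx K (Suc i)) (vtx K (Suc (Suc i)))"

lemma simple_polygon_length: "simple_polygon K \<Longrightarrow> 3 \<le> length K"
  by (simp add: simple_polygon_def)

lemma vtx_inj:
  assumes "simple_polygon K" "i < length K" "j < length K" "vtx K i = vtx K j" shows "i = j"
  using assms by (auto simp: simple_polygon_def vtx_def nth_eq_iff_index_eq)

lemma vtx_length: "vtx K (length K) = vtx K 0"
  by (simp add: vtx_def)

lemma vtx_Suc_neq:
  assumes "simple_polygon K" "k < length K" shows "vtx K k \<noteq> vtx K (Suc k)"
proof
  assume e: "vtx K k = vtx K (Suc k)"
  show False
  proof (cases "Suc k < length K")
    case True
    then show False using vtx_inj[OF assms(1,2) True e] by simp
  next
    case False
    then have "Suc k = length K" using assms by simp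
    then have "vtx K k = vtx K 0" using e vtx_length by metis
    moreover have "0 < length K" using assms by linarith
    ultimately have "k = 0" using vtx_inj[OF assms(1,2)] by blast
    then show False using \<open>Suc k = length K\<close> simple_polygon_length[OF assms(1)] by simp
  qed
qed

lemma seg_Int:
  "simple_polygon K \<Longrightarrow> i < length K \<Longrightarrow> j < length K \<Longrightarrow> i \<noteq> j \<Longrightarrow>
    seg K i \<inter> seg K j = {vtx K i, vtx K (Suc i)} \<inter> {vtx K j, vtx K (Suc j)}"
  by (simp add: simple_polygon_def seg_def)

lemma poly_path:
  assumes K: "simple_polygon K" and i: "Suc i < length K"
  shows "arc (poly_path K i) \<and> pathstart (poly_path K i) = vtx K 0 \<and>
    pathfinish (poly_path K i) = vtx K (Suc i) \<and> path_image (poly_path K i) = (\<Union>j\<le>i. seg K j)"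
  using i
proof (induction i)
  case 0
  have "vtx K 0 \<noteq> vtx K (Suc 0)" using vtx_Suc_neq[OF K, of 0] i by linarith
  then show ?case by (auto simp: seg_def)
next
  case (Suc i)
  let ?l = "linepath (vtx K (Suc i)) (vtx K (Suc (Suc i)))"
  have IH: "arc (poly_path K i)" "pathstart (poly_path K i) = vtx K 0"
    "pathfinish (poly_path K i) = vtx K (Suc i)" "path_image (poly_path K i) = (\<Union>j\<le>i. seg K j)"
    using Suc by auto
  have "path_image (poly_path K i) \<inter> path_image ?l \<subseteq> {pathstart ?l}"
  proof
    fix x assume "x \<in> path_image (poly_path K i) \<inter> path_image ?l"
    then obtain j where j: "j \<le> i" "x \<in> seg K j" "x \<in> seg K (Suc i)" using IH by (auto simp: seg_def)
    then have "x \<in> {vtx K j, vtx K (Suc j)} \<inter> {vtx K (Suc i), vtx K (Suc (Suc i))}"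
      using seg_Int[OF K, of j "Suc i"] Suc.prems by auto
    moreover have "vtx K j \<noteq> vtx K (Suc i)" "vtx K j \<noteq> vtx K (Suc (Suc i))" "vtx K (Suc j) \<noteq> vtx K (Suc (Suc i))"
      using j Suc.prems vtx_inj[OF K, of j "Suc i"] vtx_inj[OF K, of j "Suc (Suc i)"]
        vtx_inj[OF K, of "Suc j" "Suc (Suc i)"] by fastforce+
    ultimately show "x \<in> {pathstart ?l}" by auto
  qed
  then have "arc (poly_path K i +++ ?l)"
    using IH vtx_Suc_neq[OF K, of "Suc i"] Suc.prems by (intro arc_join arc_linepath) auto
  then show ?case using IH by (auto simp: path_image_join atMost_Suc seg_def)
qed

lemma polygon_boundary_seg: "polygon_boundary K = (\<Union>k<length K. seg K k)"
  by (simp add: polygon_boundary_def seg_def)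

lemma region_Jordan:
  assumes K: "simple_polygon K"
  shows "region K \<noteq> {}" "open (region K)" "bounded (region K)" "frontier (region K) = polygon_boundary K"
proof -
  \<comment> \<open>With m + 2 vertices, the edges 0 to m form the arc and the edge m + 1 returns to
    the first vertex.\<close>
  obtain m where m: "length K = Suc (Suc m)" "m \<ge> 1" using simple_polygon_length[OF K]
    by (metis One_nat_def Suc_le_D Suc_le_mono numeral_3_eq_3)
  let ?p = "poly_path K m" and ?l = "linepath (vtx K (Suc m)) (vtx K 0)"
  have P: "arc ?p" "pathstart ?p = vtx K 0" "pathfinish ?p = vtx K (Suc m)" "path_image ?p = (\<Union>j\<le>m. seg K j)"
    using poly_path[OF K, of m] m by auto
  have l: "path_image ?l = seg K (Suc m)" using vtx_length[of K] m by (simp add: seg_def)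
  have s: "simple_path (?p +++ ?l)"
  proof (rule simple_path_join_loop)
    have "vtx K (Suc m) \<noteq> vtx K 0" using vtx_inj[OF K, of "Suc m" 0] m by fastforce
    then show "arc ?l" by (rule arc_linepath)
    show "path_image ?p \<inter> path_image ?l \<subseteq> {pathstart ?p, pathstart ?l}"
    proof
      fix x assume "x \<in> path_image ?p \<inter> path_image ?l"
      then obtain j where "j \<le> m" "x \<in> seg K j" "x \<in> seg K (Suc m)" using P l by auto
      then have "x \<in> {vtx K (Suc m), vtx K (Suc (Suc m))}" using seg_Int[OF K, of j "Suc m"] m by auto
      then show "x \<in> {pathstart ?p, pathstart ?l}" using P vtx_length[of K] m by auto
    qed
  qed (use P in auto)
  have "path_image (?p +++ ?l) = polygon_boundary K"
  proof -
    have "path_image (?p +++ ?l) = (\<Union>j\<le>m. seg K j) \<union> seg K (Suc m)"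
      using P l by (simp add: path_image_join)
    also have "\<dots> = (\<Union>k<Suc (Suc m). seg K k)" by (auto simp: lessThan_Suc_atMost atMost_Suc)
    finally show ?thesis by (simp add: polygon_boundary_seg m)
  qed
  then show "region K \<noteq> {}" "open (region K)" "bounded (region K)" "frontier (region K) = polygon_boundary K"
    using Jordan_plane[OF s] P by (auto simp: region_def)
qed

lemma vtx_in_set: "K \<noteq> [] \<Longrightarrow> vtx K k \<in> set K"
  by (simp add: vtx_def)

lemma in_set_vtx: "v \<in> set K \<Longrightarrow> \<exists>k<length K. v = vtx K k"
  by (metis in_set_conv_nth mod_less vtx_def)

lemma edgesE:
  assumes "(a, b) \<in> edges K"
  obtains k where "k < length K" "a = vtx K k \<and> b = vtx K (Suc k) \<or> a = vtx K (Suc k) \<and> b = vtx K k"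
  using assms by (auto simp: edges_def doubleton_eq_iff)

lemma edgesI: "k < length K \<Longrightarrow> (vtx K k, vtx K (Suc k)) \<in> edges K"
  by (auto simp: edges_def)

lemma edges_sym: "(a, b) \<in> edges K \<Longrightarrow> (b, a) \<in> edges K"
  by (auto simp: edges_def insert_commute)

lemma edges_seg: "(a, b) \<in> edges K \<Longrightarrow> \<exists>k<length K. closed_segment a b = seg K k \<and> {a, b} = {vtx K k, vtx K (Suc k)}"
  by (erule edgesE) (auto simp: seg_def closed_segment_commute insert_commute)

lemma edges_neq: "simple_polygon K \<Longrightarrow> (a, b) \<in> edges K \<Longrightarrow> a \<noteq> b"
  by (erule edgesE) (auto simp: vtx_Suc_neq dest: vtx_Suc_neq)

section \<open>Star-shaped polygons\<close>

text \<open>Star-shapedness is demanded for every point of a ball, not just for its centre; the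
  spare room is what makes statements about the closure and the frontier work.\<close>

locale star_open =
  fixes R :: "point set" and c :: point and r :: real
  assumes R_open: "open R" and R_bounded: "bounded R" and r: "r > 0" and ball: "ball c r \<subseteq> R"
    and star: "\<And>y x. y \<in> ball c r \<Longrightarrow> x \<in> R \<Longrightarrow> closed_segment y x \<subseteq> R"
begin

lemma centre: "c \<in> R"
  using ball r by auto

text \<open>A point x of the closure is replaced by a nearby x' of R, and the error is compensated
  by moving the centre to a point y of the ball, so that the target lies on the segment from y to
  x'.\<close>

lemma closure_star:
  assumes x: "x \<in> closure R" and t: "0 \<le> t" "t < 1" shows "c + t *\<^sub>R (x - c) \<in> R"
proof (cases "t = 0")
  case True
  then show ?thesis using centre by simp
next
  case False
  then have "(1 - t) * r / t > 0" using t r by simp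
  \<comment> \<open>The tolerance is chosen so that the displaced centre y stays at distance less
    than r from c.\<close>
  then obtain x' where x': "x' \<in> R" "dist x' x < (1 - t) * r / t" using x closure_approachable by blast
  define y where "y = c + (t / (1 - t)) *\<^sub>R (x - x')"
  have "norm (y - c) = t / (1 - t) * dist x' x" using t by (simp add: y_def dist_norm norm_minus_commute)
  also have "\<dots> < t / (1 - t) * ((1 - t) * r / t)" using x' t False by (intro mult_strict_left_mono) auto
  also have "\<dots> = r" using t False by simp
  finally have y: "y \<in> ball c r" by (simp add: dist_norm norm_minus_commute)
  have "(1 - t) *\<^sub>R y = (1 - t) *\<^sub>R c + t *\<^sub>R (x - x')"
    using t by (simp add: y_def scaleR_add_right)
  then have "c + t *\<^sub>R (x - c) = (1 - t) *\<^sub>R y + t *\<^sub>R x'" by (simp add: algebra_simps)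
  then have "c + t *\<^sub>R (x - c) \<in> closed_segment y x'" using t unfolding in_segment by auto
  then show ?thesis using star[OF y x'(1)] by blast
qed

lemma frontier_not_R: "x \<in> frontier R \<Longrightarrow> x \<notin> R"
  using R_open by (simp add: frontier_def interior_open)

lemma frontier_closure: "x \<in> frontier R \<Longrightarrow> x \<in> closure R"
  by (simp add: frontier_def)

lemma beyond_frontier:
  assumes "x \<in> frontier R" "t > 1" shows "c + t *\<^sub>R (x - c) \<notin> closure R"
proof
  assume "c + t *\<^sub>R (x - c) \<in> closure R"
  then have "c + (1 / t) *\<^sub>R ((c + t *\<^sub>R (x - c)) - c) \<in> R" using assms by (intro closure_star) auto
  then show False using assms frontier_not_R by simp
qed

text \<open>Shrinking a frontier point towards c leads into R and stretching it leaves the closure,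
  so neither can produce another frontier point.\<close>

lemma ray_unique:
  assumes "x \<in> frontier R" "c + t *\<^sub>R (x - c) \<in> frontier R" "t > 0" shows "t = 1"
proof (rule ccontr)
  assume "t \<noteq> 1"
  then consider "t < 1" | "t > 1" by linarith
  then show False
  proof cases
    case 1
    then show False using closure_star[OF frontier_closure[OF assms(1)], of t] assms frontier_not_R by simp
  next
    case 2
    then show False using beyond_frontier[OF assms(1)] assms frontier_closure by blast
  qed
qed

end

section \<open>Sides of an edge and the local shape of a star-shaped set\<close>

text \<open>The vector b - a turned clockwise by a right angle, the unnormalised
  \<open>edge_normal\<close>. The sign of \<open>perp a b \<bullet> (x - a)\<close> tells the side
  of the line through a and b on which x lies.\<close>

definition perp :: "point \<Rightarrow> point \<Rightarrow> point" where
  "perp a b = vector [b$2 - a$2, a$1 - b$1]"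

lemma perp_nth [simp]: "perp a b $ 1 = b$2 - a$2" "perp a b $ 2 = a$1 - b$1"
  by (simp_all add: perp_def)

lemma inner_2: "x \<bullet> y = x$1 * y$1 + x$2 * (y::point)$2"
  by (simp add: inner_vec_def sum_2)

lemma perp_inner_self: "perp a b \<bullet> (b - a) = 0"
  by (simp add: inner_2 algebra_simps)

lemma perp_norm: "perp a b \<bullet> perp a b = (b - a) \<bullet> (b - a)"
  by (simp add: inner_2 power2_eq_square[symmetric] power2_commute)

lemma on_line:
  assumes "a \<noteq> b" "perp a b \<bullet> (x - a) = 0"
  shows "x = a + (((x - a) \<bullet> (b - a)) / ((b - a) \<bullet> (b - a))) *\<^sub>R (b - a)"
proof -
  let ?D = "(b - a) \<bullet> (b - a)"
  have D: "?D \<noteq> 0" using assms by simp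
  have p: "(b$2 - a$2) * (x$1 - a$1) = (b$1 - a$1) * (x$2 - a$2)"
    using assms(2) by (simp add: inner_2 algebra_simps)
  have "?D * (x$1 - a$1) = ((x - a) \<bullet> (b - a)) * (b$1 - a$1)"
    using arg_cong[OF p, of "\<lambda>z. (b$2 - a$2) * z"] by (simp add: inner_2 algebra_simps)
  moreover have "?D * (x$2 - a$2) = ((x - a) \<bullet> (b - a)) * (b$2 - a$2)"
    using arg_cong[OF p, of "\<lambda>z. (b$1 - a$1) * z"] by (simp add: inner_2 algebra_simps)
  ultimately have "x$1 - a$1 = ((x - a) \<bullet> (b - a)) / ?D * (b$1 - a$1)"
    "x$2 - a$2 = ((x - a) \<bullet> (b - a)) / ?D * (b$2 - a$2)"
    using D by (simp_all add: field_simps)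
  moreover define q where "q = ((x - a) \<bullet> (b - a)) / ?D"
  ultimately show ?thesis unfolding q_def[symmetric] by (simp add: vec_eq_iff forall_2)
qed

context star_open
begin

text \<open>If c lay on the line but off the edge, one endpoint would be strictly between c and the
  other. By \<open>closure_star\<close> it would then belong to R, although it is a frontier
  point.\<close>

lemma centre_off_line:
  assumes ab: "a \<noteq> b" and seg: "closed_segment a b \<subseteq> frontier R"
  shows "perp a b \<bullet> (c - a) \<noteq> 0"
proof
  assume "perp a b \<bullet> (c - a) = 0"
  then obtain s where s: "c = a + s *\<^sub>R (b - a)" using on_line[OF ab] by blast
  have ends: "a \<in> frontier R" "b \<in> frontier R" using seg by auto
  have "c \<notin> closed_segment a b" using seg frontier_not_R centre by blast
  then have "\<not> (0 \<le> s \<and> s \<le> 1)" using s unfolding in_segment by (auto simp: algebra_simps)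
  then consider "s < 0" | "s > 1" by linarith
  then show False
  proof cases
    case 1
    have "c + (- s / (1 - s)) *\<^sub>R (b - c) = a"
    proof -
      have e: "(1 - s) * (- s / (1 - s)) = - s" using 1 by simp
      have "(1 - s) *\<^sub>R (c + (- s / (1 - s)) *\<^sub>R (b - c)) = (1 - s) *\<^sub>R c + (- s) *\<^sub>R (b - c)"
        by (simp only: scaleR_add_right scaleR_scaleR e)
      also have "\<dots> = (1 - s) *\<^sub>R a" unfolding s by (simp add: algebra_simps)
      finally show ?thesis using 1 by (simp only: scaleR_cancel_left) auto
    qed
    moreover have "c + (- s / (1 - s)) *\<^sub>R (b - c) \<in> R"
      using 1 ends frontier_closure by (intro closure_star) (auto simp: field_simps)
    ultimately show False using ends frontier_not_R by auto
  next
    case 2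
    have "c + ((s - 1) / s) *\<^sub>R (a - c) = b"
    proof -
      have "s *\<^sub>R (c + ((s - 1) / s) *\<^sub>R (a - c)) = s *\<^sub>R c + (s - 1) *\<^sub>R (a - c)"
        using 2 by (simp add: scaleR_add_right)
      also have "\<dots> = s *\<^sub>R b" unfolding s by (simp add: algebra_simps)
      finally show ?thesis using 2 by (simp only: scaleR_cancel_left) auto
    qed
    moreover have "c + ((s - 1) / s) *\<^sub>R (a - c) \<in> R"
      using 2 ends frontier_closure by (intro closure_star) auto
    ultimately show False using ends frontier_not_R by auto
  qed
qed

text \<open>For z near x the central projection of z from c to the line of the edge is still a point
  of the edge, hence a frontier point. Therefore z belongs to R precisely when it comes before its
  projection on the ray from c, that is, when it is on the side of c.\<close>

lemma local_structure:
  assumes ab: "a \<noteq> b" and seg: "closed_segment a b \<subseteq> frontier R" and x: "x \<in> open_segment a b"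
  shows "\<exists>\<delta>>0. \<forall>z\<in>ball x \<delta>. z \<in> R \<longleftrightarrow> (perp a b \<bullet> (z - a)) * (perp a b \<bullet> (c - a)) > 0"
proof -
  define l where "l z = perp a b \<bullet> (z - a)" for z
  have lc: "l c \<noteq> 0" using centre_off_line[OF ab seg] by (simp add: l_def)
  define \<tau> where "\<tau> z = ((z - a) \<bullet> (b - a)) / ((b - a) \<bullet> (b - a))" for z
  \<comment> \<open>The central projection from c onto the zero set of l, in closed form; it fixes
    x.\<close>
  define p where "p z = c + (l c / (l c - l z)) *\<^sub>R (z - c)" for z
  obtain u where u: "0 < u" "u < 1" "x = a + u *\<^sub>R (b - a)"
    using x unfolding in_segment by (auto simp: algebra_simps)
  have lx: "l x = 0" using perp_inner_self[of a b] u by (simp add: l_def)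
  have D: "(b - a) \<bullet> (b - a) \<noteq> 0" using ab by simp
  have px: "p x = x" using lc lx by (simp add: p_def)
  have \<tau>x: "\<tau> x = u" using u D by (simp add: \<tau>_def)
  have cl: "isCont l x" unfolding l_def by (intro continuous_intros)
  have cp: "isCont p x" unfolding p_def using cl lc lx by (intro continuous_intros) auto
  have "isCont (\<lambda>z. \<tau> (p z)) x" unfolding \<tau>_def using cp D by (intro continuous_intros) auto
  then have t\<tau>: "((\<lambda>z. \<tau> (p z)) \<longlongrightarrow> u) (nhds x)" using px \<tau>x by (simp add: continuous_at tendsto_nhds_iff)
  have tl: "((\<lambda>z. l z / l c) \<longlongrightarrow> 0) (nhds x)"
  proof -
    have "isCont (\<lambda>z. l z / l c) x" using cl lc by (intro continuous_intros) auto
    then show ?thesis using lx by (simp add: continuous_at tendsto_nhds_iff)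
  qed
  have "\<forall>\<^sub>F z in nhds x. 0 < \<tau> (p z) \<and> \<tau> (p z) < 1 \<and> l z / l c < 1"
    using order_tendstoD(1)[OF t\<tau> u(1)] order_tendstoD(2)[OF t\<tau> u(2)] order_tendstoD(2)[OF tl zero_less_one]
    by eventually_elim simp
  then obtain \<delta> where \<delta>: "\<delta> > 0" "\<And>z. dist z x < \<delta> \<Longrightarrow> 0 < \<tau> (p z) \<and> \<tau> (p z) < 1 \<and> l z / l c < 1"
    unfolding eventually_nhds_metric by blast
  show ?thesis
  proof (intro exI[of _ \<delta>] conjI ballI \<delta>(1))
    fix z assume "z \<in> ball x \<delta>"
    then have z: "0 < \<tau> (p z)" "\<tau> (p z) < 1" "l z / l c < 1" using \<delta>(2)[of z] by (auto simp: dist_commute)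
    \<comment> \<open>The position of z on the ray from c, measured so that the projection has t =
      1.\<close>
    define t where "t = 1 - l z / l c"
    have t: "t > 0" using z by (simp add: t_def)
    have tl: "l c / (l c - l z) = 1 / t" using lc by (simp add: t_def field_simps)
    have zp: "z = c + t *\<^sub>R (p z - c)" using t by (simp add: p_def tl)
    have lin: "l (c + s *\<^sub>R (w - c)) = l c + s * (l w - l c)" for s w
      by (simp add: l_def inner_simps algebra_simps)
    have "l (p z) = l c + (l c / (l c - l z)) * (l z - l c)" unfolding p_def by (rule lin)
    also have "l z - l c = - (t * l c)" using lc by (simp add: t_def field_simps)
    also have "l c + l c / (l c - l z) * - (t * l c) = 0" unfolding tl using t by simp
    finally have "p z = a + \<tau> (p z) *\<^sub>R (b - a)"
      using on_line[OF ab] unfolding l_def \<tau>_def by blast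
    then have "p z \<in> closed_segment a b" using z unfolding in_segment
      by (intro exI[of _ "\<tau> (p z)"]) (auto simp: algebra_simps)
    then have pf: "p z \<in> frontier R" using seg by blast
    have "z \<in> R \<longleftrightarrow> t < 1"
    proof
      assume "t < 1"
      then show "z \<in> R" using closure_star[OF frontier_closure[OF pf], of t] t zp by simp
    next
      assume zR: "z \<in> R"
      show "t < 1"
      proof (rule ccontr)
        assume "\<not> t < 1"
        then consider "t = 1" | "t > 1" by linarith
        then show False
        proof cases
          case 1
          then show False using zp pf frontier_not_R zR by simp
        next
          case 2
          then show False using beyond_frontier[OF pf] zp zR closure_subset by (metis subsetD)
        qed
      qed
    qed
    also have "\<dots> \<longleftrightarrow> l z / l c > 0" by (simp add: t_def)
    also have "\<dots> \<longleftrightarrow> l z * l c > 0" by (simp add: zero_less_divide_iff zero_less_mult_iff)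
    finally show "z \<in> R \<longleftrightarrow> (perp a b \<bullet> (z - a)) * (perp a b \<bullet> (c - a)) > 0" by (simp add: l_def)
  qed
qed

end

lemma open_segment_endpoints: "x \<in> open_segment a b \<Longrightarrow> x \<noteq> a \<and> x \<noteq> b"
  by (simp add: open_segment_def)

lemma seg_cases:
  assumes "x \<in> seg K k"
  shows "x \<in> open_segment (vtx K k) (vtx K (Suc k)) \<or> x = vtx K k \<or> x = vtx K (Suc k)"
  using assms by (auto simp: seg_def open_segment_def)

locale star_polygon =
  fixes K :: polygon and c :: point and r :: real
  assumes simple: "simple_polygon K" and r: "r > 0" and ball: "ball c r \<subseteq> region K"
    and star: "\<And>y x. y \<in> ball c r \<Longrightarrow> x \<in> region K \<Longrightarrow> closed_segment y x \<subseteq> region K"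

sublocale star_polygon \<subseteq> star_open "region K" c r
  using region_Jordan[OF simple] r ball star by unfold_locales auto

sublocale star_polygon \<subseteq> bounded_open "region K"
  using region_Jordan[OF simple] by unfold_locales auto

context star_polygon
begin

lemma seg_frontier: "k < length K \<Longrightarrow> closed_segment (vtx K k) (vtx K (Suc k)) \<subseteq> frontier (region K)"
  using region_Jordan(4)[OF simple] by (auto simp: polygon_boundary_def)

lemma edge_frontier: "(a, b) \<in> edges K \<Longrightarrow> closed_segment a b \<subseteq> frontier (region K)"
  using seg_frontier edges_seg[of a b K] unfolding seg_def by metis

text \<open>The definition probes points just beyond the midpoint of the edge. Close to the
  midpoint, membership is decided by the side of the centre, so the probe amounts to one sign. It
  also makes the formula independent of the orientation of the edge.\<close>

lemma outer_normal_eq: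
  assumes e: "(a, b) \<in> edges K"
  shows "outer_normal K a b = (- sgn (perp a b \<bullet> (c - a)) / dist a b) *\<^sub>R perp a b"
proof -
  have ab: "a \<noteq> b" using e simple edges_neq by blast
  have n: "edge_normal a b = (1 / dist a b) *\<^sub>R perp a b" by (simp add: edge_normal_def perp_def)
  let ?m = "midpoint a b" and ?l = "perp a b \<bullet> (c - a)"
  have lc: "?l \<noteq> 0" using centre_off_line[OF ab edge_frontier[OF e]] .
  obtain \<delta> where \<delta>: "\<delta> > 0" "\<forall>z\<in>ball ?m \<delta>. z \<in> region K \<longleftrightarrow> (perp a b \<bullet> (z - a)) * ?l > 0"
    using local_structure[OF ab edge_frontier[OF e], of ?m] ab by auto
  have dp: "dist a b > 0" using ab by simp
  have np: "norm (perp a b) = dist a b"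
    by (metis perp_norm norm_eq_sqrt_inner dist_commute dist_norm)
  have nn: "norm (edge_normal a b) = 1" using dp np unfolding n by simp
  have pos: "perp a b \<bullet> (?m + t *\<^sub>R edge_normal a b - a) = t * dist a b" for t
  proof -
    have "?m - a = (1/2) *\<^sub>R (b - a)" by (simp add: vec_eq_iff midpoint_def field_simps)
    then have "perp a b \<bullet> (?m - a) = 0" using perp_inner_self by simp
    moreover have "perp a b \<bullet> edge_normal a b = dist a b"
      unfolding n using np dp by (simp add: power2_norm_eq_inner[symmetric] power2_eq_square)
    ultimately show ?thesis by (simp add: inner_simps algebra_simps)
  qed
  have iff: "?m + t *\<^sub>R edge_normal a b \<in> region K \<longleftrightarrow> ?l > 0" if "0 < t" "t < \<delta>" for t
  proof -
    have "?m + t *\<^sub>R edge_normal a b \<in> ball ?m \<delta>" using that nn by (simp add: dist_norm)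
    moreover have td: "0 < t * dist a b" using that dp by simp
    then have "(t * dist a b) * ?l > 0 \<longleftrightarrow> ?l > 0" by (metis mult_pos_pos zero_less_mult_pos)
    ultimately show ?thesis using \<delta>(2) pos[of t] by metis
  qed
  show ?thesis
  proof (cases "?l > 0")
    case True
    have "\<not> (\<exists>\<delta>'>0. \<forall>t. 0 < t \<and> t < \<delta>' \<longrightarrow> ?m + t *\<^sub>R edge_normal a b \<notin> region K)"
    proof
      assume "\<exists>\<delta>'>0. \<forall>t. 0 < t \<and> t < \<delta>' \<longrightarrow> ?m + t *\<^sub>R edge_normal a b \<notin> region K"
      then obtain \<delta>' where d: "\<delta>' > 0" "\<forall>t. 0 < t \<and> t < \<delta>' \<longrightarrow> ?m + t *\<^sub>R edge_normal a b \<notin> region K" by blast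
      have "0 < min \<delta> \<delta>' / 2" "min \<delta> \<delta>' / 2 < \<delta>" "min \<delta> \<delta>' / 2 < \<delta>'" using \<delta> d by auto
      then show False using d(2) iff True by blast
    qed
    then have "outer_normal K a b = - edge_normal a b" unfolding outer_normal_def by (rule if_not_P)
    then show ?thesis using True by (simp add: n)
  next
    case False
    then have "\<exists>\<delta>'>0. \<forall>t. 0 < t \<and> t < \<delta>' \<longrightarrow> ?m + t *\<^sub>R edge_normal a b \<notin> region K"
      using \<delta>(1) iff by (intro exI[of _ \<delta>]) auto
    moreover have "?l < 0" using False lc by simp
    ultimately show ?thesis unfolding outer_normal_def n by (simp add: sgn_real_def)
  qed
qed

end

text \<open>The fundamental theorem of calculus for a bounded set W on a line that changes at
  finitely many points; \<sigma> is the outward direction at each of them. Away from the points, the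
  indicator of W agrees with a step function J, since the difference is locally constant and
  vanishes far to the left.\<close>

lemma jump_integral:
  fixes g g' :: "real \<Rightarrow> real" and p \<sigma> :: "'i \<Rightarrow> real"
  assumes I: "finite I" and inj: "inj_on p I" and \<sigma>: "\<And>k. k \<in> I \<Longrightarrow> \<sigma> k = 1 \<or> \<sigma> k = -1"
    and W: "W \<subseteq> {-B..B}"
    and off: "\<And>x. x \<notin> p ` I \<Longrightarrow> \<exists>\<delta>>0. \<forall>y. \<bar>y - x\<bar> < \<delta> \<longrightarrow> (y \<in> W \<longleftrightarrow> x \<in> W)"
    and on: "\<And>k. k \<in> I \<Longrightarrow> \<exists>\<delta>>0. \<forall>y. 0 < \<bar>y - p k\<bar> \<and> \<bar>y - p k\<bar> < \<delta> \<longrightarrow> (y \<in> W \<longleftrightarrow> \<sigma> k * (y - p k) < 0)"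
    and pB: "\<And>k. k \<in> I \<Longrightarrow> \<bar>p k\<bar> < B" and B: "0 < B"
    and g: "\<And>x. (g has_real_derivative g' x) (at x)" "continuous_on UNIV g'"
  shows "(\<integral>x. indicator W x * g' x \<partial>lborel) = (\<Sum>k\<in>I. \<sigma> k * g (p k))"
proof -
  define J where "J x = (\<Sum>k\<in>I. - \<sigma> k * (if p k < x then 1 else 0))" for x
  define h where "h x = indicator W x - J x" for x
  have Jloc: "\<exists>\<delta>>0. \<forall>y. \<bar>y - x\<bar> < \<delta> \<longrightarrow> (\<forall>k\<in>I. p k \<noteq> x \<longrightarrow> (p k < y \<longleftrightarrow> p k < x))" for x
  proof -
    have "\<forall>\<^sub>F y in nhds x. \<forall>k\<in>I. p k \<noteq> x \<longrightarrow> (p k < y \<longleftrightarrow> p k < x)"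
    proof (rule eventually_ball_finite[OF I], rule ballI)
      fix k
      show "\<forall>\<^sub>F y in nhds x. p k \<noteq> x \<longrightarrow> (p k < y \<longleftrightarrow> p k < x)"
      proof (cases "p k < x")
        case True
        then have "\<forall>\<^sub>F y in nhds x. y \<in> {p k<..}" by (intro eventually_nhds_in_open) auto
        then show ?thesis using True by (auto elim: eventually_mono)
      next
        case False
        show ?thesis
        proof (cases "p k = x")
          case False
          then have "\<forall>\<^sub>F y in nhds x. y \<in> {..<p k}" using \<open>\<not> p k < x\<close> by (intro eventually_nhds_in_open) auto
          then show ?thesis using \<open>\<not> p k < x\<close> by (auto elim!: eventually_mono)
        qed simp
      qed
    qed
    then show ?thesis unfolding eventually_nhds_metric dist_real_def by blast
  qed
  \<comment> \<open>The difference h may take an exceptional value at a jump point itself, so v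
    records its value on a punctured neighbourhood.\<close>
  have "\<exists>v \<delta>. \<delta> > 0 \<and> (\<forall>y. y \<noteq> x \<and> \<bar>y - x\<bar> < \<delta> \<longrightarrow> h y = v) \<and> (x \<notin> p ` I \<longrightarrow> h x = v)" for x
  proof -
    obtain \<delta>1 where d1: "\<delta>1 > 0" "\<And>y k. \<bar>y - x\<bar> < \<delta>1 \<Longrightarrow> k \<in> I \<Longrightarrow> p k \<noteq> x \<Longrightarrow> (p k < y \<longleftrightarrow> p k < x)"
      using Jloc[of x] by blast
    show ?thesis
    proof (cases "x \<in> p ` I")
      case False
      obtain \<delta>2 where d2: "\<delta>2 > 0" "\<And>y. \<bar>y - x\<bar> < \<delta>2 \<Longrightarrow> (y \<in> W \<longleftrightarrow> x \<in> W)" using off[OF False] by blast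
      have hy: "h y = h x" if "\<bar>y - x\<bar> < min \<delta>1 \<delta>2" for y
      proof -
        have "J y = J x" unfolding J_def using d1(2)[of y] that False by (intro sum.cong) auto
        then show ?thesis using d2(2)[of y] that by (simp add: h_def indicator_def)
      qed
      have "min \<delta>1 \<delta>2 > 0" using d1(1) d2(1) by simp
      then show ?thesis using hy by blast
    next
      case True
      then obtain k where k: "k \<in> I" "x = p k" by blast
      obtain \<delta>2 where d2: "\<delta>2 > 0"
        "\<And>y. 0 < \<bar>y - p k\<bar> \<Longrightarrow> \<bar>y - p k\<bar> < \<delta>2 \<Longrightarrow> (y \<in> W \<longleftrightarrow> \<sigma> k * (y - p k) < 0)" using on[OF k(1)] by blast
      \<comment> \<open>The same value results on both sides of the jump: the change of the
        indicator at x is exactly the change -\<sigma> of the step function.\<close>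
      define v where "v = (if \<sigma> k = 1 then 1 else 0) - (\<Sum>j\<in>I - {k}. - \<sigma> j * (if p j < x then 1 else 0))"
      have hy: "h y = v" if y: "y \<noteq> x" "\<bar>y - x\<bar> < min \<delta>1 \<delta>2" for y
      proof -
        have "J y = - \<sigma> k * (if p k < y then 1 else 0) + (\<Sum>j\<in>I - {k}. - \<sigma> j * (if p j < y then 1 else 0))"
          unfolding J_def by (rule sum.remove[OF I k(1)])
        also have "(\<Sum>j\<in>I - {k}. - \<sigma> j * (if p j < y then 1 else 0)) = (\<Sum>j\<in>I - {k}. - \<sigma> j * (if p j < x then 1 else 0))"
        proof (rule sum.cong)
          fix j assume j: "j \<in> I - {k}"
          then have "p j \<noteq> x" using inj k by (auto simp: inj_on_def)
          then show "- \<sigma> j * (if p j < y then 1 else 0) = - \<sigma> j * (if p j < x then 1 else 0)"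
            using d1(2)[of y j] y j by auto
        qed simp
        finally have Jy: "J y = - \<sigma> k * (if x < y then 1 else 0) + ((if \<sigma> k = 1 then 1 else 0) - v)"
          using k by (simp add: v_def)
        have "y \<in> W \<longleftrightarrow> \<sigma> k * (y - x) < 0" using d2(2)[of y] y k by auto
        then show ?thesis using \<sigma>[OF k(1)] y(1) unfolding h_def Jy by (auto simp: indicator_def)
      qed
      have "min \<delta>1 \<delta>2 > 0" using d1(1) d2(1) by simp
      then show ?thesis using hy True by blast
    qed
  qed
  then obtain v \<delta> where v: "\<And>x. \<delta> x > 0" "\<And>x y. y \<noteq> x \<Longrightarrow> \<bar>y - x\<bar> < \<delta> x \<Longrightarrow> h y = v x"
    "\<And>x. x \<notin> p ` I \<Longrightarrow> h x = v x" by metis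
  have fin: "finite (p ` I)" using I by simp
  have "(v has_real_derivative 0) (at x)" for x
  proof -
    have "\<forall>\<^sub>F y in nhds x. y \<in> p ` I \<longrightarrow> y = x"
    proof -
      have "open (- (p ` I - {x}))" using fin by (intro open_Compl finite_imp_closed) auto
      then have "\<forall>\<^sub>F y in nhds x. y \<in> - (p ` I - {x})" by (intro eventually_nhds_in_open) auto
      then show ?thesis by (auto elim!: eventually_mono)
    qed
    moreover have "\<forall>\<^sub>F y in nhds x. \<bar>y - x\<bar> < \<delta> x"
      unfolding eventually_nhds_metric dist_real_def using v(1)[of x] by blast
    ultimately have "\<forall>\<^sub>F y in nhds x. v y = v x"
    proof eventually_elim
      case (elim y)
      then show "v y = v x" using v(2)[of y x] v(3)[of y] by (cases "y = x") auto
    qed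
    then show ?thesis by (subst DERIV_cong_ev[OF refl _ refl]) auto
  qed
  then have vc: "v x = v y" for x y by (rule DERIV_isconst_all[rule_format])
  have far: "h x = 0" if "\<bar>x\<bar> > B" "x < 0" for x
  proof -
    have "J x = 0" unfolding J_def using pB that by (intro sum.neutral) fastforce
    moreover have "x \<notin> W" using W that by auto
    ultimately show ?thesis by (simp add: h_def)
  qed
  have "v (- (B + 1)) = 0"
  proof -
    have "- (B + 1) \<notin> p ` I" using pB by fastforce
    then show ?thesis using v(3) far[of "- (B + 1)"] B by auto
  qed
  then have h0: "h x = 0" if "x \<notin> p ` I" for x using v(3)[OF that] vc by metis
  \<comment> \<open>Far to the right W is empty as well, so entries and exits balance. This removes
    the terms with g B at the end.\<close>
  have JB: "(\<Sum>k\<in>I. \<sigma> k) = 0"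
  proof -
    have "B + 1 \<notin> p ` I" using pB by fastforce
    then have "h (B + 1) = 0" by (rule h0)
    moreover have "B + 1 \<notin> W" using W by auto
    moreover have "J (B + 1) = - (\<Sum>k\<in>I. \<sigma> k)"
      unfolding J_def sum_negf[symmetric] using pB by (intro sum.cong) fastforce+
    ultimately show ?thesis by (simp add: h_def)
  qed
  have bi: "has_bochner_integral lborel (\<lambda>x. g' x * indicator {p k..B} x) (g B - g (p k))" if "k \<in> I" for k
    using g pB[OF that] by (intro has_bochner_integral_FTC_Icc_real) (auto simp: continuous_on_eq_continuous_at)
  have "(\<integral>x. indicator W x * g' x \<partial>lborel) = (\<integral>x. (\<Sum>k\<in>I. - \<sigma> k * (g' x * indicator {p k..B} x)) \<partial>lborel)"
  proof (rule integral_discrete_difference[of "insert B (p ` I)"])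
    show "countable (insert B (p ` I))" using fin countable_finite by blast
    fix x assume x: "x \<notin> insert B (p ` I)"
    show "indicator W x * g' x = (\<Sum>k\<in>I. - \<sigma> k * (g' x * indicator {p k..B} x))"
    proof (cases "x \<le> B")
      case True
      have "indicator W x = J x" using h0[of x] x by (simp add: h_def)
      moreover have "J x * g' x = (\<Sum>k\<in>I. - \<sigma> k * (g' x * indicator {p k..B} x))"
        unfolding J_def sum_distrib_right using x True by (intro sum.cong) (auto simp: indicator_def)
      ultimately show ?thesis by simp
    next
      case False
      then have "x \<notin> W" using W by auto
      then show ?thesis using False by (simp add: indicator_def)
    qed
  qed auto
  also have "\<dots> = (\<Sum>k\<in>I. - \<sigma> k * (g B - g (p k)))"
    using bi by (subst Bochner_Integration.integral_sum) (auto simp: has_bochner_integral_iff)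
  also have "\<dots> = (\<Sum>k\<in>I. \<sigma> k * g (p k)) - (\<Sum>k\<in>I. \<sigma> k) * g B"
  proof -
    have "(\<Sum>k\<in>I. - \<sigma> k * (g B - g (p k))) = (\<Sum>k\<in>I. \<sigma> k * g (p k) - \<sigma> k * g B)"
      by (intro sum.cong) (auto simp: algebra_simps)
    then show ?thesis by (simp add: sum_subtractf sum_distrib_right)
  qed
  finally show ?thesis using JB by simp
qed

section \<open>The divergence theorem on star-shaped polygons\<close>

lemma two_cases: "i \<noteq> j \<Longrightarrow> k = i \<or> k = (j::2)"
  using exhaust_2[of i] exhaust_2[of j] exhaust_2[of k] by auto

lemma perp_component: assumes "i \<noteq> (j::2)"
  obtains \<epsilon> :: real where "\<epsilon> = 1 \<or> \<epsilon> = -1" "\<And>a b. perp a b $ i = \<epsilon> * (b $ j - a $ j)"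
proof (cases "i = 1")
  case True
  then have "j = 2" using assms exhaust_2[of j] by auto
  then show ?thesis using that[of 1] True by simp
next
  case False
  then have "i = 2" "j = 1" using assms exhaust_2[of i] exhaust_2[of j] by auto
  then show ?thesis using that[of "-1"] by simp
qed

context star_polygon
begin

lemma open_edges_disjoint:
  assumes "k < length K" "l < length K" "x \<in> open_segment (vtx K k) (vtx K (Suc k))" "x \<in> seg K l"
  shows "k = l"
proof (rule ccontr)
  assume "k \<noteq> l"
  have "x \<in> seg K k" using assms by (simp add: seg_def open_segment_def)
  then have "x \<in> {vtx K k, vtx K (Suc k)}" using seg_Int[OF simple assms(1,2) \<open>k \<noteq> l\<close>] assms(4) by blast
  then show False using open_segment_endpoints[OF assms(3)] by blast
qed

text \<open>A line that avoids all vertices meets the boundary only in interior points of edges, and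
  crosses each such edge transversally. The local structure there shows on which side of the
  crossing the region lies, and the outward direction is the sign of the component i of the outer
  normal.\<close>

lemma slice_integral:
  assumes ij: "i \<noteq> (j::2)" and u: "smooth u" and t: "\<And>k. k < length K \<Longrightarrow> vtx K k $ j \<noteq> t"
  defines "P \<equiv> \<lambda>k. linepath (vtx K k) (vtx K (Suc k)) ((t - vtx K k $ j) / (vtx K (Suc k) $ j - vtx K k $ j))"
    and "L \<equiv> {k. k < length K \<and> (vtx K k $ j < t \<and> t < vtx K (Suc k) $ j \<or> vtx K (Suc k) $ j < t \<and> t < vtx K k $ j)}"
  shows "(\<integral>s. indicator (region K) (axis i s + axis j t) * pd i u (axis i s + axis j t) \<partial>lborel)
    = (\<Sum>k\<in>L. sgn (outer_normal K (vtx K k) (vtx K (Suc k)) $ i) * u (P k))"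
proof -
  let ?n = "length K"
  let ?R = "region K"
  have t': "vtx K (Suc k) $ j \<noteq> t" if "k < ?n" for k
  proof (cases "Suc k < ?n")
    case True then show ?thesis by (rule t)
  next
    case False
    then have "Suc k = ?n" using that by simp
    then show ?thesis using t[of 0] that vtx_length[of K] by (metis gr_implies_not0 neq0_conv)
  qed
  obtain \<epsilon> where \<epsilon>: "\<epsilon> = 1 \<or> \<epsilon> = -1" and pi: "\<And>a b. perp a b $ i = \<epsilon> * (b $ j - a $ j)"
    using perp_component[OF ij] by blast
  obtain B0 where B0: "B0 > 0" "\<And>x. x \<in> closure ?R \<Longrightarrow> norm x \<le> B0"
    using bounded_U bounded_closure bounded_pos by metis
  define B where "B = B0 + 1"
  define p where "p k = P k $ i" for k
  let ?q = "\<lambda>s. axis i s + axis j t :: point"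
  have qi: "?q s $ i = s" "?q s $ j = t" for s using ij by (auto simp: axis_def)
  have eqI: "x = y" if "x $ i = y $ i" "x $ j = y $ j" for x y :: point
  proof -
    have "x $ l = y $ l" for l using two_cases[OF ij, of l] that by auto
    then show ?thesis by (simp add: vec_eq_iff)
  qed
  have qB: "\<bar>s\<bar> \<le> B0" if "?q s \<in> closure ?R" for s
    using B0(2)[OF that] component_le_norm_cart[of "?q s" i] qi by simp
  have Lop: "P k \<in> open_segment (vtx K k) (vtx K (Suc k))" and Pq: "?q (p k) = P k" if k: "k \<in> L" for k
  proof -
    let ?a = "vtx K k" and ?b = "vtx K (Suc k)"
    let ?w = "(t - ?a $ j) / (?b $ j - ?a $ j)"
    have "?a $ j < t \<and> t < ?b $ j \<or> ?b $ j < t \<and> t < ?a $ j" using k by (simp add: L_def)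
    then have l: "0 < ?w" "?w < 1"
      by (auto simp: zero_less_divide_iff divide_less_eq_1)
    have nj: "?a $ j \<noteq> ?b $ j" using k by (auto simp: L_def)
    then have ab: "?a \<noteq> ?b" by metis
    show "P k \<in> open_segment ?a ?b"
      unfolding in_segment using ab l by (intro conjI exI[of _ "?w"]) (simp_all add: P_def linepath_def)
    have "linepath x y w $ j = x $ j + w * (y $ j - x $ j)" for x y :: point and w
      by (simp add: linepath_def algebra_simps)
    then have "P k $ j = ?a $ j + ?w * (?b $ j - ?a $ j)" unfolding P_def .
    then have "P k $ j = t" using nj by simp
    then show "?q (p k) = P k" by (intro eqI) (use qi in \<open>auto simp: p_def\<close>)
  qed
  have hit: "\<exists>k\<in>L. s = p k" if "?q s \<in> frontier ?R" for s
  proof -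
    obtain k where k: "k < ?n" "?q s \<in> seg K k"
      using \<open>?q s \<in> frontier ?R\<close> region_Jordan(4)[OF simple] by (auto simp: polygon_boundary_seg)
    let ?a = "vtx K k" and ?b = "vtx K (Suc k)"
    obtain w where w: "0 \<le> w" "w \<le> 1" "?q s = (1 - w) *\<^sub>R ?a + w *\<^sub>R ?b"
      using k(2) unfolding seg_def in_segment by blast
    have tj: "t = (1 - w) * ?a $ j + w * ?b $ j" using arg_cong[OF w(3), of "\<lambda>x. x $ j"] qi by simp
    then have tj': "t = ?a $ j + w * (?b $ j - ?a $ j)" by (simp add: algebra_simps)
    have "w \<noteq> 0" "w \<noteq> 1" using tj t[OF k(1)] t'[OF k(1)] by auto
    then have w': "0 < w" "w < 1" using w by auto
    have ne: "?b $ j \<noteq> ?a $ j" using tj' t[OF k(1)] by auto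
    have kL: "k \<in> L"
    proof (cases "?a $ j < ?b $ j")
      case True
      then have "0 < w * (?b $ j - ?a $ j)" "w * (?b $ j - ?a $ j) < 1 * (?b $ j - ?a $ j)"
        using w' by (auto intro!: mult_strict_right_mono)
      then show ?thesis using k tj' by (simp add: L_def)
    next
      case False
      then have "0 < w * (?a $ j - ?b $ j)" "w * (?a $ j - ?b $ j) < 1 * (?a $ j - ?b $ j)"
        using w' ne by (auto intro!: mult_strict_right_mono)
      moreover have "t = ?a $ j - w * (?a $ j - ?b $ j)" using tj' by (simp add: algebra_simps)
      ultimately show ?thesis using k by (simp add: L_def)
    qed
    have "w = (t - ?a $ j) / (?b $ j - ?a $ j)" using tj' ne by (simp add: field_simps)
    then have "P k = ?q s" using w(3) by (simp add: P_def linepath_def)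
    then show ?thesis using kL qi by (intro bexI[of _ k]) (auto simp: p_def)
  qed
  define \<sigma> where "\<sigma> k = sgn (outer_normal K (vtx K k) (vtx K (Suc k)) $ i)" for k
  have LK: "k < ?n" if "k \<in> L" for k using that by (simp add: L_def)
  have "(\<integral>s. indicator {s. ?q s \<in> ?R} s * pd i u (?q s) \<partial>lborel) = (\<Sum>k\<in>L. \<sigma> k * u (?q (p k)))"
  proof (rule jump_integral[where B = B and p = p and \<sigma> = \<sigma> and I = L and g = "\<lambda>s. u (?q s)"])
    show "finite L" by (simp add: L_def)
    show "inj_on p L"
    proof (rule inj_onI)
      fix k l assume kl: "k \<in> L" "l \<in> L" "p k = p l"
      then have "P k = P l" using Pq by metis
      then have "P k \<in> seg K l" using Lop[OF kl(2)] by (simp add: seg_def open_segment_def)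
      then show "k = l" using open_edges_disjoint[OF LK[OF kl(1)] LK[OF kl(2)] Lop[OF kl(1)]] by blast
    qed
    have sig: "\<sigma> k = - sgn (perp (vtx K k) (vtx K (Suc k)) \<bullet> (c - vtx K k)) * sgn (perp (vtx K k) (vtx K (Suc k)) $ i)"
      if "k \<in> L" for k
    proof -
      have "dist (vtx K k) (vtx K (Suc k)) > 0" using vtx_Suc_neq[OF simple LK[OF that]] by simp
      then show ?thesis
        unfolding \<sigma>_def outer_normal_eq[OF edgesI[OF LK[OF that]]]
        by (simp add: sgn_mult sgn_divide sgn_minus)
    qed
    have cl: "perp (vtx K k) (vtx K (Suc k)) \<bullet> (c - vtx K k) \<noteq> 0" if "k \<in> L" for k
      using centre_off_line[OF vtx_Suc_neq[OF simple LK[OF that]] seg_frontier[OF LK[OF that]]] .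
    have pn: "perp (vtx K k) (vtx K (Suc k)) $ i \<noteq> 0" if "k \<in> L" for k
      using that \<epsilon> by (auto simp: pi L_def)
    show "\<sigma> k = 1 \<or> \<sigma> k = -1" if "k \<in> L" for k
      using cl[OF that] pn[OF that] unfolding sig[OF that] by (auto simp: sgn_real_def)
    show "{s. ?q s \<in> ?R} \<subseteq> {-B..B}"
    proof
      fix s assume "s \<in> {s. ?q s \<in> ?R}"
      then have "\<bar>s\<bar> \<le> B0" using qB closure_subset by blast
      then show "s \<in> {-B..B}" by (auto simp: B_def)
    qed
    show "\<bar>p k\<bar> < B" if "k \<in> L" for k
    proof -
      have "P k \<in> closure ?R"
        using Lop[OF that] seg_frontier[OF LK[OF that]] frontier_closure by (auto simp: open_segment_def)
      then show ?thesis using qB[of "p k"] Pq[OF that] by (simp add: B_def)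
    qed
    show "0 < B" using B0 by (simp add: B_def)
    have cq: "continuous_on UNIV ?q" using axis_line_continuous by blast
    show "\<exists>\<delta>>0. \<forall>y. \<bar>y - x\<bar> < \<delta> \<longrightarrow> (y \<in> {s. ?q s \<in> ?R}) = (x \<in> {s. ?q s \<in> ?R})" if "x \<notin> p ` L" for x
    proof -
      have nf: "?q x \<notin> frontier ?R" using hit that by blast
      define W where "W = (if ?q x \<in> ?R then ?R else - closure ?R)"
      have oW: "open W" using open_U by (simp add: W_def open_Compl)
      have "?q x \<in> W" using nf open_U by (auto simp: W_def frontier_def interior_open)
      have "open (?q -` W)" using cq oW by (simp add: open_vimage)
      then have "x \<in> ?q -` W" "open (?q -` W)" using \<open>?q x \<in> W\<close> by auto
      then obtain \<delta> where \<delta>: "\<delta> > 0" "ball x \<delta> \<subseteq> ?q -` W" using openE by metis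
      have "(?q y \<in> ?R) = (?q x \<in> ?R)" if "\<bar>y - x\<bar> < \<delta>" for y
      proof -
        have "y \<in> ball x \<delta>" using that by (simp add: dist_real_def abs_minus_commute)
        then have "?q y \<in> W" using \<delta> by blast
        then show ?thesis using closure_subset[of ?R] unfolding W_def by (cases "?q x \<in> ?R") auto
      qed
      then show ?thesis using \<delta>(1) unfolding mem_Collect_eq by blast
    qed
    show "\<exists>\<delta>>0. \<forall>y. 0 < \<bar>y - p k\<bar> \<and> \<bar>y - p k\<bar> < \<delta> \<longrightarrow> (y \<in> {s. ?q s \<in> ?R}) = (\<sigma> k * (y - p k) < 0)"
      if k: "k \<in> L" for k
    proof -
      let ?a = "vtx K k" and ?b = "vtx K (Suc k)"
      let ?l = "perp ?a ?b \<bullet> (c - ?a)" and ?m = "perp ?a ?b $ i"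
      obtain \<delta> where \<delta>: "\<delta> > 0" "\<And>z. z \<in> ball (P k) \<delta> \<Longrightarrow> z \<in> ?R \<longleftrightarrow> (perp ?a ?b \<bullet> (z - ?a)) * ?l > 0"
        using local_structure[OF vtx_Suc_neq[OF simple LK[OF k]] seg_frontier[OF LK[OF k]] Lop[OF k]] by blast
      show ?thesis
      proof (intro exI[of _ \<delta>] conjI allI impI \<delta>(1))
        fix y assume y: "0 < \<bar>y - p k\<bar> \<and> \<bar>y - p k\<bar> < \<delta>"
        have qy: "?q y = P k + axis i (y - p k)"
          unfolding Pq[OF k, symmetric] by (auto simp: vec_eq_iff axis_def)
        have "norm (axis i (y - p k) :: point) = \<bar>y - p k\<bar>"
        proof -
          have "(axis i (y - p k) :: point) = (y - p k) *\<^sub>R axis i 1" by (simp add: vec_eq_iff axis_def)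
          then show ?thesis by simp
        qed
        then have "?q y \<in> ball (P k) \<delta>" using y unfolding qy by (simp add: dist_norm)
        then have "?q y \<in> ?R \<longleftrightarrow> (perp ?a ?b \<bullet> (?q y - ?a)) * ?l > 0" by (rule \<delta>(2))
        also have "perp ?a ?b \<bullet> (?q y - ?a) = perp ?a ?b \<bullet> (P k - ?a) + (y - p k) * ?m"
          unfolding qy by (simp add: inner_simps inner_axis algebra_simps)
        also have "perp ?a ?b \<bullet> (P k - ?a) = 0"
        proof -
          obtain w where "P k = (1 - w) *\<^sub>R ?a + w *\<^sub>R ?b" using Lop[OF k] unfolding in_segment by blast
          then have "P k - ?a = w *\<^sub>R (?b - ?a)" by (simp add: algebra_simps)
          then show ?thesis using perp_inner_self by simp
        qed
        also have "(0 + (y - p k) * ?m) * ?l > 0 \<longleftrightarrow> \<sigma> k * (y - p k) < 0"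
          using cl[OF k] pn[OF k] y unfolding sig[OF k]
          by (auto simp: sgn_real_def zero_less_mult_iff mult_less_0_iff)
        finally show "(y \<in> {s. ?q s \<in> ?R}) = (\<sigma> k * (y - p k) < 0)" by simp
      qed
    qed
    show "((\<lambda>s. u (?q s)) has_real_derivative pd i u (?q x)) (at x)" for x
      using u by (rule has_derivative_axis_line)
    show "continuous_on UNIV (\<lambda>s. pd i u (?q s))" using u by (intro smooth_axis_line_continuous smooth_pd)
  qed
  also have "(\<Sum>k\<in>L. \<sigma> k * u (?q (p k))) = (\<Sum>k\<in>L. \<sigma> k * u (P k))"
    by (intro sum.cong) (use Pq in auto)
  also have "(\<lambda>s. indicator {s. ?q s \<in> ?R} s * pd i u (?q s)) = (\<lambda>s. indicator ?R (?q s) * pd i u (?q s))"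
    by (auto simp: indicator_def)
  finally show ?thesis by (simp add: \<sigma>_def)
qed

text \<open>Slices in direction i are summed over the height in direction j; the heights of vertices
  form a finite set. Each edge is parametrised by height there, and the change to the parameter of
  \<open>linepath\<close> brings in the factor that completes the sign to the normal component times
  the length.\<close>

theorem divergence_theorem:
  assumes u: "smooth u"
  shows "(\<integral>x. pd i u x \<partial>lebesgue_on (region K))
    = (\<Sum>k<length K. edge_int (vtx K k) (vtx K (Suc k)) (\<lambda>x. u x * outer_normal K (vtx K k) (vtx K (Suc k)) $ i))"
proof -
  let ?R = "region K"
  obtain j where ij: "i \<noteq> (j::2)" using two_indices by blast
  obtain \<epsilon> :: real where \<epsilon>: "\<epsilon> = 1 \<or> \<epsilon> = -1" and pi: "\<And>a b. perp a b $ i = \<epsilon> * (b $ j - a $ j)"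
    using perp_component[OF ij] by blast
  let ?a = "\<lambda>k. vtx K k" and ?b = "\<lambda>k. vtx K (Suc k)"
  let ?\<nu> = "\<lambda>k. outer_normal K (vtx K k) (vtx K (Suc k)) $ i"
  define P where "P t k = linepath (?a k) (?b k) ((t - ?a k $ j) / (?b k $ j - ?a k $ j))" for t k
  define E where "E k = {t. ?a k $ j < t \<and> t < ?b k $ j \<or> ?b k $ j < t \<and> t < ?a k $ j}" for k
  have Ri: "integrable lborel (\<lambda>x. indicator ?R x * pd i u x)"
  proof -
    have "compact (closure ?R)" using bounded_U by (simp add: compact_closure)
    then have "integrable lborel (\<lambda>x. indicator (closure ?R) x *\<^sub>R pd i u x)"
      using u by (intro borel_integrable_compact smooth_continuous_on smooth_pd)
    then have "integrable lborel (\<lambda>x. indicator ?R x *\<^sub>R (indicator (closure ?R) x *\<^sub>R pd i u x))"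
      using open_U integrable_mult_indicator[of ?R lborel "\<lambda>x. indicator (closure ?R) x *\<^sub>R pd i u x"] by simp
    moreover have "(\<lambda>x. indicator ?R x *\<^sub>R (indicator (closure ?R) x *\<^sub>R pd i u x)) = (\<lambda>x. indicator ?R x * pd i u x)"
      using closure_subset[of ?R] by (auto simp: indicator_def fun_eq_iff)
    ultimately show ?thesis by simp
  qed
  have "(\<integral>x. pd i u x \<partial>lebesgue_on ?R) = (\<integral>x. indicator ?R x *\<^sub>R pd i u x \<partial>lebesgue)"
    by (subst integral_restrict_space) auto
  also have "\<dots> = (\<integral>x. indicator ?R x * pd i u x \<partial>lborel)"
    using Ri by (subst integral_completion) auto
  also have "\<dots> = (\<integral>t. (\<integral>s. indicator ?R (axis i s + axis j t) * pd i u (axis i s + axis j t) \<partial>lborel) \<partial>lborel)"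
    using integral_slice[OF ij Ri] by simp
  also have "\<dots> = (\<integral>t. (\<Sum>k<length K. indicator (E k) t * (sgn (?\<nu> k) * u (P t k))) \<partial>lborel)"
  proof (rule integral_discrete_difference[of "(\<lambda>k. ?a k $ j) ` {..<length K}"])
    fix t assume "t \<notin> (\<lambda>k. ?a k $ j) ` {..<length K}"
    then have "\<And>k. k < length K \<Longrightarrow> ?a k $ j \<noteq> t" by auto
    note slice_integral[OF ij u this]
    also have "(\<Sum>k | k < length K \<and> (?a k $ j < t \<and> t < ?b k $ j \<or> ?b k $ j < t \<and> t < ?a k $ j).
        sgn (?\<nu> k) * u (linepath (?a k) (?b k) ((t - ?a k $ j) / (?b k $ j - ?a k $ j))))
      = (\<Sum>k<length K. indicator (E k) t * (sgn (?\<nu> k) * u (P t k)))"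
      by (rule sum.mono_neutral_cong_left) (auto simp: E_def P_def)
    finally show "(\<integral>s. indicator ?R (axis i s + axis j t) * pd i u (axis i s + axis j t) \<partial>lborel) =
      (\<Sum>k<length K. indicator (E k) t * (sgn (?\<nu> k) * u (P t k)))" by simp
  qed (auto intro: countable_finite)
  also have "\<dots> = (\<Sum>k<length K. edge_int (?a k) (?b k) (\<lambda>x. u x * ?\<nu> k))"
  proof -
    have *: "has_bochner_integral lborel (\<lambda>t. indicator (E k) t * (sgn (?\<nu> k) * u (P t k)))
      (edge_int (?a k) (?b k) (\<lambda>x. u x * ?\<nu> k))" if k: "k < length K" for k
    proof -
      let ?d = "?b k $ j - ?a k $ j"
      let ?D = "dist (?a k) (?b k)"
      have ab: "?a k \<noteq> ?b k" using vtx_Suc_neq[OF simple k] .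
      have sl: "\<bar>sgn (perp (?a k) (?b k) \<bullet> (c - ?a k))\<bar> = 1"
        using centre_off_line[OF ab seg_frontier[OF k]] by (simp add: sgn_real_def)
      \<comment> \<open>The Jacobian of the change of parameter: the height difference of an edge is
        its length times the modulus of the normal component.\<close>
      have nu: "\<bar>?\<nu> k\<bar> * ?D = \<bar>?d\<bar>"
        unfolding outer_normal_eq[OF edgesI[OF k]] using ab sl \<epsilon> by (auto simp: pi abs_mult abs_divide)
      define h where "h \<tau> = u (linepath (?a k) (?b k) \<tau>)" for \<tau>
      have hc: "continuous_on UNIV h"
        unfolding h_def by (rule continuous_on_compose2[OF smooth_continuous_on[OF u, of UNIV]])
          (auto simp: linepath_def intro!: continuous_intros)
      have hi: "integrable lborel (\<lambda>\<tau>. indicator {0..1} \<tau> *\<^sub>R h \<tau>)"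
        by (intro borel_integrable_compact continuous_on_subset[OF hc]) auto
      have ei: "edge_int (?a k) (?b k) (\<lambda>x. u x * ?\<nu> k) = ?D * ?\<nu> k * (\<integral>\<tau>. indicator {0..1} \<tau> *\<^sub>R h \<tau> \<partial>lborel)"
      proof -
        have "edge_int (?a k) (?b k) (\<lambda>x. u x * ?\<nu> k) = ?D * (\<integral>\<tau>. (indicator {0..1} \<tau> *\<^sub>R h \<tau>) * ?\<nu> k \<partial>lebesgue)"
          unfolding edge_int_def set_lebesgue_integral_def h_def by (simp only: real_scaleR_def mult.assoc)
        also have "(\<integral>\<tau>. (indicator {0..1} \<tau> *\<^sub>R h \<tau>) * ?\<nu> k \<partial>lebesgue) = (\<integral>\<tau>. (indicator {0..1} \<tau> *\<^sub>R h \<tau>) * ?\<nu> k \<partial>lborel)"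
          using hi by (intro integral_completion) auto
        finally show ?thesis by simp
      qed
      show ?thesis
      \<comment> \<open>An edge parallel to the slices is met by no admissible slice, and its normal
        has no component in direction i.\<close>
      proof (cases "?d = 0")
        case True
        then have "E k = {}" by (auto simp: E_def)
        moreover have "?\<nu> k = 0" using nu True ab by simp
        ultimately show ?thesis using ei by (simp add: has_bochner_integral_iff)
      next
        case False
        have Pa: "P (?a k $ j + ?d * \<tau>) k = linepath (?a k) (?b k) \<tau>" for \<tau>
          using False by (simp add: P_def)
        have ind: "indicator (E k) (?a k $ j + ?d * \<tau>) = (indicator {0<..<1} \<tau> :: real)" for \<tau>
        proof -
          have "?a k $ j + ?d * \<tau> \<in> E k \<longleftrightarrow> 0 < \<tau> \<and> \<tau> < 1"
          proof -
            have mem: "?a k $ j + e \<in> E k \<longleftrightarrow> 0 < e \<and> e < ?d \<or> ?d < e \<and> e < 0" for e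
              by (auto simp: E_def)
            show ?thesis
          proof (cases "?d > 0")
            case True
            have "?d * \<tau> < ?d \<longleftrightarrow> \<tau> < 1" using mult_less_cancel_left_pos[OF True, of \<tau> 1] by simp
            moreover have "0 < ?d * \<tau> \<longleftrightarrow> 0 < \<tau>" using True by (simp add: zero_less_mult_iff)
            ultimately show ?thesis using True unfolding mem by auto
          next
            case f: False
            then have d: "?d < 0" using False by simp
            have "?d < ?d * \<tau> \<longleftrightarrow> \<tau> < 1" using mult_less_cancel_left_neg[OF d, of 1 \<tau>] by simp
            moreover have "?d * \<tau> < 0 \<longleftrightarrow> 0 < \<tau>" using d by (simp add: mult_less_0_iff)
            ultimately show ?thesis using d unfolding mem by auto
          qed
          qed
          then show ?thesis by (simp add: indicator_def)
        qed
        have "has_bochner_integral lborel (\<lambda>\<tau>. indicator {0<..<1} \<tau> * (sgn (?\<nu> k) * h \<tau>))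
          (sgn (?\<nu> k) * (\<integral>\<tau>. indicator {0..1} \<tau> *\<^sub>R h \<tau> \<partial>lborel))"
        proof (rule has_bochner_integral_discrete_difference[of "{0,1}", THEN iffD1])
          show "has_bochner_integral lborel (\<lambda>\<tau>. sgn (?\<nu> k) * (indicator {0..1} \<tau> *\<^sub>R h \<tau>))
            (sgn (?\<nu> k) * (\<integral>\<tau>. indicator {0..1} \<tau> *\<^sub>R h \<tau> \<partial>lborel))"
            using hi by (intro has_bochner_integral_mult_right) (auto simp: has_bochner_integral_iff)
        qed (auto simp: indicator_def)
        then have pulled: "has_bochner_integral lborel (\<lambda>\<tau>. indicator (E k) (?a k $ j + ?d * \<tau>) * (sgn (?\<nu> k) * u (P (?a k $ j + ?d * \<tau>) k)))
          (sgn (?\<nu> k) * (\<integral>\<tau>. indicator {0..1} \<tau> *\<^sub>R h \<tau> \<partial>lborel))"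
          by (simp add: ind Pa h_def)
        have "has_bochner_integral lborel (\<lambda>t. indicator (E k) t * (sgn (?\<nu> k) * u (P t k)))
          (\<bar>?d\<bar> *\<^sub>R (sgn (?\<nu> k) * (\<integral>\<tau>. indicator {0..1} \<tau> *\<^sub>R h \<tau> \<partial>lborel)))"
        proof (subst lborel_has_bochner_integral_real_affine_iff[OF False, of _ _ "?a k $ j"])
          have "(\<bar>?d\<bar> *\<^sub>R x) /\<^sub>R \<bar>?d\<bar> = x" for x :: real using False by simp
          then show "has_bochner_integral lborel (\<lambda>\<tau>. indicator (E k) (?a k $ j + ?d * \<tau>) * (sgn (?\<nu> k) * u (P (?a k $ j + ?d * \<tau>) k)))
            ((\<bar>?d\<bar> *\<^sub>R (sgn (?\<nu> k) * (\<integral>\<tau>. indicator {0..1} \<tau> *\<^sub>R h \<tau> \<partial>lborel))) /\<^sub>R \<bar>?d\<bar>)"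
            using pulled by metis
        qed
        moreover have "\<bar>?d\<bar> * sgn (?\<nu> k) = ?D * ?\<nu> k"
          unfolding nu[symmetric] by (simp add: abs_mult_sgn mult.assoc mult.left_commute)
        ultimately show ?thesis unfolding ei by (simp add: mult.assoc[symmetric])
      qed
    qed
    show ?thesis
      using * by (subst Bochner_Integration.integral_sum) (auto simp: has_bochner_integral_iff)
  qed
  finally show ?thesis .
qed

end

section \<open>Traces\<close>

abbreviation unit_lebesgue :: "real measure" where "unit_lebesgue \<equiv> lebesgue_on {0..1}"

lemma edge_int_lebesgue_on: "edge_int a b g = dist a b * (\<integral>t. g (linepath a b t) \<partial>unit_lebesgue)"
  by (simp add: edge_int_def LINT_lebesgue_on)

lemma finite_measure_unit: "finite_measure unit_lebesgue"
  by (rule finite_measure_lebesgue_on) auto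

lemma sq_int_unit: "sq_int {0..1} f \<longleftrightarrow> L2_on unit_lebesgue f" for f :: "real \<Rightarrow> real"
  by (simp add: sq_int_iff)

lemma linepath_continuous: "continuous_on UNIV (linepath a b)"
  by (auto simp: linepath_def intro!: continuous_intros)

lemma smooth_edge_L2: "smooth u \<Longrightarrow> L2_on unit_lebesgue (\<lambda>t. u (linepath a b t))"
  by (intro continuous_L2_on continuous_on_compose2[OF smooth_continuous_on linepath_continuous]) auto

lemma linepath_open_segment: "0 < t \<Longrightarrow> t < 1 \<Longrightarrow> a \<noteq> b \<Longrightarrow> linepath a b t \<in> open_segment a b"
  unfolding in_segment linepath_def by blast

text \<open>The end points are a null set; edge conditions are formulated on open segments
  only.\<close>

lemma AE_unit_open: "(\<And>t. 0 < t \<Longrightarrow> t < 1 \<Longrightarrow> P t) \<Longrightarrow> AE t in unit_lebesgue. P t"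
proof -
  assume P: "\<And>t. 0 < t \<Longrightarrow> t < 1 \<Longrightarrow> P t"
  have "AE t in lebesgue. t \<notin> {0, 1::real}"
    by (intro AE_not_in) (auto simp: negligible_iff_null_sets[symmetric])
  then have "AE t in lebesgue. t \<in> {0..1} \<longrightarrow> P t"
    by eventually_elim (use P in force)
  then show ?thesis by (subst AE_restrict_space_iff) auto
qed

lemma L2_on_bounded_mult:
  assumes "L2_on M g" "f \<in> borel_measurable M" "\<And>x. \<bar>f x\<bar> \<le> B"
  shows "L2_on M (\<lambda>x. f x * g x)"
  unfolding L2_on_def
proof
  note [measurable] = assms(2) L2_on_measurable[OF assms(1)]
  show m: "(\<lambda>x. f x * g x) \<in> borel_measurable M" by measurable
  show "integrable M (\<lambda>x. (f x * g x)^2)"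
  proof (rule Bochner_Integration.integrable_bound)
    show "integrable M (\<lambda>x. B^2 * (g x)^2)" using assms(1) by (simp add: L2_on_def)
    show "(\<lambda>x. (f x * g x)^2) \<in> borel_measurable M" by measurable
    have "(f x)^2 \<le> B^2" for x using power_mono[OF assms(3) abs_ge_zero, of x 2] by simp
    then show "AE x in M. norm ((f x * g x)^2) \<le> norm (B^2 * (g x)^2)"
      by (auto simp: power_mult_distrib intro!: mult_right_mono)
  qed
qed

lemma smooth_edge_mult_L2:
  assumes "smooth \<eta>" "L2_on unit_lebesgue g" shows "L2_on unit_lebesgue (\<lambda>t. \<eta> (linepath a b t) * g t)"
proof -
  have "continuous_on {0..1} (\<lambda>t. \<eta> (linepath a b t))"
    by (intro continuous_on_compose2[OF smooth_continuous_on[OF assms(1)] continuous_on_subset[OF linepath_continuous]]) auto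
  then have "bounded ((\<lambda>t. \<eta> (linepath a b t)) ` {0..1})"
    by (intro compact_imp_bounded compact_continuous_image) auto
  then obtain B where B': "\<forall>t\<in>{0..1}. \<bar>\<eta> (linepath a b t)\<bar> \<le> B"
    unfolding bounded_iff by auto
  then have B: "\<And>t. t \<in> {0..1} \<Longrightarrow> \<bar>\<eta> (linepath a b t)\<bar> \<le> B" by blast
  have B0: "0 \<le> B" using B[of 0] by (meson abs_ge_zero atLeastAtMost_iff order_refl order_trans zero_le_one)
  let ?f = "\<lambda>t. if t \<in> {0..1} then \<eta> (linepath a b t) else 0"
  have m: "(\<lambda>t. \<eta> (linepath a b t)) \<in> borel_measurable unit_lebesgue"
    using L2_on_measurable[OF smooth_edge_L2[OF assms(1)]] .
  have "?f \<in> borel_measurable unit_lebesgue"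
    by (rule measurable_cong[THEN iffD2, OF _ m]) (simp add: space_restrict_space)
  then have "L2_on unit_lebesgue (\<lambda>t. ?f t * g t)"
    using B B0 by (intro L2_on_bounded_mult[OF assms(2), where B = B]) auto
  moreover have "(\<lambda>t. \<eta> (linepath a b t) * g t) \<in> borel_measurable unit_lebesgue"
    by (intro borel_measurable_times m L2_on_measurable assms)
  ultimately show ?thesis
    by (rule L2_on_cong_AE) (intro AE_I2, simp add: space_restrict_space)
qed

context star_polygon
begin

abbreviation "\<mu> \<equiv> lebesgue_on (region K)"

lemma edge_dist_pos: "(a, b) \<in> edges K \<Longrightarrow> dist a b > 0"
  using edges_neq[OF simple] by simp

lemma smooth_mult_L2:
  assumes "smooth \<eta>" "L2_on \<mu> g" shows "L2_on \<mu> (\<lambda>x. \<eta> x * g x)"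
proof -
  have "compact (closure (region K))" using bounded_U by (simp add: compact_closure)
  then have "bounded (\<eta> ` closure (region K))"
    by (intro compact_imp_bounded compact_continuous_image smooth_continuous_on assms)
  then obtain B where "\<forall>x\<in>closure (region K). \<bar>\<eta> x\<bar> \<le> B" unfolding bounded_iff by auto
  then have B: "\<And>x. x \<in> closure (region K) \<Longrightarrow> \<bar>\<eta> x\<bar> \<le> B" by blast
  have B0: "0 \<le> B" using B[of c] centre closure_subset[of "region K"] by force
  let ?f = "\<lambda>x. if x \<in> region K then \<eta> x else 0"
  have m: "\<eta> \<in> borel_measurable \<mu>" using L2_on_measurable[OF smooth_L2[OF assms(1)]] .
  have "?f \<in> borel_measurable \<mu>"
    by (rule measurable_cong[THEN iffD2, OF _ m]) (simp add: space_restrict_space)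
  then have "L2_on \<mu> (\<lambda>x. ?f x * g x)"
    using B B0 closure_subset[of "region K"] by (intro L2_on_bounded_mult[OF assms(2), where B = B]) auto
  moreover have "(\<lambda>x. \<eta> x * g x) \<in> borel_measurable \<mu>"
    by (intro borel_measurable_times m L2_on_measurable assms)
  ultimately show ?thesis
    by (rule L2_on_cong_AE) (intro AE_I2, simp add: space_restrict_space)
qed

definition trace_seq :: "(point \<Rightarrow> real) \<Rightarrow> (point \<Rightarrow> real) \<Rightarrow> (nat \<Rightarrow> point \<Rightarrow> real) \<Rightarrow> bool" where
  "trace_seq u g s \<longleftrightarrow> (\<forall>n. smooth (s n)) \<and> L2_tendsto \<mu> s u \<and>
     (\<forall>i. L2_tendsto \<mu> (\<lambda>n. pd i (s n)) (wd (region K) i u)) \<and>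
     (\<forall>(a, b)\<in>edges K. L2_tendsto unit_lebesgue (\<lambda>n t. s n (linepath a b t)) (\<lambda>t. g (linepath a b t)))"

lemma has_trace_iff:
  "has_trace K u g \<longleftrightarrow> u \<in> H1 (region K) \<and>
    (\<forall>(a, b)\<in>edges K. L2_on unit_lebesgue (\<lambda>t. g (linepath a b t))) \<and> (\<exists>s. trace_seq u g s)"
proof -
  have "((\<lambda>n. edge_int a b (\<lambda>x. (s n x - g x)^2)) \<longlonglongrightarrow> 0) \<longleftrightarrow>
      L2_tendsto unit_lebesgue (\<lambda>n t. s n (linepath a b t)) (\<lambda>t. g (linepath a b t))"
    if "(a, b) \<in> edges K" for a b s
    unfolding edge_int_lebesgue_on L2_tendsto_def
    using tendsto_mult_left_iff[of "dist a b" "\<lambda>n. \<integral>t. (s n (linepath a b t) - g (linepath a b t))^2 \<partial>unit_lebesgue" 0 sequentially]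
      edge_dist_pos[OF that] by simp
  then have e: "(\<forall>(a, b)\<in>edges K. (\<lambda>n. edge_int a b (\<lambda>x. (s n x - g x)^2)) \<longlonglongrightarrow> 0) \<longleftrightarrow>
      (\<forall>(a, b)\<in>edges K. L2_tendsto unit_lebesgue (\<lambda>n t. s n (linepath a b t)) (\<lambda>t. g (linepath a b t)))" for s
    by fast
  show ?thesis
    unfolding has_trace_def trace_seq_def e sq_int_unit LINT_U L2_tendsto_def[of \<mu>] by blast
qed

lemma has_trace_H1: "has_trace K u g \<Longrightarrow> u \<in> H1 (region K)"
  by (simp add: has_trace_iff)

lemma has_trace_edge_L2: "has_trace K u g \<Longrightarrow> (a, b) \<in> edges K \<Longrightarrow> L2_on unit_lebesgue (\<lambda>t. g (linepath a b t))"
  unfolding has_trace_iff by fast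

lemma has_trace_lincomb:
  assumes u: "has_trace K u g" and v: "has_trace K v h"
  shows "has_trace K (\<lambda>x. a * u x + v x) (\<lambda>x. a * g x + h x)"
proof -
  obtain s t where s: "trace_seq u g s" and t: "trace_seq v h t" using u v by (auto simp: has_trace_iff)
  note H = has_trace_H1[OF u] has_trace_H1[OF v]
  have sm: "smooth (s n)" "smooth (t n)" for n using s t by (auto simp: trace_seq_def)
  have "trace_seq (\<lambda>x. a * u x + v x) (\<lambda>x. a * g x + h x) (\<lambda>n x. a * s n x + t n x)"
    unfolding trace_seq_def
  proof (intro conjI allI ballI)
    show "smooth (\<lambda>x. a * s n x + t n x)" for n using sm by (intro smooth_lincomb)
    show "L2_tendsto \<mu> (\<lambda>n x. a * s n x + t n x) (\<lambda>x. a * u x + v x)"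
      using s t sm H by (intro L2_tendsto_lincomb smooth_L2[OF sm(1)] smooth_L2[OF sm(2)] H1_L2) (auto simp: trace_seq_def)
    show "L2_tendsto \<mu> (\<lambda>n. pd i (\<lambda>x. a * s n x + t n x)) (wd (region K) i (\<lambda>x. a * u x + v x))" for i
    proof (rule L2_tendsto_cong_AE)
      have "pd i (\<lambda>x. a * s n x + t n x) = (\<lambda>x. a * pd i (s n) x + pd i (t n) x)" for n
        using sm by (simp add: pd_lincomb fun_eq_iff)
      moreover have "L2_tendsto \<mu> (\<lambda>n x. a * pd i (s n) x + pd i (t n) x) (\<lambda>x. a * wd (region K) i u x + wd (region K) i v x)"
        using s t sm H by (intro L2_tendsto_lincomb smooth_L2[OF smooth_pd[OF sm(1)]] smooth_L2[OF smooth_pd[OF sm(2)]] wd_L2) (auto simp: trace_seq_def)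
      ultimately show "L2_tendsto \<mu> (\<lambda>n. pd i (\<lambda>x. a * s n x + t n x)) (\<lambda>x. a * wd (region K) i u x + wd (region K) i v x)"
        by simp
      show "AE x in \<mu>. a * wd (region K) i u x + wd (region K) i v x = wd (region K) i (\<lambda>x. a * u x + v x) x"
        using wd_lincomb[OF H, of i a] by eventually_elim simp
      show "pd i (\<lambda>x. a * s n x + t n x) \<in> borel_measurable \<mu>" for n
        using sm by (intro L2_on_measurable smooth_L2 smooth_pd smooth_lincomb)
      show "(\<lambda>x. a * wd (region K) i u x + wd (region K) i v x) \<in> borel_measurable \<mu>"
        using H by (intro L2_on_measurable L2_on_lincomb wd_L2)
      show "wd (region K) i (\<lambda>x. a * u x + v x) \<in> borel_measurable \<mu>"
        using H by (intro L2_on_measurable wd_L2 H1_lincomb)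
    qed
    fix e assume e: "e \<in> edges K"
    obtain p q where pq: "e = (p, q)" by force
    have "L2_tendsto unit_lebesgue (\<lambda>n \<tau>. a * s n (linepath p q \<tau>) + t n (linepath p q \<tau>))
      (\<lambda>\<tau>. a * g (linepath p q \<tau>) + h (linepath p q \<tau>))"
      using s t sm e pq has_trace_edge_L2[OF u] has_trace_edge_L2[OF v]
      by (intro L2_tendsto_lincomb smooth_edge_L2[OF sm(1)] smooth_edge_L2[OF sm(2)]) (auto simp: trace_seq_def)
    then show "case e of (p, q) \<Rightarrow> L2_tendsto unit_lebesgue (\<lambda>n \<tau>. a * s n (linepath p q \<tau>) + t n (linepath p q \<tau>))
      (\<lambda>\<tau>. a * g (linepath p q \<tau>) + h (linepath p q \<tau>))" using pq by simp
  qed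
  then show ?thesis unfolding has_trace_iff
    using H1_lincomb[OF H] has_trace_edge_L2[OF u] has_trace_edge_L2[OF v] L2_on_lincomb by blast
qed

lemma has_trace_smooth: assumes u: "smooth u" shows "has_trace K u u"
proof -
  have "trace_seq u u (\<lambda>n. u)"
    unfolding trace_seq_def
  proof (intro conjI allI)
    show "L2_tendsto \<mu> (\<lambda>n. pd i u) (wd (region K) i u)" for i
    proof (rule L2_tendsto_cong_AE[OF L2_tendsto_const])
      show "AE x in \<mu>. pd i u x = wd (region K) i u x" using smooth_wd[OF u, of i] by eventually_elim simp
    qed (use u in \<open>auto intro!: L2_on_measurable smooth_L2 smooth_pd wd_L2 smooth_H1\<close>)
  qed (use u in \<open>auto simp: L2_tendsto_const\<close>)
  then show ?thesis using u by (auto simp: has_trace_iff intro: smooth_H1 smooth_edge_L2)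
qed

text \<open>The same approximating sequence serves, because the weak derivatives of almost
  everywhere equal functions coincide and the trace enters only through integrals over
  edges.\<close>

lemma has_trace_cong_AE:
  assumes u: "has_trace K u g" and v: "L2_on \<mu> v" "AE x in \<mu>. u x = v x"
    and h: "\<And>a b. (a, b) \<in> edges K \<Longrightarrow> (\<lambda>t. h (linepath a b t)) \<in> borel_measurable unit_lebesgue"
      "\<And>a b. (a, b) \<in> edges K \<Longrightarrow> AE t in unit_lebesgue. g (linepath a b t) = h (linepath a b t)"
  shows "has_trace K v h"
proof -
  obtain s where s: "trace_seq u g s" using u by (auto simp: has_trace_iff)
  then have sm: "smooth (s n)" for n by (simp add: trace_seq_def)
  have uL: "L2_on \<mu> u" using has_trace_H1[OF u] by (rule H1_L2)
  have "trace_seq v h s"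
    unfolding trace_seq_def
  proof (intro conjI allI ballI)
    show "L2_tendsto \<mu> s v"
      using s v uL by (intro L2_tendsto_cong_AE[OF _ v(2)] L2_on_measurable smooth_L2[OF sm]) (auto simp: trace_seq_def)
    have "wd (region K) i u = wd (region K) i v" for i by (rule wd_cong_AE[OF uL v])
    then show "L2_tendsto \<mu> (\<lambda>n. pd i (s n)) (wd (region K) i v)" for i
      using s unfolding trace_seq_def by metis
    fix e assume e: "e \<in> edges K"
    obtain p q where pq: "e = (p, q)" by force
    have "L2_tendsto unit_lebesgue (\<lambda>n \<tau>. s n (linepath p q \<tau>)) (\<lambda>\<tau>. h (linepath p q \<tau>))"
    proof (rule L2_tendsto_cong_AE)
      show "L2_tendsto unit_lebesgue (\<lambda>n \<tau>. s n (linepath p q \<tau>)) (\<lambda>\<tau>. g (linepath p q \<tau>))"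
        using s e pq by (auto simp: trace_seq_def)
      show "AE t in unit_lebesgue. g (linepath p q t) = h (linepath p q t)" using h(2) e pq by blast
      show "(\<lambda>\<tau>. s n (linepath p q \<tau>)) \<in> borel_measurable unit_lebesgue" for n
        by (intro L2_on_measurable smooth_edge_L2[OF sm])
      show "(\<lambda>\<tau>. g (linepath p q \<tau>)) \<in> borel_measurable unit_lebesgue"
        using has_trace_edge_L2[OF u] e pq by (intro L2_on_measurable) auto
      show "(\<lambda>\<tau>. h (linepath p q \<tau>)) \<in> borel_measurable unit_lebesgue" using h(1) e pq by blast
    qed
    then show "case e of (p, q) \<Rightarrow> L2_tendsto unit_lebesgue (\<lambda>n \<tau>. s n (linepath p q \<tau>)) (\<lambda>\<tau>. h (linepath p q \<tau>))"
      using pq by simp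
  qed (rule sm)
  moreover have "L2_on unit_lebesgue (\<lambda>t. h (linepath p q t))" if "(p, q) \<in> edges K" for p q
    using L2_on_cong_AE[OF has_trace_edge_L2[OF u that] h(1)[OF that] h(2)[OF that]] .
  moreover have "v \<in> H1 (region K)" using H1_cong_AE[OF has_trace_H1[OF u] v] .
  ultimately show ?thesis unfolding has_trace_iff by auto
qed

section \<open>Green's formula for functions with a trace\<close>

text \<open>The divergence theorem holds for the smooth approximants multiplied by \<eta>; each of
  the three integrals is continuous under the convergences built into the notion of trace.\<close>

lemma green_trace:
  assumes u: "has_trace K u g" and \<eta>: "smooth \<eta>"
  shows "(\<integral>x. wd (region K) i u x * \<eta> x \<partial>\<mu>) + (\<integral>x. u x * pd i \<eta> x \<partial>\<mu>)
    = (\<Sum>k<length K. edge_int (vtx K k) (vtx K (Suc k)) (\<lambda>x. g x * \<eta> x * outer_normal K (vtx K k) (vtx K (Suc k)) $ i))"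
proof -
  obtain s where s: "trace_seq u g s" using u by (auto simp: has_trace_iff)
  then have sm: "smooth (s n)" for n by (simp add: trace_seq_def)
  note H = has_trace_H1[OF u]
  let ?a = "\<lambda>k. vtx K k" and ?b = "\<lambda>k. vtx K (Suc k)"
  let ?\<nu> = "\<lambda>k. outer_normal K (vtx K k) (vtx K (Suc k)) $ i"
  let ?r = "\<lambda>w. \<Sum>k<length K. edge_int (?a k) (?b k) (\<lambda>x. w x * \<eta> x * ?\<nu> k)"
  have eq: "(\<integral>x. pd i (s n) x * \<eta> x \<partial>\<mu>) + (\<integral>x. s n x * pd i \<eta> x \<partial>\<mu>) = ?r (s n)" for n
  proof -
    have "?r (s n) = (\<integral>x. pd i (\<lambda>x. s n x * \<eta> x) x \<partial>\<mu>)"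
      using divergence_theorem[OF smooth_mult[OF sm \<eta>], of i n] by simp
    also have "\<dots> = (\<integral>x. pd i (s n) x * \<eta> x + s n x * pd i \<eta> x \<partial>\<mu>)"
      using sm \<eta> by (simp add: pd_mult_smooth)
    also have "\<dots> = (\<integral>x. pd i (s n) x * \<eta> x \<partial>\<mu>) + (\<integral>x. s n x * pd i \<eta> x \<partial>\<mu>)"
      using sm \<eta> by (intro Bochner_Integration.integral_add L2_on_integrable_mult smooth_L2 smooth_pd)
    finally show ?thesis by simp
  qed
  have "(\<lambda>n. (\<integral>x. pd i (s n) x * \<eta> x \<partial>\<mu>) + (\<integral>x. s n x * pd i \<eta> x \<partial>\<mu>))
    \<longlonglongrightarrow> (\<integral>x. wd (region K) i u x * \<eta> x \<partial>\<mu>) + (\<integral>x. u x * pd i \<eta> x \<partial>\<mu>)"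
    using s sm \<eta> H by (intro tendsto_add L2_tendsto_integral_mult smooth_L2[OF sm] smooth_L2[OF smooth_pd[OF sm]] smooth_L2[OF \<eta>] smooth_L2[OF smooth_pd[OF \<eta>]] wd_L2 H1_L2)
      (auto simp: trace_seq_def)
  moreover have "(\<lambda>n. ?r (s n)) \<longlonglongrightarrow> ?r g"
  proof (intro tendsto_sum)
    fix k assume "k \<in> {..<length K}"
    then have e: "(?a k, ?b k) \<in> edges K" by (simp add: edgesI)
    have ee: "edge_int (?a k) (?b k) (\<lambda>x. w x * \<eta> x * ?\<nu> k)
      = dist (?a k) (?b k) * (?\<nu> k * (\<integral>t. w (linepath (?a k) (?b k) t) * \<eta> (linepath (?a k) (?b k) t) \<partial>unit_lebesgue))" for w
      by (simp add: edge_int_lebesgue_on)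
    show "(\<lambda>n. edge_int (?a k) (?b k) (\<lambda>x. s n x * \<eta> x * ?\<nu> k)) \<longlonglongrightarrow> edge_int (?a k) (?b k) (\<lambda>x. g x * \<eta> x * ?\<nu> k)"
      unfolding ee using s sm \<eta> e has_trace_edge_L2[OF u e]
      by (intro tendsto_mult tendsto_const L2_tendsto_integral_mult smooth_edge_L2[OF sm] smooth_edge_L2[OF \<eta>]) (auto simp: trace_seq_def)
  qed
  ultimately show ?thesis unfolding eq by (rule LIMSEQ_unique)
qed

lemma green_zero_trace:
  assumes u: "has_trace K u (\<lambda>x. 0)" and \<eta>: "smooth \<eta>"
  shows "(\<integral>x. wd (region K) i u x * \<eta> x \<partial>\<mu>) = - (\<integral>x. u x * pd i \<eta> x \<partial>\<mu>)"
  using green_trace[OF u \<eta>, of i] by (simp add: edge_int_def set_lebesgue_integral_def)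

text \<open>Green's formula for zero trace is tested with smooth functions approximating the
  derivative of u itself; the trace hypothesis on that derivative supplies them together with
  convergence of their gradients.\<close>

lemma gradient_norm_zero_trace:
  assumes u: "has_trace K u (\<lambda>x. 0)" and v: "has_trace K (wd (region K) i u) \<gamma>"
  shows "(\<integral>x. (wd (region K) i u x)^2 \<partial>\<mu>) = - (\<integral>x. u x * wd (region K) i (wd (region K) i u) x \<partial>\<mu>)"
proof -
  obtain s where s: "trace_seq (wd (region K) i u) \<gamma> s" using v by (auto simp: has_trace_iff)
  then have sm: "smooth (s n)" for n by (simp add: trace_seq_def)
  note H = has_trace_H1[OF u] has_trace_H1[OF v]
  have "(\<lambda>n. \<integral>x. s n x * wd (region K) i u x \<partial>\<mu>) \<longlonglongrightarrow> (\<integral>x. wd (region K) i u x * wd (region K) i u x \<partial>\<mu>)"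
    using s sm H by (intro L2_tendsto_integral_mult smooth_L2[OF sm] wd_L2) (auto simp: trace_seq_def)
  moreover have "(\<lambda>n. - (\<integral>x. pd i (s n) x * u x \<partial>\<mu>)) \<longlonglongrightarrow> - (\<integral>x. wd (region K) i (wd (region K) i u) x * u x \<partial>\<mu>)"
    using s sm H by (intro tendsto_minus L2_tendsto_integral_mult smooth_L2[OF smooth_pd[OF sm]] wd_L2 H1_L2) (auto simp: trace_seq_def)
  moreover have "(\<integral>x. s n x * wd (region K) i u x \<partial>\<mu>) = - (\<integral>x. pd i (s n) x * u x \<partial>\<mu>)" for n
    using green_zero_trace[OF u sm, of i n] by (simp add: mult.commute)
  ultimately have "(\<integral>x. wd (region K) i u x * wd (region K) i u x \<partial>\<mu>) = - (\<integral>x. wd (region K) i (wd (region K) i u) x * u x \<partial>\<mu>)"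
    using LIMSEQ_unique by simp
  then show ?thesis by (simp add: power2_eq_square mult.commute)
qed

lemma wd_AE_zero:
  assumes "L2_on \<mu> u" "AE x in \<mu>. u x = 0" shows "AE x in \<mu>. wd (region K) i u x = 0"
proof -
  have "wd (region K) i u = wd (region K) i (\<lambda>x. 0)"
    using assms by (intro wd_cong_AE L2_on_zero)
  then show ?thesis using smooth_wd[OF smooth_const, of i 0] by (simp add: pd_const)
qed

text \<open>Summing over the directions, the squared norm of the gradient is minus the integral of u
  times its Laplacian, hence 0. The first derivatives vanish almost everywhere and so do the second
  ones.\<close>

lemma harmonic_zero_trace:
  assumes u: "u \<in> H2 (region K)" "has_trace K u (\<lambda>x. 0)"
    and v: "\<And>i. has_trace K (wd (region K) i u) (\<gamma> i)"
    and l: "AE x in \<mu>. (\<Sum>i\<in>UNIV. wd (region K) i (wd (region K) i u) x) = 0"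
  shows "AE x in \<mu>. wd (region K) j (wd (region K) i u) x = 0"
proof -
  let ?w = "\<lambda>i. wd (region K) i u" and ?ww = "\<lambda>i. wd (region K) i (wd (region K) i u)"
  have uL: "L2_on \<mu> u" using u H2_H1 H1_L2 by blast
  have wL: "L2_on \<mu> (?w i)" "L2_on \<mu> (?ww i)" for i
    using u by (auto intro: wd_L2 H2_H1)
  have "(\<Sum>i\<in>UNIV. \<integral>x. (?w i x)^2 \<partial>\<mu>) = - (\<Sum>i\<in>UNIV. \<integral>x. u x * ?ww i x \<partial>\<mu>)"
    by (simp add: gradient_norm_zero_trace[OF u(2) v] sum_negf)
  also have "(\<Sum>i\<in>UNIV. \<integral>x. u x * ?ww i x \<partial>\<mu>) = (\<integral>x. (\<Sum>i\<in>UNIV. u x * ?ww i x) \<partial>\<mu>)"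
    using uL wL by (intro Bochner_Integration.integral_sum[symmetric] L2_on_integrable_mult)
  also have "\<dots> = (\<integral>x. 0 \<partial>\<mu>)"
  proof (rule integral_cong_AE)
    show "AE x in \<mu>. (\<Sum>i\<in>UNIV. u x * ?ww i x) = 0" using l by eventually_elim (simp add: sum_distrib_left[symmetric])
    show "(\<lambda>x. \<Sum>i\<in>UNIV. u x * ?ww i x) \<in> borel_measurable \<mu>"
      using uL wL by (intro borel_measurable_sum borel_measurable_times L2_on_measurable)
  qed simp
  finally have "(\<Sum>i\<in>UNIV. \<integral>x. (?w i x)^2 \<partial>\<mu>) = 0" by simp
  then have "(\<integral>x. (?w i x)^2 \<partial>\<mu>) = 0" by (subst (asm) sum_nonneg_eq_0_iff) auto
  then show ?thesis using wd_AE_zero[OF wL(1) L2_on_zero_AE[OF wL(1)]] by blast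
qed

text \<open>The cut-offs are supported in the cone with apex \<open>c\<close> over one edge, which meets the boundary
  in that edge only; in the limit they isolate the edge in Green's formula.\<close>

definition cone_cutoff :: "point \<Rightarrow> point \<Rightarrow> nat \<Rightarrow> point \<Rightarrow> real" where
  "cone_cutoff a b m x = ramp (real m * ((perp c b \<bullet> (x - c)) * (perp c b \<bullet> (a - c))))
     * ramp (real m * ((perp c a \<bullet> (x - c)) * (perp c a \<bullet> (b - c))))"

lemma smooth_cone_cutoff: "smooth (cone_cutoff a b m)"
proof -
  have "cone_cutoff a b m = (\<lambda>x. ramp (((m * (perp c b \<bullet> (a - c))) *\<^sub>R perp c b) \<bullet> x + - (m * (perp c b \<bullet> (a - c))) * (perp c b \<bullet> c))
     * ramp (((m * (perp c a \<bullet> (b - c))) *\<^sub>R perp c a) \<bullet> x + - (m * (perp c a \<bullet> (b - c))) * (perp c a \<bullet> c)))"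
    by (auto simp: cone_cutoff_def inner_simps algebra_simps)
  then show ?thesis by (simp only:) (intro smooth_mult smooth_ramp)
qed

text \<open>Cramer's rule for x - c in the basis a - c, b - c, with the products of
  \<open>perp\<close> as determinants.\<close>

lemma cone_coordinates:
  assumes D: "perp c b \<bullet> (a - c) \<noteq> 0"
  shows "x - c = ((perp c b \<bullet> (x - c)) / (perp c b \<bullet> (a - c))) *\<^sub>R (a - c)
    + ((perp c a \<bullet> (x - c)) / (perp c a \<bullet> (b - c))) *\<^sub>R (b - c)"
proof -
  let ?D = "perp c b \<bullet> (a - c)"
  have s: "perp c a \<bullet> (b - c) = - ?D" by (simp add: inner_2 algebra_simps)
  have "?D *\<^sub>R (x - c) = (perp c b \<bullet> (x - c)) *\<^sub>R (a - c) - (perp c a \<bullet> (x - c)) *\<^sub>R (b - c)"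
    by (simp add: vec_eq_iff forall_2 inner_2 algebra_simps)
  moreover have "y = (A / D) *\<^sub>R v + (B / (- D)) *\<^sub>R w" if "D \<noteq> 0" "D *\<^sub>R y = A *\<^sub>R v - B *\<^sub>R w"
    for A B D :: real and y v w :: point
  proof -
    have "y = (1 / D) *\<^sub>R (D *\<^sub>R y)" using that(1) by simp
    then show ?thesis unfolding that(2) by (simp add: scaleR_diff_right)
  qed
  ultimately show ?thesis unfolding s using D by blast
qed

text \<open>Where the cut-off is non-zero both cone coordinates are positive, so the ray from c
  through x crosses the open edge k. Since x is on the boundary too, uniqueness on rays makes x that
  crossing point, but an open edge meets no other edge.\<close>

lemma cone_cutoff_other_edge:
  assumes k: "k < length K" "l < length K" "k \<noteq> l" and x: "x \<in> seg K l"
  shows "cone_cutoff (vtx K k) (vtx K (Suc k)) m x = 0"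
proof (rule ccontr)
  let ?a = "vtx K k" and ?b = "vtx K (Suc k)"
  let ?D = "perp c ?b \<bullet> (?a - c)"
  assume nz: "cone_cutoff ?a ?b m x \<noteq> 0"
  have D: "?D \<noteq> 0"
  proof -
    have "?D = - (perp ?a ?b \<bullet> (c - ?a))" by (simp add: inner_2 algebra_simps)
    then show ?thesis using centre_off_line[OF vtx_Suc_neq[OF simple k(1)] seg_frontier[OF k(1)]] by simp
  qed
  have s: "perp c ?a \<bullet> (?b - c) = - ?D" by (simp add: inner_2 algebra_simps)
  have pos: "(perp c ?b \<bullet> (x - c)) * ?D > 0" "(perp c ?a \<bullet> (x - c)) * (perp c ?a \<bullet> (?b - c)) > 0"
  proof -
    have "ramp (real m * z) = 0" if "\<not> z > 0" for z
      using that by (intro ramp_nonpos) (simp add: mult_nonneg_nonpos)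
    then show "(perp c ?b \<bullet> (x - c)) * ?D > 0" "(perp c ?a \<bullet> (x - c)) * (perp c ?a \<bullet> (?b - c)) > 0"
      using nz by (auto simp: cone_cutoff_def)
  qed
  define p where "p = (perp c ?b \<bullet> (x - c)) / ?D"
  define q where "q = (perp c ?a \<bullet> (x - c)) / (perp c ?a \<bullet> (?b - c))"
  have pq: "p > 0" "q > 0" using pos by (auto simp: p_def q_def zero_less_divide_iff zero_less_mult_iff)
  have xc: "x - c = p *\<^sub>R (?a - c) + q *\<^sub>R (?b - c)" unfolding p_def q_def by (rule cone_coordinates[OF D])
  define w where "w = q / (p + q)"
  have w: "0 < w" "w < 1" using pq by (auto simp: w_def field_simps)
  define y where "y = (1 - w) *\<^sub>R ?a + w *\<^sub>R ?b"
  have yo: "y \<in> open_segment ?a ?b"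
    unfolding in_segment y_def using w vtx_Suc_neq[OF simple k(1)] by blast
  have p1: "(p + q) * (1 - w) = p" "(p + q) * w = q" using pq by (auto simp: w_def field_simps)
  have "(p + q) *\<^sub>R (y - c) = ((p + q) * (1 - w)) *\<^sub>R (?a - c) + ((p + q) * w) *\<^sub>R (?b - c)"
    by (simp add: y_def algebra_simps)
  then have xy: "x = c + (p + q) *\<^sub>R (y - c)" using xc unfolding p1 by (simp add: algebra_simps)
  have yf: "y \<in> frontier (region K)" using yo seg_frontier[OF k(1)] by (auto simp: open_segment_def)
  have xf: "x \<in> frontier (region K)" using x seg_frontier[OF k(2)] by (auto simp: seg_def)
  have "p + q = 1" using ray_unique[OF yf] xf pq unfolding xy by simp
  then have "y \<in> seg K l" using xy x by simp
  then show False using open_edges_disjoint[OF k(1,2) yo] k(3) by blast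
qed

text \<open>Green's formula with the cut-offs has vanishing area integrals and a single surviving
  edge term. On that open edge the cut-offs tend to 1, so dominated convergence gives the mean. It
  follows that the mean over an edge does not depend on the trace chosen.\<close>

lemma zero_trace_mean:
  assumes u: "has_trace K u g" "AE x in \<mu>. u x = 0" and k: "k < length K"
  shows "(\<integral>t. g (linepath (vtx K k) (vtx K (Suc k)) t) \<partial>unit_lebesgue) = 0"
proof -
  let ?a = "vtx K k" and ?b = "vtx K (Suc k)"
  have uL: "L2_on \<mu> u" using has_trace_H1[OF u(1)] by (rule H1_L2)
  have e: "(?a, ?b) \<in> edges K" using k by (rule edgesI)
  have ab: "?a \<noteq> ?b" using vtx_Suc_neq[OF simple k] .
  have D: "perp ?a ?b \<bullet> (c - ?a) \<noteq> 0" using centre_off_line[OF ab seg_frontier[OF k]] .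
  \<comment> \<open>A direction in which the normal has a non-zero component, so that this factor
    can be cancelled at the end.\<close>
  obtain i where i: "perp ?a ?b $ i \<noteq> 0"
  proof -
    have "perp ?a ?b \<noteq> 0" using ab perp_norm[of ?a ?b] by auto
    then show ?thesis using that by (auto simp: vec_eq_iff)
  qed
  have \<nu>: "outer_normal K ?a ?b $ i \<noteq> 0"
    unfolding outer_normal_eq[OF e] using i D ab by (simp add: sgn_zero_iff)
  let ?g = "\<lambda>t. g (linepath ?a ?b t)"
  let ?z = "\<lambda>m t. cone_cutoff ?a ?b m (linepath ?a ?b t)"
  have z0: "(\<integral>t. ?g t * ?z m t \<partial>unit_lebesgue) = 0" for m
  proof -
    let ?\<eta> = "cone_cutoff ?a ?b m"
    have "(\<integral>x. wd (region K) i u x * ?\<eta> x \<partial>\<mu>) = 0"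
    proof -
      have "(\<integral>x. wd (region K) i u x * ?\<eta> x \<partial>\<mu>) = (\<integral>x. 0 \<partial>\<mu>)"
      proof (rule integral_cong_AE)
        show "AE x in \<mu>. wd (region K) i u x * ?\<eta> x = 0" using wd_AE_zero[OF uL u(2), of i] by eventually_elim simp
        show "(\<lambda>x. wd (region K) i u x * ?\<eta> x) \<in> borel_measurable \<mu>"
          by (intro borel_measurable_times L2_on_measurable smooth_L2 smooth_cone_cutoff wd_L2 has_trace_H1[OF u(1)])
      qed simp
      then show ?thesis by simp
    qed
    moreover have "(\<integral>x. u x * pd i ?\<eta> x \<partial>\<mu>) = 0"
    proof -
      have "(\<integral>x. u x * pd i ?\<eta> x \<partial>\<mu>) = (\<integral>x. 0 \<partial>\<mu>)"
      proof (rule integral_cong_AE)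
        show "AE x in \<mu>. u x * pd i ?\<eta> x = 0" using u(2) by eventually_elim simp
        show "(\<lambda>x. u x * pd i ?\<eta> x) \<in> borel_measurable \<mu>"
          by (intro borel_measurable_times L2_on_measurable smooth_L2 smooth_pd smooth_cone_cutoff uL)
      qed simp
      then show ?thesis by simp
    qed
    ultimately have "0 = (\<Sum>l<length K. edge_int (vtx K l) (vtx K (Suc l)) (\<lambda>x. g x * ?\<eta> x * outer_normal K (vtx K l) (vtx K (Suc l)) $ i))"
      using green_trace[OF u(1) smooth_cone_cutoff, of i ?a ?b m] by simp
    also have "\<dots> = (\<Sum>l<length K. if l = k then edge_int ?a ?b (\<lambda>x. g x * ?\<eta> x * outer_normal K ?a ?b $ i) else 0)"
    proof (rule sum.cong)
      fix l assume l: "l \<in> {..<length K}"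
      show "edge_int (vtx K l) (vtx K (Suc l)) (\<lambda>x. g x * ?\<eta> x * outer_normal K (vtx K l) (vtx K (Suc l)) $ i)
        = (if l = k then edge_int ?a ?b (\<lambda>x. g x * ?\<eta> x * outer_normal K ?a ?b $ i) else 0)"
      proof (cases "l = k")
        case False
        have "?\<eta> (linepath (vtx K l) (vtx K (Suc l)) t) = 0" if "t \<in> {0..1}" for t
          using l False k that linepath_in_path[of t]
          by (intro cone_cutoff_other_edge[OF k, of l]) (auto simp: seg_def)
        then have "(\<integral>t. g (linepath (vtx K l) (vtx K (Suc l)) t) * ?\<eta> (linepath (vtx K l) (vtx K (Suc l)) t)
            * outer_normal K (vtx K l) (vtx K (Suc l)) $ i \<partial>unit_lebesgue) = (\<integral>t. 0 \<partial>unit_lebesgue)"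
          by (intro Bochner_Integration.integral_cong) (auto simp: space_restrict_space)
        then show ?thesis using False by (simp add: edge_int_lebesgue_on)
      qed simp
    qed simp
    also have "\<dots> = edge_int ?a ?b (\<lambda>x. g x * ?\<eta> x * outer_normal K ?a ?b $ i)" using k by simp
    finally show ?thesis using \<nu> ab by (simp add: edge_int_lebesgue_on)
  qed
  interpret finite_measure unit_lebesgue by (rule finite_measure_unit)
  have gL: "L2_on unit_lebesgue ?g" using has_trace_edge_L2[OF u(1) e] .
  have "(\<lambda>m. \<integral>t. ?g t * ?z m t \<partial>unit_lebesgue) \<longlonglongrightarrow> (\<integral>t. ?g t \<partial>unit_lebesgue)"
  proof (rule integral_dominated_convergence[where w = "\<lambda>t. \<bar>?g t\<bar>"])
    show "?g \<in> borel_measurable unit_lebesgue" using gL by (rule L2_on_measurable)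
    show "(\<lambda>t. ?g t * ?z m t) \<in> borel_measurable unit_lebesgue" for m
      by (intro borel_measurable_times L2_on_measurable gL smooth_edge_L2 smooth_cone_cutoff)
    show "integrable unit_lebesgue (\<lambda>t. \<bar>?g t\<bar>)" using gL L2_on_integrable by auto
    show "AE t in unit_lebesgue. norm (?g t * ?z m t) \<le> \<bar>?g t\<bar>" for m
    proof (rule AE_I2)
      fix t
      have "\<bar>?z m t\<bar> \<le> 1"
        unfolding cone_cutoff_def using ramp_bounds by (auto simp: abs_mult intro!: mult_le_one)
      then show "norm (?g t * ?z m t) \<le> \<bar>?g t\<bar>" by (simp add: abs_mult mult_left_le)
    qed
    show "AE t in unit_lebesgue. (\<lambda>m. ?g t * ?z m t) \<longlonglongrightarrow> ?g t"
    proof (rule AE_unit_open)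
      fix t :: real assume t: "0 < t" "t < 1"
      have D': "perp c ?b \<bullet> (?a - c) = - (perp ?a ?b \<bullet> (c - ?a))" "perp c ?a \<bullet> (?b - c) = perp ?a ?b \<bullet> (c - ?a)"
        by (simp_all add: inner_2 algebra_simps)
      have l: "linepath ?a ?b t - c = (1 - t) *\<^sub>R (?a - c) + t *\<^sub>R (?b - c)"
        by (simp add: linepath_def algebra_simps)
      have 1: "(perp c ?b \<bullet> (linepath ?a ?b t - c)) * (perp c ?b \<bullet> (?a - c)) = (1 - t) * (perp ?a ?b \<bullet> (c - ?a))^2"
        unfolding l inner_add_right inner_scaleR_right perp_inner_self D' by (simp add: power2_eq_square)
      have 2: "(perp c ?a \<bullet> (linepath ?a ?b t - c)) * (perp c ?a \<bullet> (?b - c)) = t * (perp ?a ?b \<bullet> (c - ?a))^2"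
        unfolding l inner_add_right inner_scaleR_right perp_inner_self D' by (simp add: power2_eq_square)
      have "(\<lambda>m. ramp (real m * ((1 - t) * (perp ?a ?b \<bullet> (c - ?a))^2) + 0) * ramp (real m * (t * (perp ?a ?b \<bullet> (c - ?a))^2) + 0)) \<longlonglongrightarrow> 1 * 1"
        using D t by (intro tendsto_mult ramp_limit) auto
      then have "(\<lambda>m. ?z m t) \<longlonglongrightarrow> 1" unfolding cone_cutoff_def 1 2 by simp
      then show "(\<lambda>m. ?g t * ?z m t) \<longlonglongrightarrow> ?g t" using tendsto_mult[OF tendsto_const[of "?g t"]] by fastforce
    qed
  qed
  then show ?thesis unfolding z0 by (simp add: LIMSEQ_const_iff)
qed

end

section \<open>Polynomials and projections\<close>

lemma lin_space_Poly: "lin_space (Poly m)"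
  unfolding lin_space_def
proof (intro conjI ballI allI)
  show "(\<lambda>x. 0) \<in> Poly m" unfolding Poly_def by (intro CollectI exI[of _ "\<lambda>i j. 0"]) simp
  fix p q a assume "p \<in> Poly m" "q \<in> Poly m"
  then obtain c d :: "nat \<Rightarrow> nat \<Rightarrow> real" where
    "\<forall>x. p x = (\<Sum>i\<le>m. \<Sum>j\<le>m - i. c i j * (x$1)^i * (x$2)^j)"
    "\<forall>x. q x = (\<Sum>i\<le>m. \<Sum>j\<le>m - i. d i j * (x$1)^i * (x$2)^j)" unfolding Poly_def by blast
  then show "(\<lambda>x. a * p x + q x) \<in> Poly m" unfolding Poly_def
    by (intro CollectI exI[of _ "\<lambda>i j. a * c i j + d i j"])
      (simp add: sum_distrib_left sum.distrib[symmetric] algebra_simps)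
qed

lemma Poly_0_iff: "p \<in> Poly 0 \<longleftrightarrow> (\<exists>d. p = (\<lambda>x. d))"
proof
  assume "p \<in> Poly 0"
  then show "\<exists>d. p = (\<lambda>x. d)" by (auto simp: Poly_def fun_eq_iff)
next
  assume "\<exists>d. p = (\<lambda>x. d)"
  then obtain d where "p = (\<lambda>x. d)" by blast
  then show "p \<in> Poly 0" unfolding Poly_def by (intro CollectI exI[of _ "\<lambda>i j. d"]) simp
qed

lemma Poly_1_iff: "p \<in> Poly 1 \<longleftrightarrow> (\<exists>n d. p = (\<lambda>x. n \<bullet> x + d))"
proof
  assume "p \<in> Poly 1"
  then obtain c :: "nat \<Rightarrow> nat \<Rightarrow> real" where "\<forall>x. p x = (\<Sum>i\<le>1. \<Sum>j\<le>1 - i. c i j * (x$1)^i * (x$2)^j)"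
    unfolding Poly_def by blast
  then have "p x = (vector [c 1 0, c 0 1] :: point) \<bullet> x + c 0 0" for x
    by (simp add: inner_2 vector_2 algebra_simps)
  then show "\<exists>n d. p = (\<lambda>x. n \<bullet> x + d)" by blast
next
  assume "\<exists>n d. p = (\<lambda>x. n \<bullet> x + d)"
  then obtain n :: point and d where "p = (\<lambda>x. n \<bullet> x + d)" by blast
  then show "p \<in> Poly 1" unfolding Poly_def
    by (intro CollectI exI[of _ "\<lambda>i j. if i = 0 then (if j = 0 then d else n$2) else n$1"])
      (simp add: inner_2 algebra_simps)
qed

definition quad :: "real \<Rightarrow> real \<Rightarrow> real \<Rightarrow> point \<Rightarrow> real" where
  "quad a b e x = a * (x$1 * x$1) + (b * (x$1 * x$2) + e * (x$2 * x$2))"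

lemma Poly_2_iff: "p \<in> Poly 2 \<longleftrightarrow> (\<exists>a b e n d. p = (\<lambda>x. quad a b e x + (n \<bullet> x + d)))"
proof
  assume "p \<in> Poly 2"
  then obtain c :: "nat \<Rightarrow> nat \<Rightarrow> real" where "\<forall>x. p x = (\<Sum>i\<le>2. \<Sum>j\<le>2 - i. c i j * (x$1)^i * (x$2)^j)"
    unfolding Poly_def by blast
  then have "p x = quad (c 2 0) (c 1 1) (c 0 2) x + ((vector [c 1 0, c 0 1] :: point) \<bullet> x + c 0 0)" for x
    by (simp add: inner_2 vector_2 quad_def numeral_2_eq_2 algebra_simps)
  then show "\<exists>a b e n d. p = (\<lambda>x. quad a b e x + (n \<bullet> x + d))" by blast
next
  assume "\<exists>a b e n d. p = (\<lambda>x. quad a b e x + (n \<bullet> x + d))"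
  then obtain a b e d and n :: point where "p = (\<lambda>x. quad a b e x + (n \<bullet> x + d))" by blast
  then show "p \<in> Poly 2" unfolding Poly_def
    by (intro CollectI exI[of _ "\<lambda>i j. if i = 0 then (if j = 0 then d else if j = 1 then n$2 else e)
        else if i = 1 then (if j = 0 then n$1 else b) else a"])
      (simp add: inner_2 quad_def numeral_2_eq_2 algebra_simps)
qed

lemma Poly_0_1: "p \<in> Poly 0 \<Longrightarrow> p \<in> Poly 1"
proof -
  assume "p \<in> Poly 0"
  then obtain d where "p = (\<lambda>x. d)" unfolding Poly_0_iff by blast
  then have "p = (\<lambda>x. 0 \<bullet> x + d)" by simp
  then show "p \<in> Poly 1" unfolding Poly_1_iff by blast
qed

lemma fin_dim_Poly_1: "fin_dim (Poly 1)"
proof -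
  have "Poly 1 \<subseteq> fin_span (\<lambda>k x. if k = 0 then 1 else if k = 1 then x$1 else x$2) 3"
  proof
    fix p :: "point \<Rightarrow> real" assume "p \<in> Poly 1"
    then obtain n d where p: "p = (\<lambda>x. n \<bullet> x + d)" unfolding Poly_1_iff by blast
    show "p \<in> fin_span (\<lambda>k x. if k = 0 then 1 else if k = 1 then x$1 else x$2) 3"
      unfolding p by (rule fin_spanI[where c = "\<lambda>k. if k = 0 then d else if k = 1 then n$1 else n$2"])
        (simp add: inner_2 eval_nat_numeral algebra_simps)
  qed
  then show ?thesis unfolding fin_dim_def by blast
qed

text \<open>Applied to quadratic polynomials only, whose second derivatives are constant; the
  evaluation point 0 is a convention.\<close>

definition hess :: "(point \<Rightarrow> real) \<Rightarrow> 2 \<Rightarrow> 2 \<Rightarrow> real" where "hess p i j = pd j (pd i p) 0"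

lemma pd_quad:
  "pd i (\<lambda>x. quad a b e x + (n \<bullet> x + d)) = (\<lambda>x. (if i = 1 then vector [2 * a, b] else vector [b, 2 * e]) \<bullet> x + n $ i)"
proof
  fix x
  have s1: "smooth (\<lambda>x. x$i * x$j)" for i j by (intro smooth_mult smooth_coord)
  have s2: "smooth (quad a b e)" unfolding quad_def[abs_def]
    by (intro smooth_lincomb s1 smooth_add smooth_mult smooth_const)
  have "pd i (\<lambda>x. quad a b e x + (n \<bullet> x + d)) x = pd i (quad a b e) x + n $ i"
    by (simp add: pd_add smooth_differentiable s2 smooth_affine pd_affine)
  also have "pd i (quad a b e) x = a * pd i (\<lambda>x. x$1 * x$1) x + (b * pd i (\<lambda>x. x$1 * x$2) x + e * pd i (\<lambda>x. x$2 * x$2) x)"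
    unfolding quad_def[abs_def]
    by (simp add: pd_lincomb pd_mult_smooth[OF smooth_const] pd_const s1 smooth_lincomb smooth_mult smooth_const)
  finally show "pd i (\<lambda>x. quad a b e x + (n \<bullet> x + d)) x
      = (if i = 1 then vector [2 * a, b] else vector [b, 2 * e]) \<bullet> x + n $ i"
    using exhaust_2[of i] by (auto simp: pd_mult_smooth smooth_coord pd_coord inner_2 vector_2 algebra_simps)
qed

lemma hess_const: assumes "p \<in> Poly 2" shows "pd j (pd i p) x = hess p i j"
proof -
  obtain a b e n d where "p = (\<lambda>x. quad a b e x + (n \<bullet> x + d))" using assms unfolding Poly_2_iff by blast
  then show ?thesis by (simp add: hess_def pd_quad pd_affine)
qed

lemma hess_quad:
  "hess (\<lambda>x. quad a b e x + (n \<bullet> x + d)) i j = (if i = j then (if i = 1 then 2 * a else 2 * e) else b)"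
  using exhaust_2[of i] exhaust_2[of j] by (auto simp: hess_def pd_quad pd_affine vector_2)

lemma hess_zero_Poly_1: "p \<in> Poly 2 \<Longrightarrow> (\<And>i j. hess p i j = 0) \<Longrightarrow> p \<in> Poly 1"
proof -
  assume p: "p \<in> Poly 2" and h: "\<And>i j. hess p i j = 0"
  obtain a b e n d where q: "p = (\<lambda>x. quad a b e x + (n \<bullet> x + d))" using p unfolding Poly_2_iff by blast
  have "a = 0" "b = 0" "e = 0"
    using h[of 1 1] h[of 1 2] h[of 2 2] unfolding q hess_quad by auto
  then show "p \<in> Poly 1" unfolding q Poly_1_iff by (intro exI[of _ n] exI[of _ d]) (simp add: quad_def)
qed

lemma VPoly_nth: "p \<in> VPoly m \<Longrightarrow> (\<lambda>x. p x $ i) \<in> Poly m"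
  by (simp add: VPoly_def)

section \<open>Unisolvence on one element and the projections in the square-integrable sense\<close>

context star_polygon
begin

lemma emeasure_open_pos: "0 < measure lebesgue (region K)"
proof -
  have "\<not> negligible (region K)" using open_U centre open_not_negligible by blast
  moreover have "region K \<in> lmeasurable" using open_U bounded_U lmeasurable_open by blast
  ultimately show ?thesis using negligible_iff_measure0 by (metis measure_nonneg order_le_less)
qed

definition area :: real where "area = measure lebesgue (region K)"

lemma area_pos: "area > 0"
  using emeasure_open_pos by (simp add: area_def)

lemma measure_region: "measure \<mu> (region K) = area"
  by (simp add: area_def measure_restrict_space)

lemma integral_const_region: "(\<integral>x. a \<partial>\<mu>) = a * area"
  by (simp add: area_def measure_restrict_space space_restrict_space)

lemma continuous_AE_zero:
  assumes "continuous_on (region K) f" "AE x in \<mu>. f x = 0" "x \<in> region K" shows "f x = (0::real)"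
proof (rule ccontr)
  assume "f x \<noteq> 0"
  let ?W = "region K \<inter> f -` (- {0})"
  have "open ?W" using continuous_open_preimage[OF assms(1) open_U, of "- {0}"] by auto
  moreover have "x \<in> ?W" using \<open>f x \<noteq> 0\<close> assms by simp
  ultimately have "\<not> negligible ?W" using open_not_negligible by blast
  moreover have "negligible ?W"
  proof -
    have "AE x in lebesgue. x \<in> region K \<longrightarrow> f x = 0" using assms(2) by (subst (asm) AE_restrict_space_iff) auto
    then have "AE x in lebesgue. x \<notin> ?W" by eventually_elim auto
    moreover have "?W \<in> sets lebesgue" using \<open>open ?W\<close> by (metis borel_open sets_completionI_sets sets_lborel)
    ultimately show ?thesis unfolding negligible_iff_null_sets by (subst AE_iff_null_sets) auto
  qed
  ultimately show False by blast
qed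

lemma affine_zero_on_region:
  assumes "\<And>x. x \<in> region K \<Longrightarrow> n \<bullet> x + d = 0" shows "n = 0" "d = 0"
proof -
  obtain t where t: "t > 0" "t * norm n < r"
  proof -
    define t where "t = r / (2 * (norm n + 1))"
    have n1: "norm n + 1 > 0" by (simp add: add_nonneg_pos)
    have t: "t > 0" "t * (2 * (norm n + 1)) = r" using n1 r by (auto simp: t_def)
    have "t * norm n < t * (2 * (norm n + 1))" using t n1 by (intro mult_strict_left_mono) auto
    then have "t * norm n < r" using t(2) by (simp only:)
    then show ?thesis using that t(1) by blast
  qed
  then have "c + t *\<^sub>R n \<in> ball c r" by (simp add: dist_norm)
  then have 1: "n \<bullet> (c + t *\<^sub>R n) + d = 0" using assms ball by blast
  have 2: "n \<bullet> c + d = 0" using assms centre by blast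
  have "n \<bullet> (c + t *\<^sub>R n) = n \<bullet> c + t * (n \<bullet> n)" by (simp add: inner_simps)
  then have "t * (n \<bullet> n) = 0" using 1 2 by linarith
  then show "n = 0" using t by simp
  with 2 show "d = 0" by simp
qed

text \<open>Vanishing at the vertices spreads to the edges. The rays from c along n and -n both hit
  the boundary, and the values at the two points differ by a positive multiple of the squared length
  of n, so n = 0.\<close>

lemma affine_zero_on_vertices:
  assumes "\<And>v. v \<in> set K \<Longrightarrow> n \<bullet> v + d = 0" shows "n = 0" "d = 0"
proof -
  have K: "K \<noteq> []" using simple_polygon_length[OF simple] by auto
  have bd: "n \<bullet> x + d = 0" if xf: "x \<in> frontier (region K)" for x
  proof -
    obtain k where k: "x \<in> seg K k"
      using xf region_Jordan(4)[OF simple] by (auto simp: polygon_boundary_seg)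
    then obtain w where xw: "x = (1 - w) *\<^sub>R vtx K k + w *\<^sub>R vtx K (Suc k)" unfolding seg_def in_segment by blast
    have "n \<bullet> vtx K k = - d" "n \<bullet> vtx K (Suc k) = - d"
      using assms[OF vtx_in_set[OF K]] by (metis add_eq_0_iff2)+
    then show ?thesis unfolding xw by (simp add: inner_simps algebra_simps)
  qed
  show n0: "n = 0"
  proof (rule ccontr)
    assume "n \<noteq> 0"
    have ci: "c \<in> interior (region K)" using centre open_U by (simp add: interior_open)
    obtain t where t: "0 < t" "c + t *\<^sub>R n \<in> frontier (region K)"
      using ray_to_frontier[OF bounded_U ci \<open>n \<noteq> 0\<close>] by metis
    obtain t' where t': "0 < t'" "c + t' *\<^sub>R (- n) \<in> frontier (region K)"
      using ray_to_frontier[OF bounded_U ci, of "- n"] \<open>n \<noteq> 0\<close> by (metis neg_equal_0_iff_equal)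
    have "(t + t') * (n \<bullet> n) = 0" using bd[OF t(2)] bd[OF t'(2)] by (simp add: inner_simps algebra_simps)
    then show False using t t' \<open>n \<noteq> 0\<close> by simp
  qed
  show "d = 0" using assms[OF vtx_in_set[OF K]] n0 by simp
qed

lemma Poly_L2: "p \<in> Poly m \<Longrightarrow> L2_on \<mu> p"
  using Poly_smooth smooth_L2 by blast

lemma inner_on_Poly_L2: "inner_on (Poly 1) (\<lambda>p q. \<integral>x. p x * q x \<partial>\<mu>)"
  unfolding inner_on_def
proof (intro conjI ballI)
  fix q :: "point \<Rightarrow> real" assume q: "q \<in> Poly 1"
  show "lin_on (Poly 1) (\<lambda>p. \<integral>x. p x * q x \<partial>\<mu>)"
    unfolding lin_on_def using q by (auto intro!: integral_lincomb_mult Poly_L2)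
  show "0 \<le> (\<integral>x. q x * q x \<partial>\<mu>)" by simp
  show "(\<integral>x. q x * q x \<partial>\<mu>) = 0 \<longrightarrow> q = (\<lambda>x. 0)"
  proof
    assume "(\<integral>x. q x * q x \<partial>\<mu>) = 0"
    then have "AE x in \<mu>. q x = 0" using L2_on_zero_AE[OF Poly_L2[OF q]] by (simp add: power2_eq_square)
    then have z: "\<And>x. x \<in> region K \<Longrightarrow> q x = 0"
      using continuous_AE_zero[OF smooth_continuous_on[OF Poly_smooth[OF q]]] by blast
    obtain n d where nd: "q = (\<lambda>x. n \<bullet> x + d)" using q unfolding Poly_1_iff by blast
    then show "q = (\<lambda>x. 0)" using affine_zero_on_region[of n d] z by auto
  qed
qed (simp add: mult.commute)

text \<open>Definiteness is the unisolvence of the vertices for affine functions. Riesz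
  representation in this inner product will fix the affine part of \<open>Pi_D\<close>.\<close>

lemma inner_on_Poly_vertices: "inner_on (Poly 1) (\<lambda>p q. \<Sum>v\<in>set K. p v * q v)"
  unfolding inner_on_def
proof (intro conjI ballI)
  fix q :: "point \<Rightarrow> real" assume q: "q \<in> Poly 1"
  show "lin_on (Poly 1) (\<lambda>p. \<Sum>v\<in>set K. p v * q v)"
    unfolding lin_on_def by (auto simp: sum_distrib_left sum.distrib[symmetric] algebra_simps)
  show "0 \<le> (\<Sum>v\<in>set K. q v * q v)" by (simp add: sum_nonneg)
  show "(\<Sum>v\<in>set K. q v * q v) = 0 \<longrightarrow> q = (\<lambda>x. 0)"
  proof
    assume "(\<Sum>v\<in>set K. q v * q v) = 0"
    then have z: "\<And>v. v \<in> set K \<Longrightarrow> q v = 0" by (subst (asm) sum_nonneg_eq_0_iff) auto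
    obtain n d where nd: "q = (\<lambda>x. n \<bullet> x + d)" using q unfolding Poly_1_iff by blast
    then show "q = (\<lambda>x. 0)" using affine_zero_on_vertices[of n d] z by auto
  qed
qed (simp add: mult.commute)

lemma integral_diff_mult_eq_0:
  assumes "L2_on \<mu> p" "L2_on \<mu> u" "L2_on \<mu> \<eta>"
  shows "(\<integral>x. (p x - u x) * \<eta> x \<partial>\<mu>) = 0 \<longleftrightarrow> (\<integral>x. p x * \<eta> x \<partial>\<mu>) = (\<integral>x. u x * \<eta> x \<partial>\<mu>)"
  using L2_on_integrable_mult[OF assms(1,3)] L2_on_integrable_mult[OF assms(2,3)]
  by (simp add: left_diff_distrib)

text \<open>Riesz representation on the polynomials. Since \<open>L2proj\<close> is a definite
  description, its properties become available only through this lemma; the orders 0 and 1 are the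
  ones occurring in the discrete forms.\<close>

lemma ex1_L2proj:
  assumes m: "m \<le> 1" and u: "L2_on \<mu> u"
  shows "\<exists>!p. p \<in> Poly m \<and> (\<forall>\<eta>\<in>Poly m. (LINT x:region K|lebesgue. (p x - u x) * \<eta> x) = 0)"
proof -
  have sub: "Poly m \<subseteq> Poly 1" using m Poly_0_1 by (cases m) auto
  interpret fin_inner "Poly m" "\<lambda>p q. \<integral>x. p x * q x \<partial>\<mu>"
    using lin_space_Poly inner_on_subset[OF inner_on_Poly_L2 sub] fin_dim_subset[OF fin_dim_Poly_1 sub]
    by unfold_locales
  have l: "lin_on (Poly m) (\<lambda>\<eta>. \<integral>x. u x * \<eta> x \<partial>\<mu>)"
    unfolding lin_on_def
  proof (intro ballI allI)
    fix p q a assume "p \<in> Poly m" "q \<in> Poly m"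
    then show "(\<integral>x. u x * (a * p x + q x) \<partial>\<mu>) = a * (\<integral>x. u x * p x \<partial>\<mu>) + (\<integral>x. u x * q x \<partial>\<mu>)"
      using integral_lincomb_mult[OF Poly_L2 Poly_L2 u, of p m q m a] by (simp add: mult.commute)
  qed
  obtain p where p: "p \<in> Poly m" "\<And>\<eta>. \<eta> \<in> Poly m \<Longrightarrow> (\<integral>x. p x * \<eta> x \<partial>\<mu>) = (\<integral>x. u x * \<eta> x \<partial>\<mu>)"
    using riesz[OF l] by blast
  show ?thesis
  proof (rule ex1I[of _ p])
    show "p \<in> Poly m \<and> (\<forall>\<eta>\<in>Poly m. (LINT x:region K|lebesgue. (p x - u x) * \<eta> x) = 0)"
      using p u by (auto simp: LINT_U integral_diff_mult_eq_0 Poly_L2)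
    fix q assume "q \<in> Poly m \<and> (\<forall>\<eta>\<in>Poly m. (LINT x:region K|lebesgue. (q x - u x) * \<eta> x) = 0)"
    then have q: "q \<in> Poly m" "\<And>\<eta>. \<eta> \<in> Poly m \<Longrightarrow> (\<integral>x. q x * \<eta> x \<partial>\<mu>) = (\<integral>x. u x * \<eta> x \<partial>\<mu>)"
      using u by (auto simp: LINT_U integral_diff_mult_eq_0 Poly_L2)
    have qp: "(\<lambda>x. q x - p x) \<in> Poly m" using lin_space_diff[OF lin_space_Poly] p q by blast
    have "(\<integral>x. (q x - p x) * (q x - p x) \<partial>\<mu>) = 0"
      using lin_on_diff[OF lin[OF qp] q(1) p(1)] p(2)[OF qp] q(2)[OF qp] by simp
    then have "(\<lambda>x. q x - p x) = (\<lambda>x. 0)" using definite[OF qp] by blast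
    then show "q = p" by (auto simp: fun_eq_iff)
  qed
qed

lemma L2proj_spec:
  assumes "m \<le> 1" "L2_on \<mu> u"
  shows "L2proj m (region K) u \<in> Poly m"
    and "\<And>\<eta>. \<eta> \<in> Poly m \<Longrightarrow> (\<integral>x. L2proj m (region K) u x * \<eta> x \<partial>\<mu>) = (\<integral>x. u x * \<eta> x \<partial>\<mu>)"
proof -
  have *: "L2proj m (region K) u \<in> Poly m \<and> (\<forall>\<eta>\<in>Poly m. (LINT x:region K|lebesgue. (L2proj m (region K) u x - u x) * \<eta> x) = 0)"
    unfolding L2proj_def by (rule theI'[OF ex1_L2proj[OF assms]])
  then show P: "L2proj m (region K) u \<in> Poly m" by blast
  show "\<And>\<eta>. \<eta> \<in> Poly m \<Longrightarrow> (\<integral>x. L2proj m (region K) u x * \<eta> x \<partial>\<mu>) = (\<integral>x. u x * \<eta> x \<partial>\<mu>)"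
    using * by (simp add: LINT_U integral_diff_mult_eq_0 Poly_L2[OF P] Poly_L2 assms)
qed

lemma L2proj_eqI:
  assumes "m \<le> 1" "L2_on \<mu> u" "p \<in> Poly m"
    and "\<And>\<eta>. \<eta> \<in> Poly m \<Longrightarrow> (\<integral>x. p x * \<eta> x \<partial>\<mu>) = (\<integral>x. u x * \<eta> x \<partial>\<mu>)"
  shows "L2proj m (region K) u = p"
  unfolding L2proj_def
  by (rule the1_equality[OF ex1_L2proj[OF assms(1,2)]])
    (use assms in \<open>auto simp: LINT_U integral_diff_mult_eq_0 Poly_L2\<close>)

lemma L2proj_lincomb:
  assumes m: "m \<le> 1" and uv: "L2_on \<mu> u" "L2_on \<mu> v" and w: "L2_on \<mu> w" "AE x in \<mu>. w x = a * u x + v x"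
  shows "L2proj m (region K) w = (\<lambda>x. a * L2proj m (region K) u x + L2proj m (region K) v x)"
proof (rule L2proj_eqI[OF m w(1)])
  show "(\<lambda>x. a * L2proj m (region K) u x + L2proj m (region K) v x) \<in> Poly m"
    using lin_space_comb[OF lin_space_Poly] L2proj_spec m uv by blast
  fix \<eta> assume \<eta>: "\<eta> \<in> Poly m"
  have "(\<integral>x. w x * \<eta> x \<partial>\<mu>) = (\<integral>x. (a * u x + v x) * \<eta> x \<partial>\<mu>)"
  proof (rule integral_cong_AE)
    show "AE x in \<mu>. w x * \<eta> x = (a * u x + v x) * \<eta> x" using w(2) by eventually_elim simp
  qed (intro borel_measurable_times L2_on_measurable L2_on_lincomb uv w Poly_L2[OF \<eta>])+
  then show "(\<integral>x. (a * L2proj m (region K) u x + L2proj m (region K) v x) * \<eta> x \<partial>\<mu>) = (\<integral>x. w x * \<eta> x \<partial>\<mu>)"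
    using L2proj_spec[OF m uv(1)] L2proj_spec[OF m uv(2)] \<eta> uv
    by (simp add: integral_lincomb_mult Poly_L2)
qed

text \<open>Test fields with one non-zero component decouple the vector condition into the scalar
  ones.\<close>

lemma VL2proj_eq:
  assumes m: "m \<le> 1" and v: "\<And>i. L2_on \<mu> (\<lambda>x. v x $ i)"
  shows "VL2proj m (region K) v = (\<lambda>x. \<chi> i. L2proj m (region K) (\<lambda>x. v x $ i) x)"
proof -
  let ?P = "\<lambda>i. L2proj m (region K) (\<lambda>x. v x $ i)"
  have in2: "(\<integral>x. (p x - v x) \<bullet> \<eta> x \<partial>\<mu>) = (\<Sum>i\<in>UNIV. \<integral>x. (p x $ i - v x $ i) * \<eta> x $ i \<partial>\<mu>)"
    if "p \<in> VPoly m" "\<eta> \<in> VPoly m" for p \<eta>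
    unfolding inner_vec_def
    using that v by (subst Bochner_Integration.integral_sum)
      (auto intro!: L2_on_integrable_mult L2_on_diff intro: Poly_L2 VPoly_nth)
  have iff: "(\<forall>\<eta>\<in>VPoly m. (LINT x:region K|lebesgue. (p x - v x) \<bullet> \<eta> x) = 0)
      \<longleftrightarrow> (\<forall>i. \<forall>\<eta>\<in>Poly m. (\<integral>x. p x $ i * \<eta> x \<partial>\<mu>) = (\<integral>x. v x $ i * \<eta> x \<partial>\<mu>))" if p: "p \<in> VPoly m" for p
  proof
    assume L: "\<forall>\<eta>\<in>VPoly m. (LINT x:region K|lebesgue. (p x - v x) \<bullet> \<eta> x) = 0"
    show "\<forall>i. \<forall>\<eta>\<in>Poly m. (\<integral>x. p x $ i * \<eta> x \<partial>\<mu>) = (\<integral>x. v x $ i * \<eta> x \<partial>\<mu>)"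
    proof (intro allI ballI)
      fix i \<eta> assume \<eta>: "\<eta> \<in> Poly m"
      have V: "(\<lambda>x. axis i (\<eta> x)) \<in> VPoly m"
        unfolding VPoly_def
      proof (intro CollectI allI)
        fix j
        have "(\<lambda>x. axis i (\<eta> x) $ j) = (if j = i then \<eta> else (\<lambda>x. 0))" by (auto simp: axis_def)
        then show "(\<lambda>x. axis i (\<eta> x) $ j) \<in> Poly m" using \<eta> lin_space_zero[OF lin_space_Poly] by simp
      qed
      have "0 = (\<Sum>j\<in>UNIV. \<integral>x. (p x $ j - v x $ j) * axis i (\<eta> x) $ j \<partial>\<mu>)"
        using L V in2[OF p V] by (simp add: LINT_U)
      also have "\<dots> = (\<Sum>j\<in>UNIV. if j = i then (\<integral>x. (p x $ i - v x $ i) * \<eta> x \<partial>\<mu>) else 0)"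
        by (intro sum.cong) (auto simp: axis_def)
      also have "\<dots> = (\<integral>x. (p x $ i - v x $ i) * \<eta> x \<partial>\<mu>)" by simp
      finally show "(\<integral>x. p x $ i * \<eta> x \<partial>\<mu>) = (\<integral>x. v x $ i * \<eta> x \<partial>\<mu>)"
        using integral_diff_mult_eq_0[OF Poly_L2[OF VPoly_nth[OF p]] v Poly_L2[OF \<eta>]] by simp
    qed
  next
    assume R: "\<forall>i. \<forall>\<eta>\<in>Poly m. (\<integral>x. p x $ i * \<eta> x \<partial>\<mu>) = (\<integral>x. v x $ i * \<eta> x \<partial>\<mu>)"
    show "\<forall>\<eta>\<in>VPoly m. (LINT x:region K|lebesgue. (p x - v x) \<bullet> \<eta> x) = 0"
    proof
      fix \<eta> assume \<eta>: "\<eta> \<in> VPoly m"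
      have "(\<integral>x. (p x $ i - v x $ i) * \<eta> x $ i \<partial>\<mu>) = 0" for i
        using R[rule_format, OF VPoly_nth[OF \<eta>, of i], of i]
          integral_diff_mult_eq_0[OF Poly_L2[OF VPoly_nth[OF p, of i]] v[of i] Poly_L2[OF VPoly_nth[OF \<eta>, of i]]]
        by simp
      then show "(LINT x:region K|lebesgue. (p x - v x) \<bullet> \<eta> x) = 0" using in2[OF p \<eta>] by (simp add: LINT_U)
    qed
  qed
  have P: "(\<lambda>x. \<chi> i. ?P i x) \<in> VPoly m" unfolding VPoly_def using L2proj_spec(1)[OF m v] by simp
  show ?thesis
    unfolding VL2proj_def
  proof (rule the_equality)
    show "(\<lambda>x. \<chi> i. ?P i x) \<in> VPoly m \<and> (\<forall>\<eta>\<in>VPoly m. (LINT x:region K|lebesgue. ((\<chi> i. ?P i x) - v x) \<bullet> \<eta> x) = 0)"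
      using P iff[OF P] L2proj_spec(2)[OF m v] by simp
    fix p assume "p \<in> VPoly m \<and> (\<forall>\<eta>\<in>VPoly m. (LINT x:region K|lebesgue. (p x - v x) \<bullet> \<eta> x) = 0)"
    then have p: "p \<in> VPoly m" "\<forall>i. \<forall>\<eta>\<in>Poly m. (\<integral>x. p x $ i * \<eta> x \<partial>\<mu>) = (\<integral>x. v x $ i * \<eta> x \<partial>\<mu>)"
      using iff by auto
    have "?P i = (\<lambda>x. p x $ i)" for i
      using p VPoly_nth by (intro L2proj_eqI[OF m v]) auto
    then show "p = (\<lambda>x. \<chi> i. ?P i x)" by (simp add: vec_eq_iff fun_eq_iff)
  qed
qed

section \<open>The Hessian energy and the projection onto quadratic polynomials\<close>

lemma A_loc_eq: "A_loc (region K) \<phi> \<eta> = (\<integral>x. (\<Sum>i\<in>UNIV. \<Sum>j\<in>UNIV.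
    wd (region K) j (wd (region K) i \<phi>) x * wd (region K) j (wd (region K) i \<eta>) x) \<partial>\<mu>)"
  by (simp add: A_loc_def LINT_U)

lemma wd2_L2: "\<phi> \<in> H2 (region K) \<Longrightarrow> L2_on \<mu> (wd (region K) j (wd (region K) i \<phi>))"
  by (intro wd_L2 H2_H1)

lemma A_loc_sum:
  assumes "\<phi> \<in> H2 (region K)" "\<eta> \<in> H2 (region K)"
  shows "A_loc (region K) \<phi> \<eta> = (\<Sum>i\<in>UNIV. \<Sum>j\<in>UNIV.
    \<integral>x. wd (region K) j (wd (region K) i \<phi>) x * wd (region K) j (wd (region K) i \<eta>) x \<partial>\<mu>)"
proof -
  have i: "integrable \<mu> (\<lambda>x. wd (region K) j (wd (region K) i \<phi>) x * wd (region K) j (wd (region K) i \<eta>) x)" for i j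
    using assms by (intro L2_on_integrable_mult wd2_L2)
  show ?thesis unfolding A_loc_eq
    by (subst Bochner_Integration.integral_sum, intro Bochner_Integration.integrable_sum i)
      (subst Bochner_Integration.integral_sum, auto intro: i)
qed

lemma A_loc_commute: "A_loc (region K) \<phi> \<eta> = A_loc (region K) \<eta> \<phi>"
  by (simp add: A_loc_def mult.commute)

lemma A_loc_lincomb:
  assumes "\<phi> \<in> H2 (region K)" "\<psi> \<in> H2 (region K)" "\<eta> \<in> H2 (region K)"
  shows "A_loc (region K) (\<lambda>x. a * \<phi> x + \<psi> x) \<eta> = a * A_loc (region K) \<phi> \<eta> + A_loc (region K) \<psi> \<eta>"
proof -
  let ?d = "\<lambda>i j u. wd (region K) j (wd (region K) i u)"
  have "(\<integral>x. ?d i j (\<lambda>x. a * \<phi> x + \<psi> x) x * ?d i j \<eta> x \<partial>\<mu>)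
    = a * (\<integral>x. ?d i j \<phi> x * ?d i j \<eta> x \<partial>\<mu>) + (\<integral>x. ?d i j \<psi> x * ?d i j \<eta> x \<partial>\<mu>)" for i j
  proof -
    have "(\<integral>x. ?d i j (\<lambda>x. a * \<phi> x + \<psi> x) x * ?d i j \<eta> x \<partial>\<mu>) = (\<integral>x. (a * ?d i j \<phi> x + ?d i j \<psi> x) * ?d i j \<eta> x \<partial>\<mu>)"
    proof (rule integral_cong_AE)
      show "AE x in \<mu>. ?d i j (\<lambda>x. a * \<phi> x + \<psi> x) x * ?d i j \<eta> x = (a * ?d i j \<phi> x + ?d i j \<psi> x) * ?d i j \<eta> x"
        using wd2_lincomb[OF assms(1,2), of j i a] by eventually_elim simp
    qed (intro borel_measurable_times L2_on_measurable L2_on_lincomb wd2_L2 H2_lincomb assms)+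
    also have "\<dots> = a * (\<integral>x. ?d i j \<phi> x * ?d i j \<eta> x \<partial>\<mu>) + (\<integral>x. ?d i j \<psi> x * ?d i j \<eta> x \<partial>\<mu>)"
      using assms by (intro integral_lincomb_mult wd2_L2)
    finally show ?thesis .
  qed
  then show ?thesis using assms
    by (simp add: A_loc_sum H2_lincomb sum_distrib_left sum.distrib distrib_left)
qed

lemma A_loc_nonneg: "0 \<le> A_loc (region K) \<phi> \<phi>"
  unfolding A_loc_eq by (intro integral_nonneg_AE AE_I2 sum_nonneg) simp

lemma Poly_H2: "p \<in> Poly m \<Longrightarrow> p \<in> H2 (region K)"
  using Poly_smooth smooth_H2 by blast

lemma Poly_wd2: "p \<in> Poly 2 \<Longrightarrow> AE x in \<mu>. wd (region K) j (wd (region K) i p) x = hess p i j"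
  using smooth_wd2[OF Poly_smooth, of p 2 j i] hess_const[of p j i] by simp

definition hess_mean :: "(point \<Rightarrow> real) \<Rightarrow> 2 \<Rightarrow> 2 \<Rightarrow> real" where
  "hess_mean \<phi> i j = (\<integral>x. wd (region K) j (wd (region K) i \<phi>) x \<partial>\<mu>) / area"

text \<open>The Hessian of a quadratic is constant and leaves the integral, so of \<phi> only the
  mean Hessian matters.\<close>

lemma A_loc_Poly:
  assumes "\<phi> \<in> H2 (region K)" "p \<in> Poly 2"
  shows "A_loc (region K) \<phi> p = (\<Sum>i\<in>UNIV. \<Sum>j\<in>UNIV. area * hess_mean \<phi> i j * hess p i j)"
proof -
  have "(\<integral>x. wd (region K) j (wd (region K) i \<phi>) x * wd (region K) j (wd (region K) i p) x \<partial>\<mu>)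
    = area * hess_mean \<phi> i j * hess p i j" for i j
  proof -
    have "(\<integral>x. wd (region K) j (wd (region K) i \<phi>) x * wd (region K) j (wd (region K) i p) x \<partial>\<mu>)
      = (\<integral>x. wd (region K) j (wd (region K) i \<phi>) x * hess p i j \<partial>\<mu>)"
    proof (rule integral_cong_AE)
      show "AE x in \<mu>. wd (region K) j (wd (region K) i \<phi>) x * wd (region K) j (wd (region K) i p) x
          = wd (region K) j (wd (region K) i \<phi>) x * hess p i j"
        using Poly_wd2[OF assms(2), of j i] by eventually_elim simp
    qed (intro borel_measurable_times L2_on_measurable wd2_L2 assms Poly_H2[OF assms(2)] borel_measurable_const)+
    then show ?thesis using area_pos by (simp add: hess_mean_def)
  qed
  then show ?thesis using A_loc_sum[OF assms(1) Poly_H2[OF assms(2)]] by simp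
qed

lemma hess_mean_Poly: assumes "p \<in> Poly 2" shows "hess_mean p i j = hess p i j"
proof -
  have "(\<integral>x. wd (region K) j (wd (region K) i p) x \<partial>\<mu>) = (\<integral>x. hess p i j \<partial>\<mu>)"
    using Poly_wd2[OF assms, of j i]
    by (intro integral_cong_AE L2_on_measurable wd2_L2 Poly_H2[OF assms] borel_measurable_const)
  then show ?thesis using area_pos unfolding integral_const_region by (simp add: hess_mean_def)
qed

lemma A_loc_zero_Poly_1:
  assumes p: "p \<in> Poly 2" "A_loc (region K) p p = 0" shows "p \<in> Poly 1"
proof (rule hess_zero_Poly_1[OF p(1)])
  fix i j
  have "(\<Sum>i\<in>UNIV. \<Sum>j\<in>UNIV. area * (hess p i j * hess p i j)) = 0"
    using A_loc_Poly[OF Poly_H2[OF p(1)] p(1)] hess_mean_Poly[OF p(1)] p(2) by (simp add: mult.assoc)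
  then have "(\<Sum>j\<in>UNIV. area * (hess p i j * hess p i j)) = 0"
    using area_pos by (subst (asm) sum_nonneg_eq_0_iff) (auto intro!: sum_nonneg)
  then have "area * (hess p i j * hess p i j) = 0"
    using area_pos by (subst (asm) sum_nonneg_eq_0_iff) auto
  then show "hess p i j = 0" using area_pos by simp
qed

text \<open>The energy condition prescribes the Hessian and leaves an affine function free; the
  vertex condition then determines that function. Uniqueness follows in the same two stages.\<close>

lemma ex1_Pi_D:
  assumes \<phi>: "\<phi> \<in> H2 (region K)"
  shows "\<exists>!p. p \<in> Poly 2 \<and> (\<forall>\<eta>\<in>Poly 2. A_loc (region K) p \<eta> = A_loc (region K) \<phi> \<eta>) \<and>
     (\<forall>\<eta>\<in>Poly 1. (\<Sum>v\<in>set K. p v * \<eta> v) = (\<Sum>v\<in>set K. vval K \<phi> v * \<eta> v))"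
proof -
  interpret fin_inner "Poly 1" "\<lambda>p q. \<Sum>v\<in>set K. p v * q v"
    using lin_space_Poly inner_on_Poly_vertices fin_dim_Poly_1 by unfold_locales
  \<comment> \<open>The halves of the pure coefficients come from differentiating a square twice.
    The two mixed means are averaged because test quadratics have symmetric Hessians and see only
    their sum.\<close>
  let ?q = "quad (hess_mean \<phi> 1 1 / 2) ((hess_mean \<phi> 1 2 + hess_mean \<phi> 2 1) / 2) (hess_mean \<phi> 2 2 / 2)"
  have l: "lin_on (Poly 1) (\<lambda>\<eta>. \<Sum>v\<in>set K. (vval K \<phi> v - ?q v) * \<eta> v)"
    unfolding lin_on_def by (auto simp: sum_distrib_left sum.distrib[symmetric] algebra_simps)
  obtain g where g: "g \<in> Poly 1" "\<And>\<eta>. \<eta> \<in> Poly 1 \<Longrightarrow> (\<Sum>v\<in>set K. g v * \<eta> v) = (\<Sum>v\<in>set K. (vval K \<phi> v - ?q v) * \<eta> v)"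
    using riesz[OF l] by blast
  obtain n d where nd: "g = (\<lambda>x. n \<bullet> x + d)" using g(1) unfolding Poly_1_iff by blast
  define p where "p = (\<lambda>x. ?q x + (n \<bullet> x + d))"
  have p: "p \<in> Poly 2" unfolding p_def Poly_2_iff by blast
  have Ap: "A_loc (region K) p \<eta> = A_loc (region K) \<phi> \<eta>" if \<eta>: "\<eta> \<in> Poly 2" for \<eta>
  proof -
    obtain a b e m f where e: "\<eta> = (\<lambda>x. quad a b e x + (m \<bullet> x + f))" using \<eta> unfolding Poly_2_iff by blast
    show ?thesis
      unfolding A_loc_Poly[OF Poly_H2[OF p] \<eta>] A_loc_Poly[OF \<phi> \<eta>] hess_mean_Poly[OF p]
      unfolding p_def e hess_quad by (simp add: sum_2 algebra_simps add_divide_distrib)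
  qed
  have vp: "(\<Sum>v\<in>set K. p v * \<eta> v) = (\<Sum>v\<in>set K. vval K \<phi> v * \<eta> v)" if "\<eta> \<in> Poly 1" for \<eta>
    using g(2)[OF that] unfolding nd p_def by (simp add: left_diff_distrib sum_subtractf distrib_right sum.distrib)
  show ?thesis
  proof (rule ex1I[of _ p])
    fix q assume "q \<in> Poly 2 \<and> (\<forall>\<eta>\<in>Poly 2. A_loc (region K) q \<eta> = A_loc (region K) \<phi> \<eta>) \<and>
     (\<forall>\<eta>\<in>Poly 1. (\<Sum>v\<in>set K. q v * \<eta> v) = (\<Sum>v\<in>set K. vval K \<phi> v * \<eta> v))"
    then have q: "q \<in> Poly 2" "\<And>\<eta>. \<eta> \<in> Poly 2 \<Longrightarrow> A_loc (region K) q \<eta> = A_loc (region K) \<phi> \<eta>"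
      "\<And>\<eta>. \<eta> \<in> Poly 1 \<Longrightarrow> (\<Sum>v\<in>set K. q v * \<eta> v) = (\<Sum>v\<in>set K. vval K \<phi> v * \<eta> v)" by auto
    let ?e = "\<lambda>x. (-1) * p x + q x"
    have e: "?e \<in> Poly 2" using lin_space_comb[OF lin_space_Poly p q(1)] .
    have "A_loc (region K) ?e ?e = 0"
      using A_loc_lincomb[OF Poly_H2[OF p] Poly_H2[OF q(1)] Poly_H2[OF e], of "-1"] Ap[OF e] q(2)[OF e] by simp
    then have e1: "?e \<in> Poly 1" by (rule A_loc_zero_Poly_1[OF e])
    have "(\<Sum>v\<in>set K. ?e v * f v) = (\<Sum>v\<in>set K. q v * f v) - (\<Sum>v\<in>set K. p v * f v)" for f
      by (simp add: left_diff_distrib sum_subtractf)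
    then have "(\<Sum>v\<in>set K. ?e v * ?e v) = 0"
      using vp[OF e1] q(3)[OF e1] by simp
    then have "?e = (\<lambda>x. 0)" using definite[OF e1] by blast
    then show "q = p" by (auto simp: fun_eq_iff)
  qed (use p Ap vp in blast)
qed

lemma Pi_D_spec:
  assumes "\<phi> \<in> H2 (region K)"
  shows "Pi_D K \<phi> \<in> Poly 2"
    and "\<And>\<eta>. \<eta> \<in> Poly 2 \<Longrightarrow> A_loc (region K) (Pi_D K \<phi>) \<eta> = A_loc (region K) \<phi> \<eta>"
    and "\<And>\<eta>. \<eta> \<in> Poly 1 \<Longrightarrow> (\<Sum>v\<in>set K. Pi_D K \<phi> v * \<eta> v) = (\<Sum>v\<in>set K. vval K \<phi> v * \<eta> v)"
  using theI'[OF ex1_Pi_D[OF assms], folded Pi_D_def] by auto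

lemma Pi_D_eqI:
  assumes "\<phi> \<in> H2 (region K)" "p \<in> Poly 2"
    and "\<And>\<eta>. \<eta> \<in> Poly 2 \<Longrightarrow> A_loc (region K) p \<eta> = A_loc (region K) \<phi> \<eta>"
    and "\<And>\<eta>. \<eta> \<in> Poly 1 \<Longrightarrow> (\<Sum>v\<in>set K. p v * \<eta> v) = (\<Sum>v\<in>set K. vval K \<phi> v * \<eta> v)"
  shows "Pi_D K \<phi> = p"
  unfolding Pi_D_def by (rule the1_equality[OF ex1_Pi_D[OF assms(1)]]) (use assms in blast)

text \<open>Linearity of the vertex values is an assumption here, since \<open>vval\<close> is a
  limit and respects sums once the limits are known to exist.\<close>

lemma Pi_D_lincomb:
  assumes \<phi>: "\<phi> \<in> H2 (region K)" and \<psi>: "\<psi> \<in> H2 (region K)"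
    and v: "\<And>v. v \<in> set K \<Longrightarrow> vval K (\<lambda>x. a * \<phi> x + \<psi> x) v = a * vval K \<phi> v + vval K \<psi> v"
  shows "Pi_D K (\<lambda>x. a * \<phi> x + \<psi> x) = (\<lambda>x. a * Pi_D K \<phi> x + Pi_D K \<psi> x)"
proof (rule Pi_D_eqI)
  show "(\<lambda>x. a * \<phi> x + \<psi> x) \<in> H2 (region K)" using \<phi> \<psi> by (rule H2_lincomb)
  show "(\<lambda>x. a * Pi_D K \<phi> x + Pi_D K \<psi> x) \<in> Poly 2"
    using lin_space_comb[OF lin_space_Poly] Pi_D_spec(1)[OF \<phi>] Pi_D_spec(1)[OF \<psi>] by blast
  fix \<eta> :: "point \<Rightarrow> real" assume \<eta>: "\<eta> \<in> Poly 2"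
  show "A_loc (region K) (\<lambda>x. a * Pi_D K \<phi> x + Pi_D K \<psi> x) \<eta> = A_loc (region K) (\<lambda>x. a * \<phi> x + \<psi> x) \<eta>"
    using A_loc_lincomb[OF Poly_H2 Poly_H2 Poly_H2, OF Pi_D_spec(1)[OF \<phi>] Pi_D_spec(1)[OF \<psi>] \<eta>]
      A_loc_lincomb[OF \<phi> \<psi> Poly_H2[OF \<eta>]] Pi_D_spec(2)[OF \<phi> \<eta>] Pi_D_spec(2)[OF \<psi> \<eta>] by simp
next
  fix \<eta> :: "point \<Rightarrow> real" assume \<eta>: "\<eta> \<in> Poly 1"
  have "(\<Sum>v\<in>set K. (a * Pi_D K \<phi> v + Pi_D K \<psi> v) * \<eta> v)
    = a * (\<Sum>v\<in>set K. Pi_D K \<phi> v * \<eta> v) + (\<Sum>v\<in>set K. Pi_D K \<psi> v * \<eta> v)"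
    by (simp add: sum_distrib_left sum.distrib algebra_simps)
  also have "\<dots> = a * (\<Sum>v\<in>set K. vval K \<phi> v * \<eta> v) + (\<Sum>v\<in>set K. vval K \<psi> v * \<eta> v)"
    using Pi_D_spec(3)[OF \<phi> \<eta>] Pi_D_spec(3)[OF \<psi> \<eta>] by simp
  also have "\<dots> = (\<Sum>v\<in>set K. (a * vval K \<phi> v + vval K \<psi> v) * \<eta> v)"
    by (simp add: sum_distrib_left sum.distrib algebra_simps)
  also have "\<dots> = (\<Sum>v\<in>set K. vval K (\<lambda>x. a * \<phi> x + \<psi> x) v * \<eta> v)"
    using v by (intro sum.cong) auto
  finally show "(\<Sum>v\<in>set K. (a * Pi_D K \<phi> v + Pi_D K \<psi> v) * \<eta> v)
    = (\<Sum>v\<in>set K. vval K (\<lambda>x. a * \<phi> x + \<psi> x) v * \<eta> v)" .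
qed

lemma Pi_D_Poly:
  assumes p: "p \<in> Poly 2" and u: "u \<in> H2 (region K)" "\<And>x. x \<in> region K \<Longrightarrow> u x = p x"
    and v: "\<And>v. v \<in> set K \<Longrightarrow> vval K u v = p v"
  shows "Pi_D K u = p"
proof (rule Pi_D_eqI[OF u(1) p])
  have "wd (region K) i p = wd (region K) i u" for i using u(2) by (intro wd_local) simp
  then show "A_loc (region K) p \<eta> = A_loc (region K) u \<eta>" for \<eta> by (simp add: A_loc_def)
  show "(\<Sum>v\<in>set K. p v * \<eta> v) = (\<Sum>v\<in>set K. vval K u v * \<eta> v)" for \<eta>
    using v by (intro sum.cong) auto
qed

section \<open>The gradient projection of vector fields in closed form\<close>

definition bd_int :: "(point \<Rightarrow> real) \<Rightarrow> real" where
  "bd_int g = (\<Sum>k<length K. edge_int (vtx K k) (vtx K (Suc k)) g)"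

definition perimeter :: real where "perimeter = bd_int (\<lambda>x. 1)"

lemma perimeter_pos: "perimeter > 0"
proof -
  have e: "edge_int a b (\<lambda>x. 1) = dist a b" for a b :: point
    by (simp add: edge_int_lebesgue_on measure_restrict_space space_restrict_space)
  have K: "0 < length K" using simple_polygon_length[OF simple] by linarith
  show ?thesis unfolding perimeter_def bd_int_def e
    by (rule sum_pos2[of _ 0]) (use K vtx_Suc_neq[OF simple K] in auto)
qed

lemma bd_int_lincomb:
  assumes "\<And>a b. (a, b) \<in> edges K \<Longrightarrow> L2_on unit_lebesgue (\<lambda>t. g (linepath a b t))"
    and "\<And>a b. (a, b) \<in> edges K \<Longrightarrow> L2_on unit_lebesgue (\<lambda>t. h (linepath a b t))"
  shows "bd_int (\<lambda>x. s * g x + h x) = s * bd_int g + bd_int h"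
proof -
  interpret finite_measure unit_lebesgue by (rule finite_measure_unit)
  have "edge_int a b (\<lambda>x. s * g x + h x) = s * edge_int a b g + edge_int a b h" if "(a, b) \<in> edges K" for a b
    using L2_on_integrable[OF assms(1)[OF that]] L2_on_integrable[OF assms(2)[OF that]]
    by (simp add: edge_int_lebesgue_on algebra_simps)
  then show ?thesis unfolding bd_int_def
    by (simp add: edgesI sum_distrib_left sum.distrib)
qed

definition grad_mean :: "(point \<Rightarrow> real) \<Rightarrow> point" where
  "grad_mean u = (\<chi> j. (\<integral>x. wd (region K) j u x \<partial>\<mu>) / area)"

text \<open>One component of \<open>Pi_nabla\<close>: the affine function whose gradient is the mean
  gradient of u and whose boundary mean is that of the trace g.\<close>

definition nabla_proj :: "(point \<Rightarrow> real) \<Rightarrow> (point \<Rightarrow> real) \<Rightarrow> point \<Rightarrow> real" where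
  "nabla_proj u g x = grad_mean u \<bullet> x + (bd_int g - bd_int (\<lambda>x. grad_mean u \<bullet> x)) / perimeter"

text \<open>For affine fields the orthogonality condition reads area times the product of the
  gradient error with an arbitrary matrix, and the boundary condition is one linear equation for
  each constant. From the closed form, linearity can be read off.\<close>

lemma Pi_nabla_eq:
  assumes v: "\<And>i. (\<lambda>x. v x $ i) \<in> H1 (region K)"
    and g: "\<And>a b i. (a, b) \<in> edges K \<Longrightarrow> L2_on unit_lebesgue (\<lambda>t. g (linepath a b t) $ i)"
  shows "Pi_nabla K v g = (\<lambda>x. \<chi> i. nabla_proj (\<lambda>x. v x $ i) (\<lambda>x. g x $ i) x)"
proof -
  interpret F: finite_measure \<mu> by (rule finite_measure_U)
  let ?M = "\<lambda>i. grad_mean (\<lambda>x. v x $ i)"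
  have aff: "L2_on unit_lebesgue (\<lambda>t. n \<bullet> linepath a b t + d)" for n :: point and d a b
    using smooth_edge_L2[OF smooth_affine[of n d]] .
  have c1: "(LINT x:region K|lebesgue. (\<Sum>i\<in>UNIV. \<Sum>j\<in>UNIV.
        (wd (region K) j (\<lambda>y. N i \<bullet> y + d i) x - wd (region K) j (\<lambda>y. v y $ i) x)
        * wd (region K) j (\<lambda>y. L i \<bullet> y + e i) x))
      = (\<Sum>i\<in>UNIV. \<Sum>j\<in>UNIV. area * (N i $ j - ?M i $ j) * L i $ j)" for N L :: "2 \<Rightarrow> point" and d e :: "2 \<Rightarrow> real"
  proof -
    have w: "AE x in \<mu>. wd (region K) j (\<lambda>y. n \<bullet> y + d) x = n $ j" for n d j
      using smooth_wd[OF smooth_affine, of j n d] by (simp add: pd_affine)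
    have L2: "L2_on \<mu> (wd (region K) j (\<lambda>y. n \<bullet> y + d))" for n d j
      by (intro wd_L2 smooth_H1 smooth_affine)
    have "(\<integral>x. (wd (region K) j (\<lambda>y. N i \<bullet> y + d i) x - wd (region K) j (\<lambda>y. v y $ i) x)
        * wd (region K) j (\<lambda>y. L i \<bullet> y + e i) x \<partial>\<mu>) = area * (N i $ j - ?M i $ j) * L i $ j" for i j
    proof -
      have "(\<integral>x. (wd (region K) j (\<lambda>y. N i \<bullet> y + d i) x - wd (region K) j (\<lambda>y. v y $ i) x)
        * wd (region K) j (\<lambda>y. L i \<bullet> y + e i) x \<partial>\<mu>) = (\<integral>x. (N i $ j - wd (region K) j (\<lambda>y. v y $ i) x) * L i $ j \<partial>\<mu>)"
      proof (rule integral_cong_AE)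
        show "AE x in \<mu>. (wd (region K) j (\<lambda>y. N i \<bullet> y + d i) x - wd (region K) j (\<lambda>y. v y $ i) x)
          * wd (region K) j (\<lambda>y. L i \<bullet> y + e i) x = (N i $ j - wd (region K) j (\<lambda>y. v y $ i) x) * L i $ j"
          using w[of j "N i" "d i"] w[of j "L i" "e i"] by eventually_elim simp
      qed (intro borel_measurable_times borel_measurable_diff borel_measurable_const L2_on_measurable L2 wd_L2 v)+
      also have "\<dots> = (N i $ j * area - (\<integral>x. wd (region K) j (\<lambda>y. v y $ i) x \<partial>\<mu>)) * L i $ j"
        using F.L2_on_integrable[OF wd_L2[OF v]]
        by (simp add: Bochner_Integration.integral_diff F.integrable_const measure_region)
      also have "\<dots> = area * (N i $ j - ?M i $ j) * L i $ j"
        using area_pos by (simp add: grad_mean_def right_diff_distrib mult.commute)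
      finally show ?thesis .
    qed
    moreover have "integrable \<mu> (\<lambda>x. (wd (region K) j (\<lambda>y. N i \<bullet> y + d i) x - wd (region K) j (\<lambda>y. v y $ i) x)
        * wd (region K) j (\<lambda>y. L i \<bullet> y + e i) x)" for i j
      by (intro L2_on_integrable_mult L2_on_diff L2 wd_L2 v)
    ultimately show ?thesis unfolding LINT_U
      by (simp add: Bochner_Integration.integral_sum Bochner_Integration.integrable_sum)
  qed
  have c2: "(\<Sum>k<length K. edge_int (vtx K k) (vtx K (Suc k)) (\<lambda>x. (n \<bullet> x + d) - g x $ i))
     = bd_int (\<lambda>x. n \<bullet> x) + d * perimeter - bd_int (\<lambda>x. g x $ i)" for n d i
  proof -
    have "bd_int (\<lambda>x. (-1) * g x $ i + (n \<bullet> x + d)) = (-1) * bd_int (\<lambda>x. g x $ i) + bd_int (\<lambda>x. n \<bullet> x + d)"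
      using g aff by (intro bd_int_lincomb) auto
    moreover have "bd_int (\<lambda>x. d * 1 + n \<bullet> x) = d * perimeter + bd_int (\<lambda>x. n \<bullet> x)"
      unfolding perimeter_def using aff[where n = 0 and d = 1] aff[where n = n and d = 0] by (intro bd_int_lincomb) auto
    ultimately show ?thesis by (simp add: bd_int_def add.commute)
  qed
  have V: "p \<in> VPoly 1 \<longleftrightarrow> (\<exists>N d. p = (\<lambda>x. \<chi> i. N i \<bullet> x + d i))" for p
  proof
    assume "p \<in> VPoly 1"
    then have "\<forall>i. \<exists>n d. (\<lambda>x. p x $ i) = (\<lambda>x. n \<bullet> x + d)" unfolding VPoly_def Poly_1_iff by blast
    then obtain N d where "\<And>i. (\<lambda>x. p x $ i) = (\<lambda>x. N i \<bullet> x + d i)" by metis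
    then have "p = (\<lambda>x. \<chi> i. N i \<bullet> x + d i)" by (simp add: vec_eq_iff fun_eq_iff)
    then show "\<exists>N d. p = (\<lambda>x. \<chi> i. N i \<bullet> x + d i)" by blast
  next
    assume "\<exists>N d. p = (\<lambda>x. \<chi> i. N i \<bullet> x + d i)"
    then obtain N d where "p = (\<lambda>x. \<chi> i. N i \<bullet> x + d i)" by blast
    then have "(\<lambda>x. p x $ i) = (\<lambda>x. N i \<bullet> x + d i)" for i by simp
    then show "p \<in> VPoly 1" unfolding VPoly_def Poly_1_iff by blast
  qed
  define P where "P = (\<lambda>x. \<chi> i. nabla_proj (\<lambda>x. v x $ i) (\<lambda>x. g x $ i) x)"
  show ?thesis
    unfolding Pi_nabla_def P_def[symmetric]
  proof (rule the_equality)
    let ?d = "\<lambda>i. (bd_int (\<lambda>x. g x $ i) - bd_int (\<lambda>x. ?M i \<bullet> x)) / perimeter"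
    have pe: "P = (\<lambda>x. \<chi> i. ?M i \<bullet> x + ?d i)" by (simp add: P_def nabla_proj_def)
    show "P \<in> VPoly 1 \<and>
     (\<forall>\<eta>\<in>VPoly 1. (LINT x:region K|lebesgue. (\<Sum>i\<in>UNIV. \<Sum>j\<in>UNIV.
        (wd (region K) j (\<lambda>y. P y $ i) x - wd (region K) j (\<lambda>y. v y $ i) x)
        * wd (region K) j (\<lambda>y. \<eta> y $ i) x)) = 0) \<and>
     (\<forall>i. (\<Sum>k<length K. edge_int (vtx K k) (vtx K (Suc k)) (\<lambda>x. P x $ i - g x $ i)) = 0)"
      unfolding pe
    proof (intro conjI ballI allI)
      show "(\<lambda>x. \<chi> i. ?M i \<bullet> x + ?d i) \<in> VPoly 1" unfolding V by (intro exI[of _ ?M] exI[of _ ?d]) simp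
      fix \<eta> assume "\<eta> \<in> VPoly 1"
      then obtain L e where "\<eta> = (\<lambda>x. \<chi> i. L i \<bullet> x + e i)" unfolding V by blast
      then show "(LINT x:region K|lebesgue. (\<Sum>i\<in>UNIV. \<Sum>j\<in>UNIV.
        (wd (region K) j (\<lambda>y. (\<chi> i. ?M i \<bullet> y + ?d i) $ i) x - wd (region K) j (\<lambda>y. v y $ i) x)
        * wd (region K) j (\<lambda>y. \<eta> y $ i) x)) = 0"
        using c1[of ?M ?d L e] by simp
    next
      fix i
      show "(\<Sum>k<length K. edge_int (vtx K k) (vtx K (Suc k)) (\<lambda>x. (\<chi> i. ?M i \<bullet> x + ?d i) $ i - g x $ i)) = 0"
        using c2[of "?M i" "?d i" i] perimeter_pos by simp
    qed
    fix p assume p: "p \<in> VPoly 1 \<and>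
     (\<forall>\<eta>\<in>VPoly 1. (LINT x:region K|lebesgue. (\<Sum>i\<in>UNIV. \<Sum>j\<in>UNIV.
        (wd (region K) j (\<lambda>y. p y $ i) x - wd (region K) j (\<lambda>y. v y $ i) x)
        * wd (region K) j (\<lambda>y. \<eta> y $ i) x)) = 0) \<and>
     (\<forall>i. (\<Sum>k<length K. edge_int (vtx K k) (vtx K (Suc k)) (\<lambda>x. p x $ i - g x $ i)) = 0)"
    then obtain N d where pN: "p = (\<lambda>x. \<chi> i. N i \<bullet> x + d i)" unfolding V by blast
    \<comment> \<open>The test field has the gradient error itself as gradient, which turns the
      condition into a sum of squares.\<close>
    let ?\<eta> = "\<lambda>x. \<chi> i. (N i - ?M i) \<bullet> x + 0"
    have "?\<eta> \<in> VPoly 1" unfolding V by (intro exI[of _ "\<lambda>i. N i - ?M i"] exI[of _ "\<lambda>i. 0"]) simp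
    then have "(\<Sum>i\<in>UNIV. \<Sum>j\<in>UNIV. area * (N i $ j - ?M i $ j) * (N i - ?M i) $ j) = 0"
      using p c1[of N d "\<lambda>i. N i - ?M i" "\<lambda>i. 0"] unfolding pN by fastforce
    then have z: "(\<Sum>i\<in>UNIV. \<Sum>j\<in>UNIV. area * ((N i $ j - ?M i $ j) * (N i $ j - ?M i $ j))) = 0"
      by (simp add: mult.assoc)
    have "N i $ j = ?M i $ j" for i j
    proof -
      have "(\<Sum>j\<in>UNIV. area * ((N i $ j - ?M i $ j) * (N i $ j - ?M i $ j))) = 0"
        using z area_pos by (subst (asm) sum_nonneg_eq_0_iff) (auto intro!: sum_nonneg)
      then have "area * ((N i $ j - ?M i $ j) * (N i $ j - ?M i $ j)) = 0"
        using area_pos by (subst (asm) sum_nonneg_eq_0_iff) auto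
      then show ?thesis using area_pos by simp
    qed
    then have NM: "N i = ?M i" for i by (simp add: vec_eq_iff)
    have "d i = ?d i" for i
    proof -
      have "(\<Sum>k<length K. edge_int (vtx K k) (vtx K (Suc k)) (\<lambda>x. (N i \<bullet> x + d i) - g x $ i)) = 0"
        using p unfolding pN by simp
      then have "d i * perimeter = bd_int (\<lambda>x. g x $ i) - bd_int (\<lambda>x. ?M i \<bullet> x)"
        unfolding c2 NM by simp
      then show ?thesis using perimeter_pos by (simp add: field_simps)
    qed
    then show "p = P" unfolding pe pN NM by simp
  qed
qed

lemma nabla_proj_lincomb:
  assumes u: "u \<in> H1 (region K)" "u' \<in> H1 (region K)" and w: "w \<in> H1 (region K)" "AE x in \<mu>. w x = a * u x + u' x"
    and g: "\<And>a b. (a, b) \<in> edges K \<Longrightarrow> L2_on unit_lebesgue (\<lambda>t. g (linepath a b t))"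
    and h: "\<And>a b. (a, b) \<in> edges K \<Longrightarrow> L2_on unit_lebesgue (\<lambda>t. h (linepath a b t))"
  shows "nabla_proj w (\<lambda>x. a * g x + h x) x = a * nabla_proj u g x + nabla_proj u' h x"
proof -
  interpret F: finite_measure \<mu> by (rule finite_measure_U)
  have gm: "grad_mean w = a *\<^sub>R grad_mean u + grad_mean u'"
  proof -
    have "(\<integral>x. wd (region K) j w x \<partial>\<mu>) = a * (\<integral>x. wd (region K) j u x \<partial>\<mu>) + (\<integral>x. wd (region K) j u' x \<partial>\<mu>)" for j
    proof -
      have e: "wd (region K) j w = wd (region K) j (\<lambda>x. a * u x + u' x)"
        using u w by (intro wd_cong_AE L2_on_lincomb H1_L2)
      have "(\<integral>x. wd (region K) j w x \<partial>\<mu>) = (\<integral>x. a * wd (region K) j u x + wd (region K) j u' x \<partial>\<mu>)"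
        unfolding e using u by (intro integral_cong_AE wd_lincomb L2_on_measurable L2_on_lincomb wd_L2 H1_lincomb)
      then show ?thesis using F.L2_on_integrable[OF wd_L2[OF u(1)]] F.L2_on_integrable[OF wd_L2[OF u(2)]] by simp
    qed
    then show ?thesis by (simp add: grad_mean_def vec_eq_iff add_divide_distrib)
  qed
  have lin: "L2_on unit_lebesgue (\<lambda>t. n \<bullet> linepath a b t)" for n :: point and a b
    using smooth_edge_L2[OF smooth_affine[of n 0]] by simp
  have "bd_int (\<lambda>x. grad_mean w \<bullet> x) = a * bd_int (\<lambda>x. grad_mean u \<bullet> x) + bd_int (\<lambda>x. grad_mean u' \<bullet> x)"
    unfolding gm inner_add_left inner_scaleR_left using lin by (intro bd_int_lincomb)
  moreover have "bd_int (\<lambda>x. a * g x + h x) = a * bd_int g + bd_int h" using g h by (rule bd_int_lincomb)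
  ultimately have "nabla_proj w (\<lambda>x. a * g x + h x) x = (a *\<^sub>R grad_mean u + grad_mean u') \<bullet> x
    + (a * bd_int g + bd_int h - (a * bd_int (\<lambda>x. grad_mean u \<bullet> x) + bd_int (\<lambda>x. grad_mean u' \<bullet> x))) / perimeter"
    unfolding nabla_proj_def gm[symmetric] by simp
  also have "\<dots> = a * nabla_proj u g x + nabla_proj u' h x"
    unfolding nabla_proj_def using perimeter_pos by (simp add: inner_simps field_simps)
  finally show ?thesis .
qed

end

section \<open>The local virtual element space\<close>

lemma edge_int_open_cong:
  assumes ab: "a \<noteq> b" and eq: "\<And>x. x \<in> open_segment a b \<Longrightarrow> f x = g x"
  shows "edge_int a b f = edge_int a b g"
proof -
  have "(\<integral>t. indicator {0..1} t *\<^sub>R f (linepath a b t) \<partial>lebesgue) = (\<integral>t. indicator {0..1} t *\<^sub>R g (linepath a b t) \<partial>lebesgue)"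
  proof (rule integral_discrete_difference[of "{0,1}"])
    fix t :: real assume "t \<notin> {0, 1}"
    then show "indicator {0..1} t *\<^sub>R f (linepath a b t) = indicator {0..1} t *\<^sub>R g (linepath a b t)"
      using eq[OF linepath_open_segment[OF _ _ ab, of t]] by (auto simp: indicator_def)
  qed auto
  then show ?thesis by (simp add: edge_int_def set_lebesgue_integral_def)
qed

lemma edge_int_lincomb:
  assumes "L2_on unit_lebesgue (\<lambda>t. f (linepath a b t))" "L2_on unit_lebesgue (\<lambda>t. h (linepath a b t))"
  shows "edge_int a b (\<lambda>x. s * f x + h x) = s * edge_int a b f + edge_int a b h"
proof -
  interpret finite_measure unit_lebesgue by (rule finite_measure_unit)
  show ?thesis using L2_on_integrable[OF assms(1)] L2_on_integrable[OF assms(2)]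
    by (simp add: edge_int_lebesgue_on algebra_simps)
qed

lemma L2_edge_inner:
  assumes "\<And>i. L2_on unit_lebesgue (\<lambda>t. g (linepath a b t) $ i)"
  shows "L2_on unit_lebesgue (\<lambda>t. g (linepath a b t) \<bullet> (n :: point))"
  unfolding inner_2 using L2_on_add[OF L2_on_scale[OF assms, of "n $ 1" 1] L2_on_scale[OF assms, of "n $ 2" 2]]
  by (simp add: mult.commute)

lemma wcurl_nth [simp]: "wcurl U u x $ 1 = wd U 2 u x" "wcurl U u x $ 2 = - wd U 1 u x"
  by (simp_all add: wcurl_def vector_2)

lemma wgrad_nth [simp]: "wgrad U u x $ i = wd U i u x"
  by (simp add: wgrad_def)

context star_polygon
begin

section \<open>Vertex values and locality on the element\<close>

abbreviation "R \<equiv> region K"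

lemma vertex_frontier: "v \<in> set K \<Longrightarrow> v \<in> frontier R"
  using in_set_vtx[of v K] seg_frontier by auto

lemma vertex_nontrivial: "v \<in> set K \<Longrightarrow> at v within R \<noteq> bot"
  using vertex_frontier[of v] frontier_not_R frontier_closure
  by (auto simp: trivial_limit_within closure_def)

lemma vval_eqI: "v \<in> set K \<Longrightarrow> (\<phi> \<longlongrightarrow> l) (at v within R) \<Longrightarrow> vval K \<phi> v = l"
  unfolding vval_def using vertex_nontrivial by (intro tendsto_Lim) auto

text \<open>Uniform continuity extends \<phi> continuously to the closure of the element, so the
  limit at a vertex exists and \<open>Lim\<close> returns it.\<close>

lemma vval_tendsto:
  assumes "uniformly_continuous_on R \<phi>" "v \<in> set K"
  shows "(\<phi> \<longlongrightarrow> vval K \<phi> v) (at v within R)"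
proof -
  obtain g where g: "uniformly_continuous_on (closure R) g" "\<And>x. x \<in> R \<Longrightarrow> \<phi> x = g x"
    using uniformly_continuous_on_extension_on_closure[OF assms(1)] by metis
  have "v \<in> closure R" using vertex_frontier[OF assms(2)] frontier_closure by blast
  then have "(g \<longlongrightarrow> g v) (at v within closure R)"
    using uniformly_continuous_imp_continuous[OF g(1)] by (simp add: continuous_on_def)
  then have "(g \<longlongrightarrow> g v) (at v within R)" by (rule tendsto_within_subset) (rule closure_subset)
  then have "(\<phi> \<longlongrightarrow> g v) (at v within R)"
    by (rule Lim_transform_eventually) (auto simp: eventually_at_filter g(2))
  then show ?thesis using vval_eqI[OF assms(2)] by simp
qed

lemma vval_lincomb:
  assumes "uniformly_continuous_on R \<phi>" "uniformly_continuous_on R \<psi>" "v \<in> set K"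
  shows "vval K (\<lambda>x. a * \<phi> x + \<psi> x) v = a * vval K \<phi> v + vval K \<psi> v"
  using assms by (intro vval_eqI tendsto_intros vval_tendsto)

lemma vval_continuous:
  assumes "continuous_on UNIV p" "\<And>x. x \<in> R \<Longrightarrow> u x = p x" "v \<in> set K"
  shows "vval K u v = p v"
proof (rule vval_eqI[OF assms(3)])
  have "(p \<longlongrightarrow> p v) (at v within R)"
    by (rule tendsto_within_subset[OF _ subset_UNIV]) (use assms(1) in \<open>simp add: continuous_on_def\<close>)
  then show "(u \<longlongrightarrow> p v) (at v within R)"
    by (rule Lim_transform_eventually) (auto simp: eventually_at_filter assms(2))
qed

lemma vval_local:
  assumes "\<And>x. x \<in> R \<Longrightarrow> u x = w x" shows "vval K u v = vval K w v"
proof -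
  have "(u \<longlongrightarrow> l) (at v within R) \<longleftrightarrow> (w \<longlongrightarrow> l) (at v within R)" for l
    by (rule tendsto_cong) (auto simp: eventually_at_filter assms)
  then show ?thesis by (simp add: vval_def Topological_Spaces.Lim_def)
qed

lemma L2_local: "L2_on \<mu> v \<Longrightarrow> (\<And>x. x \<in> R \<Longrightarrow> u x = v x) \<Longrightarrow> L2_on \<mu> u"
proof -
  assume v: "L2_on \<mu> v" and eq: "\<And>x. x \<in> R \<Longrightarrow> u x = v x"
  have "u \<in> borel_measurable \<mu>"
    by (rule measurable_cong[THEN iffD2, OF _ L2_on_measurable[OF v]]) (simp add: space_restrict_space eq)
  then show "L2_on \<mu> u" by (rule L2_on_cong_AE[OF v]) (intro AE_I2, simp add: space_restrict_space eq)
qed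

lemma AE_local: "(\<And>x. x \<in> R \<Longrightarrow> P x) \<Longrightarrow> AE x in \<mu>. P x"
  by (intro AE_I2) (simp add: space_restrict_space)

lemma H2_local: assumes v: "v \<in> H2 R" and eq: "\<And>x. x \<in> R \<Longrightarrow> u x = v x" shows "u \<in> H2 R"
proof -
  have "u \<in> H1 R"
    by (rule H1_cong_AE[OF H2_H1(1)[OF v]])
      (auto intro!: AE_local L2_local[OF H1_L2[OF H2_H1(1)[OF v]]] simp: eq)
  moreover have "wd R i u = wd R i v" for i using eq by (rule wd_local)
  ultimately show ?thesis using v by (simp add: H2_def)
qed

lemma restr_eq: "x \<in> R \<Longrightarrow> restr K \<phi> x = \<phi> x"
  by (simp add: restr_def)

lemma restr_lincomb: "restr K (\<lambda>x. a * \<phi> x + \<psi> x) = (\<lambda>x. a * restr K \<phi> x + restr K \<psi> x)"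
  by (auto simp: restr_def)

lemma wd_restr: "wd R i (restr K \<phi>) = wd R i \<phi>"
  by (rule wd_local) (simp add: restr_def)

lemma vval_restr: "vval K (restr K \<phi>) v = vval K \<phi> v"
  by (rule vval_local) (simp add: restr_def)

lemma A_loc_restr: "A_loc R (restr K \<phi>) \<eta> = A_loc R \<phi> \<eta>"
  by (simp add: A_loc_def wd_restr)

lemma Pi_D_restr: "Pi_D K (restr K \<phi>) = Pi_D K \<phi>"
  by (simp add: Pi_D_def A_loc_restr vval_restr)

lemma H2_repD: "\<phi> \<in> H2_rep K \<Longrightarrow> \<phi> \<in> H2 R \<and> uniformly_continuous_on R \<phi> \<and> restr K \<phi> = \<phi>"
  by (simp add: H2_rep_def)

lemma H2_rep_lincomb: "\<phi> \<in> H2_rep K \<Longrightarrow> \<psi> \<in> H2_rep K \<Longrightarrow> (\<lambda>x. a * \<phi> x + \<psi> x) \<in> H2_rep K"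
  unfolding H2_rep_def
  by (auto simp: restr_lincomb intro!: H2_lincomb uniformly_continuous_on_add uniformly_continuous_on_cmul_left)

lemma wlap_L2: "\<phi> \<in> H2 R \<Longrightarrow> L2_on \<mu> (wlap R \<phi>)"
  unfolding wlap_def[abs_def] by (intro L2_on_sum wd2_L2)

lemma wlap_lincomb:
  assumes "\<phi> \<in> H2 R" "\<psi> \<in> H2 R"
  shows "AE x in \<mu>. wlap R (\<lambda>x. a * \<phi> x + \<psi> x) x = a * wlap R \<phi> x + wlap R \<psi> x"
  using wd2_lincomb[OF assms, of 1 1 a] wd2_lincomb[OF assms, of 2 2 a]
  by eventually_elim (simp add: wlap_def sum_2 algebra_simps)

lemma integral_mult_AE_lincomb:
  assumes "L2_on \<mu> u" "L2_on \<mu> v" "L2_on \<mu> w" "L2_on \<mu> f" "AE x in \<mu>. w x = a * u x + v x"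
  shows "(\<integral>x. w x * f x \<partial>\<mu>) = a * (\<integral>x. u x * f x \<partial>\<mu>) + (\<integral>x. v x * f x \<partial>\<mu>)"
proof -
  have "(\<integral>x. w x * f x \<partial>\<mu>) = (\<integral>x. (a * u x + v x) * f x \<partial>\<mu>)"
  proof (rule integral_cong_AE)
    show "AE x in \<mu>. w x * f x = (a * u x + v x) * f x" using assms(5) by eventually_elim simp
  qed (intro borel_measurable_times L2_on_measurable L2_on_lincomb assms)+
  then show ?thesis using integral_lincomb_mult[OF assms(1,2,4)] by simp
qed

lemma smooth_laplacian: "smooth \<eta> \<Longrightarrow> smooth (\<lambda>x. \<Sum>i\<in>UNIV. pd i (pd i \<eta>) x)"
  by (intro smooth_sum smooth_pd)

lemma has_bilap_lincomb:
  assumes "\<phi> \<in> H2 R" "\<psi> \<in> H2 R" "has_bilap K \<phi> p" "has_bilap K \<psi> q" "p \<in> Poly 2" "q \<in> Poly 2"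
  shows "has_bilap K (\<lambda>x. a * \<phi> x + \<psi> x) (\<lambda>x. a * p x + q x)"
  unfolding has_bilap_def LINT_U
proof (intro allI impI)
  fix \<eta> assume \<eta>: "test_function R \<eta>"
  have s: "smooth \<eta>" using \<eta> by (simp add: test_function_def)
  have "(\<integral>x. wlap R (\<lambda>x. a * \<phi> x + \<psi> x) x * (\<Sum>i\<in>UNIV. pd i (pd i \<eta>) x) \<partial>\<mu>)
    = a * (\<integral>x. wlap R \<phi> x * (\<Sum>i\<in>UNIV. pd i (pd i \<eta>) x) \<partial>\<mu>) + (\<integral>x. wlap R \<psi> x * (\<Sum>i\<in>UNIV. pd i (pd i \<eta>) x) \<partial>\<mu>)"
    by (intro integral_mult_AE_lincomb wlap_L2 wlap_lincomb H2_lincomb assms smooth_L2 smooth_laplacian s)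
  also have "\<dots> = (\<integral>x. (a * p x + q x) * \<eta> x \<partial>\<mu>)"
    using assms \<eta> by (simp add: has_bilap_def LINT_U integral_lincomb_mult Poly_L2 smooth_L2[OF s])
  finally show "(\<integral>x. wlap R (\<lambda>x. a * \<phi> x + \<psi> x) x * (\<Sum>i\<in>UNIV. pd i (pd i \<eta>) x) \<partial>\<mu>) = (\<integral>x. (a * p x + q x) * \<eta> x \<partial>\<mu>)" .
qed

definition edge_const :: "(point \<Rightarrow> real) \<Rightarrow> (nat \<Rightarrow> real) \<Rightarrow> bool" where
  "edge_const g C \<longleftrightarrow> (\<forall>k<length K. \<forall>x\<in>open_segment (vtx K k) (vtx K (Suc k)). g x = C k)"

text \<open>Edgewise constant values leave the edge integrals, the end points being a null set. The
  boundary term becomes linear in the constants, and products of two unknown traces no longer have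
  to be integrated.\<close>

lemma weak_trace_const_iff:
  assumes C: "edge_const g C"
  shows "has_weak_trace K w q g \<longleftrightarrow>
    (\<forall>\<eta> \<gamma>. \<eta> \<in> H2 R \<and> has_trace K \<eta> (\<lambda>x. 0) \<and> has_vtrace K (wgrad R \<eta>) \<gamma> \<longrightarrow>
        (\<integral>x. w x * wlap R \<eta> x - \<eta> x * q x \<partial>\<mu>)
        = (\<Sum>k<length K. C k * edge_int (vtx K k) (vtx K (Suc k)) (\<lambda>x. \<gamma> x \<bullet> outer_normal K (vtx K k) (vtx K (Suc k)))))"
proof -
  have "(\<Sum>k<length K. edge_int (vtx K k) (vtx K (Suc k)) (\<lambda>x. g x * (\<gamma> x \<bullet> outer_normal K (vtx K k) (vtx K (Suc k)))))
    = (\<Sum>k<length K. C k * edge_int (vtx K k) (vtx K (Suc k)) (\<lambda>x. \<gamma> x \<bullet> outer_normal K (vtx K k) (vtx K (Suc k))))" for \<gamma>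
  proof (intro sum.cong refl)
    fix k assume k: "k \<in> {..<length K}"
    have "edge_int (vtx K k) (vtx K (Suc k)) (\<lambda>x. g x * (\<gamma> x \<bullet> outer_normal K (vtx K k) (vtx K (Suc k))))
      = edge_int (vtx K k) (vtx K (Suc k)) (\<lambda>x. C k * (\<gamma> x \<bullet> outer_normal K (vtx K k) (vtx K (Suc k))))"
      using C k vtx_Suc_neq[OF simple] by (intro edge_int_open_cong) (auto simp: edge_const_def)
    then show "edge_int (vtx K k) (vtx K (Suc k)) (\<lambda>x. g x * (\<gamma> x \<bullet> outer_normal K (vtx K k) (vtx K (Suc k))))
      = C k * edge_int (vtx K k) (vtx K (Suc k)) (\<lambda>x. \<gamma> x \<bullet> outer_normal K (vtx K k) (vtx K (Suc k)))"
      by (simp add: edge_int_lebesgue_on)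
  qed
  then show ?thesis unfolding has_weak_trace_def LINT_U by simp
qed

lemma weak_trace_lincomb:
  assumes \<phi>: "\<phi> \<in> H2 R" "p \<in> Poly 2" "has_weak_trace K (wlap R \<phi>) p g" "edge_const g C"
    and \<psi>: "\<psi> \<in> H2 R" "q \<in> Poly 2" "has_weak_trace K (wlap R \<psi>) q h" "edge_const h D"
  shows "has_weak_trace K (wlap R (\<lambda>x. a * \<phi> x + \<psi> x)) (\<lambda>x. a * p x + q x) (\<lambda>x. a * g x + h x)"
proof (subst weak_trace_const_iff[where C = "\<lambda>k. a * C k + D k"])
  show "edge_const (\<lambda>x. a * g x + h x) (\<lambda>k. a * C k + D k)" using \<phi>(4) \<psi>(4) by (simp add: edge_const_def)
  show "\<forall>\<eta> \<gamma>. \<eta> \<in> H2 R \<and> has_trace K \<eta> (\<lambda>x. 0) \<and> has_vtrace K (wgrad R \<eta>) \<gamma> \<longrightarrow>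
        (\<integral>x. wlap R (\<lambda>x. a * \<phi> x + \<psi> x) x * wlap R \<eta> x - \<eta> x * (a * p x + q x) \<partial>\<mu>)
        = (\<Sum>k<length K. (a * C k + D k) * edge_int (vtx K k) (vtx K (Suc k)) (\<lambda>x. \<gamma> x \<bullet> outer_normal K (vtx K k) (vtx K (Suc k))))"
  proof (intro allI impI)
    fix \<eta> \<gamma> assume \<eta>: "\<eta> \<in> H2 R \<and> has_trace K \<eta> (\<lambda>x. 0) \<and> has_vtrace K (wgrad R \<eta>) \<gamma>"
    have L: "L2_on \<mu> \<eta>" "L2_on \<mu> (wlap R \<eta>)" using \<eta> H1_L2 H2_H1 wlap_L2 by auto
    note P = Poly_L2[OF \<phi>(2)] Poly_L2[OF \<psi>(2)]
    note W = wlap_L2[OF \<phi>(1)] wlap_L2[OF \<psi>(1)] wlap_L2[OF H2_lincomb[OF \<phi>(1) \<psi>(1)], of a]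
    have split: "(\<integral>x. w x * wlap R \<eta> x - \<eta> x * q x \<partial>\<mu>) = (\<integral>x. w x * wlap R \<eta> x \<partial>\<mu>) - (\<integral>x. q x * \<eta> x \<partial>\<mu>)"
      if "L2_on \<mu> w" "L2_on \<mu> q" for w q
      using L2_on_integrable_mult[OF that(1) L(2)] L2_on_integrable_mult[OF that(2) L(1)] by (simp add: mult.commute)
    let ?e = "\<lambda>k. edge_int (vtx K k) (vtx K (Suc k)) (\<lambda>x. \<gamma> x \<bullet> outer_normal K (vtx K k) (vtx K (Suc k)))"
    have 1: "(\<integral>x. wlap R \<phi> x * wlap R \<eta> x \<partial>\<mu>) - (\<integral>x. p x * \<eta> x \<partial>\<mu>) = (\<Sum>k<length K. C k * ?e k)"
      using \<phi>(3)[unfolded weak_trace_const_iff[OF \<phi>(4)], rule_format, OF \<eta>] split[OF W(1) P(1)] by simp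
    have 2: "(\<integral>x. wlap R \<psi> x * wlap R \<eta> x \<partial>\<mu>) - (\<integral>x. q x * \<eta> x \<partial>\<mu>) = (\<Sum>k<length K. D k * ?e k)"
      using \<psi>(3)[unfolded weak_trace_const_iff[OF \<psi>(4)], rule_format, OF \<eta>] split[OF W(2) P(2)] by simp
    have "(\<integral>x. wlap R (\<lambda>x. a * \<phi> x + \<psi> x) x * wlap R \<eta> x - \<eta> x * (a * p x + q x) \<partial>\<mu>)
      = (\<integral>x. wlap R (\<lambda>x. a * \<phi> x + \<psi> x) x * wlap R \<eta> x \<partial>\<mu>) - (\<integral>x. (a * p x + q x) * \<eta> x \<partial>\<mu>)"
      by (rule split[OF W(3) L2_on_lincomb[OF P]])
    also have "\<dots> = a * ((\<integral>x. wlap R \<phi> x * wlap R \<eta> x \<partial>\<mu>) - (\<integral>x. p x * \<eta> x \<partial>\<mu>))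
      + ((\<integral>x. wlap R \<psi> x * wlap R \<eta> x \<partial>\<mu>) - (\<integral>x. q x * \<eta> x \<partial>\<mu>))"
      using integral_mult_AE_lincomb[OF W L(2) wlap_lincomb[OF \<phi>(1) \<psi>(1)]] integral_lincomb_mult[OF P L(1), of a]
      by (simp add: right_diff_distrib)
    also have "\<dots> = (\<Sum>k<length K. (a * C k + D k) * ?e k)"
      unfolding 1 2 by (simp add: sum_distrib_left sum.distrib[symmetric] algebra_simps)
    finally show "(\<integral>x. wlap R (\<lambda>x. a * \<phi> x + \<psi> x) x * wlap R \<eta> x - \<eta> x * (a * p x + q x) \<partial>\<mu>)
      = (\<Sum>k<length K. (a * C k + D k) * ?e k)" .
  qed
qed

definition poly2 :: "(nat \<Rightarrow> nat \<Rightarrow> real) \<Rightarrow> point \<Rightarrow> real" where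
  "poly2 f x = (\<Sum>i\<le>2. \<Sum>j\<le>2 - i. f i j * (x$1)^i * (x$2)^j)"

lemma poly2_Poly: "p \<in> Poly 2 \<longleftrightarrow> (\<exists>c. p = poly2 c)"
  unfolding Poly_def poly2_def[abs_def] by (auto simp: fun_eq_iff)

lemma poly2_lincomb: "poly2 (\<lambda>i j. a * f i j + g i j) = (\<lambda>x. a * poly2 f x + poly2 g x)"
  by (auto simp: poly2_def fun_eq_iff sum_distrib_left sum.distrib[symmetric] algebra_simps)

text \<open>The family \<open>d\<close> collects the coefficients of the bilaplacian of \<open>\<phi>\<close>, of the trace of its
  Laplacian, of its own trace and of its projection onto the quadratic polynomials.\<close>

definition local_data :: "(point \<Rightarrow> real) \<Rightarrow> (nat \<times> nat \<times> nat \<times> nat \<Rightarrow> real) \<Rightarrow> bool" where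
  "local_data \<phi> d \<longleftrightarrow> \<phi> \<in> H2_rep K \<and> has_bilap K \<phi> (poly2 (\<lambda>i j. d (0, 0, i, j))) \<and>
    (\<exists>g. has_weak_trace K (wlap R \<phi>) (poly2 (\<lambda>i j. d (0, 0, i, j))) g \<and> edge_const g (\<lambda>k. d (1, k, 0, 0))) \<and>
    (\<exists>g. has_trace K \<phi> g \<and> (\<forall>k<length K. \<forall>x\<in>open_segment (vtx K k) (vtx K (Suc k)). g x = poly2 (\<lambda>i j. d (2, k, i, j)) x)) \<and>
    Pi_D K \<phi> = poly2 (\<lambda>i j. d (3, 0, i, j))"

lemma edge_const_ex:
  assumes "\<forall>(a, b)\<in>edges K. \<exists>p\<in>Poly 0. \<forall>x\<in>open_segment a b. g x = p x"
  shows "\<exists>C. edge_const g C"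
proof -
  have "\<exists>C. k < length K \<longrightarrow> (\<forall>x\<in>open_segment (vtx K k) (vtx K (Suc k)). g x = C)" for k
  proof (cases "k < length K")
    case True
    then obtain p where "p \<in> Poly 0" "\<forall>x\<in>open_segment (vtx K k) (vtx K (Suc k)). g x = p x"
      using bspec[OF assms edgesI[OF True]] by auto
    then show ?thesis unfolding Poly_0_iff by auto
  qed simp
  then show ?thesis unfolding edge_const_def by metis
qed

lemma M_tilde_iff: "\<phi> \<in> M_tilde K \<longleftrightarrow> (\<exists>d. local_data \<phi> d)"
proof
  assume "\<phi> \<in> M_tilde K"
  then obtain q g h where \<phi>: "\<phi> \<in> H2_rep K" and q: "q \<in> Poly 2" "has_bilap K \<phi> q"
    and g: "has_weak_trace K (wlap R \<phi>) q g" "\<forall>(a, b)\<in>edges K. \<exists>p\<in>Poly 0. \<forall>x\<in>open_segment a b. g x = p x"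
    and h: "has_trace K \<phi> h" "\<forall>(a, b)\<in>edges K. \<exists>p\<in>Poly 2. \<forall>x\<in>open_segment a b. h x = p x"
    unfolding M_tilde_def by blast
  obtain c0 where c0: "q = poly2 c0" using q poly2_Poly by blast
  obtain c1 where c1: "edge_const g c1" using edge_const_ex[OF g(2)] by blast
  have "\<exists>c. k < length K \<longrightarrow> (\<forall>x\<in>open_segment (vtx K k) (vtx K (Suc k)). h x = poly2 c x)" for k
  proof (cases "k < length K")
    case True
    then obtain p where "p \<in> Poly 2" "\<forall>x\<in>open_segment (vtx K k) (vtx K (Suc k)). h x = p x"
      using bspec[OF h(2) edgesI[OF True]] by auto
    then show ?thesis unfolding poly2_Poly by auto
  qed simp
  then obtain c2 where c2: "\<And>k x. k < length K \<Longrightarrow> x \<in> open_segment (vtx K k) (vtx K (Suc k)) \<Longrightarrow> h x = poly2 (c2 k) x"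
    by metis
  have "\<phi> \<in> H2 R" using \<phi> H2_repD by blast
  then obtain c3 where c3: "Pi_D K \<phi> = poly2 c3" using Pi_D_spec(1) poly2_Poly by blast
  \<comment> \<open>The first index selects the kind of datum and the second the edge; the last two
    are the exponents of a monomial. Indices that a kind does not have are ignored here and set to 0
    by \<open>local_data\<close>.\<close>
  define d where "d = (\<lambda>(s :: nat, k, i, j). if s = 0 then c0 i j else if s = 1 then c1 k else if s = 2 then c2 k i j else c3 i j :: real)"
  have "local_data \<phi> d"
    unfolding local_data_def
  proof (intro conjI)
    have e: "poly2 (\<lambda>i j. d (0, 0, i, j)) = q" by (simp add: d_def c0)
    show "has_bilap K \<phi> (poly2 (\<lambda>i j. d (0, 0, i, j)))" using e q by simp
    show "\<exists>g. has_weak_trace K (wlap R \<phi>) (poly2 (\<lambda>i j. d (0, 0, i, j))) g \<and> edge_const g (\<lambda>k. d (1, k, 0, 0))"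
      using e g c1 by (intro exI[of _ g]) (simp add: d_def)
    show "\<exists>g. has_trace K \<phi> g \<and> (\<forall>k<length K. \<forall>x\<in>open_segment (vtx K k) (vtx K (Suc k)). g x = poly2 (\<lambda>i j. d (2, k, i, j)) x)"
      using h c2 by (intro exI[of _ h]) (simp add: d_def)
    show "Pi_D K \<phi> = poly2 (\<lambda>i j. d (3, 0, i, j))" by (simp add: d_def c3)
  qed (rule \<phi>)
  then show "\<exists>d. local_data \<phi> d" by blast
next
  assume "\<exists>d. local_data \<phi> d"
  then obtain d :: "nat \<times> nat \<times> nat \<times> nat \<Rightarrow> real" and g h where \<phi>: "\<phi> \<in> H2_rep K" and q: "has_bilap K \<phi> (poly2 (\<lambda>i j. d (0, 0, i, j)))"
    and g: "has_weak_trace K (wlap R \<phi>) (poly2 (\<lambda>i j. d (0, 0, i, j))) g" "edge_const g (\<lambda>k. d (1, k, 0, 0))"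
    and h: "has_trace K \<phi> h" "\<forall>k<length K. \<forall>x\<in>open_segment (vtx K k) (vtx K (Suc k)). h x = poly2 (\<lambda>i j. d (2, k, i, j)) x"
    unfolding local_data_def by blast
  have seg: "\<exists>k<length K. open_segment a b = open_segment (vtx K k) (vtx K (Suc k))" if "(a, b) \<in> edges K" for a b
    using that by (elim edgesE) (auto simp: open_segment_commute)
  have 0: "\<exists>p\<in>Poly 0. \<forall>x\<in>open_segment a b. g x = p x" if ab: "(a, b) \<in> edges K" for a b
  proof -
    obtain k where k: "k < length K" "open_segment a b = open_segment (vtx K k) (vtx K (Suc k))" using seg[OF ab] by blast
    have "g x = d (1, k, 0, 0)" if "x \<in> open_segment a b" for x
      using g(2) k(1) that[unfolded k(2)] unfolding edge_const_def by blast
    then show ?thesis by (intro bexI[where x = "\<lambda>x. d (1, k, 0, 0)"]) (auto simp: Poly_0_iff)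
  qed
  have 2: "\<exists>p\<in>Poly 2. \<forall>x\<in>open_segment a b. h x = p x" if ab: "(a, b) \<in> edges K" for a b
  proof -
    obtain k where k: "k < length K" "open_segment a b = open_segment (vtx K k) (vtx K (Suc k))" using seg[OF ab] by blast
    have "h x = poly2 (\<lambda>i j. d (2, k, i, j)) x" if "x \<in> open_segment a b" for x
      using h(2) k(1) that[unfolded k(2)] by blast
    moreover have "poly2 (\<lambda>i j. d (2, k, i, j)) \<in> Poly 2" using poly2_Poly by blast
    ultimately show ?thesis by blast
  qed
  have "poly2 (\<lambda>i j. d (0, 0, i, j)) \<in> Poly 2" using poly2_Poly by blast
  then have "\<exists>q\<in>Poly 2. has_bilap K \<phi> q \<and>
        (\<exists>g. has_weak_trace K (wlap R \<phi>) q g \<and> (\<forall>(a, b)\<in>edges K. \<exists>p\<in>Poly 0. \<forall>x\<in>open_segment a b. g x = p x))"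
    using q g(1) 0 by fast
  moreover have "\<exists>g. has_trace K \<phi> g \<and> (\<forall>(a, b)\<in>edges K. \<exists>p\<in>Poly 2. \<forall>x\<in>open_segment a b. g x = p x)"
    using h(1) 2 by fast
  ultimately show "\<phi> \<in> M_tilde K" using \<phi> by (simp add: M_tilde_def)
qed

lemma local_data_lincomb:
  assumes \<phi>: "local_data \<phi> d" and \<psi>: "local_data \<psi> e"
  shows "local_data (\<lambda>x. a * \<phi> x + \<psi> x) (\<lambda>j. a * d j + e j)"
proof -
  have H: "\<phi> \<in> H2_rep K" "\<psi> \<in> H2_rep K" using \<phi> \<psi> by (auto simp: local_data_def)
  then have H2: "\<phi> \<in> H2 R" "\<psi> \<in> H2 R" and u: "uniformly_continuous_on R \<phi>" "uniformly_continuous_on R \<psi>"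
    using H2_repD by auto
  let ?q = "poly2 (\<lambda>i j. d (0, 0, i, j))" and ?r = "poly2 (\<lambda>i j. e (0, 0, i, j))"
  have P: "?q \<in> Poly 2" "?r \<in> Poly 2" using poly2_Poly by blast+
  show ?thesis
    unfolding local_data_def poly2_lincomb
  proof (intro conjI)
    show "(\<lambda>x. a * \<phi> x + \<psi> x) \<in> H2_rep K" using H by (rule H2_rep_lincomb)
    show "has_bilap K (\<lambda>x. a * \<phi> x + \<psi> x) (\<lambda>x. a * ?q x + ?r x)"
      using \<phi> \<psi> H2 P by (intro has_bilap_lincomb) (auto simp: local_data_def)
    obtain g h where gh: "has_weak_trace K (wlap R \<phi>) ?q g" "edge_const g (\<lambda>k. d (1, k, 0, 0))"
      "has_weak_trace K (wlap R \<psi>) ?r h" "edge_const h (\<lambda>k. e (1, k, 0, 0))"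
      using \<phi> \<psi> unfolding local_data_def by blast
    then show "\<exists>g. has_weak_trace K (wlap R (\<lambda>x. a * \<phi> x + \<psi> x)) (\<lambda>x. a * ?q x + ?r x) g
        \<and> edge_const g (\<lambda>k. a * d (1, k, 0, 0) + e (1, k, 0, 0))"
      using weak_trace_lincomb[OF H2(1) P(1) gh(1,2) H2(2) P(2) gh(3,4), of a]
      by (intro exI[of _ "\<lambda>x. a * g x + h x"]) (auto simp: edge_const_def)
    obtain g h where gh: "has_trace K \<phi> g" "\<forall>k<length K. \<forall>x\<in>open_segment (vtx K k) (vtx K (Suc k)). g x = poly2 (\<lambda>i j. d (2, k, i, j)) x"
      "has_trace K \<psi> h" "\<forall>k<length K. \<forall>x\<in>open_segment (vtx K k) (vtx K (Suc k)). h x = poly2 (\<lambda>i j. e (2, k, i, j)) x"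
      using \<phi> \<psi> unfolding local_data_def by blast
    then show "\<exists>g. has_trace K (\<lambda>x. a * \<phi> x + \<psi> x) g \<and> (\<forall>k<length K. \<forall>x\<in>open_segment (vtx K k) (vtx K (Suc k)).
        g x = a * poly2 (\<lambda>i j. d (2, k, i, j)) x + poly2 (\<lambda>i j. e (2, k, i, j)) x)"
      using has_trace_lincomb[OF gh(1,3), of a] by (intro exI[of _ "\<lambda>x. a * g x + h x"]) auto
    have "Pi_D K (\<lambda>x. a * \<phi> x + \<psi> x) = (\<lambda>x. a * Pi_D K \<phi> x + Pi_D K \<psi> x)"
      using H2 u by (intro Pi_D_lincomb vval_lincomb)
    then show "Pi_D K (\<lambda>x. a * \<phi> x + \<psi> x) = (\<lambda>x. a * poly2 (\<lambda>i j. d (3, 0, i, j)) x + poly2 (\<lambda>i j. e (3, 0, i, j)) x)"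
      using \<phi> \<psi> by (simp add: local_data_def)
  qed
qed

lemma M_tilde_lincomb: "\<phi> \<in> M_tilde K \<Longrightarrow> \<psi> \<in> M_tilde K \<Longrightarrow> (\<lambda>x. a * \<phi> x + \<psi> x) \<in> M_tilde K"
  unfolding M_tilde_iff using local_data_lincomb by blast

lemma M_tilde_H2: "\<phi> \<in> M_tilde K \<Longrightarrow> \<phi> \<in> H2 R \<and> uniformly_continuous_on R \<phi> \<and> restr K \<phi> = \<phi>"
  using H2_repD by (auto simp: M_tilde_def)

lemma wcurl_H1: "\<phi> \<in> H2 R \<Longrightarrow> (\<lambda>x. wcurl R \<phi> x $ i) \<in> H1 R"
proof -
  assume \<phi>: "\<phi> \<in> H2 R"
  have "(\<lambda>x. (-1) * wd R 1 \<phi> x + 0) \<in> H1 R"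
    using \<phi> by (intro H1_lincomb H2_H1 smooth_H1 smooth_const)
  then show ?thesis using exhaust_2[of i] H2_H1(2)[OF \<phi>] by auto
qed

lemma wcurl_lincomb:
  assumes "\<phi> \<in> H2 R" "\<psi> \<in> H2 R"
  shows "AE x in \<mu>. wcurl R (\<lambda>x. a * \<phi> x + \<psi> x) x $ i = a * wcurl R \<phi> x $ i + wcurl R \<psi> x $ i"
  using wd_lincomb[OF H2_H1(1)[OF assms(1)] H2_H1(1)[OF assms(2)], of 1 a]
    wd_lincomb[OF H2_H1(1)[OF assms(1)] H2_H1(1)[OF assms(2)], of 2 a]
  by eventually_elim (use exhaust_2[of i] in auto)

lemma has_trace_AE_lincomb:
  assumes "has_trace K u g" "has_trace K v h" "L2_on \<mu> w" "AE x in \<mu>. w x = a * u x + v x"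
  shows "has_trace K w (\<lambda>x. a * g x + h x)"
proof (rule has_trace_cong_AE[OF has_trace_lincomb[OF assms(1,2)] assms(3)])
  show "AE x in \<mu>. a * u x + v x = w x" using assms(4) by eventually_elim simp
  show "(\<lambda>t. a * g (linepath p q t) + h (linepath p q t)) \<in> borel_measurable unit_lebesgue" if "(p, q) \<in> edges K" for p q
    using has_trace_edge_L2[OF assms(1) that] has_trace_edge_L2[OF assms(2) that] by (intro L2_on_measurable L2_on_lincomb)
qed simp

text \<open>The trace \<gamma> is an explicit argument because it also enters
  \<open>Pi_nabla\<close> and has to be combined together with \<phi>.\<close>

definition curl_cond :: "(point \<Rightarrow> real) \<Rightarrow> (point \<Rightarrow> point) \<Rightarrow> bool" where
  "curl_cond \<phi> \<gamma> \<longleftrightarrow> has_vtrace K (wcurl R \<phi>) \<gamma> \<and>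
        (\<forall>(a, b)\<in>edges K. \<forall>\<eta>\<in>Poly 1. edge_int a b \<eta> = 0 \<longrightarrow>
           edge_int a b (\<lambda>x. (\<gamma> x \<bullet> edge_normal a b
             - Pi_nabla K (wcurl R \<phi>) \<gamma> x \<bullet> edge_normal a b) * \<eta> x) = 0)"

lemma M_loc_iff: "\<phi> \<in> M_loc K \<longleftrightarrow> \<phi> \<in> M_tilde K \<and> (\<exists>\<gamma>. curl_cond \<phi> \<gamma>) \<and>
  (\<forall>\<eta>\<in>Poly 2. (\<integral>x. (\<phi> x - Pi_D K \<phi> x) * \<eta> x \<partial>\<mu>) = 0)"
  unfolding M_loc_def curl_cond_def LINT_U by blast

lemma has_vtrace_edge_L2: "has_vtrace K v \<gamma> \<Longrightarrow> (a, b) \<in> edges K \<Longrightarrow> L2_on unit_lebesgue (\<lambda>t. \<gamma> (linepath a b t) $ i)"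
  using has_trace_edge_L2[of "\<lambda>x. v x $ i" "\<lambda>x. \<gamma> x $ i" a b] by (simp add: has_vtrace_def)

lemma curl_cond_lincomb:
  assumes H: "\<phi> \<in> H2 R" "\<psi> \<in> H2 R" and \<gamma>: "curl_cond \<phi> \<gamma>" and \<delta>: "curl_cond \<psi> \<delta>"
  shows "curl_cond (\<lambda>x. s * \<phi> x + \<psi> x) (\<lambda>x. s *\<^sub>R \<gamma> x + \<delta> x)"
proof -
  let ?w = "\<lambda>x. s * \<phi> x + \<psi> x" and ?g = "\<lambda>x. s *\<^sub>R \<gamma> x + \<delta> x"
  have w: "?w \<in> H2 R" using H by (rule H2_lincomb)
  have t: "has_vtrace K (wcurl R \<phi>) \<gamma>" "has_vtrace K (wcurl R \<psi>) \<delta>" using \<gamma> \<delta> by (auto simp: curl_cond_def)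
  have vt: "has_vtrace K (wcurl R ?w) ?g"
    unfolding has_vtrace_def
  proof
    fix i
    have "has_trace K (\<lambda>x. wcurl R ?w x $ i) (\<lambda>x. s * \<gamma> x $ i + \<delta> x $ i)"
      using t unfolding has_vtrace_def
      by (intro has_trace_AE_lincomb[OF _ _ H1_L2[OF wcurl_H1[OF w]] wcurl_lincomb[OF H]]) auto
    then show "has_trace K (\<lambda>x. wcurl R ?w x $ i) (\<lambda>x. ?g x $ i)" by simp
  qed
  let ?P = "Pi_nabla K (wcurl R \<phi>) \<gamma>" and ?Q = "Pi_nabla K (wcurl R \<psi>) \<delta>"
  have Pe: "Pi_nabla K (wcurl R ?w) ?g x = s *\<^sub>R ?P x + ?Q x" for x
  proof -
    have "nabla_proj (\<lambda>x. wcurl R ?w x $ i) (\<lambda>x. s * \<gamma> x $ i + \<delta> x $ i) x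
      = s * nabla_proj (\<lambda>x. wcurl R \<phi> x $ i) (\<lambda>x. \<gamma> x $ i) x + nabla_proj (\<lambda>x. wcurl R \<psi> x $ i) (\<lambda>x. \<delta> x $ i) x" for i
      using has_vtrace_edge_L2[OF t(1)] has_vtrace_edge_L2[OF t(2)]
      by (intro nabla_proj_lincomb wcurl_H1 H w wcurl_lincomb) auto
    then show ?thesis
      using Pi_nabla_eq[OF wcurl_H1[OF H(1)] has_vtrace_edge_L2[OF t(1)]]
        Pi_nabla_eq[OF wcurl_H1[OF H(2)] has_vtrace_edge_L2[OF t(2)]]
        Pi_nabla_eq[OF wcurl_H1[OF w] has_vtrace_edge_L2[OF vt]] by (simp add: vec_eq_iff)
  qed
  have sm: "smooth (\<lambda>x. nabla_proj u g x)" for u g unfolding nabla_proj_def by (rule smooth_affine)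
  have PL: "L2_on unit_lebesgue (\<lambda>t. ?P (linepath a b t) $ i)" "L2_on unit_lebesgue (\<lambda>t. ?Q (linepath a b t) $ i)" for a b i
    using Pi_nabla_eq[OF wcurl_H1[OF H(1)] has_vtrace_edge_L2[OF t(1)]]
        Pi_nabla_eq[OF wcurl_H1[OF H(2)] has_vtrace_edge_L2[OF t(2)]] smooth_edge_L2[OF sm] by auto
  have "edge_int a b (\<lambda>x. (?g x \<bullet> edge_normal a b - Pi_nabla K (wcurl R ?w) ?g x \<bullet> edge_normal a b) * \<eta> x) = 0"
    if ab: "(a, b) \<in> edges K" and \<eta>: "\<eta> \<in> Poly 1" "edge_int a b \<eta> = 0" for a b \<eta>
  proof -
    let ?n = "edge_normal a b"
    have se: "smooth \<eta>" using \<eta>(1) by (rule Poly_smooth)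
    have L: "L2_on unit_lebesgue (\<lambda>t. (G (linepath a b t) \<bullet> ?n - Q (linepath a b t) \<bullet> ?n) * \<eta> (linepath a b t))"
      if "\<And>i. L2_on unit_lebesgue (\<lambda>t. G (linepath a b t) $ i)" "\<And>i. L2_on unit_lebesgue (\<lambda>t. Q (linepath a b t) $ i)" for G Q :: "point \<Rightarrow> point"
      using smooth_edge_mult_L2[OF se L2_on_diff[OF L2_edge_inner[OF that(1)] L2_edge_inner[OF that(2)]]]
      by (simp add: mult.commute)
    have "edge_int a b (\<lambda>x. (?g x \<bullet> ?n - Pi_nabla K (wcurl R ?w) ?g x \<bullet> ?n) * \<eta> x)
      = edge_int a b (\<lambda>x. s * ((\<gamma> x \<bullet> ?n - ?P x \<bullet> ?n) * \<eta> x) + (\<delta> x \<bullet> ?n - ?Q x \<bullet> ?n) * \<eta> x)"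
      unfolding Pe by (rule arg_cong[where f = "edge_int a b"]) (auto simp: inner_simps algebra_simps)
    also have "\<dots> = s * edge_int a b (\<lambda>x. (\<gamma> x \<bullet> ?n - ?P x \<bullet> ?n) * \<eta> x) + edge_int a b (\<lambda>x. (\<delta> x \<bullet> ?n - ?Q x \<bullet> ?n) * \<eta> x)"
      using has_vtrace_edge_L2[OF t(1) ab] has_vtrace_edge_L2[OF t(2) ab] PL by (intro edge_int_lincomb L)
    also have "\<dots> = 0" using \<gamma> \<delta> ab \<eta> unfolding curl_cond_def by fastforce
    finally show ?thesis .
  qed
  then show ?thesis using vt unfolding curl_cond_def by blast
qed

lemma M_loc_lincomb:
  assumes "\<phi> \<in> M_loc K" "\<psi> \<in> M_loc K" shows "(\<lambda>x. a * \<phi> x + \<psi> x) \<in> M_loc K"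
proof -
  have M: "\<phi> \<in> M_tilde K" "\<psi> \<in> M_tilde K" using assms by (auto simp: M_loc_iff)
  then have H: "\<phi> \<in> H2 R" "\<psi> \<in> H2 R" and u: "uniformly_continuous_on R \<phi>" "uniformly_continuous_on R \<psi>"
    using M_tilde_H2 by auto
  have Pi: "Pi_D K (\<lambda>x. a * \<phi> x + \<psi> x) = (\<lambda>x. a * Pi_D K \<phi> x + Pi_D K \<psi> x)"
    using H u by (intro Pi_D_lincomb vval_lincomb)
  have "(\<integral>x. ((a * \<phi> x + \<psi> x) - Pi_D K (\<lambda>x. a * \<phi> x + \<psi> x) x) * \<eta> x \<partial>\<mu>) = 0" if \<eta>: "\<eta> \<in> Poly 2" for \<eta>
  proof -
    have L: "L2_on \<mu> (\<lambda>x. \<phi> x - Pi_D K \<phi> x)" "L2_on \<mu> (\<lambda>x. \<psi> x - Pi_D K \<psi> x)"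
      by (intro L2_on_diff H1_L2[OF H2_H1(1)] H Poly_L2[OF Pi_D_spec(1)])+
    have "(a * \<phi> x + \<psi> x) - Pi_D K (\<lambda>x. a * \<phi> x + \<psi> x) x = a * (\<phi> x - Pi_D K \<phi> x) + (\<psi> x - Pi_D K \<psi> x)" for x
      unfolding Pi by (simp add: algebra_simps)
    then have "(\<integral>x. ((a * \<phi> x + \<psi> x) - Pi_D K (\<lambda>x. a * \<phi> x + \<psi> x) x) * \<eta> x \<partial>\<mu>)
      = (\<integral>x. (a * (\<phi> x - Pi_D K \<phi> x) + (\<psi> x - Pi_D K \<psi> x)) * \<eta> x \<partial>\<mu>)" by (simp only:)
    also have "\<dots> = 0" using assms \<eta> by (simp add: integral_lincomb_mult[OF L Poly_L2[OF \<eta>]] M_loc_iff)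
    finally show ?thesis .
  qed
  then show ?thesis using assms curl_cond_lincomb[OF H] M_tilde_lincomb[OF M] unfolding M_loc_iff by blast
qed

section \<open>Quadratic polynomials belong to the local space\<close>

lemma smooth_zero_outside:
  assumes C: "compact C" "\<And>x. x \<notin> C \<Longrightarrow> u x = (0::real)" and x: "x \<notin> C" shows "pd i u x = 0"
proof -
  have "open (- C)" using C by (simp add: compact_imp_closed open_Compl)
  then have "(u has_derivative (\<lambda>h. 0)) (at x)"
    using x C(2) by (intro has_derivative_transform_within_open[OF has_derivative_const[of 0]]) auto
  from pd_eq[OF this] show ?thesis .
qed

lemma test_function_pd: "test_function U \<eta> \<Longrightarrow> test_function U (pd i \<eta>)"
  unfolding test_function_def using smooth_pd smooth_zero_outside by metis

lemma integral_pd_test: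
  assumes "test_function R \<eta>" shows "(\<integral>x. pd i \<eta> x \<partial>\<mu>) = 0"
  using smooth_has_weak_deriv[OF smooth_const, of i 1] assms
  by (simp add: has_weak_deriv_iff pd_const)

lemma has_trace_eq_AE:
  assumes g: "smooth g" and v: "L2_on \<mu> v" "AE x in \<mu>. v x = g x" shows "has_trace K v g"
proof (rule has_trace_cong_AE[OF has_trace_smooth[OF g] v(1)])
  show "AE x in \<mu>. g x = v x" using v(2) by eventually_elim simp
qed (use smooth_edge_L2[OF g] in \<open>auto intro: L2_on_measurable\<close>)

lemma nabla_proj_affine:
  assumes f: "f \<in> Poly 1" and u: "L2_on \<mu> u" "AE x in \<mu>. u x = f x"
  shows "nabla_proj u f = f"
proof -
  obtain n d where nd: "f = (\<lambda>x. n \<bullet> x + d)" using f unfolding Poly_1_iff by blast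
  have sf: "smooth f" using f by (rule Poly_smooth)
  have w: "wd R j u = wd R j f" for j by (rule wd_cong_AE[OF u(1) smooth_L2[OF sf] u(2)])
  have "(\<integral>x. wd R j f x \<partial>\<mu>) = (\<integral>x. n $ j \<partial>\<mu>)" for j
    using smooth_wd[OF sf, of j] unfolding nd pd_affine
    by (intro integral_cong_AE L2_on_measurable wd_L2 smooth_H1 smooth_affine borel_measurable_const)
  then have gm: "grad_mean u = n" using area_pos unfolding grad_mean_def w integral_const_region by (simp add: vec_eq_iff)
  have "bd_int (\<lambda>x. d * 1 + n \<bullet> x) = d * bd_int (\<lambda>x. 1) + bd_int (\<lambda>x. n \<bullet> x)"
    using smooth_edge_L2[OF smooth_const[of 1]] smooth_edge_L2[OF smooth_affine[of n 0]] by (intro bd_int_lincomb) auto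
  then have "bd_int f - bd_int (\<lambda>x. n \<bullet> x) = d * perimeter" by (simp add: nd perimeter_def add.commute)
  then show ?thesis using perimeter_pos by (auto simp: nabla_proj_def[abs_def] gm nd)
qed

lemma pd_Poly_2: assumes "p \<in> Poly 2" shows "pd i p \<in> Poly 1"
proof -
  obtain a b e n d where "p = (\<lambda>x. quad a b e x + (n \<bullet> x + d))" using assms unfolding Poly_2_iff by blast
  then have "pd i p = (\<lambda>x. (if i = 1 then vector [2 * a, b] else vector [b, 2 * e]) \<bullet> x + n $ i)"
    by (simp only: pd_quad)
  then show ?thesis unfolding Poly_1_iff by blast
qed

text \<open>Green's formula for the gradient of \<open>\<eta>\<close>: constants have themselves as weak trace.\<close>

lemma integral_wlap:
  assumes \<eta>: "\<eta> \<in> H2 R" "has_vtrace K (wgrad R \<eta>) \<gamma>"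
  shows "(\<integral>x. wlap R \<eta> x \<partial>\<mu>)
    = (\<Sum>k<length K. edge_int (vtx K k) (vtx K (Suc k)) (\<lambda>x. \<gamma> x \<bullet> outer_normal K (vtx K k) (vtx K (Suc k))))"
proof -
  interpret F: finite_measure \<mu> by (rule finite_measure_U)
  interpret E: finite_measure unit_lebesgue by (rule finite_measure_unit)
  let ?\<nu> = "\<lambda>k. outer_normal K (vtx K k) (vtx K (Suc k))"
  let ?e = "\<lambda>k. edge_int (vtx K k) (vtx K (Suc k))"
  have g: "(\<integral>x. wd R i (wd R i \<eta>) x \<partial>\<mu>) = (\<Sum>k<length K. ?e k (\<lambda>x. \<gamma> x $ i * ?\<nu> k $ i))" for i
    using green_trace[of "wd R i \<eta>" "\<lambda>x. \<gamma> x $ i" "\<lambda>x. 1" i] \<eta>(2)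
    by (simp add: has_vtrace_def smooth_const pd_const)
  have "(\<integral>x. wlap R \<eta> x \<partial>\<mu>) = (\<Sum>i\<in>UNIV. \<integral>x. wd R i (wd R i \<eta>) x \<partial>\<mu>)"
    unfolding wlap_def by (intro Bochner_Integration.integral_sum F.L2_on_integrable wd2_L2 \<eta>)
  also have "\<dots> = (\<Sum>k<length K. \<Sum>i\<in>UNIV. ?e k (\<lambda>x. \<gamma> x $ i * ?\<nu> k $ i))"
    unfolding g by (rule sum.swap)
  also have "\<dots> = (\<Sum>k<length K. ?e k (\<lambda>x. \<gamma> x \<bullet> ?\<nu> k))"
  proof (intro sum.cong refl)
    fix k assume "k \<in> {..<length K}"
    then have "integrable unit_lebesgue (\<lambda>t. \<gamma> (linepath (vtx K k) (vtx K (Suc k)) t) $ i)" for i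
      using has_vtrace_edge_L2[OF \<eta>(2) edgesI] E.L2_on_integrable by auto
    then show "(\<Sum>i\<in>UNIV. ?e k (\<lambda>x. \<gamma> x $ i * ?\<nu> k $ i)) = ?e k (\<lambda>x. \<gamma> x \<bullet> ?\<nu> k)"
      by (simp add: edge_int_lebesgue_on inner_2 sum_2 distrib_left)
  qed
  finally show ?thesis .
qed

text \<open>The Laplacian of a quadratic is a constant and its bilaplacian is 0. By Green's formula
  for gradients, that constant is the weak trace of the Laplacian.\<close>

lemma restr_Poly_M_tilde:
  assumes p: "p \<in> Poly 2" shows "restr K p \<in> M_tilde K"
proof -
  let ?u = "restr K p"
  have sp: "smooth p" using p by (rule Poly_smooth)
  have eq: "\<And>x. x \<in> R \<Longrightarrow> ?u x = p x" by (rule restr_eq)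
  have u: "?u \<in> H2 R" using H2_local[OF Poly_H2[OF p] eq] .
  define L where "L = (\<Sum>i\<in>UNIV. hess p i i)"
  have wl: "AE x in \<mu>. wlap R ?u x = L"
    using Poly_wd2[OF p, of 1 1] Poly_wd2[OF p, of 2 2]
    by eventually_elim (simp add: wlap_def L_def wd_restr sum_2)
  have wi: "(\<integral>x. wlap R ?u x * f x \<partial>\<mu>) = L * (\<integral>x. f x \<partial>\<mu>)" if "L2_on \<mu> f" for f
  proof -
    have "(\<integral>x. wlap R ?u x * f x \<partial>\<mu>) = (\<integral>x. L * f x \<partial>\<mu>)"
    proof (rule integral_cong_AE)
      show "AE x in \<mu>. wlap R ?u x * f x = L * f x" using wl by eventually_elim simp
    qed (intro borel_measurable_times borel_measurable_const L2_on_measurable wlap_L2 u that)+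
    then show ?thesis by simp
  qed
  have "?u \<in> H2_rep K"
  proof -
    have "uniformly_continuous_on (closure R) p"
      using sp bounded_U by (intro compact_uniformly_continuous smooth_continuous_on) (auto simp: compact_closure)
    then have "uniformly_continuous_on R p"
      unfolding uniformly_continuous_on_def by (meson closure_subset subsetD)
    then have "uniformly_continuous_on R ?u" unfolding uniformly_continuous_on_def by (simp add: eq)
    moreover have "restr K ?u = ?u" by (auto simp: restr_def)
    ultimately show ?thesis using u by (simp add: H2_rep_def)
  qed
  moreover have "has_bilap K ?u (\<lambda>x. 0)"
    unfolding has_bilap_def LINT_U
  proof (intro allI impI)
    fix \<eta> assume \<eta>: "test_function R \<eta>"
    then have s: "smooth \<eta>" by (simp add: test_function_def)
    interpret F: finite_measure \<mu> by (rule finite_measure_U)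
    have "(\<integral>x. (\<Sum>i\<in>UNIV. pd i (pd i \<eta>) x) \<partial>\<mu>) = (\<Sum>i\<in>UNIV. \<integral>x. pd i (pd i \<eta>) x \<partial>\<mu>)"
      by (intro Bochner_Integration.integral_sum F.L2_on_integrable smooth_L2 smooth_pd s)
    also have "\<dots> = 0" using integral_pd_test[OF test_function_pd[OF \<eta>]] by simp
    finally show "(\<integral>x. wlap R ?u x * (\<Sum>i\<in>UNIV. pd i (pd i \<eta>) x) \<partial>\<mu>) = (\<integral>x. 0 * \<eta> x \<partial>\<mu>)"
      using wi[OF smooth_L2[OF smooth_laplacian[OF s]]] by simp
  qed
  moreover have "has_weak_trace K (wlap R ?u) (\<lambda>x. 0) (\<lambda>x. L)"
  proof (subst weak_trace_const_iff[where C = "\<lambda>k. L"])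
    show "edge_const (\<lambda>x. L) (\<lambda>k. L)" by (simp add: edge_const_def)
    show "\<forall>\<eta> \<gamma>. \<eta> \<in> H2 R \<and> has_trace K \<eta> (\<lambda>x. 0) \<and> has_vtrace K (wgrad R \<eta>) \<gamma> \<longrightarrow>
        (\<integral>x. wlap R ?u x * wlap R \<eta> x - \<eta> x * 0 \<partial>\<mu>)
        = (\<Sum>k<length K. L * edge_int (vtx K k) (vtx K (Suc k)) (\<lambda>x. \<gamma> x \<bullet> outer_normal K (vtx K k) (vtx K (Suc k))))"
      using wi[OF wlap_L2] integral_wlap by (simp add: sum_distrib_left[symmetric])
  qed
  moreover have "has_trace K ?u p"
    using sp L2_local[OF smooth_L2[OF sp] eq] AE_local[of "\<lambda>x. ?u x = p x"] eq by (intro has_trace_eq_AE) auto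
  moreover have "(\<lambda>x. 0) \<in> Poly 2" by (rule lin_space_zero[OF lin_space_Poly])
  moreover have "\<exists>q\<in>Poly 0. \<forall>x\<in>open_segment a b. L = q x" for a b
    by (intro bexI[of _ "\<lambda>x. L"]) (auto simp: Poly_0_iff)
  ultimately show ?thesis unfolding M_tilde_def using p by fast
qed

text \<open>Both projections reproduce what is put in: \<open>Pi_D\<close> the quadratic,
  \<open>Pi_nabla\<close> its affine curl. The additional conditions then hold with zero
  differences. Consequently the remainder after \<open>Pi_D\<close> stays in the local space, where
  the stabilisation is defined.\<close>

lemma restr_Poly_M_loc:
  assumes p: "p \<in> Poly 2" shows "restr K p \<in> M_loc K"
  unfolding M_loc_iff
proof (intro conjI ballI)
  let ?u = "restr K p"
  have sp: "smooth p" using p by (rule Poly_smooth)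
  have eq: "\<And>x. x \<in> R \<Longrightarrow> ?u x = p x" by (rule restr_eq)
  show M: "?u \<in> M_tilde K" using p by (rule restr_Poly_M_tilde)
  have u: "?u \<in> H2 R" using M_tilde_H2[OF M] by simp
  define \<gamma> :: "point \<Rightarrow> point" where "\<gamma> x = vector [pd 2 p x, - pd 1 p x]" for x
  have \<gamma>P: "(\<lambda>x. \<gamma> x $ i) \<in> Poly 1" for i
  proof -
    have "(\<lambda>x. (-1) * pd 1 p x) \<in> Poly 1" by (rule lin_space_scale[OF lin_space_Poly pd_Poly_2[OF p]])
    then show ?thesis using exhaust_2[of i] pd_Poly_2[OF p] by (auto simp: \<gamma>_def vector_2)
  qed
  have c\<gamma>: "AE x in \<mu>. wcurl R ?u x $ i = \<gamma> x $ i" for i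
    using smooth_wd[OF sp, of 1] smooth_wd[OF sp, of 2]
    by eventually_elim (use exhaust_2[of i] in \<open>auto simp: \<gamma>_def vector_2 wd_restr\<close>)
  have cL: "L2_on \<mu> (\<lambda>x. wcurl R ?u x $ i)" for i using wcurl_H1[OF u] H1_L2 by blast
  have vt: "has_vtrace K (wcurl R ?u) \<gamma>"
    unfolding has_vtrace_def using has_trace_eq_AE[OF Poly_smooth[OF \<gamma>P] cL c\<gamma>] by blast
  have "Pi_nabla K (wcurl R ?u) \<gamma> = \<gamma>"
    using Pi_nabla_eq[OF wcurl_H1[OF u] has_vtrace_edge_L2[OF vt]] nabla_proj_affine[OF \<gamma>P cL c\<gamma>]
    by (simp add: vec_eq_iff fun_eq_iff)
  then have "curl_cond ?u \<gamma>" using vt by (auto simp: curl_cond_def edge_int_def set_lebesgue_integral_def)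
  then show "\<exists>\<gamma>. curl_cond ?u \<gamma>" by blast
  fix \<eta> :: "point \<Rightarrow> real"
  have "Pi_D K ?u = p"
    by (rule Pi_D_Poly[OF p u eq]) (auto intro: vval_continuous smooth_continuous_on[OF sp] eq)
  then have "(\<integral>x. (?u x - Pi_D K ?u x) * \<eta> x \<partial>\<mu>) = (\<integral>x. 0 \<partial>\<mu>)"
    by (intro Bochner_Integration.integral_cong) (auto simp: space_restrict_space eq)
  then show "(\<integral>x. (?u x - Pi_D K ?u x) * \<eta> x \<partial>\<mu>) = 0" by simp
qed

lemma M_loc_zero: "(\<lambda>x. 0) \<in> M_loc K"
proof -
  have "restr K (\<lambda>x. 0) = (\<lambda>x. 0)" by (auto simp: restr_def fun_eq_iff)
  then show ?thesis using restr_Poly_M_loc[OF lin_space_zero[OF lin_space_Poly]] by simp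
qed

lemma lin_space_M_loc: "lin_space (M_loc K)"
  unfolding lin_space_def using M_loc_zero M_loc_lincomb by blast

lemma M_loc_H2: "\<phi> \<in> M_loc K \<Longrightarrow> \<phi> \<in> H2 R \<and> uniformly_continuous_on R \<phi> \<and> restr K \<phi> = \<phi>"
  using M_tilde_H2 by (simp add: M_loc_iff)

text \<open>An element with vanishing data is harmonic with zero trace, so its Hessian vanishes and the
  stabilisation, which is equivalent to the energy on the kernel of the projection, does as well.\<close>

lemma M_loc_data_zero:
  assumes S: "stabilisation c_lo c_up K S" and \<phi>: "\<phi> \<in> M_loc K" and d: "local_data \<phi> d"
    and z: "\<And>s k i j. s \<le> 3 \<Longrightarrow> k \<le> length K \<Longrightarrow> i \<le> 2 \<Longrightarrow> j \<le> 2 \<Longrightarrow> d (s, k, i, j) = 0"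
  shows "\<phi> = (\<lambda>x. 0)"
proof -
  have p0: "poly2 (\<lambda>i j. d (s, k, i, j)) = (\<lambda>x. 0)" if "s \<le> 3" "k \<le> length K" for s k
    using z[OF that] by (auto simp: poly2_def intro!: sum.neutral)
  have H: "\<phi> \<in> H2 R" using M_loc_H2[OF \<phi>] by simp
  have L: "L2_on \<mu> \<phi>" using H1_L2[OF H2_H1(1)[OF H]] .
  obtain g where g: "has_weak_trace K (wlap R \<phi>) (\<lambda>x. 0) g" "edge_const g (\<lambda>k. 0)"
  proof -
    obtain g where "has_weak_trace K (wlap R \<phi>) (poly2 (\<lambda>i j. d (0, 0, i, j))) g" "edge_const g (\<lambda>k. d (1, k, 0, 0))"
      using d unfolding local_data_def by blast
    then show ?thesis using that p0[of 0 0] z[of 1 _ 0 0] by (auto simp: edge_const_def)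
  qed
  obtain h where h: "has_trace K \<phi> h" "\<And>k x. k < length K \<Longrightarrow> x \<in> open_segment (vtx K k) (vtx K (Suc k)) \<Longrightarrow> h x = 0"
  proof -
    obtain h where "has_trace K \<phi> h" "\<forall>k<length K. \<forall>x\<in>open_segment (vtx K k) (vtx K (Suc k)). h x = poly2 (\<lambda>i j. d (2, k, i, j)) x"
      using d unfolding local_data_def by blast
    then show ?thesis using that p0[of 2] by auto
  qed
  have t0: "has_trace K \<phi> (\<lambda>x. 0)"
  proof (rule has_trace_cong_AE[OF h(1) L])
    fix a b assume ab: "(a, b) \<in> edges K"
    show "AE t in unit_lebesgue. h (linepath a b t) = 0"
    proof (rule AE_unit_open)
      fix t :: real assume "0 < t" "t < 1"
      then have "linepath a b t \<in> open_segment a b" using edges_neq[OF simple ab] linepath_open_segment by blast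
      then show "h (linepath a b t) = 0" using h(2) ab by (elim edgesE) (auto simp: open_segment_commute)
    qed
  qed auto
  obtain \<gamma> where \<gamma>: "has_vtrace K (wcurl R \<phi>) \<gamma>" using \<phi> unfolding M_loc_iff curl_cond_def by blast
  \<comment> \<open>The gradient is the curl turned back by a right angle, so its trace is obtained
    from that of the curl.\<close>
  define \<delta> :: "point \<Rightarrow> point" where "\<delta> x = vector [- \<gamma> x $ 2, \<gamma> x $ 1]" for x
  have \<delta>: "has_trace K (wd R i \<phi>) (\<lambda>x. \<delta> x $ i)" for i
  proof -
    have "has_trace K (\<lambda>x. wcurl R \<phi> x $ 1) (\<lambda>x. \<gamma> x $ 1)" "has_trace K (\<lambda>x. wcurl R \<phi> x $ 2) (\<lambda>x. \<gamma> x $ 2)"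
      using \<gamma> unfolding has_vtrace_def by blast+
    then have c: "has_trace K (wd R 2 \<phi>) (\<lambda>x. \<gamma> x $ 1)" "has_trace K (\<lambda>x. - wd R 1 \<phi> x) (\<lambda>x. \<gamma> x $ 2)" by simp_all
    have "has_trace K (wd R 1 \<phi>) (\<lambda>x. - \<gamma> x $ 2)"
      using has_trace_lincomb[OF c(2) has_trace_smooth[OF smooth_const[of 0]], of "-1"] by simp
    then show ?thesis using c exhaust_2[of i] by (auto simp: \<delta>_def vector_2)
  qed
  have "has_vtrace K (wgrad R \<phi>) \<delta>" using \<delta> by (simp add: has_vtrace_def)
  \<comment> \<open>The function itself is the test function in the definition of the weak trace; it
    qualifies because it has zero trace and its gradient has a trace.\<close>
  then have "(\<integral>x. wlap R \<phi> x * wlap R \<phi> x - \<phi> x * 0 \<partial>\<mu>) = 0"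
    using g(1)[unfolded weak_trace_const_iff[OF g(2)], rule_format, of \<phi> \<delta>] H t0 by simp
  then have "AE x in \<mu>. wlap R \<phi> x = 0"
    by (intro L2_on_zero_AE wlap_L2 H) (simp add: power2_eq_square)
  then have "AE x in \<mu>. wd R j (wd R i \<phi>) x = 0" for i j
    by (intro harmonic_zero_trace[OF H t0 \<delta>]) (simp add: wlap_def)
  then have zz: "(\<integral>x. wd R j (wd R i \<phi>) x * wd R j (wd R i \<phi>) x \<partial>\<mu>) = 0" for i j
  proof -
    have "(\<integral>x. wd R j (wd R i \<phi>) x * wd R j (wd R i \<phi>) x \<partial>\<mu>) = (\<integral>x. 0 \<partial>\<mu>)"
    proof (rule integral_cong_AE)
      show "AE x in \<mu>. wd R j (wd R i \<phi>) x * wd R j (wd R i \<phi>) x = 0"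
        using \<open>AE x in \<mu>. wd R j (wd R i \<phi>) x = 0\<close> by eventually_elim simp
    qed (intro borel_measurable_times borel_measurable_const L2_on_measurable wd2_L2 H)+
    then show ?thesis by simp
  qed
  have A: "A_loc R \<phi> \<phi> = 0" unfolding A_loc_sum[OF H H] zz by simp
  have "Pi_D K \<phi> = (\<lambda>x. 0)" using d p0[of 3 0] by (simp add: local_data_def)
  moreover have "\<forall>\<phi>\<in>M_loc K. Pi_D K \<phi> = (\<lambda>x. 0) \<longrightarrow> S \<phi> \<phi> \<le> c_up * A_loc R \<phi> \<phi>"
    using S by (simp add: stabilisation_def)
  ultimately have "S \<phi> \<phi> \<le> 0" using \<phi> A by fastforce
  moreover have "\<forall>u\<in>M_loc K. u \<noteq> (\<lambda>x. 0) \<longrightarrow> S u u > 0"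
    using S by (simp add: stabilisation_def spd_form_def)
  ultimately show ?thesis using \<phi> by (meson not_less)
qed

text \<open>The index set bounds all indices that \<open>local_data\<close> refers to, and an
  element whose data vanish there is 0, so the kernel required by \<open>fin_dim_relation\<close> is
  trivial.\<close>

lemma fin_dim_M_loc:
  assumes S: "stabilisation c_lo c_up K S" shows "fin_dim (M_loc K)"
proof -
  let ?Q = "\<lambda>\<phi> d. \<phi> \<in> M_loc K \<and> local_data \<phi> d"
  let ?J = "{..3::nat} \<times> {..length K} \<times> {..2::nat} \<times> {..2::nat}"
  have "fin_dim {\<phi>. \<exists>d. ?Q \<phi> d}"
  proof (rule fin_dim_relation[of ?J])
    show "?Q (\<lambda>x. a * u x + v x) (\<lambda>j. a * p j + q j)" if "?Q u p" "?Q v q" for u v p q a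
      using that M_loc_lincomb local_data_lincomb by blast
    have "{u. \<exists>d. ?Q u d \<and> (\<forall>j\<in>?J. d j = 0)} \<subseteq> {\<lambda>x. 0}"
    proof
      fix u assume "u \<in> {u. \<exists>d. ?Q u d \<and> (\<forall>j\<in>?J. d j = 0)}"
      then obtain d where d: "u \<in> M_loc K" "local_data u d" "\<forall>j\<in>?J. d j = 0" by blast
      have "d (s, k, i, j) = 0" if "s \<le> 3" "k \<le> length K" "i \<le> 2" "j \<le> 2" for s k i j
        using d(3) that by auto
      then have "u = (\<lambda>x. 0)" by (rule M_loc_data_zero[OF S d(1,2)])
      then show "u \<in> {\<lambda>x. 0}" by simp
    qed
    then show "fin_dim {u. \<exists>d. ?Q u d \<and> (\<forall>j\<in>?J. d j = 0)}" using fin_dim_zero fin_dim_subset by blast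
  qed simp
  moreover have "{\<phi>. \<exists>d. ?Q \<phi> d} = M_loc K" using M_loc_iff M_tilde_iff by blast
  ultimately show ?thesis by simp
qed

end

section \<open>Connectivity of a mesh\<close>

lemma small_multiple:
  assumes "m > 0" obtains t where "t > 0" "t * norm (v :: point) < m"
proof
  have n: "norm v + 1 > 0" by (simp add: add_nonneg_pos)
  then show "m / (norm v + 1) > 0" "m / (norm v + 1) * norm v < m"
    using assms by (auto simp: pos_divide_less_eq distrib_left)
qed

context star_polygon
begin

abbreviation side :: "point \<Rightarrow> point \<Rightarrow> point \<Rightarrow> real" where
  "side a b z \<equiv> (perp a b \<bullet> (z - a)) * (perp a b \<bullet> (c - a))"

lemma open_edge_separate:
  assumes e: "(a, b) \<in> edges K" and x: "x \<in> open_segment a b"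
  shows "x \<notin> set K" and "(p, q) \<in> edges K \<Longrightarrow> x \<in> closed_segment p q \<Longrightarrow> {p, q} = {a, b}"
proof -
  obtain k where k: "k < length K" "open_segment a b = open_segment (vtx K k) (vtx K (Suc k))" "{a, b} = {vtx K k, vtx K (Suc k)}"
    using e by (elim edgesE) (auto simp: open_segment_commute)
  show "x \<notin> set K"
  proof
    assume "x \<in> set K"
    then obtain l where l: "l < length K" "x = vtx K l" using in_set_vtx by blast
    then have "x \<in> seg K l" by (simp add: seg_def)
    then have "k = l" using open_edges_disjoint[OF k(1) l(1)] x k(2) by simp
    then show False using x l k(2) open_segment_endpoints by blast
  qed
  assume pq: "(p, q) \<in> edges K" "x \<in> closed_segment p q"
  obtain l where l: "l < length K" "closed_segment p q = seg K l" "{p, q} = {vtx K l, vtx K (Suc l)}"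
    using edges_seg[OF pq(1)] by blast
  then have "k = l" using open_edges_disjoint[OF k(1) l(1)] x k(2) pq(2) by simp
  then show "{p, q} = {a, b}" using l k by simp
qed

lemma side_towards:
  assumes e: "(a, b) \<in> edges K" and x: "x \<in> open_segment a b"
  shows "perp a b \<bullet> (x + t *\<^sub>R (c - x) - a) = t * (perp a b \<bullet> (c - a))"
proof -
  obtain u where "x = (1 - u) *\<^sub>R a + u *\<^sub>R b" using x unfolding in_segment by auto
  then have "x - a = u *\<^sub>R (b - a)" by (simp add: algebra_simps)
  then have 0: "perp a b \<bullet> (x - a) = 0" using perp_inner_self[of a b] by (simp add: inner_scaleR_right)
  have "x + t *\<^sub>R (c - x) - a = t *\<^sub>R (c - a) + (1 - t) *\<^sub>R (x - a)" by (simp add: algebra_simps)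
  then show ?thesis using 0 by (simp add: inner_add_right inner_scaleR_right)
qed

lemma edge_local:
  assumes e: "(a, b) \<in> edges K" and x: "x \<in> open_segment a b"
  shows "\<exists>\<delta>>0. \<forall>z\<in>ball x \<delta>. z \<in> R \<longleftrightarrow> side a b z > 0"
  using local_structure[OF edges_neq[OF simple e] edge_frontier[OF e] x] .

lemma edge_off_line: "(a, b) \<in> edges K \<Longrightarrow> perp a b \<bullet> (c - a) \<noteq> 0"
  using centre_off_line[OF edges_neq[OF simple] edge_frontier] .

text \<open>Beyond the edge, away from the centre, lies an open half-disc disjoint from the region
  and hence from its closure; it comes arbitrarily close to x.\<close>

lemma edge_not_interior:
  assumes e: "(a, b) \<in> edges K" and x: "x \<in> open_segment a b"
  shows "x \<notin> interior (closure R)"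
proof
  assume "x \<in> interior (closure R)"
  then obtain d where d: "d > 0" "ball x d \<subseteq> closure R" unfolding mem_interior by blast
  obtain \<delta> where \<delta>: "\<delta> > 0" "\<forall>z\<in>ball x \<delta>. z \<in> R \<longleftrightarrow> side a b z > 0" using edge_local[OF e x] by blast
  let ?W = "ball x \<delta> \<inter> {z. side a b z < 0}"
  have "open ?W" by (intro open_Int open_Collect_less continuous_intros) auto
  moreover have "?W \<inter> R = {}" using \<delta> by force
  ultimately have W: "?W \<inter> closure R = {}" using open_Int_closure_eq_empty by blast
  have "min d \<delta> > 0" using d \<delta> by simp
  then obtain t where t: "t > 0" and tn: "t * norm (c - x) < min d \<delta>" by (rule small_multiple)
  let ?z = "x + (-t) *\<^sub>R (c - x)"
  have "dist x ?z = t * norm (c - x)" using t by (simp add: dist_norm)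
  then have z: "?z \<in> ball x d" "?z \<in> ball x \<delta>" using tn by auto
  have "side a b ?z = (-t) * (perp a b \<bullet> (c - a))^2" unfolding side_towards[OF e x] by (simp add: power2_eq_square)
  also have "\<dots> < 0" using t edge_off_line[OF e] by (simp add: mult_neg_pos)
  finally show False using z W d by blast
qed

end

text \<open>A short step from the midpoint towards c enters the first region. Were c' on the same
  side, this point would belong to the second region too.\<close>

lemma opposite_sides:
  assumes K: "star_polygon K c r" and K': "star_polygon K' c' r'" and d: "region K \<inter> region K' = {}"
    and e: "(a, b) \<in> edges K" "(a, b) \<in> edges K'"
  shows "(perp a b \<bullet> (c - a)) * (perp a b \<bullet> (c' - a)) < 0"
proof -
  interpret K: star_polygon K c r by (rule K)
  interpret K': star_polygon K' c' r' by (rule K')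
  let ?x = "midpoint a b"
  have x: "?x \<in> open_segment a b" using edges_neq[OF K.simple e(1)] by simp
  obtain \<delta> where \<delta>: "\<delta> > 0" "\<forall>z\<in>ball ?x \<delta>. z \<in> region K \<longleftrightarrow> K.side a b z > 0" using K.edge_local[OF e(1) x] by blast
  obtain \<delta>' where \<delta>': "\<delta>' > 0" "\<forall>z\<in>ball ?x \<delta>'. z \<in> region K' \<longleftrightarrow> K'.side a b z > 0" using K'.edge_local[OF e(2) x] by blast
  have "min \<delta> \<delta>' > 0" using \<delta> \<delta>' by simp
  then obtain t where t: "t > 0" and tn: "t * norm (c - ?x) < min \<delta> \<delta>'" by (rule small_multiple)
  let ?z = "?x + t *\<^sub>R (c - ?x)"
  have "dist ?x ?z = t * norm (c - ?x)" using t by (simp add: dist_norm)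
  then have z: "?z \<in> ball ?x \<delta>" "?z \<in> ball ?x \<delta>'" using tn by auto
  have "K.side a b ?z = t * (perp a b \<bullet> (c - a))^2" unfolding K.side_towards[OF e(1) x] by (simp add: power2_eq_square)
  then have "?z \<in> region K" using \<delta>(2) z t K.edge_off_line[OF e(1)] by simp
  then have "?z \<notin> region K'" using d by blast
  then have "\<not> K'.side a b ?z > 0" using \<delta>'(2) z by blast
  then have "\<not> t * ((perp a b \<bullet> (c - a)) * (perp a b \<bullet> (c' - a))) > 0" unfolding K.side_towards[OF e(1) x] by (simp add: mult.assoc)
  then have "(perp a b \<bullet> (c - a)) * (perp a b \<bullet> (c' - a)) \<le> 0" using t by (metis mult_pos_pos not_less)
  then show ?thesis using K.edge_off_line[OF e(1)] K'.edge_off_line[OF e(2)] by (simp add: less_le)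
qed

text \<open>Near x every point off the line of the edge is on the side of one of the two centres and
  therefore in a region. The uncovered points form an open subset of a line, which is empty.\<close>

lemma shared_edge_interior:
  assumes K: "star_polygon K c r" and K': "star_polygon K' c' r'" and d: "region K \<inter> region K' = {}"
    and e: "(a, b) \<in> edges K" "(a, b) \<in> edges K'" and x: "x \<in> open_segment a b"
  shows "x \<in> interior (closure (region K) \<union> closure (region K'))"
proof -
  interpret K: star_polygon K c r by (rule K)
  interpret K': star_polygon K' c' r' by (rule K')
  obtain \<delta> where \<delta>: "\<delta> > 0" "\<forall>z\<in>ball x \<delta>. z \<in> region K \<longleftrightarrow> K.side a b z > 0" using K.edge_local[OF e(1) x] by blast
  obtain \<delta>' where \<delta>': "\<delta>' > 0" "\<forall>z\<in>ball x \<delta>'. z \<in> region K' \<longleftrightarrow> K'.side a b z > 0" using K'.edge_local[OF e(2) x] by blast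
  let ?B = "ball x \<delta> \<inter> ball x \<delta>'" and ?C = "closure (region K) \<union> closure (region K')"
  have opp: "(perp a b \<bullet> (c - a)) * (perp a b \<bullet> (c' - a)) < 0" by (rule opposite_sides[OF K K' d e])
  have off: "z \<in> ?C" if "z \<in> ?B" "perp a b \<bullet> (z - a) \<noteq> 0" for z
  proof -
    have "K.side a b z > 0 \<or> K'.side a b z > 0" using opp that(2) by (auto simp: zero_less_mult_iff mult_less_0_iff)
    then have "z \<in> region K \<or> z \<in> region K'" using \<delta> \<delta>' that(1) by blast
    then show ?thesis using closure_subset by blast
  qed
  have p: "perp a b \<noteq> 0" using K.edge_off_line[OF e(1)] by auto
  have "?B - ?C \<subseteq> {z. perp a b \<bullet> z = perp a b \<bullet> a}" using off by (force simp: inner_diff_right)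
  moreover have "open (?B - ?C)" by (intro open_Diff open_Int open_ball closed_Un closed_closure)
  ultimately have "?B - ?C \<subseteq> interior {z. perp a b \<bullet> z = perp a b \<bullet> a}" by (rule interior_maximal)
  then have "?B - ?C = {}" using interior_hyperplane[OF p] by simp
  then have "?B \<subseteq> ?C" by blast
  moreover have "open ?B" "x \<in> ?B" using \<delta> \<delta>' by auto
  ultimately show ?thesis unfolding interior_def by blast
qed

locale star_mesh =
  fixes \<Omega> :: "point set" and \<T> :: "polygon set"
  assumes \<Omega>_open: "open \<Omega>" and mesh: "is_mesh \<Omega> \<T>" and star_elements: "\<And>K. K \<in> \<T> \<Longrightarrow> \<exists>c r. star_polygon K c r"
begin

lemma finite_mesh: "finite \<T>" and region_subset: "K \<in> \<T> \<Longrightarrow> region K \<subseteq> \<Omega>"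
  and cover: "(\<Union>K\<in>\<T>. closure (region K)) = closure \<Omega>"
  and regions_disjoint: "K \<in> \<T> \<Longrightarrow> K' \<in> \<T> \<Longrightarrow> K \<noteq> K' \<Longrightarrow> region K \<inter> region K' = {}"
  and closures_Int: "K \<in> \<T> \<Longrightarrow> K' \<in> \<T> \<Longrightarrow> K \<noteq> K' \<Longrightarrow> closure (region K) \<inter> closure (region K')
        = (set K \<inter> set K') \<union> (\<Union>(a, b)\<in>edges K \<inter> edges K'. closed_segment a b)"
  using mesh by (auto simp: is_mesh_def)

text \<open>By the conformity of the mesh an interior point of the edge is in the closure of no
  other element. If it were in \<Omega>, the finitely many other closed elements would leave it a
  neighbourhood covered by this one alone, which \<open>edge_not_interior\<close> excludes.\<close>

lemma unshared_edge_boundary: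
  assumes K: "K \<in> \<T>" and e: "(a, b) \<in> edges K"
    and u: "\<And>K'. K' \<in> \<T> \<Longrightarrow> K' \<noteq> K \<Longrightarrow> (a, b) \<notin> edges K'"
  shows "closed_segment a b \<subseteq> frontier \<Omega>"
proof -
  obtain c r where "star_polygon K c r" using star_elements[OF K] by blast
  then interpret star_polygon K c r .
  have ab: "a \<noteq> b" using edges_neq[OF simple e] .
  have "x \<in> frontier \<Omega>" if x: "x \<in> open_segment a b" for x
  proof -
    have xK: "x \<in> closure R" using edge_frontier[OF e] x frontier_closure segment_open_subset_closed by blast
    have other: "x \<notin> closure (region K')" if K': "K' \<in> \<T>" "K' \<noteq> K" for K'
    proof
      assume "x \<in> closure (region K')"
      then consider "x \<in> set K" | p q where "(p, q) \<in> edges K" "(p, q) \<in> edges K'" "x \<in> closed_segment p q"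
        using closures_Int[OF K K'(1)] K'(2) xK by blast
      then show False
      proof cases
        case 1
        then show False using open_edge_separate(1)[OF e x] by blast
      next
        case 2
        have "{p, q} = {a, b}" using open_edge_separate(2)[OF e x 2(1,3)] .
        then have "(a, b) \<in> edges K'" using 2(2) edges_sym by (auto simp: doubleton_eq_iff)
        then show False using u K' by blast
      qed
    qed
    have "x \<notin> \<Omega>"
    proof
      assume "x \<in> \<Omega>"
      let ?W = "\<Omega> \<inter> - (\<Union>K'\<in>\<T> - {K}. closure (region K'))"
      have "open ?W" using \<Omega>_open finite_mesh by (intro open_Int open_Compl closed_UN) auto
      moreover have "x \<in> ?W" using \<open>x \<in> \<Omega>\<close> other by blast
      moreover have "?W \<subseteq> closure R" using cover closure_subset by blast
      ultimately have "x \<in> interior (closure R)" unfolding interior_def by blast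
      then show False using edge_not_interior[OF e x] by blast
    qed
    moreover have "x \<in> closure \<Omega>" using xK cover K by blast
    ultimately show ?thesis using \<Omega>_open by (simp add: frontier_def interior_open)
  qed
  then have "closure (open_segment a b) \<subseteq> frontier \<Omega>" by (intro closure_minimal frontier_closed) blast
  then show ?thesis using ab by simp
qed

text \<open>The union of the elements violating \<open>Z\<close> is relatively open and closed in the complement of the
  finite vertex set, which is connected and unbounded.\<close>

lemma mesh_induct:
  assumes boundary: "\<And>K a b. K \<in> \<T> \<Longrightarrow> (a, b) \<in> edges K \<Longrightarrow> closed_segment a b \<subseteq> frontier \<Omega> \<Longrightarrow> Z K"
    and shared: "\<And>K K' a b. K \<in> \<T> \<Longrightarrow> K' \<in> \<T> \<Longrightarrow> K \<noteq> K' \<Longrightarrow> (a, b) \<in> edges K \<Longrightarrow> (a, b) \<in> edges K' \<Longrightarrow> Z K' \<Longrightarrow> Z K"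
    and K0: "K0 \<in> \<T>"
  shows "Z K0"
proof (rule ccontr)
  assume nZ: "\<not> Z K0"
  define M where "M = {K \<in> \<T>. \<not> Z K}"
  define C where "C = (\<Union>K\<in>M. closure (region K))"
  define N where "N = (\<Union>K\<in>\<T>. set K)"
  have finM: "finite M" using finite_mesh by (simp add: M_def)
  have finN: "finite N" using finite_mesh by (simp add: N_def)
  have "closed C" using finM by (auto simp: C_def)
  have "bounded C"
  proof -
    have "bounded (closure (region K))" if "K \<in> M" for K
      using that star_elements[of K] region_Jordan(3)[OF star_polygon.simple] by (auto simp: M_def)
    then show ?thesis using finM by (auto simp: C_def)
  qed
  \<comment> \<open>Away from the vertices a point of C is in an open region or on an open edge.
    That edge is not on the boundary, since its element violates Z; hence it is shared, and its
    neighbour violates Z as well.\<close>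
  have inner: "x \<in> interior C" if x: "x \<in> C" "x \<notin> N" for x
  proof -
    obtain K where K: "K \<in> \<T>" "\<not> Z K" "x \<in> closure (region K)" using x by (auto simp: C_def M_def)
    then have KC: "closure (region K) \<subseteq> C" by (auto simp: C_def M_def)
    obtain c r where st: "star_polygon K c r" using star_elements[OF K(1)] by blast
    interpret star_polygon K c r by (rule st)
    show ?thesis
    proof (cases "x \<in> R")
      case True
      moreover have "R \<subseteq> C" using KC closure_subset by blast
      ultimately show ?thesis using open_U unfolding interior_def by blast
    next
      case False
      then have "x \<in> frontier R" using K(3) open_U by (simp add: frontier_def interior_open)
      then obtain k where k: "k < length K" "x \<in> seg K k"
        using region_Jordan(4)[OF simple] by (auto simp: polygon_boundary_seg)
      let ?a = "vtx K k" and ?b = "vtx K (Suc k)"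
      have "K \<noteq> []" using k by auto
      then have "?a \<in> N" "?b \<in> N" using K(1) vtx_in_set by (auto simp: N_def)
      then have xo: "x \<in> open_segment ?a ?b" using seg_cases[OF k(2)] x(2) by auto
      have e: "(?a, ?b) \<in> edges K" using k(1) by (rule edgesI)
      obtain K' where K': "K' \<in> \<T>" "K' \<noteq> K" "(?a, ?b) \<in> edges K'"
        using unshared_edge_boundary[OF K(1) e] boundary[OF K(1) e] K(2) by blast
      then have "\<not> Z K'" using shared[OF K(1) K'(1) _ e] K(2) by blast
      then have K'C: "closure (region K') \<subseteq> C" using K' by (auto simp: C_def M_def)
      obtain c' r' where st': "star_polygon K' c' r'" using star_elements[OF K'(1)] by blast
      have "x \<in> interior (closure R \<union> closure (region K'))"
        using shared_edge_interior[OF st st' regions_disjoint[OF K(1) K'(1)] e K'(3) xo] K'(2) by blast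
      then show ?thesis using interior_mono[of "closure R \<union> closure (region K')" C] KC K'C by blast
    qed
  qed
  have conn: "connected (- N)"
    by (rule path_connected_imp_connected[OF path_connected_complement_countable]) (use finN in \<open>auto intro: countable_finite\<close>)
  have "interior C \<inter> - N = {} \<or> - C \<inter> - N = {}"
  proof (rule connectedD[OF conn])
    show "interior C \<inter> - C \<inter> - N = {}" using interior_subset by blast
    show "- N \<subseteq> interior C \<union> - C" using inner by blast
  qed (use \<open>closed C\<close> in auto)
  then show False
  proof
    assume "interior C \<inter> - N = {}"
    then have "interior C \<subseteq> N" by blast
    then have "finite (interior C)" using finN finite_subset by blast
    then have "interior C = {}" using finite_imp_not_open[of "interior C"] by blast
    moreover have "region K0 \<subseteq> C" using closure_subset nZ K0 by (fastforce simp: C_def M_def)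
    ultimately show False using region_Jordan(1,2) star_polygon.simple star_elements[OF K0] interior_maximal by blast
  next
    assume "- C \<inter> - N = {}"
    then have "UNIV \<subseteq> C \<union> N" by blast
    moreover have "bounded (C \<union> N)" using \<open>bounded C\<close> finite_imp_bounded[OF finN] by simp
    ultimately show False using bounded_subset not_bounded_UNIV by blast
  qed
qed

end

section \<open>The discrete forms on one element\<close>

text \<open>The substitution t to 1 - t. It is needed because \<open>edges\<close> contains both
  orientations of an edge, while Green's formula is a sum over one of them.\<close>

lemma edge_int_reverse:
  assumes "integrable unit_lebesgue (\<lambda>t. g (linepath b a t))" "integrable unit_lebesgue (\<lambda>t. g (linepath a b t))"
  shows "edge_int a b g = edge_int b a g"
proof -
  let ?h = "\<lambda>t. g (linepath b a t)"
  have eq: "(\<integral>t. f t \<partial>unit_lebesgue) = integral {0..1} f" if "integrable unit_lebesgue f" for f :: "real \<Rightarrow> real"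
    using lebesgue_integral_eq_integral[OF that] by simp
  have "?h integrable_on {0..1}"
    using assms(1) by (intro integrable_on_lebesgue_on) auto
  then have "(?h has_integral integral {0..1} ?h) (cbox 0 1)" by (simp add: integrable_integral)
  from has_integral_affinity[OF this, of "-1" 1]
  have "((\<lambda>t. ?h (1 - t)) has_integral integral {0..1} ?h) ((\<lambda>t. 1 - t) ` {0..1})" by simp
  moreover have "(\<lambda>t. 1 - t) ` {0..1} = {0..1::real}" by (auto simp: image_iff intro: bexI[of _ "1 - _"])
  moreover have "?h (1 - t) = g (linepath a b t)" for t by (simp add: linepath_def add.commute)
  ultimately have "((\<lambda>t. g (linepath a b t)) has_integral integral {0..1} ?h) {0..1}" by simp
  then have "integral {0..1} (\<lambda>t. g (linepath a b t)) = integral {0..1} ?h" by (rule integral_unique)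
  then show ?thesis using eq[OF assms(1)] eq[OF assms(2)] by (simp add: edge_int_lebesgue_on dist_commute)
qed

text \<open>Equal values at the two ends annihilate the tangential derivative, so the gradient n is
  orthogonal to the edge and to its normal.\<close>

lemma affine_zero_cauchy:
  assumes "a \<noteq> b" "n \<bullet> a + d = 0" "n \<bullet> b + d = 0" "n \<bullet> edge_normal a b = (0::real)"
  shows "n = 0 \<and> d = 0"
proof -
  have "n \<bullet> perp a b = 0" using assms(1,4) by (simp add: edge_normal_def perp_def)
  then have "n$1 * (b$2 - a$2) = n$2 * (b$1 - a$1)" by (simp add: inner_2 algebra_simps)
  moreover have "n$1 * (b$1 - a$1) + n$2 * (b$2 - a$2) = 0"
    using assms(2,3) by (simp add: inner_2 algebra_simps)
  ultimately have "n$1 * ((b$1 - a$1)^2 + (b$2 - a$2)^2) = 0" "n$2 * ((b$1 - a$1)^2 + (b$2 - a$2)^2) = 0"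
    by algebra+
  moreover have "(b$1 - a$1)^2 + (b$2 - a$2)^2 \<noteq> 0"
    using assms(1) by (auto simp: sum_power2_eq_zero_iff vec_eq_iff forall_2)
  ultimately have "n = 0" unfolding vec_eq_iff forall_2 by (metis mult_eq_0_iff zero_index)
  then show ?thesis using assms(2) by simp
qed

context star_polygon
begin

lemma trace_zero_mean:
  assumes u: "has_trace K u g" "AE x in \<mu>. u x = 0" and e: "(a, b) \<in> edges K"
  shows "edge_int a b g = 0"
proof -
  interpret L: finite_measure unit_lebesgue by (rule finite_measure_unit)
  have i: "integrable unit_lebesgue (\<lambda>t. g (linepath p q t))" if "(p, q) \<in> edges K" for p q
    using has_trace_edge_L2[OF u(1) that] by (rule L.L2_on_integrable)
  have 0: "edge_int (vtx K k) (vtx K (Suc k)) g = 0" if "k < length K" for k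
    using zero_trace_mean[OF u that] by (simp add: edge_int_lebesgue_on)
  show ?thesis using e
  proof (cases rule: edgesE)
    case (1 k)
    then show ?thesis using 0[OF 1(1)] edge_int_reverse[OF i i, OF edges_sym[OF e] e] by auto
  qed
qed

text \<open>Subtracting the constant gradient leaves a trace of a function that is zero almost
  everywhere, and such a trace has mean 0 on the edge. The result thus holds for whatever trace
  \<gamma> was chosen.\<close>

lemma affine_normal_mean:
  assumes \<phi>: "\<phi> \<in> H2 R" "\<And>x. x \<in> R \<Longrightarrow> \<phi> x = n \<bullet> x + d"
    and \<gamma>: "has_vtrace K (wgrad R \<phi>) \<gamma>" and e: "(a, b) \<in> edges K"
  shows "edge_int a b (\<lambda>x. \<gamma> x \<bullet> m) = dist a b * (n \<bullet> m)"
proof -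
  interpret L: finite_measure unit_lebesgue by (rule finite_measure_unit)
  have wd: "AE x in \<mu>. wd R i \<phi> x = n $ i" for i
  proof -
    have "wd R i \<phi> = wd R i (\<lambda>x. n \<bullet> x + d)" using \<phi>(2) by (rule wd_local)
    then show ?thesis using smooth_wd[OF smooth_affine[of n d], of i] by (simp add: pd_affine)
  qed
  have mean: "(\<integral>t. \<gamma> (linepath a b t) $ i \<partial>unit_lebesgue) = n $ i" for i
  proof -
    have t: "has_trace K (wd R i \<phi>) (\<lambda>x. \<gamma> x $ i)" using \<gamma> by (simp add: has_vtrace_def)
    have "has_trace K (\<lambda>x. 1 * wd R i \<phi> x + - n $ i) (\<lambda>x. 1 * \<gamma> x $ i + - n $ i)"
      by (rule has_trace_lincomb[OF t has_trace_smooth[OF smooth_const]])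
    moreover have "AE x in \<mu>. 1 * wd R i \<phi> x + - n $ i = 0" using wd[of i] by eventually_elim simp
    ultimately have "edge_int a b (\<lambda>x. 1 * \<gamma> x $ i + - n $ i) = 0" using e by (rule trace_zero_mean)
    then have "(\<integral>t. \<gamma> (linepath a b t) $ i - n $ i \<partial>unit_lebesgue) = 0"
      using edge_dist_pos[OF e] by (simp add: edge_int_lebesgue_on)
    moreover have "integrable unit_lebesgue (\<lambda>t. \<gamma> (linepath a b t) $ i)"
      using has_trace_edge_L2[OF t e] by (rule L.L2_on_integrable)
    ultimately show ?thesis by (simp add: measure_restrict_space space_restrict_space)
  qed
  have i: "integrable unit_lebesgue (\<lambda>t. \<gamma> (linepath a b t) $ i)" for i
    using has_vtrace_edge_L2[OF \<gamma> e] by (rule L.L2_on_integrable)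
  have "(\<integral>t. \<gamma> (linepath a b t) \<bullet> m \<partial>unit_lebesgue) = n \<bullet> m"
    unfolding inner_2 using i mean by simp
  then show ?thesis by (simp add: edge_int_lebesgue_on)
qed

lemma vval_affine:
  assumes "\<And>x. x \<in> R \<Longrightarrow> \<phi> x = n \<bullet> x + d" "v \<in> set K" shows "vval K \<phi> v = n \<bullet> v + d"
  by (rule vval_continuous[OF _ assms]) (intro continuous_intros)

section \<open>The stabilised energy form on one element\<close>

definition disc :: "((point \<Rightarrow> real) \<Rightarrow> (point \<Rightarrow> real) \<Rightarrow> real) \<Rightarrow> (point \<Rightarrow> real) \<Rightarrow> (point \<Rightarrow> real) \<Rightarrow> real" where
  "disc S \<phi> \<eta> = A_loc R (Pi_D K \<phi>) (Pi_D K \<eta>)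
     + S (restr K (\<lambda>x. \<phi> x - Pi_D K \<phi> x)) (restr K (\<lambda>x. \<eta> x - Pi_D K \<eta> x))"

lemma remainder_M_loc:
  assumes "restr K \<phi> \<in> M_loc K"
  shows "restr K (\<lambda>x. \<phi> x - Pi_D K \<phi> x) \<in> M_loc K" "Pi_D K \<phi> \<in> Poly 2"
proof -
  have H: "restr K \<phi> \<in> H2 R" using M_loc_H2[OF assms] by simp
  show P: "Pi_D K \<phi> \<in> Poly 2" using Pi_D_spec(1)[OF H] by (simp add: Pi_D_restr)
  have "(\<lambda>x. restr K \<phi> x - restr K (Pi_D K \<phi>) x) \<in> M_loc K"
    by (rule lin_space_diff[OF lin_space_M_loc assms restr_Poly_M_loc[OF P]])
  moreover have "(\<lambda>x. restr K \<phi> x - restr K (Pi_D K \<phi>) x) = restr K (\<lambda>x. \<phi> x - Pi_D K \<phi> x)"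
    by (auto simp: restr_def)
  ultimately show "restr K (\<lambda>x. \<phi> x - Pi_D K \<phi> x) \<in> M_loc K" by simp
qed

lemma Pi_D_restr_lincomb:
  assumes "restr K \<phi> \<in> M_loc K" "restr K \<psi> \<in> M_loc K"
  shows "Pi_D K (\<lambda>x. a * \<phi> x + \<psi> x) = (\<lambda>x. a * Pi_D K \<phi> x + Pi_D K \<psi> x)"
proof -
  have "Pi_D K (\<lambda>x. a * restr K \<phi> x + restr K \<psi> x) = (\<lambda>x. a * Pi_D K (restr K \<phi>) x + Pi_D K (restr K \<psi>) x)"
    using M_loc_H2[OF assms(1)] M_loc_H2[OF assms(2)] by (intro Pi_D_lincomb vval_lincomb) auto
  then show ?thesis using Pi_D_restr[of "\<lambda>x. a * \<phi> x + \<psi> x"] by (simp add: restr_lincomb Pi_D_restr)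
qed

lemma disc_lincomb:
  assumes S: "spd_form (M_loc K) S"
    and M: "restr K \<phi> \<in> M_loc K" "restr K \<psi> \<in> M_loc K" "restr K \<eta> \<in> M_loc K"
  shows "disc S (\<lambda>x. a * \<phi> x + \<psi> x) \<eta> = a * disc S \<phi> \<eta> + disc S \<psi> \<eta>"
proof -
  let ?r = "\<lambda>\<phi>. restr K (\<lambda>x. \<phi> x - Pi_D K \<phi> x)"
  note Pi = Pi_D_restr_lincomb[OF M(1,2)]
  have "?r (\<lambda>x. a * \<phi> x + \<psi> x) = (\<lambda>x. a * ?r \<phi> x + ?r \<psi> x)"
    unfolding Pi restr_def by (auto simp: algebra_simps)
  moreover have "S (\<lambda>x. a * ?r \<phi> x + ?r \<psi> x) (?r \<eta>) = a * S (?r \<phi>) (?r \<eta>) + S (?r \<psi>) (?r \<eta>)"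
    using S M(1,2,3)[THEN remainder_M_loc(1)] unfolding spd_form_def by blast
  moreover have "A_loc R (\<lambda>x. a * Pi_D K \<phi> x + Pi_D K \<psi> x) (Pi_D K \<eta>)
      = a * A_loc R (Pi_D K \<phi>) (Pi_D K \<eta>) + A_loc R (Pi_D K \<psi>) (Pi_D K \<eta>)"
    using M[THEN remainder_M_loc(2)] by (intro A_loc_lincomb Poly_H2)
  ultimately show ?thesis unfolding disc_def Pi by (simp add: distrib_left)
qed

lemma disc_commute:
  assumes S: "spd_form (M_loc K) S" and M: "restr K \<phi> \<in> M_loc K" "restr K \<eta> \<in> M_loc K"
  shows "disc S \<phi> \<eta> = disc S \<eta> \<phi>"
proof -
  let ?r = "\<lambda>\<phi>. restr K (\<lambda>x. \<phi> x - Pi_D K \<phi> x)"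
  have "S (?r \<phi>) (?r \<eta>) = S (?r \<eta>) (?r \<phi>)"
    using S M[THEN remainder_M_loc(1)] unfolding spd_form_def by blast
  then show ?thesis unfolding disc_def using A_loc_commute[of "Pi_D K \<phi>" "Pi_D K \<eta>"] by linarith
qed

lemma spd_form_nonneg:
  assumes S: "spd_form (M_loc K) S" and u: "u \<in> M_loc K"
  shows "S u u \<ge> 0" "S u u = 0 \<Longrightarrow> u = (\<lambda>x. 0)"
proof -
  have pos: "u \<noteq> (\<lambda>x. 0) \<Longrightarrow> S u u > 0" using S u unfolding spd_form_def by blast
  then show "S u u = 0 \<Longrightarrow> u = (\<lambda>x. 0)" by (metis less_irrefl)
  have "S (\<lambda>x. a * u x + v x) w = a * S u w + S v w"
    if "u \<in> M_loc K" "v \<in> M_loc K" "w \<in> M_loc K" for a u v w using S that unfolding spd_form_def by blast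
  from this[OF M_loc_zero M_loc_zero M_loc_zero, of 1] have "S (\<lambda>x. 0) (\<lambda>x. 0) = 0" by simp
  then show "S u u \<ge> 0" using pos by (cases "u = (\<lambda>x. 0)") (auto intro: less_imp_le)
qed

lemma disc_nonneg:
  assumes S: "spd_form (M_loc K) S" and M: "restr K \<phi> \<in> M_loc K" shows "disc S \<phi> \<phi> \<ge> 0"
  unfolding disc_def by (intro add_nonneg_nonneg A_loc_nonneg spd_form_nonneg[OF S] remainder_M_loc M)

text \<open>Both summands are non-negative and so vanish separately: the second forces \<phi> to
  equal its projection, the first forces the projection to have zero Hessian.\<close>

lemma disc_zero_affine:
  assumes S: "spd_form (M_loc K) S" and M: "restr K \<phi> \<in> M_loc K" and 0: "disc S \<phi> \<phi> = 0"
  shows "\<exists>n d. \<forall>x\<in>R. \<phi> x = n \<bullet> x + d"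
proof -
  let ?r = "restr K (\<lambda>x. \<phi> x - Pi_D K \<phi> x)"
  have r: "?r \<in> M_loc K" and P: "Pi_D K \<phi> \<in> Poly 2" using remainder_M_loc[OF M] by auto
  have "A_loc R (Pi_D K \<phi>) (Pi_D K \<phi>) \<ge> 0" "S ?r ?r \<ge> 0" using A_loc_nonneg spd_form_nonneg(1)[OF S r] by auto
  then have *: "A_loc R (Pi_D K \<phi>) (Pi_D K \<phi>) = 0" "S ?r ?r = 0" using 0 unfolding disc_def by linarith+
  have "?r = (\<lambda>x. 0)" using spd_form_nonneg(2)[OF S r *(2)] .
  then have "\<forall>x\<in>R. \<phi> x = Pi_D K \<phi> x" by (metis restr_eq right_minus_eq)
  moreover have "Pi_D K \<phi> \<in> Poly 1" using A_loc_zero_Poly_1[OF P *(1)] .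
  then obtain n d where "Pi_D K \<phi> = (\<lambda>x. n \<bullet> x + d)" unfolding Poly_1_iff by blast
  ultimately show ?thesis by auto
qed

lemma proj_lincomb:
  assumes u: "L2_on \<mu> u" "L2_on \<mu> v" "L2_on \<mu> w" "AE x in \<mu>. w x = a * u x + v x" and m: "m \<le> 1"
  shows "L2proj m R w x = a * L2proj m R u x + L2proj m R v x"
  using L2proj_lincomb[OF m u] by simp

section \<open>The convective form and the load on one element\<close>

abbreviation proj1 :: "(point \<Rightarrow> real) \<Rightarrow> 2 \<Rightarrow> point \<Rightarrow> real" where
  "proj1 \<phi> i \<equiv> L2proj 1 R (wd R i \<phi>)"

definition conv :: "(point \<Rightarrow> real) \<Rightarrow> (point \<Rightarrow> real) \<Rightarrow> (point \<Rightarrow> real) \<Rightarrow> real" where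
  "conv \<zeta> \<phi> \<eta> = (LINT x:R|lebesgue.
     (L2proj 0 R (wlap R \<zeta>) x *\<^sub>R VL2proj 1 R (wcurl R \<phi>) x) \<bullet> VL2proj 1 R (wgrad R \<eta>) x)"

lemma wd_L2_H2: "\<phi> \<in> H2 R \<Longrightarrow> L2_on \<mu> (wd R i \<phi>)"
  by (intro wd_L2 H2_H1(1))

lemma proj_wcurl:
  assumes "\<phi> \<in> H2 R" shows "VL2proj 1 R (wcurl R \<phi>) x = vector [proj1 \<phi> 2 x, - proj1 \<phi> 1 x]"
proof -
  have L: "L2_on \<mu> (\<lambda>x. wcurl R \<phi> x $ i)" for i by (rule H1_L2[OF wcurl_H1[OF assms]])
  have "L2proj 1 R (\<lambda>x. - wd R 1 \<phi> x) x = -1 * proj1 \<phi> 1 x + L2proj 1 R (\<lambda>x. 0) x"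
    using L2_on_zero wd_L2_H2[OF assms] L[of 2] by (intro proj_lincomb) auto
  moreover have "L2proj 1 R (\<lambda>x. 0) = (\<lambda>x. 0)"
    by (intro L2proj_eqI) (auto simp: L2_on_zero lin_space_zero lin_space_Poly)
  ultimately show ?thesis using VL2proj_eq[OF order_refl L] by (simp add: vec_eq_iff forall_2 vector_2)
qed

lemma proj_wgrad:
  assumes "\<phi> \<in> H2 R" shows "VL2proj 1 R (wgrad R \<phi>) x = (\<chi> i. proj1 \<phi> i x)"
  using VL2proj_eq[OF order_refl, of "wgrad R \<phi>"] wd_L2_H2[OF assms] by simp

text \<open>The projection acts componentwise and so commutes with the quarter turn from gradient to
  curl. What remains is, up to sign, the determinant of the two projected gradients, which is
  visibly alternating.\<close>

lemma conv_eq: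
  assumes "\<phi> \<in> H2 R" "\<eta> \<in> H2 R"
  shows "conv \<zeta> \<phi> \<eta> = (\<integral>x. L2proj 0 R (wlap R \<zeta>) x * (proj1 \<phi> 2 x * proj1 \<eta> 1 x - proj1 \<phi> 1 x * proj1 \<eta> 2 x) \<partial>\<mu>)"
  unfolding conv_def LINT_U by (simp add: proj_wcurl proj_wgrad assms inner_2 vector_2 algebra_simps del: One_nat_def)

lemma conv_skew: "\<phi> \<in> H2 R \<Longrightarrow> conv \<zeta> \<phi> \<phi> = 0"
  by (simp add: conv_eq mult.commute)

lemma proj1_lincomb:
  assumes "\<phi> \<in> H2 R" "\<psi> \<in> H2 R"
  shows "proj1 (\<lambda>x. a * \<phi> x + \<psi> x) i x = a * proj1 \<phi> i x + proj1 \<psi> i x"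
  using assms by (intro proj_lincomb wd_L2_H2 H2_lincomb wd_lincomb H2_H1(1)) auto

lemma proj0_lincomb:
  assumes "\<phi> \<in> H2 R" "\<psi> \<in> H2 R"
  shows "L2proj 0 R (wlap R (\<lambda>x. a * \<phi> x + \<psi> x)) x = a * L2proj 0 R (wlap R \<phi>) x + L2proj 0 R (wlap R \<psi>) x"
  using assms by (intro proj_lincomb wlap_L2 H2_lincomb wlap_lincomb) auto

text \<open>All three factors are polynomials by their projections, hence smooth and bounded on the
  element, so their triple product is integrable.\<close>

lemma conv_integrable:
  assumes "\<zeta> \<in> H2 R" "\<phi> \<in> H2 R" "\<eta> \<in> H2 R"
  shows "integrable \<mu> (\<lambda>x. L2proj 0 R (wlap R \<zeta>) x * (proj1 \<phi> 2 x * proj1 \<eta> 1 x - proj1 \<phi> 1 x * proj1 \<eta> 2 x))"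
proof -
  have "smooth (L2proj 0 R (wlap R \<zeta>))" using assms by (intro Poly_smooth[of _ 0] L2proj_spec wlap_L2) auto
  moreover have "smooth (proj1 \<phi> i)" if "\<phi> \<in> H2 R" for \<phi> i using that by (intro Poly_smooth[of _ 1] L2proj_spec wd_L2_H2) auto
  ultimately show ?thesis using assms
    by (intro L2_on_integrable_mult smooth_L2 L2_on_diff smooth_mult_L2)
qed

lemma conv_lincomb:
  assumes "u \<in> H2 R" "v \<in> H2 R" "\<phi> \<in> H2 R" "\<eta> \<in> H2 R"
  shows "conv (\<lambda>x. a * u x + v x) \<phi> \<eta> = a * conv u \<phi> \<eta> + conv v \<phi> \<eta>"
    and "conv \<phi> (\<lambda>x. a * u x + v x) \<eta> = a * conv \<phi> u \<eta> + conv \<phi> v \<eta>"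
    and "conv \<phi> \<eta> (\<lambda>x. a * u x + v x) = a * conv \<phi> \<eta> u + conv \<phi> \<eta> v"
proof -
  have H: "(\<lambda>x. a * u x + v x) \<in> H2 R" using assms(1,2) by (rule H2_lincomb)
  have comb: "a * (\<integral>x. f x \<partial>\<mu>) + (\<integral>x. g x \<partial>\<mu>) = (\<integral>x. a * f x + g x \<partial>\<mu>)"
    if "integrable \<mu> f" "integrable \<mu> g" for f g :: "point \<Rightarrow> real" using that by simp
  note s = proj1_lincomb[OF assms(1,2)] proj0_lincomb[OF assms(1,2)]
  show "conv (\<lambda>x. a * u x + v x) \<phi> \<eta> = a * conv u \<phi> \<eta> + conv v \<phi> \<eta>"
    unfolding conv_eq[OF assms(3,4)] s
    by (subst comb, (intro conv_integrable assms)+,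
      (rule Bochner_Integration.integral_cong, simp_all add: algebra_simps del: One_nat_def))
  show "conv \<phi> (\<lambda>x. a * u x + v x) \<eta> = a * conv \<phi> u \<eta> + conv \<phi> v \<eta>"
    unfolding conv_eq[OF assms(1,4)] conv_eq[OF assms(2,4)] conv_eq[OF H assms(4)] s
    by (subst comb, (intro conv_integrable assms)+,
      (rule Bochner_Integration.integral_cong, simp_all add: algebra_simps del: One_nat_def))
  show "conv \<phi> \<eta> (\<lambda>x. a * u x + v x) = a * conv \<phi> \<eta> u + conv \<phi> \<eta> v"
    unfolding conv_eq[OF assms(4,1)] conv_eq[OF assms(4,2)] conv_eq[OF assms(4) H] s
    by (subst comb, (intro conv_integrable assms)+,
      (rule Bochner_Integration.integral_cong, simp_all add: algebra_simps del: One_nat_def))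
qed

lemma load_lincomb:
  assumes f: "\<And>i. L2_on \<mu> (\<lambda>x. f x $ i)" and H: "u \<in> H2 R" "v \<in> H2 R"
  shows "(LINT x:R|lebesgue. VL2proj 1 R f x \<bullet> wcurl R (\<lambda>x. a * u x + v x) x)
    = a * (LINT x:R|lebesgue. VL2proj 1 R f x \<bullet> wcurl R u x) + (LINT x:R|lebesgue. VL2proj 1 R f x \<bullet> wcurl R v x)"
proof -
  let ?p = "\<lambda>i. L2proj 1 R (\<lambda>x. f x $ i)"
  have p: "L2_on \<mu> (?p i)" for i using L2proj_spec(1)[OF order_refl f] by (rule Poly_L2)
  have L: "L2_on \<mu> (\<lambda>x. wcurl R w x $ i)" if "w \<in> H2 R" for w i by (rule H1_L2[OF wcurl_H1[OF that]])
  have eq: "(LINT x:R|lebesgue. VL2proj 1 R f x \<bullet> wcurl R w x) = (\<integral>x. wcurl R w x $ 1 * ?p 1 x \<partial>\<mu>) + (\<integral>x. wcurl R w x $ 2 * ?p 2 x \<partial>\<mu>)"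
    if w: "w \<in> H2 R" for w
  proof -
    have "integrable \<mu> (\<lambda>x. wcurl R w x $ i * ?p i x)" for i using L[OF w] p by (rule L2_on_integrable_mult)
    then show ?thesis
      unfolding LINT_U by (subst Bochner_Integration.integral_add[symmetric])
        (auto simp: VL2proj_eq[OF order_refl f] inner_2 mult.commute simp del: wcurl_nth One_nat_def)
  qed
  have c: "(\<integral>x. wcurl R (\<lambda>x. a * u x + v x) x $ i * ?p i x \<partial>\<mu>)
      = a * (\<integral>x. wcurl R u x $ i * ?p i x \<partial>\<mu>) + (\<integral>x. wcurl R v x $ i * ?p i x \<partial>\<mu>)" for i
    by (rule integral_mult_AE_lincomb[OF L[OF H(1)] L[OF H(2)] L[OF H2_lincomb[OF H]] p wcurl_lincomb[OF H]])
  show ?thesis unfolding eq[OF H(1)] eq[OF H(2)] eq[OF H2_lincomb[OF H]] c by (simp add: algebra_simps)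
qed

end

section \<open>The global space\<close>

lemma sq_int_subset:
  assumes "sq_int S u" "T \<subseteq> S" "T \<in> sets lebesgue" shows "sq_int T u"
  using assms unfolding sq_int_def by (auto intro: set_borel_measurable_subset set_integrable_subset)

lemma has_vtrace_lincomb_wgrad:
  assumes st: "star_polygon K c r" and H: "u \<in> H2 (region K)" "v \<in> H2 (region K)"
    and t: "has_vtrace K (wgrad (region K) u) \<gamma>" "has_vtrace K (wgrad (region K) v) \<delta>"
  shows "has_vtrace K (wgrad (region K) (\<lambda>x. a * u x + v x)) (\<lambda>x. a *\<^sub>R \<gamma> x + \<delta> x)"
proof -
  interpret star_polygon K c r by (rule st)
  have "has_trace K (wd R i (\<lambda>x. a * u x + v x)) (\<lambda>x. a * \<gamma> x $ i + \<delta> x $ i)" for i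
  proof (rule has_trace_AE_lincomb)
    show "has_trace K (wd R i u) (\<lambda>x. \<gamma> x $ i)" "has_trace K (wd R i v) (\<lambda>x. \<delta> x $ i)"
      using t by (simp_all add: has_vtrace_def)
  qed (use H in \<open>auto intro: wd_L2_H2 H2_lincomb wd_lincomb H2_H1(1)\<close>)
  then show ?thesis by (simp add: has_vtrace_def)
qed

locale morley_mesh = star_mesh +
  fixes S :: "polygon \<Rightarrow> (point \<Rightarrow> real) \<Rightarrow> (point \<Rightarrow> real) \<Rightarrow> real" and c_lo c_up :: real
  assumes stab: "\<And>K. K \<in> \<T> \<Longrightarrow> stabilisation c_lo c_up K (S K)"
begin

abbreviation "V \<equiv> M_glob \<Omega> \<T>"

lemma spd: "K \<in> \<T> \<Longrightarrow> spd_form (M_loc K) (S K)"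
  using stab by (simp add: stabilisation_def)

lemma V_local:
  assumes "\<phi> \<in> V" "K \<in> \<T>" shows "\<phi> \<in> H2 (region K)" "restr K \<phi> \<in> M_loc K"
  using assms by (auto simp: M_glob_def H2_broken_def)

lemma V_outside: "\<phi> \<in> V \<Longrightarrow> x \<notin> (\<Union>K\<in>\<T>. region K) \<Longrightarrow> \<phi> x = 0"
  unfolding M_glob_def by blast

lemma V_match:
  assumes "\<phi> \<in> V" "K \<in> \<T>" "K' \<in> \<T>" "x \<in> set K" "x \<in> set K'" "x \<in> \<Omega>" shows "vval K \<phi> x = vval K' \<phi> x"
proof -
  have "\<forall>K\<in>\<T>. \<forall>K'\<in>\<T>. \<forall>v\<in>set K \<inter> set K'. v \<in> \<Omega> \<longrightarrow> vval K \<phi> v = vval K' \<phi> v"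
    using assms(1) unfolding M_glob_def by (elim CollectE conjE)
  then show ?thesis using assms(2-) by (meson IntI)
qed

lemma V_boundary:
  assumes "\<phi> \<in> V" "K \<in> \<T>" "x \<in> set K" "x \<in> frontier \<Omega>" shows "vval K \<phi> x = 0"
proof -
  have "\<forall>K\<in>\<T>. \<forall>v\<in>set K. v \<in> frontier \<Omega> \<longrightarrow> vval K \<phi> v = 0"
    using assms(1) unfolding M_glob_def by (elim CollectE conjE)
  then show ?thesis using assms(2-) by blast
qed

lemma vval_lincomb_mesh:
  assumes "K \<in> \<T>" "u \<in> V" "v \<in> V" "w \<in> set K"
  shows "vval K (\<lambda>x. a * u x + v x) w = a * vval K u w + vval K v w"
proof -
  obtain c r where st: "star_polygon K c r" using star_elements assms by blast
  interpret star_polygon K c r by (rule st)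
  have "vval K (\<lambda>x. a * restr K u x + restr K v x) w = a * vval K (restr K u) w + vval K (restr K v) w"
    using M_loc_H2[OF V_local(2)[OF assms(2,1)]] M_loc_H2[OF V_local(2)[OF assms(3,1)]] assms(4) by (intro vval_lincomb) auto
  then show ?thesis using vval_restr[of "\<lambda>x. a * u x + v x" w] by (simp add: restr_lincomb vval_restr)
qed

lemma vtrace_inner_L2:
  assumes "K \<in> \<T>" "has_vtrace K v \<gamma>" "(a, b) \<in> edges K"
  shows "L2_on unit_lebesgue (\<lambda>t. \<gamma> (linepath a b t) \<bullet> n)"
proof -
  obtain c r where st: "star_polygon K c r" using star_elements assms by blast
  show ?thesis by (rule L2_edge_inner[OF star_polygon.has_vtrace_edge_L2[OF st assms(2,3)]])
qed

text \<open>The condition \<open>normal_jumps_vanish\<close> with its witness exposed: linear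
  combinations have to use one family of traces for all elements and all three clauses at
  once.\<close>

definition gradient_traces :: "(point \<Rightarrow> real) \<Rightarrow> (polygon \<Rightarrow> point \<Rightarrow> point) \<Rightarrow> bool" where
  "gradient_traces \<phi> \<gamma> \<longleftrightarrow> (\<forall>K\<in>\<T>. has_vtrace K (wgrad (region K) \<phi>) (\<gamma> K)) \<and>
     (\<forall>K\<in>\<T>. \<forall>K'\<in>\<T>. K \<noteq> K' \<longrightarrow> (\<forall>(a, b)\<in>edges K \<inter> edges K'.
        edge_int a b (\<lambda>x. \<gamma> K x \<bullet> edge_normal a b - \<gamma> K' x \<bullet> edge_normal a b) = 0)) \<and>
     (\<forall>K\<in>\<T>. \<forall>(a, b)\<in>edges K. closed_segment a b \<subseteq> frontier \<Omega> \<longrightarrow>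
        edge_int a b (\<lambda>x. \<gamma> K x \<bullet> edge_normal a b) = 0)"

lemma normal_jumps_iff: "normal_jumps_vanish \<Omega> \<T> \<phi> \<longleftrightarrow> (\<exists>\<gamma>. gradient_traces \<phi> \<gamma>)"
  by (simp add: normal_jumps_vanish_def gradient_traces_def)

lemma gradient_traces_ex: "\<phi> \<in> V \<Longrightarrow> \<exists>\<gamma>. gradient_traces \<phi> \<gamma>"
  by (simp add: M_glob_def normal_jumps_iff)

lemma gradient_tracesD:
  assumes "gradient_traces \<phi> \<gamma>" "K \<in> \<T>"
  shows "has_vtrace K (wgrad (region K) \<phi>) (\<gamma> K)"
    and "K' \<in> \<T> \<Longrightarrow> K \<noteq> K' \<Longrightarrow> (a, b) \<in> edges K \<Longrightarrow> (a, b) \<in> edges K' \<Longrightarrow>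
       edge_int a b (\<lambda>x. \<gamma> K x \<bullet> edge_normal a b - \<gamma> K' x \<bullet> edge_normal a b) = 0"
    and "(a, b) \<in> edges K \<Longrightarrow> closed_segment a b \<subseteq> frontier \<Omega> \<Longrightarrow>
       edge_int a b (\<lambda>x. \<gamma> K x \<bullet> edge_normal a b) = 0"
proof -
  show "has_vtrace K (wgrad (region K) \<phi>) (\<gamma> K)" using assms unfolding gradient_traces_def by blast
  have "\<forall>e\<in>edges K \<inter> edges K'. case e of (a, b) \<Rightarrow>
      edge_int a b (\<lambda>x. \<gamma> K x \<bullet> edge_normal a b - \<gamma> K' x \<bullet> edge_normal a b) = 0" if "K' \<in> \<T>" "K \<noteq> K'"
    using assms that unfolding gradient_traces_def by (elim conjE) (drule bspec, assumption, simp)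
  from bspec[OF this, of "(a, b)"]
  show "K' \<in> \<T> \<Longrightarrow> K \<noteq> K' \<Longrightarrow> (a, b) \<in> edges K \<Longrightarrow> (a, b) \<in> edges K' \<Longrightarrow>
       edge_int a b (\<lambda>x. \<gamma> K x \<bullet> edge_normal a b - \<gamma> K' x \<bullet> edge_normal a b) = 0" by simp
  have "\<forall>e\<in>edges K. case e of (a, b) \<Rightarrow> closed_segment a b \<subseteq> frontier \<Omega> \<longrightarrow>
      edge_int a b (\<lambda>x. \<gamma> K x \<bullet> edge_normal a b) = 0"
    using assms unfolding gradient_traces_def by (elim conjE) (rule bspec, assumption+)
  from bspec[OF this, of "(a, b)"]
  show "(a, b) \<in> edges K \<Longrightarrow> closed_segment a b \<subseteq> frontier \<Omega> \<Longrightarrow>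
       edge_int a b (\<lambda>x. \<gamma> K x \<bullet> edge_normal a b) = 0" by simp
qed

lemma normal_jumps_lincomb:
  assumes u: "u \<in> V" and v: "v \<in> V"
  shows "normal_jumps_vanish \<Omega> \<T> (\<lambda>x. s * u x + v x)"
proof -
  obtain \<gamma> where \<gamma>: "gradient_traces u \<gamma>" using gradient_traces_ex[OF u] by blast
  obtain \<delta> where \<delta>: "gradient_traces v \<delta>" using gradient_traces_ex[OF v] by blast
  note \<gamma> = gradient_tracesD[OF \<gamma>] and \<delta> = gradient_tracesD[OF \<delta>]
  let ?g = "\<lambda>K x. s *\<^sub>R \<gamma> K x + \<delta> K x"
  note L = vtrace_inner_L2[OF _ \<gamma>(1)] vtrace_inner_L2[OF _ \<delta>(1)]
  show ?thesis
    unfolding normal_jumps_vanish_def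
  proof (intro exI[of _ ?g] conjI ballI impI, goal_cases)
    case (1 K)
    then obtain c r where st: "star_polygon K c r" using star_elements by blast
    show ?case by (rule has_vtrace_lincomb_wgrad[OF st V_local(1)[OF u 1] V_local(1)[OF v 1] \<gamma>(1)[OF 1] \<delta>(1)[OF 1]])
  next
    case (2 K K' e)
    obtain a b where e: "e = (a, b)" by (cases e)
    let ?n = "edge_normal a b"
    have ab: "(a, b) \<in> edges K" "(a, b) \<in> edges K'" using 2 e by auto
    have "edge_int a b (\<lambda>x. s * (\<gamma> K x \<bullet> ?n - \<gamma> K' x \<bullet> ?n) + (\<delta> K x \<bullet> ?n - \<delta> K' x \<bullet> ?n)) = 0"
      using 2 ab \<gamma>(2) \<delta>(2) by (subst edge_int_lincomb) (auto intro!: L2_on_diff L)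
    moreover have "?g K x \<bullet> ?n - ?g K' x \<bullet> ?n = s * (\<gamma> K x \<bullet> ?n - \<gamma> K' x \<bullet> ?n) + (\<delta> K x \<bullet> ?n - \<delta> K' x \<bullet> ?n)" for x
      by (simp add: inner_add_left right_diff_distrib)
    ultimately show ?case by (simp add: e)
  next
    case (3 K e)
    obtain a b where e: "e = (a, b)" by (cases e)
    let ?n = "edge_normal a b"
    have "edge_int a b (\<lambda>x. s * (\<gamma> K x \<bullet> ?n) + \<delta> K x \<bullet> ?n) = 0" if "closed_segment a b \<subseteq> frontier \<Omega>"
      using 3 e that \<gamma>(3) \<delta>(3) by (subst edge_int_lincomb) (auto intro!: L)
    then show ?case by (simp add: e inner_add_left)
  qed
qed

lemma V_zero: "(\<lambda>x. 0) \<in> V"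
proof -
  have loc: "(\<lambda>x. 0) \<in> H2 (region K)" "restr K (\<lambda>x. 0) \<in> M_loc K"
    "\<And>v. v \<in> set K \<Longrightarrow> vval K (\<lambda>x. 0) v = 0" "has_vtrace K (wgrad (region K) (\<lambda>x. 0)) (\<lambda>x. 0)" if K: "K \<in> \<T>" for K
  proof -
    obtain c r where st: "star_polygon K c r" using star_elements K by blast
    interpret star_polygon K c r by (rule st)
    show H: "(\<lambda>x. 0) \<in> H2 (region K)" by (intro smooth_H2 smooth_const)
    show "restr K (\<lambda>x. 0) \<in> M_loc K" by (intro restr_Poly_M_loc lin_space_zero lin_space_Poly)
    show "vval K (\<lambda>x. 0) v = 0" if "v \<in> set K" for v using vval_affine[of "\<lambda>x. 0" 0 0, OF _ that] by simp
    have "has_trace K (wd R i (\<lambda>x. 0)) (\<lambda>x. 0 * 0 + 0)" for i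
    proof (rule has_trace_AE_lincomb[OF has_trace_smooth has_trace_smooth, OF smooth_const smooth_const wd_L2_H2[OF H]])
      show "AE x in \<mu>. wd R i (\<lambda>x. 0) x = 0 * 0 + 0" using smooth_wd[OF smooth_const[of 0], of i] by (simp add: pd_const)
    qed
    then show "has_vtrace K (wgrad (region K) (\<lambda>x. 0)) (\<lambda>x. 0)" by (simp add: has_vtrace_def)
  qed
  have "normal_jumps_vanish \<Omega> \<T> (\<lambda>x. 0)"
    unfolding normal_jumps_vanish_def
    by (rule exI[of _ "\<lambda>K x. 0"]) (auto simp: loc(4) edge_int_def)
  then show ?thesis using loc(1-3) by (auto simp: M_glob_def H2_broken_def)
qed

lemma lin_space_V: "lin_space V"
  unfolding lin_space_def
proof (intro conjI ballI allI V_zero)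
  fix u v a assume u: "u \<in> V" and v: "v \<in> V"
  let ?w = "\<lambda>x. a * u x + v x"
  have loc: "?w \<in> H2 (region K) \<and> restr K ?w \<in> M_loc K" if K: "K \<in> \<T>" for K
  proof -
    obtain c r where st: "star_polygon K c r" using star_elements K by blast
    interpret star_polygon K c r by (rule st)
    show ?thesis using V_local[OF u K] V_local[OF v K] by (simp add: restr_lincomb H2_lincomb M_loc_lincomb)
  qed
  have out: "?w x = 0" if "x \<notin> (\<Union>K\<in>\<T>. region K)" for x
    using V_outside[OF u that] V_outside[OF v that] by simp
  have H: "?w \<in> H2_broken \<T>" using loc by (simp add: H2_broken_def)
  have match: "vval K ?w x = vval K' ?w x" if "K \<in> \<T>" "K' \<in> \<T>" "x \<in> set K \<inter> set K'" "x \<in> \<Omega>" for K K' x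
    using vval_lincomb_mesh[OF that(1) u v] vval_lincomb_mesh[OF that(2) u v]
      V_match[OF u that(1,2)] V_match[OF v that(1,2)] that(3,4) by simp
  have bd: "vval K ?w x = 0" if "K \<in> \<T>" "x \<in> set K" "x \<in> frontier \<Omega>" for K x
    using vval_lincomb_mesh[OF that(1) u v that(2)] V_boundary[OF u that] V_boundary[OF v that] by simp
  show "?w \<in> V" unfolding M_glob_def
    by (intro CollectI conjI ballI allI impI H out match bd normal_jumps_lincomb[OF u v])
      (use loc in simp_all)
qed

text \<open>Elements of the global space vanish off the open regions, which are disjoint, so each is
  the sum of its restrictions. This embeds the global space into the sum of the finitely many local
  ones.\<close>

lemma fin_dim_V: "fin_dim V"
proof (rule fin_dim_sum[OF finite_mesh, of M_loc])
  show "fin_dim (M_loc K)" if K: "K \<in> \<T>" for K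
  proof -
    obtain c r where st: "star_polygon K c r" using star_elements K by blast
    show ?thesis by (rule star_polygon.fin_dim_M_loc[OF st stab[OF K]])
  qed
  fix u assume u: "u \<in> V"
  have "u x = (\<Sum>K\<in>\<T>. restr K u x)" for x
  proof (cases "\<exists>K\<in>\<T>. x \<in> region K")
    case True
    then obtain K where K: "K \<in> \<T>" "x \<in> region K" by blast
    have "restr K' u x = (if K' = K then u x else 0)" if "K' \<in> \<T>" for K'
      using regions_disjoint[OF K(1) that] K by (auto simp: restr_def)
    then show ?thesis using K finite_mesh by (simp cong: sum.cong)
  next
    case False
    then show ?thesis using V_outside[OF u] by (simp add: restr_def)
  qed
  then show "\<exists>w. (\<forall>K\<in>\<T>. w K \<in> M_loc K) \<and> u = (\<lambda>x. \<Sum>K\<in>\<T>. w K x)"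
    using V_local(2)[OF u] by (intro exI[of _ "\<lambda>K. restr K u"]) (auto simp: fun_eq_iff)
qed

text \<open>An element of zero energy is affine on each polygon; the vanishing of its value at the ends of
  an edge and of its normal derivative, transported from one element to the next, forces it to be 0.\<close>

lemma piecewise_affine_zero:
  assumes \<phi>: "\<phi> \<in> V" and aff: "\<And>K. K \<in> \<T> \<Longrightarrow> \<exists>n d. \<forall>x\<in>region K. \<phi> x = n \<bullet> x + d"
  shows "\<phi> = (\<lambda>x. 0)"
proof -
  obtain \<gamma> where \<gamma>: "gradient_traces \<phi> \<gamma>" using gradient_traces_ex[OF \<phi>] by blast
  note \<gamma> = gradient_tracesD[OF \<gamma>]
  note match = V_match[OF \<phi>] and bd = V_boundary[OF \<phi>]
  let ?Z = "\<lambda>K. \<forall>x\<in>region K. \<phi> x = 0"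
  have ends: "a \<in> set K" "b \<in> set K" if "(a, b) \<in> edges K" for a b K
    using that vtx_in_set[of K] by (cases "K = []"; auto elim!: edgesE)+
  \<comment> \<open>Zero data on a single edge, namely both end values and the mean normal
    derivative, already determine an affine function to be 0.\<close>
  have zero: "?Z K" if K: "K \<in> \<T>" and e: "(a, b) \<in> edges K" and v: "vval K \<phi> a = 0" "vval K \<phi> b = 0"
    and n: "edge_int a b (\<lambda>x. \<gamma> K x \<bullet> edge_normal a b) = 0" for K a b
  proof -
    obtain c r where st: "star_polygon K c r" using star_elements K by blast
    interpret star_polygon K c r by (rule st)
    obtain m d where m: "\<And>x. x \<in> R \<Longrightarrow> \<phi> x = m \<bullet> x + d" using aff[OF K] by blast
    have "dist a b * (m \<bullet> edge_normal a b) = 0"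
      using affine_normal_mean[OF V_local(1)[OF \<phi> K] m \<gamma>(1)[OF K] e] n by simp
    then have "m \<bullet> edge_normal a b = 0" using edge_dist_pos[OF e] by simp
    moreover have "m \<bullet> a + d = 0" "m \<bullet> b + d = 0" using vval_affine[OF m] ends[OF e] v by auto
    ultimately have "m = 0 \<and> d = 0" using affine_zero_cauchy edges_neq[OF simple e] by blast
    then show ?thesis using m by simp
  qed
  have Z: "?Z K" if "K \<in> \<T>" for K
  proof (rule mesh_induct[OF _ _ that])
    fix K a b assume K: "K \<in> \<T>" and e: "(a, b) \<in> edges K" and f: "closed_segment a b \<subseteq> frontier \<Omega>"
    then have "a \<in> frontier \<Omega>" "b \<in> frontier \<Omega>" by auto
    then show "?Z K" using K e f ends[OF e] by (intro zero bd \<gamma>(3)) auto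
  next
    fix K K' a b assume K: "K \<in> \<T>" "K' \<in> \<T>" "K \<noteq> K'" and e: "(a, b) \<in> edges K" "(a, b) \<in> edges K'" and Z': "?Z K'"
    obtain c r where st: "star_polygon K' c r" using star_elements K(2) by blast
    interpret K': star_polygon K' c r by (rule st)
    have z: "\<And>x. x \<in> region K' \<Longrightarrow> \<phi> x = 0 \<bullet> x + 0" using Z' by simp
    \<comment> \<open>A shared vertex inside \<Omega> takes its value from the vanishing neighbour
      by continuity; otherwise it is on the boundary, where the value is prescribed.\<close>
    have v: "vval K \<phi> x = 0" if x: "x \<in> set K" "x \<in> set K'" for x
    proof (cases "x \<in> \<Omega>")
      case True
      then show ?thesis using match[OF K(1,2) x True] K'.vval_affine[OF z x(2)] by simp
    next
      case False
      have "x \<in> closure \<Omega>" using K'.vertex_frontier[OF x(2)] cover K(2) unfolding frontier_def by blast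
      then have "x \<in> frontier \<Omega>" using False \<Omega>_open by (simp add: frontier_def interior_open)
      then show ?thesis using bd K x by blast
    qed
    let ?n = "edge_normal a b"
    have 0: "edge_int a b (\<lambda>x. \<gamma> K' x \<bullet> ?n) = 0"
      using K'.affine_normal_mean[OF V_local(1)[OF \<phi> K(2)] z \<gamma>(1)[OF K(2)] e(2), of ?n] by simp
    have L: "L2_on unit_lebesgue (\<lambda>t. \<gamma> K (linepath a b t) \<bullet> ?n)" "L2_on unit_lebesgue (\<lambda>t. \<gamma> K' (linepath a b t) \<bullet> ?n)"
      by (rule vtrace_inner_L2[OF _ \<gamma>(1)]; use K e in simp)+
    \<comment> \<open>The mean normal derivative from K is the mean jump plus that from K', and both
      are 0.\<close>
    have "edge_int a b (\<lambda>x. 1 * (\<gamma> K x \<bullet> ?n - \<gamma> K' x \<bullet> ?n) + \<gamma> K' x \<bullet> ?n) = 0"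
      using \<gamma>(2)[OF K e] 0 L by (subst edge_int_lincomb) (auto intro: L2_on_diff)
    then show "?Z K" using ends[OF e(1)] ends[OF e(2)] by (intro zero[OF K(1) e(1)] v) auto
  qed
  have "\<phi> x = 0" for x
    using Z V_outside[OF \<phi>] by (cases "x \<in> (\<Union>K\<in>\<T>. region K)") auto
  then show ?thesis by auto
qed

lemma A_h_disc: "A_h S \<T> \<phi> \<eta> = (\<Sum>K\<in>\<T>. star_polygon.disc K (S K) \<phi> \<eta>)"
  unfolding A_h_def
proof (rule sum.cong)
  fix K assume "K \<in> \<T>"
  then obtain c r where st: "star_polygon K c r" using star_elements by blast
  show "A_loc (region K) (Pi_D K \<phi>) (Pi_D K \<eta>) + S K (restr K (\<lambda>x. \<phi> x - Pi_D K \<phi> x)) (restr K (\<lambda>x. \<eta> x - Pi_D K \<eta> x))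
    = star_polygon.disc K (S K) \<phi> \<eta>" by (simp add: star_polygon.disc_def[OF st])
qed simp

lemma B_h_conv: "B_h \<T> \<zeta> \<phi> \<eta> = (\<Sum>K\<in>\<T>. star_polygon.conv K \<zeta> \<phi> \<eta>)"
  unfolding B_h_def
proof (rule sum.cong)
  fix K assume "K \<in> \<T>"
  then obtain c r where st: "star_polygon K c r" using star_elements by blast
  show "(LINT x:region K|lebesgue. (L2proj 0 (region K) (wlap (region K) \<zeta>) x *\<^sub>R VL2proj 1 (region K) (wcurl (region K) \<phi>) x)
     \<bullet> VL2proj 1 (region K) (wgrad (region K) \<eta>) x) = star_polygon.conv K \<zeta> \<phi> \<eta>"
    by (simp add: star_polygon.conv_def[OF st])
qed simp

lemma sum_lincomb:
  assumes "\<And>K. K \<in> \<T> \<Longrightarrow> f K = a * g K + h K"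
  shows "(\<Sum>K\<in>\<T>. f K) = a * (\<Sum>K\<in>\<T>. g K) + (\<Sum>K\<in>\<T>. h K :: real)"
  using assms by (simp add: sum.distrib sum_distrib_left cong: sum.cong)

lemma inner_on_A_h: "inner_on V (A_h S \<T>)"
  unfolding inner_on_def lin_on_def
proof (intro conjI ballI allI impI)
  fix w u v a assume V: "w \<in> V" "u \<in> V" "v \<in> V"
  show "A_h S \<T> (\<lambda>x. a * u x + v x) w = a * A_h S \<T> u w + A_h S \<T> v w"
    unfolding A_h_disc
  proof (rule sum_lincomb)
    fix K assume K: "K \<in> \<T>"
    then obtain c r where st: "star_polygon K c r" using star_elements by blast
    show "star_polygon.disc K (S K) (\<lambda>x. a * u x + v x) w = a * star_polygon.disc K (S K) u w + star_polygon.disc K (S K) v w"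
      using V K by (intro star_polygon.disc_lincomb[OF st] spd V_local)
  qed
next
  fix u v assume V: "u \<in> V" "v \<in> V"
  show "A_h S \<T> u v = A_h S \<T> v u"
    unfolding A_h_disc
  proof (rule sum.cong)
    fix K assume K: "K \<in> \<T>"
    then obtain c r where st: "star_polygon K c r" using star_elements by blast
    show "star_polygon.disc K (S K) u v = star_polygon.disc K (S K) v u"
      using V K by (intro star_polygon.disc_commute[OF st] spd V_local)
  qed simp
next
  fix u assume u: "u \<in> V"
  have nn: "0 \<le> star_polygon.disc K (S K) u u" if K: "K \<in> \<T>" for K
  proof -
    obtain c r where st: "star_polygon K c r" using star_elements K by blast
    show ?thesis using u K by (intro star_polygon.disc_nonneg[OF st] spd V_local)
  qed
  then show "0 \<le> A_h S \<T> u u" unfolding A_h_disc by (intro sum_nonneg)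
  assume "A_h S \<T> u u = 0"
  then have 0: "star_polygon.disc K (S K) u u = 0" if "K \<in> \<T>" for K
    using that sum_nonneg_eq_0_iff[OF finite_mesh nn] by (simp add: A_h_disc)
  show "u = (\<lambda>x. 0)"
  proof (rule piecewise_affine_zero[OF u])
    fix K assume K: "K \<in> \<T>"
    then obtain c r where st: "star_polygon K c r" using star_elements by blast
    show "\<exists>n d. \<forall>x\<in>region K. u x = n \<bullet> x + d"
      by (rule star_polygon.disc_zero_affine[OF st spd[OF K] V_local(2)[OF u K] 0[OF K]])
  qed
qed

sublocale fin_inner V "A_h S \<T>"
  using lin_space_V inner_on_A_h fin_dim_V by unfold_locales

lemma B_h_linear:
  assumes "v \<in> V" "w \<in> V"
  shows "lin_on V (\<lambda>u. B_h \<T> u v w)" "lin_on V (\<lambda>u. B_h \<T> v u w)" "lin_on V (\<lambda>u. B_h \<T> v w u)"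
proof -
  have c: "star_polygon.conv K (\<lambda>x. a * u x + z x) v w = a * star_polygon.conv K u v w + star_polygon.conv K z v w"
    "star_polygon.conv K v (\<lambda>x. a * u x + z x) w = a * star_polygon.conv K v u w + star_polygon.conv K v z w"
    "star_polygon.conv K v w (\<lambda>x. a * u x + z x) = a * star_polygon.conv K v w u + star_polygon.conv K v w z"
    if K: "K \<in> \<T>" and V': "u \<in> V" "z \<in> V" for K u z a
  proof -
    obtain c r where st: "star_polygon K c r" using star_elements K by blast
    note H = V_local(1)[OF _ K]
    show "star_polygon.conv K (\<lambda>x. a * u x + z x) v w = a * star_polygon.conv K u v w + star_polygon.conv K z v w"
      "star_polygon.conv K v (\<lambda>x. a * u x + z x) w = a * star_polygon.conv K v u w + star_polygon.conv K v z w"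
      "star_polygon.conv K v w (\<lambda>x. a * u x + z x) = a * star_polygon.conv K v w u + star_polygon.conv K v w z"
      by (rule star_polygon.conv_lincomb[OF st H H H H]; use assms V' in simp)+
  qed
  show "lin_on V (\<lambda>u. B_h \<T> u v w)" "lin_on V (\<lambda>u. B_h \<T> v u w)" "lin_on V (\<lambda>u. B_h \<T> v w u)"
    unfolding lin_on_def B_h_conv using c by (auto intro!: sum_lincomb)
qed

lemma B_h_skew: "v \<in> V \<Longrightarrow> B_h \<T> u v v = 0"
  unfolding B_h_conv
proof (rule sum.neutral, rule ballI)
  fix K assume v: "v \<in> V" and K: "K \<in> \<T>"
  then obtain c r where st: "star_polygon K c r" using star_elements by blast
  show "star_polygon.conv K u v v = 0" by (rule star_polygon.conv_skew[OF st V_local(1)[OF v K]])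
qed

lemma F_h_linear:
  assumes f: "\<And>i. sq_int \<Omega> (\<lambda>x. f x $ i)" shows "lin_on V (F_h f \<T>)"
  unfolding lin_on_def F_h_def
proof (intro ballI allI sum_lincomb)
  fix u v a K assume V: "u \<in> V" "v \<in> V" and K: "K \<in> \<T>"
  then obtain c r where st: "star_polygon K c r" using star_elements by blast
  interpret K: star_polygon K c r by (rule st)
  have "sq_int (region K) (\<lambda>x. f x $ i)" for i using sq_int_subset[OF f region_subset[OF K] K.U_sets] .
  then have "L2_on K.\<mu> (\<lambda>x. f x $ i)" for i by (simp add: K.sq_int_U)
  then show "(LINT x:region K|lebesgue. VL2proj 1 (region K) f x \<bullet> wcurl (region K) (\<lambda>x. a * u x + v x) x)
    = a * (LINT x:region K|lebesgue. VL2proj 1 (region K) f x \<bullet> wcurl (region K) u x)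
      + (LINT x:region K|lebesgue. VL2proj 1 (region K) f x \<bullet> wcurl (region K) v x)"
    using V_local(1)[OF V(1) K] V_local(1)[OF V(2) K] by (rule K.load_lincomb)
qed

lemma seminorm2h_nonneg: "0 \<le> seminorm2h \<T> u"
  unfolding seminorm2h_def
proof (intro real_sqrt_ge_zero sum_nonneg)
  fix K assume "K \<in> \<T>"
  then obtain c r where st: "star_polygon K c r" using star_elements by blast
  show "0 \<le> A_loc (region K) u u" by (rule star_polygon.A_loc_nonneg[OF st])
qed

end

text \<open>Shape regularity bounds the radius of the ball below by a multiple of the diameter,
  which is positive because a non-empty open region contains two different points.\<close>

lemma shape_regular_star:
  assumes K: "simple_polygon K" "K \<in> \<T>" and \<rho>: "\<rho> > 0" "shape_regular \<rho> \<T>"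
  shows "\<exists>c r. star_polygon K c r"
proof -
  obtain c r where cr: "r \<ge> \<rho> * diameter (region K)" "ball c r \<subseteq> region K"
    "\<forall>y\<in>ball c r. \<forall>x\<in>region K. closed_segment y x \<subseteq> region K"
    using \<rho>(2) K(2) unfolding shape_regular_def by blast
  obtain x e where x: "e > 0" "ball x e \<subseteq> region K"
    using region_Jordan(1,2)[OF K(1)] by (meson ex_in_conv open_contains_ball)
  let ?y = "x + (e / 2) *\<^sub>R axis 1 1"
  have d: "dist x ?y = e / 2" using x(1) by (simp add: dist_norm)
  then have "x \<in> region K" "?y \<in> region K" using x by (auto intro!: subsetD[OF x(2)])
  then have "dist x ?y \<le> diameter (region K)" using diameter_bounded_bound[OF region_Jordan(3)[OF K(1)]] by blast
  then have "diameter (region K) > 0" using d x(1) by simp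
  then have "r > 0" using cr(1) \<rho>(1) by (meson less_le_trans mult_pos_pos)
  then have "star_polygon K c r" using K(1) cr by unfold_locales auto
  then show ?thesis by blast
qed

theorem theorem4p2:
  fixes \<Omega> :: "point set" and \<T> :: "real \<Rightarrow> polygon set" and H :: "real set"
    and S :: "polygon \<Rightarrow> (point \<Rightarrow> real) \<Rightarrow> (point \<Rightarrow> real) \<Rightarrow> real"
    and f :: "point \<Rightarrow> point"
    and \<rho> \<nu> c_lo c_up \<alpha> C_B C_F h :: real
  assumes "lipschitz_domain \<Omega>" "bounded \<Omega>" "simply_connected \<Omega>" "polygonal_boundary \<Omega>"
    and "\<rho> > 0" "mesh_family \<Omega> \<rho> H \<T>"
    and "c_lo > 0" "c_up > 0" "\<And>h K. h \<in> H \<Longrightarrow> K \<in> \<T> h \<Longrightarrow> stabilisation c_lo c_up K (S K)"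
    and "\<nu> > 0" "\<And>i. sq_int \<Omega> (\<lambda>x. f x $ i)"
    and "\<alpha> > 0"
      "\<And>h \<phi>. h \<in> H \<Longrightarrow> \<phi> \<in> M_glob \<Omega> (\<T> h) \<Longrightarrow>
         A_h S (\<T> h) \<phi> \<phi> \<ge> \<alpha> * (seminorm2h (\<T> h) \<phi>)^2"
    and "C_B > 0"
      "\<And>h \<zeta> \<phi> \<eta>. h \<in> H \<Longrightarrow> \<zeta> \<in> M_glob \<Omega> (\<T> h) \<Longrightarrow> \<phi> \<in> M_glob \<Omega> (\<T> h) \<Longrightarrow> \<eta> \<in> M_glob \<Omega> (\<T> h) \<Longrightarrow>
         B_h (\<T> h) \<zeta> \<phi> \<eta> \<le> C_B * seminorm2h (\<T> h) \<zeta> * seminorm2h (\<T> h) \<phi> * seminorm2h (\<T> h) \<eta>"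
    and "C_F > 0"
      "\<And>h \<eta>. h \<in> H \<Longrightarrow> \<eta> \<in> M_glob \<Omega> (\<T> h) \<Longrightarrow>
         \<bar>F_h f (\<T> h) \<eta>\<bar> \<le> C_F * L2norm \<Omega> f * seminorm2h (\<T> h) \<eta>"
    and "C_B * C_F * (1 / (\<alpha> * \<nu>)^2) * L2norm \<Omega> f < 1"
    and "h \<in> H"
  shows "(\<exists>!\<psi>. solves S \<nu> f \<Omega> (\<T> h) \<psi>) \<and>
    (\<forall>\<psi>. solves S \<nu> f \<Omega> (\<T> h) \<psi> \<longrightarrow> seminorm2h (\<T> h) \<psi> \<le> C_F * (1 / (\<alpha> * \<nu>)) * L2norm \<Omega> f)"
proof -
  have mesh: "is_mesh \<Omega> (\<T> h)" "shape_regular \<rho> (\<T> h)" using assms(6,19) by (auto simp: mesh_family_def)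
  interpret morley_mesh \<Omega> "\<T> h" S c_lo c_up
  proof
    show "open \<Omega>" using assms(1) by (simp add: lipschitz_domain_def)
    show "\<exists>c r. star_polygon K c r" if "K \<in> \<T> h" for K
      using mesh that by (intro shape_regular_star[OF _ that assms(5) mesh(2)]) (simp add: is_mesh_def)
  qed (use mesh assms(9,19) in auto)
  have L: "0 \<le> L2norm \<Omega> f" unfolding L2norm_def set_lebesgue_integral_def by (intro real_sqrt_ge_zero integral_nonneg_AE AE_I2) simp
  have "(\<alpha> * \<nu>)^2 > 0" using assms(10,12) by simp
  \<comment> \<open>The abstract constant CF is C_F times the norm of f; the hypothesis is
    multiplied by the positive number (\<alpha> \<nu>)^2.\<close>
  then have small: "C_B * (C_F * L2norm \<Omega> f) < (\<alpha> * \<nu>)^2" using assms(18) by (simp add: field_simps)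
  have "(\<exists>!u. u \<in> V \<and> (\<forall>v\<in>V. \<nu> * A_h S (\<T> h) u v + B_h (\<T> h) u u v = F_h f (\<T> h) v)) \<and>
    (\<forall>u. u \<in> V \<and> (\<forall>v\<in>V. \<nu> * A_h S (\<T> h) u v + B_h (\<T> h) u u v = F_h f (\<T> h) v) \<longrightarrow>
      seminorm2h (\<T> h) u \<le> C_F * L2norm \<Omega> f / (\<alpha> * \<nu>))"
    by (rule ex1_solution[OF assms(10,12,14) _ B_h_linear B_h_skew F_h_linear[OF assms(11)] seminorm2h_nonneg
          assms(13)[OF assms(19)] assms(15)[OF assms(19)] assms(17)[OF assms(19)] small])
      (use assms(16) L in auto)
  then show ?thesis by (simp add: solves_def)
qed

end
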